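(* Let $F=\frac{(b\alpha+\beta)^2}{\alpha}$ be a singular square metric on an $n$-dimensional manifold with $n\geq 3$. Then $F$ has constant flag curvature $K$ if and only if $K=0$ and there exist scalar functions $c=c(x)$, $d=d(x)$ such that $\alpha$ and $\beta$ satisfy \begin{align*} R^i{}_k={}&-\frac{1}{9b^4}\Big\{\big[(9b^2c^2+144t)\alpha^2-2b^4d^2\beta^2-6(b^4d_0+12cs_0+14b^2ds_0)\beta+288s_0^2+36b^2s_{0|0}\big]\delta^i{}_k\\ &-(9b^2c^2+144t)y^iy_k+2b^2(b^2d^2\beta+3b^2d_0+6ds_0)(y^ib_k+y_kb^i)-2b^4d^2\alpha^2b^ib_k-3b^4\alpha^2(b^id_k+b_kd^i)\\ &-6\alpha^2(6c+7b^2d)(b^is_k+b_ks^i)+72\big[(c+b^2d)\beta-4s_0\big](y^is_k+y_ks^i)+288\alpha^2s^is_k\\ &-36b^2(y^is_{k|0}+y_ks^i{}_{|0})+18b^2\alpha^2(s^i{}_{|k}+s_{k|}{}^i)\Big\},\\ r_{ij}={}&c\,a_{ij}+d\,b_ib_j-\frac{3}{b^2}(b_is_j+b_js_i),\\ s_{ij}={}&\frac{1}{b^2}(b_is_j-b_js_i), \end{align*} where $R^i{}_k$ is the Riemann tensor of $\alpha$.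
   Context: Setting: $\alpha=\sqrt{a_{ij}(x)y^iy^j}$ is a Riemannian metric and $\beta=b_i(x)y^i$ is a nowhere-vanishing 1-form on an $n$-dimensional manifold; $b=b(x)=\sqrt{a^{ij}b_ib_j}$ is the length of $\beta$ with respect to $\alpha$ (not assumed constant). The singular square metric is the (non-regular) Finsler metric $F=\frac{(b\alpha+\beta)^2}{\alpha}$; its curvatures are considered at those $y\neq 0$ where its fundamental tensor is nondegenerate (i.e. where $b^2\alpha^2-\beta^2\neq0$). Curvature: for a Finsler metric $F$, $g_{ij}=\frac12[F^2]_{y^iy^j}$ with inverse $(g^{ij})$, the spray coefficients are $G^i=\frac14g^{il}\{[F^2]_{x^ky^l}y^k-[F^2]_{x^l}\}$, and the Riemann tensor is ${}^FR^i{}_k=2G^i_{x^k}-G^i_{x^ly^k}y^l+2G^lG^i_{y^ky^l}-G^i_{y^l}G^l_{y^k}$. $F$ has constant flag curvature $K$ (a constant) if ${}^FR^i{}_k=K(F^2\delta^i{}_k-Fy^iF_{y^k})$. $R^i{}_k$ without superscript denotes the Riemann tensor of $\alpha$ (same formula with $F$ replaced by $\alpha$; it is quadratic in $y$). Notation: $_{|}$ denotes covariant derivative with respect to the Levi-Civita connection of $\alpha$; indices are raised and lowered with $a^{ij}$ and $a_{ij}$ (so $y_k=a_{kj}y^j$, $b^i=a^{ij}b_j$); an index $0$ means contraction with $y^i$ (covariant derivatives being taken first). $r_{ij}=\frac12(b_{i|j}+b_{j|i})$, $s_{ij}=\frac12(b_{i|j}-b_{j|i})$; $s_i=b^ms_{mi}$,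 $s^i=a^{im}s_m$, $s_0=s_iy^i$; $s_{k|0}=s_{k|j}y^j$, $s^i{}_{|0}=s^i{}_{|j}y^j$, $s_{0|0}=s_{i|j}y^iy^j$, $s_{k|}{}^i=a^{ij}s_{k|j}$. $t_{ij}=s_{im}s^m{}_j$ and $t=t_{ij}b^ib^j$. For the scalar function $d$: $d_k=d_{|k}=\partial d/\partial x^k$, $d^i=a^{ik}d_k$, $d_0=d_ky^k$. *)

theory Defs
  imports "HOL-Analysis.Analysis"
begin

section \<open>Smooth functions and manifolds\<close>

definition pd :: "'n \<Rightarrow> (real^'n \<Rightarrow> real) \<Rightarrow> real^'n \<Rightarrow> real" where
  "pd i f x = deriv (\<lambda>t. f (x + t *\<^sub>R axis i 1)) 0"

fun Ck_on :: "nat \<Rightarrow> (real^'n) set \<Rightarrow> (real^'n \<Rightarrow> real) \<Rightarrow> bool" where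
  "Ck_on 0 S f \<longleftrightarrow> continuous_on S f"
| "Ck_on (Suc k) S f \<longleftrightarrow> f differentiable_on S \<and> (\<forall>i. Ck_on k S (pd i f))"

text \<open>Only used for open \<open>S\<close>.\<close>

definition smooth_on :: "(real^'n) set \<Rightarrow> (real^'n \<Rightarrow> real) \<Rightarrow> bool" where
  "smooth_on S f \<longleftrightarrow> (\<forall>k. Ck_on k S f)"

text \<open>A chart is a pair of its domain and its coordinate map; the values of the coordinate map
  outside the domain are irrelevant.\<close>

type_synonym ('m, 'n) chart = "'m set \<times> ('m \<Rightarrow> real^'n)"

definition cimage :: "('m, 'n) chart \<Rightarrow> (real^'n) set" where
  "cimage C = snd C ` fst C"

definition cinv :: "('m, 'n) chart \<Rightarrow> real^'n \<Rightarrow> 'm" where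
  "cinv C = inv_into (fst C) (snd C)"

definition overlap :: "('m, 'n) chart \<Rightarrow> ('m, 'n) chart \<Rightarrow> (real^'n) set" where
  "overlap C C' = snd C ` (fst C \<inter> fst C')"

definition transition :: "('m, 'n) chart \<Rightarrow> ('m, 'n) chart \<Rightarrow> real^'n \<Rightarrow> real^'n" where
  "transition C C' = snd C' \<circ> cinv C"

definition smooth_atlas :: "('m::topological_space, 'n::finite) chart set \<Rightarrow> bool" where
  "smooth_atlas A \<longleftrightarrow>
     (\<forall>C\<in>A. open (fst C) \<and> open (cimage C) \<and> homeomorphism (fst C) (cimage C) (snd C) (cinv C)) \<and>
     (\<Union>C\<in>A. fst C) = UNIV \<and>
     (\<forall>C\<in>A. \<forall>C'\<in>A. \<forall>i. smooth_on (overlap C C') (\<lambda>x. transition C C' x $ i))"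

definition scalar_field :: "('m, 'n::finite) chart set \<Rightarrow> ('m \<Rightarrow> real) \<Rightarrow> bool" where
  "scalar_field A f \<longleftrightarrow> (\<forall>C\<in>A. smooth_on (cimage C) (f \<circ> cinv C))"

text \<open>Tensor fields are given by their component functions in every chart of the atlas, subject to
  the transformation law on overlaps.\<close>

definition one_form :: "('m, 'n::finite) chart set \<Rightarrow> (('m, 'n) chart \<Rightarrow> real^'n \<Rightarrow> real^'n) \<Rightarrow> bool" where
  "one_form A b \<longleftrightarrow>
     (\<forall>C\<in>A. \<forall>i. smooth_on (cimage C) (\<lambda>x. b C x $ i)) \<and>
     (\<forall>C\<in>A. \<forall>C'\<in>A. \<forall>x\<in>overlap C C'. \<forall>i.
        b C x $ i = (\<Sum>k\<in>UNIV. pd i (\<lambda>z. transition C C' z $ k) x * b C' (transition C C' x) $ k))"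

definition nowhere_vanishing :: "('m, 'n::finite) chart set \<Rightarrow> (('m, 'n) chart \<Rightarrow> real^'n \<Rightarrow> real^'n) \<Rightarrow> bool" where
  "nowhere_vanishing A b \<longleftrightarrow> (\<forall>C\<in>A. \<forall>x\<in>cimage C. b C x \<noteq> 0)"

definition riemannian_metric :: "('m, 'n::finite) chart set \<Rightarrow> (('m, 'n) chart \<Rightarrow> real^'n \<Rightarrow> real^'n^'n) \<Rightarrow> bool" where
  "riemannian_metric A a \<longleftrightarrow>
     (\<forall>C\<in>A. \<forall>i j. smooth_on (cimage C) (\<lambda>x. a C x $ i $ j)) \<and>
     (\<forall>C\<in>A. \<forall>x\<in>cimage C. (\<forall>i j. a C x $ i $ j = a C x $ j $ i) \<and>
        (\<forall>y. y \<noteq> 0 \<longrightarrow> (\<Sum>i\<in>UNIV. \<Sum>j\<in>UNIV. a C x $ i $ j * y $ i * y $ j) > 0)) \<and>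
     (\<forall>C\<in>A. \<forall>C'\<in>A. \<forall>x\<in>overlap C C'. \<forall>i j.
        a C x $ i $ j = (\<Sum>k\<in>UNIV. \<Sum>l\<in>UNIV.
          pd i (\<lambda>z. transition C C' z $ k) x * pd j (\<lambda>z. transition C C' z $ l) x *
          a C' (transition C C' x) $ k $ l))"

section \<open>Curvature of a Finsler metric in a chart\<close>

text \<open>Here \<open>F x y\<close> is the metric at the point with coordinates \<open>x\<close>, evaluated on the
  tangent vector with components \<open>y\<close>.\<close>

type_synonym 'n finsler = "real^'n \<Rightarrow> real^'n \<Rightarrow> real"

definition fund_tensor :: "'n::finite finsler \<Rightarrow> real^'n \<Rightarrow> real^'n \<Rightarrow> real^'n^'n" where
  "fund_tensor F x y = (\<chi> i j. 1/2 * pd j (\<lambda>v. pd i (\<lambda>w. (F x w)\<^sup>2) v) y)"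

definition spray :: "'n::finite finsler \<Rightarrow> real^'n \<Rightarrow> real^'n \<Rightarrow> 'n \<Rightarrow> real" where
  "spray F x y i = 1/4 * (\<Sum>l\<in>UNIV. matrix_inv (fund_tensor F x y) $ i $ l *
     ((\<Sum>k\<in>UNIV. pd l (\<lambda>v. pd k (\<lambda>z. (F z v)\<^sup>2) x) y * y $ k) - pd l (\<lambda>z. (F z y)\<^sup>2) x))"

definition riemann :: "'n::finite finsler \<Rightarrow> real^'n \<Rightarrow> real^'n \<Rightarrow> 'n \<Rightarrow> 'n \<Rightarrow> real" where
  "riemann F x y i k =
     2 * pd k (\<lambda>z. spray F z y i) x
     - (\<Sum>l\<in>UNIV. pd k (\<lambda>v. pd l (\<lambda>z. spray F z v i) x) y * y $ l)
     + 2 * (\<Sum>l\<in>UNIV. spray F x y l * pd l (\<lambda>v. pd k (\<lambda>w. spray F x w i) v) y)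
     - (\<Sum>l\<in>UNIV. pd l (\<lambda>w. spray F x w i) y * pd k (\<lambda>w. spray F x w l) y)"

definition kdelta :: "'n \<Rightarrow> 'n \<Rightarrow> real" where
  "kdelta i k = (if i = k then 1 else 0)"

text \<open>\<open>F\<close> need not be regular: its curvature is considered only in the directions \<open>y \<noteq> 0\<close> in which
  the fundamental tensor is nondegenerate.\<close>

definition constant_flag_curvature ::
  "('m, 'n::finite) chart set \<Rightarrow> (('m, 'n) chart \<Rightarrow> 'n finsler) \<Rightarrow> real \<Rightarrow> bool" where
  "constant_flag_curvature A F K \<longleftrightarrow>
     (\<forall>C\<in>A. \<forall>x\<in>cimage C. \<forall>y. y \<noteq> 0 \<longrightarrow> invertible (fund_tensor (F C) x y) \<longrightarrow>
        (\<forall>i k. riemann (F C) x y i k =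
           K * ((F C x y)\<^sup>2 * kdelta i k - F C x y * y $ i * pd k (\<lambda>w. F C x w) y)))"

section \<open>Tensor calculus of \<open>\<alpha>\<close> and \<open>\<beta>\<close> in a chart\<close>

text \<open>In the following \<open>a\<close> and \<open>b\<close> are the components of \<open>\<alpha>\<^sup>2\<close> and \<open>\<beta>\<close> in one chart.\<close>

type_synonym 'n cmetric = "real^'n \<Rightarrow> real^'n^'n"
type_synonym 'n cvec = "real^'n \<Rightarrow> real^'n"

definition alpha :: "'n::finite cmetric \<Rightarrow> 'n finsler" where
  "alpha a x y = sqrt (\<Sum>i\<in>UNIV. \<Sum>j\<in>UNIV. a x $ i $ j * y $ i * y $ j)"

definition beta :: "'n::finite cvec \<Rightarrow> 'n finsler" where
  "beta b x y = (\<Sum>i\<in>UNIV. b x $ i * y $ i)"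

definition upper :: "'n::finite cmetric \<Rightarrow> real^'n \<Rightarrow> 'n \<Rightarrow> 'n \<Rightarrow> real" where
  "upper a x i j = matrix_inv (a x) $ i $ j"

definition raise :: "'n::finite cmetric \<Rightarrow> 'n cvec \<Rightarrow> 'n cvec" where
  "raise a w x = (\<chi> i. \<Sum>j\<in>UNIV. upper a x i j * w x $ j)"

definition blength :: "'n::finite cmetric \<Rightarrow> 'n cvec \<Rightarrow> real^'n \<Rightarrow> real" where
  "blength a b x = sqrt (\<Sum>i\<in>UNIV. \<Sum>j\<in>UNIV. upper a x i j * b x $ i * b x $ j)"

definition singular_square :: "'n::finite cmetric \<Rightarrow> 'n cvec \<Rightarrow> 'n finsler" where
  "singular_square a b x y = (blength a b x * alpha a x y + beta b x y)\<^sup>2 / alpha a x y"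

text \<open>Christoffel symbols \<open>\<Gamma>\<^sup>i\<^sub>j\<^sub>k\<close> of the Levi-Civita connection.\<close>

definition christoffel :: "'n::finite cmetric \<Rightarrow> real^'n \<Rightarrow> 'n \<Rightarrow> 'n \<Rightarrow> 'n \<Rightarrow> real" where
  "christoffel a x i j k = 1/2 * (\<Sum>l\<in>UNIV. upper a x i l *
     (pd j (\<lambda>z. a z $ l $ k) x + pd k (\<lambda>z. a z $ l $ j) x - pd l (\<lambda>z. a z $ j $ k) x))"

text \<open>\<open>cov_lower a w x i j\<close> is \<open>w\<^sub>i\<^sub>|\<^sub>j\<close>, and \<open>cov_upper a w x i j\<close> is \<open>w\<^sup>i\<^sub>|\<^sub>j\<close>.\<close>

definition cov_lower :: "'n::finite cmetric \<Rightarrow> 'n cvec \<Rightarrow> real^'n \<Rightarrow> 'n \<Rightarrow> 'n \<Rightarrow> real" where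
  "cov_lower a w x i j = pd j (\<lambda>z. w z $ i) x - (\<Sum>k\<in>UNIV. christoffel a x k i j * w x $ k)"

definition cov_upper :: "'n::finite cmetric \<Rightarrow> 'n cvec \<Rightarrow> real^'n \<Rightarrow> 'n \<Rightarrow> 'n \<Rightarrow> real" where
  "cov_upper a w x i j = pd j (\<lambda>z. w z $ i) x + (\<Sum>k\<in>UNIV. christoffel a x i k j * w x $ k)"

definition r_tensor :: "'n::finite cmetric \<Rightarrow> 'n cvec \<Rightarrow> real^'n \<Rightarrow> 'n \<Rightarrow> 'n \<Rightarrow> real" where
  "r_tensor a b x i j = 1/2 * (cov_lower a b x i j + cov_lower a b x j i)"

definition s_tensor :: "'n::finite cmetric \<Rightarrow> 'n cvec \<Rightarrow> real^'n \<Rightarrow> 'n \<Rightarrow> 'n \<Rightarrow> real" where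
  "s_tensor a b x i j = 1/2 * (cov_lower a b x i j - cov_lower a b x j i)"

definition s_form :: "'n::finite cmetric \<Rightarrow> 'n cvec \<Rightarrow> 'n cvec" where
  "s_form a b x = (\<chi> i. \<Sum>m\<in>UNIV. raise a b x $ m * s_tensor a b x m i)"

definition t_tensor :: "'n::finite cmetric \<Rightarrow> 'n cvec \<Rightarrow> real^'n \<Rightarrow> 'n \<Rightarrow> 'n \<Rightarrow> real" where
  "t_tensor a b x i j =
     (\<Sum>m\<in>UNIV. s_tensor a b x i m * (\<Sum>l\<in>UNIV. upper a x m l * s_tensor a b x l j))"

definition t_scalar :: "'n::finite cmetric \<Rightarrow> 'n cvec \<Rightarrow> real^'n \<Rightarrow> real" where
  "t_scalar a b x =
     (\<Sum>i\<in>UNIV. \<Sum>j\<in>UNIV. t_tensor a b x i j * raise a b x $ i * raise a b x $ j)"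

definition gradient_form :: "(real^'n \<Rightarrow> real) \<Rightarrow> 'n::finite cvec" where
  "gradient_form f x = (\<chi> k. pd k f x)"

text \<open>The prescribed value of the Riemann tensor \<open>R\<^sup>i\<^sub>k\<close> of \<open>\<alpha>\<close>. A suffix \<open>l\<close> or \<open>u\<close> marks
  lowered or raised components, and a suffix \<open>0\<close> contraction with \<open>y\<close>: for instance
  \<open>Sl0 k\<close> is \<open>s\<^sub>k\<^sub>|\<^sub>0\<close>, \<open>Su0 i\<close> is \<open>s\<^sup>i\<^sub>|\<^sub>0\<close>, \<open>S00\<close> is \<open>s\<^sub>0\<^sub>|\<^sub>0\<close> and
  \<open>Slu k i\<close> is \<open>s\<^sub>k\<^sub>|\<^sup>i\<close>.\<close>

definition prescribed_curvature ::
  "'n::finite cmetric \<Rightarrow> 'n cvec \<Rightarrow> (real^'n \<Rightarrow> real) \<Rightarrow> (real^'n \<Rightarrow> real) \<Rightarrow>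
   real^'n \<Rightarrow> real^'n \<Rightarrow> 'n \<Rightarrow> 'n \<Rightarrow> real" where
  "prescribed_curvature a b cf df x y i k =
    (let c = cf x; d = df x; t = t_scalar a b x;
         \<alpha> = alpha a x y; \<beta> = beta b x y; B = blength a b x;
         yl = (\<lambda>k. \<Sum>j\<in>UNIV. a x $ k $ j * y $ j);
         bl = (\<lambda>k. b x $ k); bu = (\<lambda>i. raise a b x $ i);
         dl = (\<lambda>k. gradient_form df x $ k); du = (\<lambda>i. raise a (gradient_form df) x $ i);
         d0 = (\<Sum>j\<in>UNIV. dl j * y $ j);
         sl = (\<lambda>k. s_form a b x $ k); su = (\<lambda>i. raise a (s_form a b) x $ i);
         s0 = (\<Sum>j\<in>UNIV. sl j * y $ j);
         Sll = cov_lower a (s_form a b) x;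
         Sul = cov_upper a (raise a (s_form a b)) x;
         Slu = (\<lambda>k i. \<Sum>j\<in>UNIV. upper a x i j * Sll k j);
         Sl0 = (\<lambda>k. \<Sum>j\<in>UNIV. Sll k j * y $ j);
         Su0 = (\<lambda>i. \<Sum>j\<in>UNIV. Sul i j * y $ j);
         S00 = (\<Sum>i\<in>UNIV. \<Sum>j\<in>UNIV. Sll i j * y $ i * y $ j)
     in - 1 / (9 * B^4) *
       (((9 * B^2 * c^2 + 144 * t) * \<alpha>^2 - 2 * B^4 * d^2 * \<beta>^2
          - 6 * (B^4 * d0 + 12 * c * s0 + 14 * B^2 * d * s0) * \<beta>
          + 288 * s0^2 + 36 * B^2 * S00) * kdelta i k
        - (9 * B^2 * c^2 + 144 * t) * y $ i * yl k
        + 2 * B^2 * (B^2 * d^2 * \<beta> + 3 * B^2 * d0 + 6 * d * s0) * (y $ i * bl k + yl k * bu i)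
        - 2 * B^4 * d^2 * \<alpha>^2 * bu i * bl k
        - 3 * B^4 * \<alpha>^2 * (bu i * dl k + bl k * du i)
        - 6 * \<alpha>^2 * (6 * c + 7 * B^2 * d) * (bu i * sl k + bl k * su i)
        + 72 * ((c + B^2 * d) * \<beta> - 4 * s0) * (y $ i * sl k + yl k * su i)
        + 288 * \<alpha>^2 * su i * sl k
        - 36 * B^2 * (y $ i * Sl0 k + yl k * Su0 i)
        + 18 * B^2 * \<alpha>^2 * (Sul i k + Slu k i)))"

end

theory Submission
  imports Defs
begin

text \<open>Replacing \<open>a\<close> by \<open>B\<^sup>4 a\<close> and \<open>\<beta>\<close> by \<open>B \<beta>\<close>, where \<open>B\<close> is the length of \<open>\<beta>\<close>, does not change \<open>F\<close> and
  reduces to a form of unit length. Its spray is then explicit, and \<open>F\<close> degenerates exactly along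
  the line spanned by \<open>b\<close>. Suppose that \<open>F\<close> has constant flag curvature \<open>K\<close>. For \<open>w\<close> orthogonal to
  \<open>y\<close> and \<open>b\<close> the curvature \<open>R\<^sub>i\<^sub>k w\<^sup>i w\<^sup>k\<close> equals \<open>K F\<^sup>2 |w|\<^sup>2\<close> and stays bounded as \<open>y\<close> tends to \<open>b\<close>,
  whereas its explicit value has poles there: the leading coefficients give first \<open>s\<^sub>i = 0\<close> and then
  \<open>s\<^sub>i\<^sub>j = 0\<close>. Comparing \<open>y\<close> with \<open>- y\<close> now gives an identity between polynomials in \<open>\<beta>\<close>, from which
  \<open>K = 0\<close> and \<open>r\<^sub>i\<^sub>j = \<tau> (a\<^sub>i\<^sub>j - b\<^sub>i b\<^sub>j)\<close>.

  For the original pair this is the asserted form of \<open>r\<^sub>i\<^sub>j\<close> and \<open>s\<^sub>i\<^sub>j\<close>. It means that the spray of \<open>F\<close>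
  is a projective change by \<open>\<kappa> \<alpha>\<close> of the spray of a Weyl connection of \<open>\<alpha>\<close> with a 1-form \<open>m\<close>. Its
  Riemann tensor is a sum of a part that is even and a part that is odd in \<open>y\<close>. The even part
  vanishes if and only if \<open>\<alpha>\<close> has the prescribed curvature (\<open>m\<close> is then closed), and in that case the
  odd part vanishes too, because the differential of \<open>F\<^sup>2\<close> along the fibres annihilates the image of
  the Riemann tensor of \<open>F\<close>. The functions \<open>c\<close> and \<open>d\<close> are values of a tensor on invariantly defined
  vectors, hence do not depend on the chart.\<close>

section \<open>Directional derivatives and smoothness on Euclidean spaces\<close>

text \<open>The exponents of the rescaling are forced: (\<lambda>\<alpha> + \<mu>\<beta>)^2 /
  (\<lambda>\<alpha>) is (B\<alpha> + \<beta>)^2 / \<alpha> only for \<lambda> = B^2 and \<mu> = B.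
  The obstacle is the size of the Riemann tensor of F. Necessity therefore uses a single scalar
  component of it, in a direction w along which \<alpha> and \<beta> are stationary; dimension at
  least three supplies w. The unknown curvature of \<alpha> occurs in this component as well, but it
  is continuous at b, hence harmless for the poles, and even in y, hence eliminated by comparing y
  with - y. That \<open>r\<close> is a multiple of the metric on the complement of b is a matter of
  divisibility: the comparison makes the square of r(\<eta>, \<eta>) divisible by |\<eta>|^2, which
  in two variables is irreducible over the reals. Sufficiency avoids the general formula altogether:
  under the structure equations the denominators of the spray of F cancel, and the curvature of the
  resulting Weyl-type spray is short enough to be computed in full.\<close>

definition dd :: "'a::real_normed_vector \<Rightarrow> ('a \<Rightarrow> 'b::real_normed_vector) \<Rightarrow> 'a \<Rightarrow> 'b" where
  "dd h f p = frechet_derivative f (at p) h"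

lemma dd_eq: "(f has_derivative f') (at p) \<Longrightarrow> dd h f p = f' h"
  unfolding dd_def using frechet_derivative_at by metis

lemma has_derivative_dd: "f differentiable (at p) \<Longrightarrow> (f has_derivative (\<lambda>h. dd h f p)) (at p)"
  unfolding dd_def using frechet_derivative_works by blast

text \<open>The two functions have the same Frechet derivatives at p, so
  \<open>frechet_derivative\<close> makes the same choice for both, even where no derivative
  exists.\<close>

lemma dd_cong:
  assumes "open S" "p \<in> S" "\<And>q. q \<in> S \<Longrightarrow> f q = g q"
  shows "dd h f p = dd h g p"
proof -
  have "(f has_derivative f') (at p) \<longleftrightarrow> (g has_derivative f') (at p)" for f'
    using has_derivative_transform_within_open[of _ _ p UNIV S] assms by metis
  then show ?thesis unfolding dd_def frechet_derivative_def by simp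
qed

lemma differentiable_cong_open:
  assumes "open S" "p \<in> S" "\<And>q. q \<in> S \<Longrightarrow> f q = g q" "f differentiable (at p)"
  shows "g differentiable (at p)"
  using assms has_derivative_transform_within_open[of f _ p UNIV S g] unfolding differentiable_def by blast

lemma bounded_linear_dd: "f differentiable (at p) \<Longrightarrow> bounded_linear (\<lambda>h. dd h f p)"
  using has_derivative_dd has_derivative_bounded_linear by blast

lemma dd_dir:
  assumes "f differentiable (at p)"
  shows dd_dir_add: "dd (h + k) f p = dd h f p + dd k f p"
    and dd_dir_diff: "dd (h - k) f p = dd h f p - dd k f p"
    and dd_dir_minus: "dd (- h) f p = - dd h f p"
    and dd_dir_scale: "dd (c *\<^sub>R h) f p = c *\<^sub>R dd h f p"
    and dd_dir_zero: "dd 0 f p = 0"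
    and dd_dir_sum: "dd (sum v I) f p = (\<Sum>i\<in>I. dd (v i) f p)"
proof -
  interpret bounded_linear "\<lambda>h. dd h f p" by (rule bounded_linear_dd[OF assms])
  show "dd (h + k) f p = dd h f p + dd k f p" "dd (h - k) f p = dd h f p - dd k f p"
    "dd (- h) f p = - dd h f p" "dd (c *\<^sub>R h) f p = c *\<^sub>R dd h f p" "dd 0 f p = 0"
    "dd (sum v I) f p = (\<Sum>i\<in>I. dd (v i) f p)"
    by (rule add diff neg scaleR zero sum)+
qed

lemma dd_const: "dd h (\<lambda>q. c) p = 0"
  by (rule dd_eq) (rule derivative_intros)

lemma dd_ident: "dd h (\<lambda>q. q) p = h"
  by (rule dd_eq) (rule derivative_intros)

lemma dd_linear:
  assumes "bounded_linear L" "f differentiable (at p)"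
  shows "dd h (\<lambda>q. L (f q)) p = L (dd h f p)"
  by (rule dd_eq) (rule bounded_linear.has_derivative[OF assms(1) has_derivative_dd[OF assms(2)]])

lemma dd_bilinear:
  assumes "bounded_bilinear B" "f differentiable (at p)" "g differentiable (at p)"
  shows "dd h (\<lambda>q. B (f q) (g q)) p = B (dd h f p) (g p) + B (f p) (dd h g p)"
proof -
  have "((\<lambda>q. B (f q) (g q)) has_derivative (\<lambda>h. B (f p) (dd h g p) + B (dd h f p) (g p))) (at p)"
    by (rule bounded_bilinear.FDERIV[OF assms(1) has_derivative_dd[OF assms(2)] has_derivative_dd[OF assms(3)]])
  from dd_eq[OF this, of h] show ?thesis by (simp add: add.commute)
qed

lemma dd_chain:
  assumes "g differentiable (at p)" "f differentiable (at (g p))"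
  shows "dd h (\<lambda>q. f (g q)) p = dd (dd h g p) f (g p)"
  by (rule dd_eq) (rule has_derivative_compose[OF has_derivative_dd[OF assms(1)] has_derivative_dd[OF assms(2)]])

lemma dd_comp_linear:
  assumes "bounded_linear L" "f differentiable (at (L p))"
  shows "dd h (\<lambda>q. f (L q)) p = dd (L h) f (L p)"
  by (rule dd_eq) (rule has_derivative_compose[OF bounded_linear.has_derivative[OF assms(1) has_derivative_ident] has_derivative_dd[OF assms(2)]])

lemma dd_add:
  "f differentiable (at p) \<Longrightarrow> g differentiable (at p) \<Longrightarrow> dd h (\<lambda>q. f q + g q) p = dd h f p + dd h g p"
  by (rule dd_eq) (intro has_derivative_add has_derivative_dd)

lemma dd_diff:
  "f differentiable (at p) \<Longrightarrow> g differentiable (at p) \<Longrightarrow> dd h (\<lambda>q. f q - g q) p = dd h f p - dd h g p"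
  by (rule dd_eq) (intro has_derivative_diff has_derivative_dd)

lemma dd_minus: "f differentiable (at p) \<Longrightarrow> dd h (\<lambda>q. - f q) p = - dd h f p"
  by (rule dd_eq) (intro has_derivative_minus has_derivative_dd)

lemma dd_sum:
  "(\<And>i. i \<in> I \<Longrightarrow> f i differentiable (at p)) \<Longrightarrow> dd h (\<lambda>q. \<Sum>i\<in>I. f i q) p = (\<Sum>i\<in>I. dd h (f i) p)"
  by (rule dd_eq) (intro has_derivative_sum has_derivative_dd)

lemma dd_snd: "dd h (\<lambda>q. snd q) p = snd h"
  by (rule dd_eq) (intro derivative_intros)

lemma dd_comp_fst:
  "f differentiable (at (fst p)) \<Longrightarrow> dd h (\<lambda>q. f (fst q)) p = dd (fst h) f (fst p)"
  by (rule dd_comp_linear[OF bounded_linear_fst])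

lemmas dd_mult = dd_bilinear[OF bounded_bilinear_mult]
lemmas dd_scaleR = dd_bilinear[OF bounded_bilinear_scaleR]
lemmas dd_inner = dd_bilinear[OF bounded_bilinear_inner]

lemma dd_power2:
  fixes f :: "_ \<Rightarrow> real"
  shows "f differentiable (at p) \<Longrightarrow> dd h (\<lambda>q. (f q)\<^sup>2) p = 2 * f p * dd h f p"
  unfolding power2_eq_square by (simp add: dd_mult)

lemma dd_inverse:
  fixes f :: "_ \<Rightarrow> real"
  assumes "f differentiable (at p)" "f p \<noteq> 0"
  shows "dd h (\<lambda>q. inverse (f q)) p = - (dd h f p / (f p)\<^sup>2)"
proof -
  have "((\<lambda>q. inverse (f q)) has_derivative (\<lambda>h. - (inverse (f p) * dd h f p * inverse (f p)))) (at p)"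
    using Deriv.has_derivative_inverse[OF assms(2) has_derivative_dd[OF assms(1)]] .
  then have "dd h (\<lambda>q. inverse (f q)) p = - (inverse (f p) * dd h f p * inverse (f p))" by (rule dd_eq)
  then show ?thesis by (simp add: field_simps power2_eq_square)
qed

lemma dd_divide:
  fixes f g :: "_ \<Rightarrow> real"
  assumes "f differentiable (at p)" "g differentiable (at p)" "g p \<noteq> 0"
  shows "dd h (\<lambda>q. f q / g q) p = (dd h f p * g p - f p * dd h g p) / (g p)\<^sup>2"
proof -
  have "((\<lambda>q. f q / g q) has_derivative (\<lambda>h. (dd h f p * g p - f p * dd h g p) / (g p * g p))) (at p)"
    using has_derivative_divide'[OF has_derivative_dd[OF assms(1)] has_derivative_dd[OF assms(2)] assms(3)] .
  then have "dd h (\<lambda>q. f q / g q) p = (dd h f p * g p - f p * dd h g p) / (g p * g p)" by (rule dd_eq)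
  then show ?thesis by (simp add: power2_eq_square)
qed

lemma dd_sqrt:
  assumes "f differentiable (at p)" "f p > 0"
  shows "dd h (\<lambda>q. sqrt (f q)) p = dd h f p / (2 * sqrt (f p))"
proof -
  have "dd h (\<lambda>q. sqrt (f q)) p = dd h f p * (1 / (2 * sqrt (f p)))"
    by (rule dd_eq) (use has_derivative_real_sqrt[OF assms(2) has_derivative_dd[OF assms(1)]]
      in \<open>simp only: divide_inverse mult.commute mult_1_left mult_1_right inverse_mult_distrib\<close>)
  then show ?thesis by simp
qed

lemma dd_eq_sum_Basis:
  fixes f :: "'a::euclidean_space \<Rightarrow> 'b::real_normed_vector"
  assumes "f differentiable (at p)"
  shows "dd v f p = (\<Sum>e\<in>Basis. (v \<bullet> e) *\<^sub>R dd e f p)"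
proof -
  have "dd v f p = dd (\<Sum>e\<in>Basis. (v \<bullet> e) *\<^sub>R e) f p" by (simp add: euclidean_representation)
  also have "\<dots> = (\<Sum>e\<in>Basis. (v \<bullet> e) *\<^sub>R dd e f p)"
    by (simp add: dd_dir_sum[OF assms] dd_dir_scale[OF assms])
  finally show ?thesis .
qed

text \<open>A coordinate-free counterpart of \<open>Ck_on\<close>: it makes sense for vector-valued
  maps and on the product space of pairs (x, y), where sprays live.\<close>

primrec ck :: "nat \<Rightarrow> 'a::real_normed_vector set \<Rightarrow> ('a \<Rightarrow> 'b::real_normed_vector) \<Rightarrow> bool" where
  "ck 0 S f \<longleftrightarrow> continuous_on S f"
| "ck (Suc k) S f \<longleftrightarrow> (\<forall>p\<in>S. f differentiable (at p)) \<and> (\<forall>h. ck k S (dd h f))"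

definition sm :: "'a::real_normed_vector set \<Rightarrow> ('a \<Rightarrow> 'b::real_normed_vector) \<Rightarrow> bool" where
  "sm S f \<longleftrightarrow> (\<forall>k. ck k S f)"

lemma ck_Suc_imp: "ck (Suc k) S f \<Longrightarrow> ck k S f"
proof (induction k arbitrary: f)
  case 0
  then show ?case
    by (auto simp del: continuous_on_eq_continuous_within intro!: continuous_at_imp_continuous_on differentiable_imp_continuous_within)
qed auto

lemma ck_cong:
  assumes "open S" "\<And>p. p \<in> S \<Longrightarrow> f p = g p" "ck k S f"
  shows "ck k S g"
  using assms(2,3)
proof (induction k arbitrary: f g)
  case 0
  then show ?case using continuous_on_cong by fastforce
next
  case (Suc k)
  have "ck k S (dd h g)" for h
  proof (rule Suc.IH[of "dd h f"])
    show "dd h f p = dd h g p" if "p \<in> S" for p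
      by (rule dd_cong[OF assms(1) that Suc.prems(1)])
  qed (use Suc.prems in auto)
  moreover have "\<forall>p\<in>S. g differentiable (at p)"
    using differentiable_cong_open[OF assms(1) _ Suc.prems(1)] Suc.prems(2) by auto
  ultimately show ?case by simp
qed

lemma ck_subset: "ck k S f \<Longrightarrow> T \<subseteq> S \<Longrightarrow> ck k T f"
  by (induction k arbitrary: f) (auto intro: continuous_on_subset)

lemma ck_const: "ck k S (\<lambda>q. c)"
proof (induction k arbitrary: c)
  case (Suc k)
  have "dd h (\<lambda>q. c) = (\<lambda>q. 0)" for h :: 'a by (rule ext) (rule dd_const)
  then show ?case using Suc by simp
qed auto

lemma differentiable_linear_comp:
  "bounded_linear L \<Longrightarrow> f differentiable (at p) \<Longrightarrow> (\<lambda>q. L (f q)) differentiable (at p)"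
  unfolding differentiable_def using bounded_linear.has_derivative by blast

lemma ck_linear_comp:
  assumes "open S" "bounded_linear L" "ck k S f"
  shows "ck k S (\<lambda>q. L (f q))"
  using assms(3)
proof (induction k arbitrary: f)
  case 0
  then show ?case using bounded_linear.continuous_on[OF assms(2)] by auto
next
  case (Suc k)
  have "ck k S (dd h (\<lambda>q. L (f q)))" for h
    by (rule ck_cong[OF assms(1), of "\<lambda>q. L (dd h f q)"])
      (use Suc in \<open>auto simp: dd_linear[OF assms(2)]\<close>)
  moreover have "\<forall>p\<in>S. (\<lambda>q. L (f q)) differentiable (at p)"
    using Suc.prems by (auto intro!: differentiable_linear_comp[OF assms(2)])
  ultimately show ?case by simp
qed

lemma ck_comp_linear:
  assumes "open S" "bounded_linear L" "\<And>p. p \<in> S \<Longrightarrow> L p \<in> T" "ck k T f"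
  shows "ck k S (\<lambda>q. f (L q))"
  using assms(4)
proof (induction k arbitrary: f)
  case 0
  have "continuous_on S L" by (rule linear_continuous_on[OF assms(2)])
  then show ?case using 0 assms(3) continuous_on_compose2[of T f S L] by auto
next
  case (Suc k)
  have dL: "L differentiable (at p)" for p
    using bounded_linear_imp_differentiable[OF assms(2)] by blast
  have "ck k S (dd h (\<lambda>q. f (L q)))" for h
    by (rule ck_cong[OF assms(1), of "\<lambda>q. dd (L h) f (L q)"])
      (use Suc assms(3) in \<open>auto simp: dd_comp_linear[OF assms(2)]\<close>)
  moreover have "\<forall>p\<in>S. (\<lambda>q. f (L q)) differentiable (at p)"
    using Suc.prems assms(3) dL differentiable_chain_at[of L _ f] by (auto simp: o_def)
  ultimately show ?case by simp
qed

lemma ck_add: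
  assumes "open S" "ck k S f" "ck k S g"
  shows "ck k S (\<lambda>q. f q + g q)"
  using assms(2,3)
proof (induction k arbitrary: f g)
  case (Suc k)
  have "ck k S (dd h (\<lambda>q. f q + g q))" for h
    by (rule ck_cong[OF assms(1), of "\<lambda>q. dd h f q + dd h g q"])
      (use Suc in \<open>auto simp: dd_add\<close>)
  then show ?case using Suc.prems by (auto intro: differentiable_add)
qed (auto intro: continuous_on_add)

lemma differentiable_bilinear:
  "bounded_bilinear B \<Longrightarrow> f differentiable (at p) \<Longrightarrow> g differentiable (at p) \<Longrightarrow> (\<lambda>q. B (f q) (g q)) differentiable (at p)"
  unfolding differentiable_def using bounded_bilinear.FDERIV by blast

lemma ck_bilinear:
  assumes "open S" "bounded_bilinear B" "ck k S f" "ck k S g"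
  shows "ck k S (\<lambda>q. B (f q) (g q))"
  using assms(3,4)
proof (induction k arbitrary: f g)
  case 0
  then show ?case using bounded_bilinear.continuous_on[OF assms(2)] by auto
next
  case (Suc k)
  have f: "ck k S f" "ck k S g" using Suc.prems ck_Suc_imp by blast+
  have "ck k S (dd h (\<lambda>q. B (f q) (g q)))" for h
    by (rule ck_cong[OF assms(1), of "\<lambda>q. B (dd h f q) (g q) + B (f q) (dd h g q)"])
      (use Suc f in \<open>auto intro!: ck_add[OF assms(1)] Suc.IH simp: dd_bilinear[OF assms(2)]\<close>)
  moreover have "\<forall>p\<in>S. (\<lambda>q. B (f q) (g q)) differentiable (at p)"
    using Suc.prems by (auto intro!: differentiable_bilinear[OF assms(2)])
  ultimately show ?case by simp
qed

text \<open>The derivative of the reciprocal is a product of \<open>dd h f\<close> with the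
  reciprocal itself, which is already of class k by induction. The square root is treated in the
  same way.\<close>

lemma ck_inverse:
  fixes f :: "_ \<Rightarrow> real"
  assumes "open S" "\<And>p. p \<in> S \<Longrightarrow> f p \<noteq> 0" "ck k S f"
  shows "ck k S (\<lambda>q. inverse (f q))"
  using assms(3)
proof (induction k)
  case 0
  then show ?case using assms(2) by (auto intro: continuous_on_inverse)
next
  case (Suc k)
  have i: "ck k S (\<lambda>q. inverse (f q))" using Suc ck_Suc_imp by blast
  have *: "ck k S (\<lambda>q. (- 1) * (dd h f q * (inverse (f q) * inverse (f q))))" for h
    using Suc.prems by (intro ck_bilinear[OF assms(1) bounded_bilinear_mult] i ck_const) auto
  have "ck k S (dd h (\<lambda>q. inverse (f q)))" for h
  proof (rule ck_cong[OF assms(1) _ *[of h]])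
    fix p assume p: "p \<in> S"
    then have "f differentiable (at p)" "f p \<noteq> 0" using Suc.prems assms(2) by auto
    from dd_inverse[OF this, of h]
    show "- 1 * (dd h f p * (inverse (f p) * inverse (f p))) = dd h (\<lambda>q. inverse (f q)) p"
      by (simp add: field_simps power2_eq_square)
  qed
  then show ?case using Suc.prems assms(2) by (auto intro: differentiable_inverse)
qed

lemma differentiable_sqrt: "f differentiable (at p) \<Longrightarrow> f p > 0 \<Longrightarrow> (\<lambda>q. sqrt (f q)) differentiable (at p)"
  unfolding differentiable_def using has_derivative_real_sqrt by blast

lemma ck_sqrt:
  assumes "open S" "\<And>p. p \<in> S \<Longrightarrow> f p > 0" "ck k S f"
  shows "ck k S (\<lambda>q. sqrt (f q))"
  using assms(3)
proof (induction k)
  case 0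
  then show ?case by (auto intro: continuous_on_real_sqrt)
next
  case (Suc k)
  have i: "ck k S (\<lambda>q. inverse (sqrt (f q)))"
  proof (rule ck_inverse[OF assms(1)])
    show "sqrt (f p) \<noteq> 0" if "p \<in> S" for p using assms(2)[OF that] by simp
    show "ck k S (\<lambda>q. sqrt (f q))" by (rule Suc.IH[OF ck_Suc_imp[OF Suc.prems]])
  qed
  have *: "ck k S (\<lambda>q. (1/2) * (dd h f q * inverse (sqrt (f q))))" for h
    using Suc.prems by (intro ck_bilinear[OF assms(1) bounded_bilinear_mult] i ck_const) auto
  have "ck k S (dd h (\<lambda>q. sqrt (f q)))" for h
  proof (rule ck_cong[OF assms(1) _ *[of h]])
    fix p assume p: "p \<in> S"
    then have "f differentiable (at p)" "f p > 0" using Suc.prems assms(2) by auto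
    from dd_sqrt[OF this, of h] show "1/2 * (dd h f p * inverse (sqrt (f p))) = dd h (\<lambda>q. sqrt (f q)) p"
      by (simp add: field_simps)
  qed
  moreover have "\<forall>p\<in>S. (\<lambda>q. sqrt (f q)) differentiable (at p)"
    using Suc.prems assms(2) by (auto intro!: differentiable_sqrt)
  ultimately show ?case by simp
qed

text \<open>Removes the order of differentiability from the definition, so that smoothness can be
  passed to derivatives without counting.\<close>

lemma sm_iff: "sm S f \<longleftrightarrow> (\<forall>p\<in>S. f differentiable (at p)) \<and> (\<forall>h. sm S (dd h f))"
proof
  assume "sm S f"
  then have *: "ck (Suc k) S f" for k unfolding sm_def by (rule spec)
  have "\<forall>p\<in>S. f differentiable (at p)" using *[of 0] unfolding ck.simps(2) by (rule conjunct1)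
  moreover have "sm S (dd h f)" for h
    unfolding sm_def
  proof
    fix k
    have "\<forall>h. ck k S (dd h f)" using *[of k] unfolding ck.simps(2) by (rule conjunct2)
    then show "ck k S (dd h f)" by (rule spec)
  qed
  ultimately show "(\<forall>p\<in>S. f differentiable (at p)) \<and> (\<forall>h. sm S (dd h f))" by (intro conjI allI)
next
  assume *: "(\<forall>p\<in>S. f differentiable (at p)) \<and> (\<forall>h. sm S (dd h f))"
  have "ck (Suc k) S f" for k using * by (simp add: sm_def)
  then show "sm S f" by (simp add: sm_def ck_Suc_imp)
qed

lemma sm_diff_at: "sm S f \<Longrightarrow> p \<in> S \<Longrightarrow> f differentiable (at p)"
  by (simp add: sm_iff[of S f])

lemma sm_dd: "sm S f \<Longrightarrow> sm S (dd h f)"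
  by (simp add: sm_iff[of S f])

lemma sm_continuous_on: "sm S f \<Longrightarrow> continuous_on S f"
  unfolding sm_def using ck.simps(1) by blast

lemma sm_cong: "open S \<Longrightarrow> (\<And>p. p \<in> S \<Longrightarrow> f p = g p) \<Longrightarrow> sm S f \<Longrightarrow> sm S g"
  unfolding sm_def by (metis ck_cong)

lemma sm_subset: "sm S f \<Longrightarrow> T \<subseteq> S \<Longrightarrow> sm T f"
  unfolding sm_def by (metis ck_subset)

lemma sm_const: "sm S (\<lambda>q. c)"
  by (simp add: sm_def ck_const)

lemma sm_linear_comp: "open S \<Longrightarrow> bounded_linear L \<Longrightarrow> sm S f \<Longrightarrow> sm S (\<lambda>q. L (f q))"
  by (simp add: sm_def ck_linear_comp)

lemma sm_comp_linear:
  "open S \<Longrightarrow> bounded_linear L \<Longrightarrow> (\<And>p. p \<in> S \<Longrightarrow> L p \<in> T) \<Longrightarrow> sm T f \<Longrightarrow> sm S (\<lambda>q. f (L q))"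
  unfolding sm_def by (metis ck_comp_linear)

lemma sm_comp_fst: "open S \<Longrightarrow> (\<And>p. p \<in> S \<Longrightarrow> fst p \<in> T) \<Longrightarrow> sm T f \<Longrightarrow> sm S (\<lambda>q. f (fst q))"
  by (rule sm_comp_linear[OF _ bounded_linear_fst])

lemma sm_ident: "sm S (\<lambda>q. q)"
proof -
  have "dd h (\<lambda>q. q) = (\<lambda>q. h)" for h :: 'a by (rule ext) (rule dd_ident)
  then show ?thesis by (subst sm_iff) (simp add: sm_const)
qed

lemma sm_snd: "open S \<Longrightarrow> sm S (\<lambda>q. snd q)"
  by (rule sm_linear_comp[OF _ bounded_linear_snd sm_ident])

lemma sm_add: "open S \<Longrightarrow> sm S f \<Longrightarrow> sm S g \<Longrightarrow> sm S (\<lambda>q. f q + g q)"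
  by (simp add: sm_def ck_add)

lemma sm_bilinear: "open S \<Longrightarrow> bounded_bilinear B \<Longrightarrow> sm S f \<Longrightarrow> sm S g \<Longrightarrow> sm S (\<lambda>q. B (f q) (g q))"
  by (simp add: sm_def ck_bilinear)

lemmas sm_mult = sm_bilinear[OF _ bounded_bilinear_mult]
lemmas sm_scaleR = sm_bilinear[OF _ bounded_bilinear_scaleR]
lemmas sm_inner = sm_bilinear[OF _ bounded_bilinear_inner]

lemma sm_minus: "open S \<Longrightarrow> sm S f \<Longrightarrow> sm S (\<lambda>q. - f q)"
  by (rule sm_linear_comp[OF _ bounded_linear_minus[OF bounded_linear_ident]])

lemma sm_diff: "open S \<Longrightarrow> sm S f \<Longrightarrow> sm S g \<Longrightarrow> sm S (\<lambda>q. f q - g q)"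
  using sm_add[of S f "\<lambda>q. - g q"] sm_minus[of S g] by simp

lemma sm_sum: "open S \<Longrightarrow> (\<And>i. i \<in> I \<Longrightarrow> sm S (f i)) \<Longrightarrow> sm S (\<lambda>q. \<Sum>i\<in>I. f i q)"
  by (induction I rule: infinite_finite_induct) (auto intro: sm_const sm_add)

lemma sm_prod:
  fixes f :: "_ \<Rightarrow> _ \<Rightarrow> real"
  shows "open S \<Longrightarrow> (\<And>i. i \<in> I \<Longrightarrow> sm S (f i)) \<Longrightarrow> sm S (\<lambda>q. \<Prod>i\<in>I. f i q)"
  by (induction I rule: infinite_finite_induct) (auto intro: sm_const sm_mult)

lemma sm_power:
  fixes f :: "_ \<Rightarrow> real"
  shows "open S \<Longrightarrow> sm S f \<Longrightarrow> sm S (\<lambda>q. (f q) ^ n)"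
  by (induction n) (auto intro: sm_const sm_mult)

lemma sm_inverse:
  fixes f :: "_ \<Rightarrow> real"
  shows "open S \<Longrightarrow> sm S f \<Longrightarrow> (\<And>p. p \<in> S \<Longrightarrow> f p \<noteq> 0) \<Longrightarrow> sm S (\<lambda>q. inverse (f q))"
  by (simp add: sm_def ck_inverse)

lemma sm_divide:
  fixes f g :: "_ \<Rightarrow> real"
  shows "open S \<Longrightarrow> sm S f \<Longrightarrow> sm S g \<Longrightarrow> (\<And>p. p \<in> S \<Longrightarrow> g p \<noteq> 0) \<Longrightarrow> sm S (\<lambda>q. f q / g q)"
  unfolding divide_inverse by (intro sm_mult sm_inverse)

lemma sm_sqrt: "open S \<Longrightarrow> sm S f \<Longrightarrow> (\<And>p. p \<in> S \<Longrightarrow> f p > 0) \<Longrightarrow> sm S (\<lambda>q. sqrt (f q))"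
  by (simp add: sm_def ck_sqrt)

lemma sm_dd_var:
  fixes f :: "'a::euclidean_space \<Rightarrow> 'b::real_normed_vector"
  assumes "open S" "sm S v" "sm S f"
  shows "sm S (\<lambda>p. dd (v p) f p)"
proof (rule sm_cong[OF assms(1)])
  show "sm S (\<lambda>p. \<Sum>e\<in>Basis. (v p \<bullet> e) *\<^sub>R dd e f p)"
  proof (rule sm_sum[OF assms(1)])
    fix e
    show "sm S (\<lambda>p. (v p \<bullet> e) *\<^sub>R dd e f p)"
      using sm_scaleR[OF assms(1) sm_inner[OF assms(1,2) sm_const[of S e]] sm_dd[OF assms(3), of e]] .
  qed
  show "(\<Sum>e\<in>Basis. (v p \<bullet> e) *\<^sub>R dd e f p) = dd (v p) f p" if "p \<in> S" for p
    by (rule dd_eq_sum_Basis[symmetric, OF sm_diff_at[OF assms(3) that]])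
qed

text \<open>Expanding the direction in \<open>Basis\<close> turns the derivative along a vector
  field into a finite sum of products, to which the product rule applies.\<close>

lemma dd_var:
  fixes f :: "'a::euclidean_space \<Rightarrow> 'b::real_normed_vector"
  assumes "open S" "p \<in> S" "sm S f" "v differentiable (at p)"
  shows "dd k (\<lambda>q. dd (v q) f q) p = dd (dd k v p) f p + dd k (dd (v p) f) p"
proof -
  have D: "f differentiable (at q)" if "q \<in> S" for q using sm_diff_at[OF assms(3) that] .
  have De: "dd e f differentiable (at p)" for e using sm_diff_at[OF sm_dd[OF assms(3)] assms(2)] .
  have V: "(\<lambda>q. v q \<bullet> e) differentiable (at p)" for e
    by (rule differentiable_bilinear[OF bounded_bilinear_inner assms(4) differentiable_const])
  have "dd k (\<lambda>q. dd (v q) f q) p = dd k (\<lambda>q. \<Sum>e\<in>Basis. (v q \<bullet> e) *\<^sub>R dd e f q) p"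
    by (rule dd_cong[OF assms(1,2)]) (rule dd_eq_sum_Basis[OF D])
  also have "\<dots> = (\<Sum>e\<in>Basis. dd k (\<lambda>q. (v q \<bullet> e) *\<^sub>R dd e f q) p)"
    by (rule dd_sum) (intro differentiable_bilinear[OF bounded_bilinear_scaleR] V De)
  also have "\<dots> = (\<Sum>e\<in>Basis. (dd k v p \<bullet> e) *\<^sub>R dd e f p) + (\<Sum>e\<in>Basis. (v p \<bullet> e) *\<^sub>R dd k (dd e f) p)"
    by (simp add: dd_scaleR[OF V De] dd_inner[OF assms(4) differentiable_const] dd_const sum.distrib)
  also have "(\<Sum>e\<in>Basis. (dd k v p \<bullet> e) *\<^sub>R dd e f p) = dd (dd k v p) f p"
    by (rule dd_eq_sum_Basis[symmetric, OF D[OF assms(2)]])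
  also have "(\<Sum>e\<in>Basis. (v p \<bullet> e) *\<^sub>R dd k (dd e f) p) = dd k (\<lambda>q. \<Sum>e\<in>Basis. (v p \<bullet> e) *\<^sub>R dd e f q) p"
  proof -
    have "(\<lambda>q. c *\<^sub>R dd e f q) differentiable (at p)" for c e
      by (rule differentiable_bilinear[OF bounded_bilinear_scaleR differentiable_const De])
    then show ?thesis by (simp add: dd_sum dd_scaleR[OF differentiable_const De] dd_const)
  qed
  also have "\<dots> = dd k (dd (v p) f) p"
    by (rule dd_cong[OF assms(1,2)]) (rule dd_eq_sum_Basis[symmetric, OF D])
  finally show ?thesis .
qed

section \<open>Symmetry of second derivatives\<close>

lemma has_real_derivative_line:
  fixes f :: "'a::real_normed_vector \<Rightarrow> real"
  assumes "f differentiable (at (p + s *\<^sub>R h))"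
  shows "((\<lambda>s. f (p + s *\<^sub>R h)) has_real_derivative dd h f (p + s *\<^sub>R h)) (at s)"
proof -
  have "((\<lambda>s. p + s *\<^sub>R h) has_derivative (\<lambda>r. r *\<^sub>R h)) (at s)"
    by (auto intro!: derivative_eq_intros)
  from has_derivative_compose[OF this has_derivative_dd[OF assms]]
  have "((\<lambda>s. f (p + s *\<^sub>R h)) has_derivative (\<lambda>r. dd (r *\<^sub>R h) f (p + s *\<^sub>R h))) (at s)" .
  then show ?thesis
    unfolding has_field_derivative_def
    by (rule has_derivative_eq_rhs) (simp add: dd_dir_scale[OF assms] mult.commute fun_eq_iff)
qed

text \<open>The mean value theorem twice: for the difference of f across t k as a function of the
  step along h, and then for \<open>dd h f\<close> along k.\<close>

lemma second_difference_mvt: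
  fixes f :: "'a::real_normed_vector \<Rightarrow> real"
  assumes ball: "ball p e \<subseteq> S" and S: "sm S f" and t: "t > 0" "t * (norm h + norm k) < e"
  shows "\<exists>q. dist q p \<le> t * (norm h + norm k) \<and>
    f (p + t *\<^sub>R h + t *\<^sub>R k) - f (p + t *\<^sub>R h) - f (p + t *\<^sub>R k) + f p = t * t * dd k (dd h f) q"
proof -
  have near: "p + s *\<^sub>R h + r *\<^sub>R k \<in> S \<and> dist (p + s *\<^sub>R h + r *\<^sub>R k) p \<le> t * (norm h + norm k)"
    if "0 \<le> s" "s \<le> t" "0 \<le> r" "r \<le> t" for s r
  proof -
    have "norm (s *\<^sub>R h + r *\<^sub>R k) \<le> s * norm h + r * norm k"
      using norm_triangle_ineq[of "s *\<^sub>R h" "r *\<^sub>R k"] that by simp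
    also have "\<dots> \<le> t * (norm h + norm k)"
      using that by (simp add: distrib_left add_mono mult_right_mono)
    finally have *: "dist (p + s *\<^sub>R h + r *\<^sub>R k) p \<le> t * (norm h + norm k)"
      by (simp add: dist_norm add.assoc)
    moreover from this have "p + s *\<^sub>R h + r *\<^sub>R k \<in> ball p e" using t by (simp add: dist_commute)
    ultimately show ?thesis using ball by blast
  qed
  have D: "f differentiable (at q)" "dd h f differentiable (at q)" if "q \<in> S" for q
    using sm_diff_at[OF S that] sm_diff_at[OF sm_dd[OF S] that] .
  let ?u = "\<lambda>s. f (p + t *\<^sub>R k + s *\<^sub>R h) - f (p + s *\<^sub>R h)"
  have "DERIV ?u s :> dd h f (p + t *\<^sub>R k + s *\<^sub>R h) - dd h f (p + s *\<^sub>R h)" if "0 \<le> s" "s \<le> t" for s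
    using near[of s t] near[of s 0] that t
    by (intro DERIV_diff has_real_derivative_line D) (simp_all add: add_ac)
  from MVT2[OF t(1) this] obtain s where s: "0 < s" "s < t"
    and 1: "?u t - ?u 0 = (t - 0) * (dd h f (p + t *\<^sub>R k + s *\<^sub>R h) - dd h f (p + s *\<^sub>R h))" by blast
  let ?w = "\<lambda>r. dd h f (p + s *\<^sub>R h + r *\<^sub>R k)"
  have "DERIV ?w r :> dd k (dd h f) (p + s *\<^sub>R h + r *\<^sub>R k)" if "0 \<le> r" "r \<le> t" for r
    using near[of s r] that s by (intro has_real_derivative_line D) auto
  from MVT2[OF t(1) this] obtain r where r: "0 < r" "r < t"
    and 2: "?w t - ?w 0 = (t - 0) * dd k (dd h f) (p + s *\<^sub>R h + r *\<^sub>R k)" by blast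
  have "?u t - ?u 0 = t * t * dd k (dd h f) (p + s *\<^sub>R h + r *\<^sub>R k)"
    using 1 2 by (simp add: add_ac)
  then have "f (p + t *\<^sub>R h + t *\<^sub>R k) - f (p + t *\<^sub>R h) - f (p + t *\<^sub>R k) + f p
      = t * t * dd k (dd h f) (p + s *\<^sub>R h + r *\<^sub>R k)"
    by (simp add: add_ac algebra_simps)
  then show ?thesis using near[of s r] s r by (intro exI[of _ "p + s *\<^sub>R h + r *\<^sub>R k"]) simp
qed

lemma second_difference_quotient:
  fixes f :: "'a::real_normed_vector \<Rightarrow> real"
  assumes "open S" "p \<in> S" and S: "sm S f"
  shows "((\<lambda>t. (f (p + t *\<^sub>R h + t *\<^sub>R k) - f (p + t *\<^sub>R h) - f (p + t *\<^sub>R k) + f p) / (t * t))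
    \<longlongrightarrow> dd k (dd h f) p) (at_right 0)"
proof (rule tendstoI)
  fix \<epsilon> :: real assume \<epsilon>: "\<epsilon> > 0"
  obtain e where e: "e > 0" "ball p e \<subseteq> S" using assms open_contains_ball by metis
  have "isCont (dd k (dd h f)) p"
    by (rule differentiable_imp_continuous_within) (rule sm_diff_at[OF sm_dd[OF sm_dd[OF S]] assms(2)])
  then obtain d where d: "d > 0" "\<And>q. dist q p < d \<Longrightarrow> dist (dd k (dd h f) q) (dd k (dd h f) p) < \<epsilon>"
    using \<epsilon> unfolding continuous_at_eps_delta by metis
  define c where "c = min e d / (norm h + norm k + 1)"
  have c: "c > 0" unfolding c_def using e(1) d(1) by (auto intro!: divide_pos_pos add_nonneg_pos)
  have "dist ((f (p + t *\<^sub>R h + t *\<^sub>R k) - f (p + t *\<^sub>R h) - f (p + t *\<^sub>R k) + f p) / (t * t)) (dd k (dd h f) p) < \<epsilon>"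
    if t: "0 < t" "t < c" for t
  proof -
    have "t * (norm h + norm k) < t * (norm h + norm k + 1)" using t by simp
    also have "\<dots> < c * (norm h + norm k + 1)" using t by (intro mult_strict_right_mono) (auto intro: add_nonneg_pos)
    also have "\<dots> = min e d"
    proof -
      have "norm h + norm k + 1 \<noteq> 0" using norm_ge_zero[of h] norm_ge_zero[of k] by linarith
      then show ?thesis unfolding c_def by simp
    qed
    finally have le: "t * (norm h + norm k) < e" "t * (norm h + norm k) < d" by auto
    from second_difference_mvt[OF e(2) S t(1) le(1)] obtain q where
      q: "dist q p \<le> t * (norm h + norm k)" and
      eq: "f (p + t *\<^sub>R h + t *\<^sub>R k) - f (p + t *\<^sub>R h) - f (p + t *\<^sub>R k) + f p = t * t * dd k (dd h f) q" by blast
    from q le(2) have "dist q p < d" by linarith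
    from d(2)[OF this] show ?thesis using t unfolding eq by simp
  qed
  then show "\<forall>\<^sub>F t in at_right 0. dist ((f (p + t *\<^sub>R h + t *\<^sub>R k) - f (p + t *\<^sub>R h) - f (p + t *\<^sub>R k) + f p) / (t * t)) (dd k (dd h f) p) < \<epsilon>"
    unfolding eventually_at_right_field using c by blast
qed

text \<open>The second difference quotient is symmetric in h and k, so both mixed derivatives are
  its limit.\<close>

lemma dd_symmetric_real:
  fixes f :: "'a::real_normed_vector \<Rightarrow> real"
  assumes "open S" "p \<in> S" "sm S f"
  shows "dd k (dd h f) p = dd h (dd k f) p"
proof -
  have "((\<lambda>t. (f (p + t *\<^sub>R h + t *\<^sub>R k) - f (p + t *\<^sub>R h) - f (p + t *\<^sub>R k) + f p) / (t * t))
    \<longlongrightarrow> dd h (dd k f) p) (at_right 0)"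
    using second_difference_quotient[OF assms, of k h] by (simp add: algebra_simps)
  then show ?thesis
    by (rule tendsto_unique[OF trivial_limit_at_right_real second_difference_quotient[OF assms, of h k]])
qed

lemma dd_symmetric:
  fixes f :: "'a::real_normed_vector \<Rightarrow> 'b::euclidean_space"
  assumes "open S" "p \<in> S" "sm S f"
  shows "dd k (dd h f) p = dd h (dd k f) p"
proof (rule euclidean_eqI)
  fix e :: 'b
  have L: "bounded_linear (\<lambda>v::'b. v \<bullet> e)" by (rule bounded_linear_inner_left)
  have *: "dd h (dd k f) p \<bullet> e = dd h (dd k (\<lambda>q. f q \<bullet> e)) p" for h k
  proof -
    have "dd h (dd k f) p \<bullet> e = dd h (\<lambda>q. dd k f q \<bullet> e) p"
      by (rule dd_linear[OF L, symmetric]) (rule sm_diff_at[OF sm_dd[OF assms(3)] assms(2)])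
    also have "\<dots> = dd h (dd k (\<lambda>q. f q \<bullet> e)) p"
      by (rule dd_cong[OF assms(1,2)]) (rule dd_linear[OF L, symmetric], rule sm_diff_at[OF assms(3)])
    finally show ?thesis .
  qed
  show "dd k (dd h f) p \<bullet> e = dd h (dd k f) p \<bullet> e"
    unfolding * by (rule dd_symmetric_real[OF assms(1,2) sm_linear_comp[OF assms(1) L assms(3)]])
qed

section \<open>Coordinates\<close>

lemma pd_eq_dd:
  fixes f :: "real^'n \<Rightarrow> real"
  assumes "f differentiable (at x)"
  shows "pd i f x = dd (axis i 1) f x"
  unfolding pd_def
  by (rule DERIV_imp_deriv) (use has_real_derivative_line[of f x 0 "axis i 1"] assms in simp)

lemma pd_cong:
  assumes "open S" "x \<in> S" "\<And>z. z \<in> S \<Longrightarrow> f z = g z"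
  shows "pd i f x = pd i g x"
  unfolding pd_def
proof (rule deriv_cong_ev)
  have "((\<lambda>t. x + t *\<^sub>R axis i (1::real)) \<longlongrightarrow> x + 0 *\<^sub>R axis i 1) (nhds 0)"
    by (intro tendsto_intros filterlim_ident)
  then have "\<forall>\<^sub>F t in nhds 0. x + t *\<^sub>R axis i 1 \<in> S"
    using assms(1,2) by (auto dest: topological_tendstoD)
  then show "\<forall>\<^sub>F t in nhds 0. f (x + t *\<^sub>R axis i 1) = g (x + t *\<^sub>R axis i 1)"
    by eventually_elim (rule assms(3))
qed simp

lemma dd_eq_sum_axis:
  fixes f :: "real^'n::finite \<Rightarrow> 'b::real_normed_vector"
  assumes "f differentiable (at x)"
  shows "dd v f x = (\<Sum>i\<in>UNIV. v $ i *\<^sub>R dd (axis i 1) f x)"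
proof -
  have "dd v f x = dd (\<Sum>i\<in>UNIV. v $ i *\<^sub>R axis i 1) f x"
    using basis_expansion[of v] by (simp add: scalar_mult_eq_scaleR)
  also have "\<dots> = (\<Sum>i\<in>UNIV. v $ i *\<^sub>R dd (axis i 1) f x)"
    by (simp add: dd_dir_sum[OF assms] dd_dir_scale[OF assms])
  finally show ?thesis .
qed

lemma Ck_on_cong:
  assumes "open S" "\<And>x. x \<in> S \<Longrightarrow> f x = g x" "Ck_on k S f"
  shows "Ck_on k S g"
  using assms(2,3)
proof (induction k arbitrary: f g)
  case 0
  then show ?case using continuous_on_cong by fastforce
next
  case (Suc k)
  have "Ck_on k S (pd i g)" for i
  proof (rule Suc.IH[of "pd i f"])
    show "pd i f x = pd i g x" if "x \<in> S" for x by (rule pd_cong[OF assms(1) that Suc.prems(1)])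
  qed (use Suc.prems in auto)
  moreover have "g differentiable_on S"
    using Suc.prems differentiable_cong_open[OF assms(1) _ Suc.prems(1)] assms(1)
    by (auto simp: differentiable_on_eq_differentiable_at)
  ultimately show ?case by simp
qed

lemma Ck_on_imp_ck:
  fixes f :: "real^'n::finite \<Rightarrow> real"
  assumes "open S" "Ck_on k S f"
  shows "ck k S f"
  using assms(2)
proof (induction k arbitrary: f)
  case (Suc k)
  have D: "f differentiable (at x)" if "x \<in> S" for x
    using Suc.prems that assms(1) by (auto simp: differentiable_on_eq_differentiable_at)
  have "ck k S (dd v f)" for v
  proof (rule ck_cong[OF assms(1)])
    show "(\<Sum>i\<in>UNIV. v $ i *\<^sub>R pd i f x) = dd v f x" if "x \<in> S" for x
      by (simp add: dd_eq_sum_axis[OF D[OF that], of v] pd_eq_dd[OF D[OF that]])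
    have "ck k S (\<lambda>x. \<Sum>i\<in>I. v $ i *\<^sub>R pd i f x)" for I
      by (induction I rule: infinite_finite_induct)
        (use Suc in \<open>auto intro!: ck_const ck_add[OF assms(1)] ck_bilinear[OF assms(1) bounded_bilinear_scaleR]
          ck_bilinear[OF assms(1) bounded_bilinear_mult]\<close>)
    then show "ck k S (\<lambda>x. \<Sum>i\<in>UNIV. v $ i *\<^sub>R pd i f x)" .
  qed
  then show ?case using D by simp
qed simp

lemma ck_imp_Ck_on:
  fixes f :: "real^'n::finite \<Rightarrow> real"
  assumes "open S" "ck k S f"
  shows "Ck_on k S f"
  using assms(2)
proof (induction k arbitrary: f)
  case (Suc k)
  have D: "f differentiable (at x)" if "x \<in> S" for x using Suc.prems that by simp
  have "Ck_on k S (pd i f)" for i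
  proof (rule Ck_on_cong[OF assms(1)])
    show "dd (axis i 1) f x = pd i f x" if "x \<in> S" for x by (simp add: pd_eq_dd[OF D[OF that]])
    show "Ck_on k S (dd (axis i 1) f)" using Suc by simp
  qed
  moreover have "f differentiable_on S" using D assms(1) by (simp add: differentiable_on_eq_differentiable_at)
  ultimately show ?case by simp
qed simp

lemma smooth_on_iff_sm:
  fixes f :: "real^'n::finite \<Rightarrow> real"
  assumes "open S"
  shows "smooth_on S f \<longleftrightarrow> sm S f"
  unfolding smooth_on_def sm_def using Ck_on_imp_ck[OF assms] ck_imp_Ck_on[OF assms] by blast

lemma sm_vec_lambda:
  fixes f :: "'n::finite \<Rightarrow> 'a::real_normed_vector \<Rightarrow> real"
  assumes "open S" "\<And>i. sm S (f i)"
  shows "sm S (\<lambda>x. \<chi> i. f i x)"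
proof (rule sm_cong[OF assms(1)])
  show "sm S (\<lambda>x. \<Sum>i\<in>UNIV. f i x *\<^sub>R axis i (1::real))"
    by (rule sm_sum[OF assms(1)], rule sm_scaleR[OF assms(1) assms(2) sm_const])
  show "(\<Sum>i\<in>UNIV. f i x *\<^sub>R axis i (1::real)) = (\<chi> i. f i x)" for x
    using basis_expansion[of "\<chi> i. f i x"] by (simp add: scalar_mult_eq_scaleR)
qed

lemma sm_vec_nth:
  fixes f :: "'a::real_normed_vector \<Rightarrow> real^'n::finite"
  shows "open S \<Longrightarrow> sm S f \<Longrightarrow> sm S (\<lambda>x. f x $ i)"
  by (rule sm_linear_comp[OF _ bounded_linear_vec_nth])

lemma dd_vec_nth:
  fixes f :: "'a::real_normed_vector \<Rightarrow> real^'n::finite"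
  shows "f differentiable (at p) \<Longrightarrow> dd h (\<lambda>q. f q $ i) p = dd h f p $ i"
  by (rule dd_linear[OF bounded_linear_vec_nth])

lemma matrix_inv_mult:
  fixes A :: "real^'n::finite^'n"
  assumes "invertible A"
  shows "A ** matrix_inv A = mat 1" "matrix_inv A ** A = mat 1"
  using someI_ex[of "\<lambda>A'. A ** A' = mat 1 \<and> A' ** A = mat 1"] assms
  unfolding invertible_def matrix_inv_def by auto

text \<open>Cramer's rule writes the entries of the inverse as quotients of determinants, which are
  polynomials in the entries of M.\<close>

lemma sm_matrix_inv:
  fixes M :: "'a::real_normed_vector \<Rightarrow> real^'n::finite^'n"
  assumes "open S" "\<And>i j. sm S (\<lambda>x. M x $ i $ j)" "\<And>x. x \<in> S \<Longrightarrow> invertible (M x)"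
  shows "sm S (\<lambda>x. matrix_inv (M x) $ i $ j)"
proof -
  have inv: "matrix_inv (M x) $ i $ j =
      det (\<chi> r s. if s = i then axis j 1 $ r else M x $ r $ s) / det (M x)" if "x \<in> S" for x i j
  proof -
    have d: "det (M x) \<noteq> 0" using assms(3)[OF that] invertible_det_nz by blast
    have "M x *v (matrix_inv (M x) *v axis j 1) = axis j 1"
      using assms(3)[OF that] by (simp add: matrix_vector_mul_assoc matrix_inv_mult)
    then have "matrix_inv (M x) *v axis j 1 = (\<chi> k. det (\<chi> r s. if s = k then axis j 1 $ r else M x $ r $ s) / det (M x))"
      using cramer[OF d] by blast
    then have "(matrix_inv (M x) *v axis j 1) $ i = det (\<chi> r s. if s = i then axis j 1 $ r else M x $ r $ s) / det (M x)"
      by simp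
    then show ?thesis by (simp add: matrix_vector_mult_basis column_def)
  qed
  have det: "sm S (\<lambda>x. det (N x))" if "\<And>i j. sm S (\<lambda>x. N x $ i $ j)" for N :: "'a \<Rightarrow> real^'n^'n"
    unfolding det_def by (intro sm_sum sm_mult sm_const sm_prod assms(1) that)
  have N: "sm S (\<lambda>x. (\<chi> r s. if s = i then axis j 1 $ r else M x $ r $ s) $ r $ s)" for i j r s
    by (cases "s = i") (simp_all add: sm_const assms(2))
  show ?thesis
  proof (rule sm_cong[OF assms(1)])
    show "sm S (\<lambda>x. det (\<chi> r s. if s = i then axis j 1 $ r else M x $ r $ s) / det (M x))"
      by (intro sm_divide assms(1) det N assms(2)) (use assms(3) invertible_det_nz in blast)
  qed (simp add: inv)
qed

section \<open>Sprays and their curvature\<close>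

text \<open>A point of the tangent bundle over a chart is a pair \<open>(x, y)\<close>. For spray coefficients \<open>G\<close>,
  \<open>RR G w (x, y)\<close> is the vector \<open>R\<^sup>i\<^sub>k w\<^sup>k\<close>.\<close>

definition spr :: "('a::euclidean_space \<times> 'a \<Rightarrow> 'a) \<Rightarrow> ('a \<times> 'a \<Rightarrow> 'b) \<Rightarrow> 'a \<times> 'a \<Rightarrow> 'b::euclidean_space" where
  "spr G f p = dd (snd p, - 2 *\<^sub>R G p) f p"

definition RR :: "('a::euclidean_space \<times> 'a \<Rightarrow> 'a) \<Rightarrow> 'a \<Rightarrow> 'a \<times> 'a \<Rightarrow> 'a" where
  "RR G w p = 2 *\<^sub>R dd (w, 0) G p - spr G (dd (0, w) G) p - dd (0, dd (0, w) G p) G p"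

lemma dd_Pair:
  assumes "f differentiable (at p)" "g differentiable (at p)"
  shows "dd h (\<lambda>q. (f q, g q)) p = (dd h f p, dd h g p)"
  by (rule dd_eq) (rule has_derivative_Pair[OF has_derivative_dd[OF assms(1)] has_derivative_dd[OF assms(2)]])

lemma differentiable_Pair:
  assumes "f differentiable (at p)" "g differentiable (at p)"
  shows "(\<lambda>q. (f q, g q)) differentiable (at p)"
  unfolding differentiable_def
  using has_derivative_Pair[OF has_derivative_dd[OF assms(1)] has_derivative_dd[OF assms(2)]] by blast

lemma bounded_linear_Pair0: "bounded_linear (\<lambda>x. (x, 0))" "bounded_linear (\<lambda>x. (0, x))"
  by (intro bounded_linear_Pair bounded_linear_ident bounded_linear_zero)+

lemma sm_Pair:
  assumes "open S" "sm S f" "sm S g"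
  shows "sm S (\<lambda>q. (f q, g q))"
  using sm_add[OF assms(1) sm_linear_comp[OF assms(1) bounded_linear_Pair0(1) assms(2)]
      sm_linear_comp[OF assms(1) bounded_linear_Pair0(2) assms(3)]] by simp

lemma dd_split: "f differentiable (at p) \<Longrightarrow> dd (u, v) f p = dd (u, 0) f p + dd (0, v) f p"
  using dd_dir_add[of f p "(u, 0)" "(0, v)"] by simp

lemma dd_fst_scale: "f differentiable (at p) \<Longrightarrow> dd (c *\<^sub>R u, 0) f p = c *\<^sub>R dd (u, 0) f p"
  using dd_dir_scale[of f p c "(u, 0)"] by simp

lemma dd_snd_scale: "f differentiable (at p) \<Longrightarrow> dd (0, c *\<^sub>R u) f p = c *\<^sub>R dd (0, u) f p"
  using dd_dir_scale[of f p c "(0, u)"] by simp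

lemma dd_snd_add: "f differentiable (at p) \<Longrightarrow> dd (0, u + v) f p = dd (0, u) f p + dd (0, v) f p"
  using dd_dir_add[of f p "(0, u)" "(0, v)"] by simp

lemma dd_snd_diff: "f differentiable (at p) \<Longrightarrow> dd (0, u - v) f p = dd (0, u) f p - dd (0, v) f p"
  using dd_dir_diff[of f p "(0, u)" "(0, v)"] by simp

lemma dd_snd_minus: "f differentiable (at p) \<Longrightarrow> dd (0, - v) f p = - dd (0, v) f p"
  using dd_dir_minus[of f p "(0, v)"] by simp

lemma dd_snd_sum: "f differentiable (at p) \<Longrightarrow> dd (0, sum v I) f p = (\<Sum>i\<in>I. dd (0, v i) f p)"
proof -
  assume f: "f differentiable (at p)"
  interpret bounded_linear "\<lambda>h. dd (0, h) f p"
    by (rule bounded_linear_compose[OF bounded_linear_dd[OF f] bounded_linear_Pair0(2)])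
  show ?thesis by (rule sum)
qed

lemma dd_fst_sum: "f differentiable (at p) \<Longrightarrow> dd (sum v I, 0) f p = (\<Sum>i\<in>I. dd (v i, 0) f p)"
proof -
  assume f: "f differentiable (at p)"
  interpret bounded_linear "\<lambda>h. dd (h, 0) f p"
    by (rule bounded_linear_compose[OF bounded_linear_dd[OF f] bounded_linear_Pair0(1)])
  show ?thesis by (rule sum)
qed

lemma spr_split:
  assumes "f differentiable (at p)"
  shows "spr G f p = dd (snd p, 0) f p - 2 *\<^sub>R dd (0, G p) f p"
proof -
  have "spr G f p = dd (snd p, 0) f p + dd (0, - 2 *\<^sub>R G p) f p"
    unfolding spr_def by (rule dd_split[OF assms])
  then show ?thesis by (simp only: dd_snd_scale[OF assms]) simp
qed

text \<open>The second term is what remains after interchanging the two derivatives; the first is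
  due to the dependence of the field (y, -2G) on the point.\<close>

lemma dd_spr:
  fixes f :: "'a::euclidean_space \<times> 'a \<Rightarrow> 'b::euclidean_space"
  assumes "open S" "p \<in> S" "sm S G" "sm S f"
  shows "dd h (spr G f) p = dd (snd h, - 2 *\<^sub>R dd h G p) f p + spr G (dd h f) p"
proof -
  have G: "G differentiable (at p)" by (rule sm_diff_at[OF assms(3,2)])
  have sd: "(\<lambda>q::'a \<times> 'a. snd q) differentiable (at p)"
    by (rule differentiable_linear_comp[OF bounded_linear_snd differentiable_ident])
  have G2: "(\<lambda>q. - 2 *\<^sub>R G q) differentiable (at p)"
    by (rule differentiable_linear_comp[OF bounded_linear_scaleR_right G])
  note v = differentiable_Pair[OF sd G2]
  have "dd h (spr G f) p = dd h (\<lambda>q. dd ((\<lambda>q. (snd q, - 2 *\<^sub>R G q)) q) f q) p"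
    unfolding spr_def by simp
  also have "\<dots> = dd (dd h (\<lambda>q. (snd q, - 2 *\<^sub>R G q)) p) f p + dd h (dd (snd p, - 2 *\<^sub>R G p) f) p"
    by (rule dd_var[OF assms(1,2,4) v])
  also have "dd h (\<lambda>q. (snd q, - 2 *\<^sub>R G q)) p = (snd h, - 2 *\<^sub>R dd h G p)"
    by (simp only: dd_Pair[OF sd G2] dd_snd dd_linear[OF bounded_linear_scaleR_right G])
  also have "dd h (dd (snd p, - 2 *\<^sub>R G p) f) p = spr G (dd h f) p"
    unfolding spr_def by (rule dd_symmetric[OF assms(1,2,4)])
  finally show ?thesis .
qed

lemma RR_cong:
  assumes "open S" "p \<in> S" "\<And>q. q \<in> S \<Longrightarrow> G q = H q"
  shows "RR G w p = RR H w p"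
proof -
  have 1: "dd h G q = dd h H q" if "q \<in> S" for h q by (rule dd_cong[OF assms(1) that assms(3)])
  have "spr G (dd (0, w) G) p = spr H (dd (0, w) H) p"
    unfolding spr_def assms(3)[OF assms(2)] by (rule dd_cong[OF assms(1,2) 1])
  then show ?thesis unfolding RR_def by (simp add: 1[OF assms(2)])
qed

text \<open>If the spray \<open>(y, -2G)\<close> is that of a Lagrangian \<open>L\<close> that it preserves, then the derivatives
  of \<open>L\<close> along horizontal vectors vanish, and differentiating \<open>L\<close> once more along the spray shows that
  the fibre derivative of \<open>L\<close> kills the image of the Riemann tensor.\<close>

lemma dd_RR_eq_0:
  fixes L :: "'a::euclidean_space \<times> 'a \<Rightarrow> real"
  assumes S: "open S" "p \<in> S" "sm S G" and L: "sm S L"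
    and inv: "\<And>q. q \<in> S \<Longrightarrow> spr G L q = 0"
    and EL: "\<And>q u. q \<in> S \<Longrightarrow> spr G (dd (0, u) L) q = dd (u, 0) L q"
  shows "dd (0, RR G w p) L p = 0"
proof -
  have DL: "L differentiable (at q)" if "q \<in> S" for q by (rule sm_diff_at[OF L that])
  have z: "dd h (spr G L) q = 0" if "q \<in> S" for h q
    using dd_cong[OF S(1) that inv, where h = h] by (simp add: dd_const)
  \<comment> \<open>The fibre derivative of \<open>spr G L = 0\<close>, combined with the
    Euler-Lagrange equation \<open>EL\<close>.\<close>
  have hor: "dd (u, 0) L q = dd (0, dd (0, u) G q) L q" if q: "q \<in> S" for u q
  proof -
    have "0 = dd (u, - 2 *\<^sub>R dd (0, u) G q) L q + dd (u, 0) L q"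
      using dd_spr[OF S(1) q S(3) L, of "(0, u)"] z[OF q] EL[OF q] by simp
    also have "dd (u, - 2 *\<^sub>R dd (0, u) G q) L q = dd (u, 0) L q - 2 * dd (0, dd (0, u) G q) L q"
      by (subst dd_split[OF DL[OF q]]) (simp only: dd_snd_scale[OF DL[OF q]], simp)
    finally show ?thesis by simp
  qed
  have "0 = dd (0, - 2 *\<^sub>R dd (w, 0) G p) L p + spr G (dd (w, 0) L) p"
    using dd_spr[OF S L, of "(w, 0)"] z[OF S(2)] by simp
  also have "spr G (dd (w, 0) L) p = dd (snd p, - 2 *\<^sub>R G p) (\<lambda>q. dd (0, dd (0, w) G q) L q) p"
    unfolding spr_def by (rule dd_cong[OF S(1,2) hor])
  also have "\<dots> = dd (dd (snd p, - 2 *\<^sub>R G p) (\<lambda>q. (0, dd (0, w) G q)) p) L p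
      + dd (snd p, - 2 *\<^sub>R G p) (dd (0, dd (0, w) G p) L) p"
    by (rule dd_var[OF S(1,2) L])
      (intro differentiable_Pair differentiable_const sm_diff_at[OF sm_dd[OF S(3)] S(2)])
  also have "dd (snd p, - 2 *\<^sub>R G p) (\<lambda>q. (0, dd (0, w) G q)) p = (0, spr G (dd (0, w) G) p)"
    by (subst dd_Pair) (auto simp: dd_const spr_def intro!: sm_diff_at[OF sm_dd[OF S(3)] S(2)])
  also have "dd (snd p, - 2 *\<^sub>R G p) (dd (0, dd (0, w) G p) L) p = dd (0, dd (0, dd (0, w) G p) G p) L p"
    using EL[OF S(2), of "dd (0, w) G p"] hor[OF S(2)] unfolding spr_def by simp
  finally show ?thesis
    unfolding RR_def by (simp only: dd_snd_diff[OF DL[OF S(2)]] dd_snd_scale[OF DL[OF S(2)]]) simp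
qed

text \<open>The mixed derivative is expressed by the fibre derivative of the whole function
  \<open>dd (snd q, 0) G q\<close>. Since the direction \<open>snd q\<close> is differentiated too,
  a further \<open>dd (w, 0) G\<close> appears, which changes the coefficient 2 into 3.\<close>

lemma RR_expand:
  assumes S: "open S" "p \<in> S" "sm S G"
  shows "RR G w p = 3 *\<^sub>R dd (w, 0) G p - dd (0, w) (\<lambda>q. dd (snd q, 0) G q) p
    + 2 *\<^sub>R dd (0, G p) (dd (0, w) G) p - dd (0, dd (0, w) G p) G p"
proof -
  have "dd (0, w) (\<lambda>q. dd (snd q, 0) G q) p = dd (dd (0, w) (\<lambda>q. (snd q, 0)) p) G p + dd (0, w) (dd (snd p, 0) G) p"
    by (rule dd_var[OF S]) (intro differentiable_linear_comp[OF bounded_linear_Pair0(1)]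
      differentiable_linear_comp[OF bounded_linear_snd] differentiable_ident)
  also have "dd (0, w) (\<lambda>q. (snd q, 0)) p = (w, 0)"
    by (subst dd_linear[OF bounded_linear_Pair0(1)])
      (auto simp: dd_snd intro!: differentiable_linear_comp[OF bounded_linear_snd])
  also have "dd (0, w) (dd (snd p, 0) G) p = dd (snd p, 0) (dd (0, w) G) p"
    by (rule dd_symmetric[OF S])
  finally have 1: "dd (0, w) (\<lambda>q. dd (snd q, 0) G q) p = dd (w, 0) G p + dd (snd p, 0) (dd (0, w) G) p" .
  have "2 *\<^sub>R a - (b - 2 *\<^sub>R c) - d = 3 *\<^sub>R a - (a + b) + 2 *\<^sub>R c - d" for a b c d :: 'a
    using scaleR_add_left[of 2 1 a] by simp
  then show ?thesis
    unfolding RR_def 1 spr_split[OF sm_diff_at[OF sm_dd[OF S(3)] S(2)]] .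
qed

text \<open>Translates the iterated partial derivatives of the definitions one at a time. Agreement
  on an open set is enough, because \<open>pd\<close> is local; the inner derivatives are known only
  on such a set.\<close>

lemma pd_slice_fst:
  fixes f :: "(real^'n::finite) \<times> (real^'n) \<Rightarrow> real"
  assumes S: "open S" "(x, y) \<in> S" and f: "\<And>z v. (z, v) \<in> S \<Longrightarrow> \<phi> z v = f (z, v)"
    and D: "f differentiable (at (x, y))"
  shows "pd k (\<lambda>z. \<phi> z y) x = dd (axis k 1, 0) f (x, y)"
proof -
  have o: "open {z. (z, y) \<in> S}"
    using open_vimage[OF S(1) continuous_on_Pair[OF continuous_on_id continuous_on_const[of UNIV y]]]
    by (simp add: vimage_def)
  have d: "((\<lambda>z. f (z, y)) has_derivative (\<lambda>h. dd (h, 0) f (x, y))) (at x)"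
    using has_derivative_compose[OF has_derivative_Pair[OF has_derivative_ident has_derivative_const] has_derivative_dd[OF D]] .
  have "pd k (\<lambda>z. \<phi> z y) x = pd k (\<lambda>z. f (z, y)) x"
    by (rule pd_cong[OF o]) (use S f in auto)
  also have "\<dots> = dd (axis k 1) (\<lambda>z. f (z, y)) x"
    by (rule pd_eq_dd) (use d differentiable_def in blast)
  also have "\<dots> = dd (axis k 1, 0) f (x, y)" by (rule dd_eq[OF d])
  finally show ?thesis .
qed

lemma pd_slice_snd:
  fixes f :: "(real^'n::finite) \<times> (real^'n) \<Rightarrow> real"
  assumes S: "open S" "(x, y) \<in> S" and f: "\<And>z v. (z, v) \<in> S \<Longrightarrow> \<phi> z v = f (z, v)"
    and D: "f differentiable (at (x, y))"
  shows "pd k (\<lambda>v. \<phi> x v) y = dd (0, axis k 1) f (x, y)"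
proof -
  have o: "open {v. (x, v) \<in> S}"
    using open_vimage[OF S(1) continuous_on_Pair[OF continuous_on_const[of UNIV x] continuous_on_id]]
    by (simp add: vimage_def)
  have d: "((\<lambda>v. f (x, v)) has_derivative (\<lambda>h. dd (0, h) f (x, y))) (at y)"
    using has_derivative_compose[OF has_derivative_Pair[OF has_derivative_const has_derivative_ident] has_derivative_dd[OF D]] .
  have "pd k (\<lambda>v. \<phi> x v) y = pd k (\<lambda>v. f (x, v)) y"
    by (rule pd_cong[OF o]) (use S f in auto)
  also have "\<dots> = dd (axis k 1) (\<lambda>v. f (x, v)) y"
    by (rule pd_eq_dd) (use d differentiable_def in blast)
  also have "\<dots> = dd (0, axis k 1) f (x, y)" by (rule dd_eq[OF d])
  finally show ?thesis .
qed

lemma dd_fst_eq_sum: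
  fixes f :: "(real^'n::finite) \<times> (real^'n) \<Rightarrow> 'b::real_normed_vector"
  assumes "f differentiable (at p)"
  shows "dd (v, 0) f p = (\<Sum>i\<in>UNIV. v $ i *\<^sub>R dd (axis i 1, 0) f p)"
    and "dd (0, v) f p = (\<Sum>i\<in>UNIV. v $ i *\<^sub>R dd (0, axis i 1) f p)"
proof -
  have v: "v = (\<Sum>i\<in>UNIV. v $ i *\<^sub>R axis i 1)"
    using basis_expansion[of v] by (simp add: scalar_mult_eq_scaleR)
  show "dd (v, 0) f p = (\<Sum>i\<in>UNIV. v $ i *\<^sub>R dd (axis i 1, 0) f p)"
    by (subst v) (simp add: dd_fst_sum[OF assms] dd_fst_scale[OF assms])
  show "dd (0, v) f p = (\<Sum>i\<in>UNIV. v $ i *\<^sub>R dd (0, axis i 1) f p)"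
    by (subst v) (simp add: dd_snd_sum[OF assms] dd_snd_scale[OF assms])
qed

lemma riemann_eq_RR:
  fixes G :: "(real^'n::finite) \<times> (real^'n) \<Rightarrow> real^'n"
  assumes S: "open S" "(x, y) \<in> S" and G: "sm S G"
    and spray: "\<And>z v i. (z, v) \<in> S \<Longrightarrow> spray F z v i = G (z, v) $ i"
  shows "riemann F x y i k = RR G (axis k 1) (x, y) $ i"
proof -
  let ?g = "\<lambda>i p. G p $ i"
  have g: "sm S (?g i)" for i by (rule sm_vec_nth[OF S(1) G])
  have D: "?g i differentiable (at q)" if "q \<in> S" for i q by (rule sm_diff_at[OF g that])
  have D2: "dd h (?g i) differentiable (at q)" if "q \<in> S" for h i q by (rule sm_diff_at[OF sm_dd[OF g] that])
  have x1: "pd k (\<lambda>z. spray F z v i) z' = dd (axis k 1, 0) (?g i) (z', v)" if "(z', v) \<in> S" for k i z' v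
    by (rule pd_slice_fst[OF S(1) that _ D[OF that]]) (rule spray)
  have y1: "pd k (\<lambda>v. spray F z' v i) v' = dd (0, axis k 1) (?g i) (z', v')" if "(z', v') \<in> S" for k i z' v'
    by (rule pd_slice_snd[OF S(1) that _ D[OF that], of "\<lambda>z v. spray F z v i"]) (rule spray)
  have xy: "pd k (\<lambda>v. pd l (\<lambda>z. spray F z v i) x) y = dd (0, axis k 1) (dd (axis l 1, 0) (?g i)) (x, y)" for k l i
    by (rule pd_slice_snd[OF S _ D2[OF S(2)], of "\<lambda>x v. pd l (\<lambda>z. spray F z v i) x"]) (rule x1)
  have yy: "pd l (\<lambda>v. pd k (\<lambda>w. spray F x w i) v) y = dd (0, axis l 1) (dd (0, axis k 1) (?g i)) (x, y)" for k l i
    by (rule pd_slice_snd[OF S _ D2[OF S(2)], of "\<lambda>x v. pd k (\<lambda>w. spray F x w i) v"]) (rule y1)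
  have comp: "dd h (?g i) p = dd h G p $ i" if "p \<in> S" for h i p
    by (rule dd_vec_nth[OF sm_diff_at[OF G that]])
  have comp2: "dd k (dd h (?g i)) (x, y) = dd k (dd h G) (x, y) $ i" for h k i
  proof -
    have "dd k (dd h (?g i)) (x, y) = dd k (\<lambda>q. dd h G q $ i) (x, y)"
      by (rule dd_cong[OF S comp])
    then show ?thesis using dd_vec_nth[OF sm_diff_at[OF sm_dd[OF G] S(2)]] by simp
  qed
  have s1: "(\<Sum>l\<in>UNIV. dd (0, axis k 1) (dd (axis l 1, 0) (?g i)) (x, y) * y $ l)
      = dd (y, 0) (dd (0, axis k 1) G) (x, y) $ i"
  proof -
    have "dd (0, axis k 1) (dd (axis l 1, 0) (?g i)) (x, y) = dd (axis l 1, 0) (dd (0, axis k 1) (?g i)) (x, y)" for l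
      by (rule dd_symmetric[OF S g])
    then have "(\<Sum>l\<in>UNIV. dd (0, axis k 1) (dd (axis l 1, 0) (?g i)) (x, y) * y $ l)
        = dd (y, 0) (dd (0, axis k 1) (?g i)) (x, y)"
      by (simp add: dd_fst_eq_sum(1)[OF D2[OF S(2)], of y] mult.commute)
    then show ?thesis by (simp add: comp2)
  qed
  have s2: "(\<Sum>l\<in>UNIV. spray F x y l * dd (0, axis l 1) (dd (0, axis k 1) (?g i)) (x, y))
      = dd (0, G (x, y)) (dd (0, axis k 1) G) (x, y) $ i"
    by (simp add: spray[OF S(2)] flip: comp2) (simp add: dd_fst_eq_sum(2)[OF D2[OF S(2)], of "G (x, y)"])
  have s3: "(\<Sum>l\<in>UNIV. dd (0, axis l 1) (?g i) (x, y) * dd (0, axis k 1) (?g l) (x, y))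
      = dd (0, dd (0, axis k 1) G (x, y)) G (x, y) $ i"
    by (simp add: comp[OF S(2)] dd_fst_eq_sum(2)[OF sm_diff_at[OF G S(2)], of "dd (0, axis k 1) G (x, y)"] mult.commute)
  have "riemann F x y i k = 2 * dd (axis k 1, 0) G (x, y) $ i - dd (y, 0) (dd (0, axis k 1) G) (x, y) $ i
      + 2 * dd (0, G (x, y)) (dd (0, axis k 1) G) (x, y) $ i - dd (0, dd (0, axis k 1) G (x, y)) G (x, y) $ i"
    unfolding riemann_def x1[OF S(2)] y1[OF S(2)] xy yy s1 s2 comp[OF S(2)] s3[unfolded comp[OF S(2)]] ..
  then show ?thesis
    unfolding RR_def spr_split[OF sm_diff_at[OF sm_dd[OF G] S(2)]] by simp
qed

definition Lag :: "'n::finite finsler \<Rightarrow> (real^'n) \<times> (real^'n) \<Rightarrow> real" where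
  "Lag F p = (F (fst p) (snd p))\<^sup>2"

lemma fund_tensor_eq_dd:
  assumes S: "open S" "(x, y) \<in> S" and L: "sm S (Lag F)"
  shows "fund_tensor F x y $ i $ j = 1/2 * dd (0, axis j 1) (dd (0, axis i 1) (Lag F)) (x, y)"
proof -
  have y1: "pd i (\<lambda>w. (F x' w)\<^sup>2) v' = dd (0, axis i 1) (Lag F) (x', v')" if "(x', v') \<in> S" for x' v' i
    by (rule pd_slice_snd[OF S(1) that _ sm_diff_at[OF L that], of "\<lambda>x' w. (F x' w)\<^sup>2"]) (simp add: Lag_def)
  show ?thesis unfolding fund_tensor_def
    using pd_slice_snd[OF S _ sm_diff_at[OF sm_dd[OF L] S(2)], of "\<lambda>x' v. pd i (\<lambda>w. (F x' w)\<^sup>2) v", OF y1] by simp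
qed

text \<open>In terms of the fundamental tensor M, the hypothesis \<open>EL\<close> is the linear
  system whose right-hand side defines the spray, so invertibility of M leaves only one solution. A
  candidate can thus be verified without computing the inverse of M.\<close>

lemma spray_eqI:
  assumes S: "open S" "(x, y) \<in> S" and L: "sm S (Lag F)"
    and inv: "invertible (fund_tensor F x y)"
    and EL: "\<And>u. dd (y, - 2 *\<^sub>R g) (dd (0, u) (Lag F)) (x, y) = dd (u, 0) (Lag F) (x, y)"
  shows "spray F x y i = g $ i"
proof -
  let ?L = "Lag F" and ?M = "fund_tensor F x y"
  have D: "dd h ?L differentiable (at (x, y))" for h by (rule sm_diff_at[OF sm_dd[OF L] S(2)])
  have x1: "pd i (\<lambda>z. (F z v)\<^sup>2) x' = dd (axis i 1, 0) ?L (x', v)" if "(x', v) \<in> S" for x' v i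
    by (rule pd_slice_fst[OF S(1) that _ sm_diff_at[OF L that]]) (simp add: Lag_def)
  have xy: "pd l (\<lambda>v. pd k (\<lambda>z. (F z v)\<^sup>2) x) y = dd (0, axis l 1) (dd (axis k 1, 0) ?L) (x, y)" for k l
    by (rule pd_slice_snd[OF S _ D, of "\<lambda>x v. pd k (\<lambda>z. (F z v)\<^sup>2) x"]) (rule x1)
  have "(\<Sum>k\<in>UNIV. pd l (\<lambda>v. pd k (\<lambda>z. (F z v)\<^sup>2) x) y * y $ k) - pd l (\<lambda>z. (F z y)\<^sup>2) x
      = 4 * (?M *v g) $ l" for l
  proof -
    have "(\<Sum>k\<in>UNIV. pd l (\<lambda>v. pd k (\<lambda>z. (F z v)\<^sup>2) x) y * y $ k) = dd (y, 0) (dd (0, axis l 1) ?L) (x, y)"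
      unfolding xy dd_fst_eq_sum(1)[OF D, of y] by (simp add: dd_symmetric[OF S L, of "(0, axis l 1)"] mult.commute)
    moreover have "dd (y, - 2 *\<^sub>R g) (dd (0, axis l 1) ?L) (x, y)
        = dd (y, 0) (dd (0, axis l 1) ?L) (x, y) - 2 * dd (0, g) (dd (0, axis l 1) ?L) (x, y)"
      by (subst dd_split[OF D]) (simp only: dd_snd_scale[OF D], simp)
    moreover have "dd (0, g) (dd (0, axis l 1) ?L) (x, y) = 2 * (?M *v g) $ l"
      unfolding dd_fst_eq_sum(2)[OF D, of g]
      by (simp add: matrix_vector_mult_def fund_tensor_eq_dd[OF S L] sum_distrib_left mult_ac)
    ultimately show ?thesis using EL[of "axis l 1"] by (simp add: x1[OF S(2)])
  qed
  then have "spray F x y i = (\<Sum>l\<in>UNIV. matrix_inv ?M $ i $ l * (?M *v g) $ l)"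
    unfolding spray_def by (simp add: sum_distrib_left mult_ac)
  also have "\<dots> = (matrix_inv ?M *v (?M *v g)) $ i" by (simp add: matrix_vector_mult_def)
  also have "\<dots> = g $ i" using matrix_inv_mult(2)[OF inv] by (simp add: matrix_vector_mul_assoc)
  finally show ?thesis .
qed

lemma fund_tensor_bilinear:
  assumes S: "open S" "(x, y) \<in> S" and L: "sm S (Lag F)"
  shows "u \<bullet> (fund_tensor F x y *v v) = 1/2 * dd (0, v) (dd (0, u) (Lag F)) (x, y)"
proof -
  have D: "dd h (Lag F) differentiable (at (x, y))" for h by (rule sm_diff_at[OF sm_dd[OF L] S(2)])
  have "dd (0, v) (dd (0, u) (Lag F)) (x, y) = dd (0, u) (dd (0, v) (Lag F)) (x, y)" for u v
    by (rule dd_symmetric[OF S L])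
  note sym = this
  have "dd (0, v) (dd (0, u) (Lag F)) (x, y) = (\<Sum>i\<in>UNIV. u $ i * dd (0, v) (dd (0, axis i 1) (Lag F)) (x, y))"
    unfolding sym[of v u] dd_fst_eq_sum(2)[OF D, of u] by (simp add: sym)
  also have "\<dots> = (\<Sum>i\<in>UNIV. \<Sum>j\<in>UNIV. u $ i * (v $ j * dd (0, axis j 1) (dd (0, axis i 1) (Lag F)) (x, y)))"
    unfolding dd_fst_eq_sum(2)[OF D, of v] by (simp add: sum_distrib_left)
  also have "\<dots> = 2 * (u \<bullet> (fund_tensor F x y *v v))"
    by (simp add: inner_vec_def matrix_vector_mult_def fund_tensor_eq_dd[OF S L] sum_distrib_left mult_ac)
  finally show ?thesis by simp
qed

section \<open>Tensor fields in a chart\<close>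

text \<open>Tensor fields are kept as families of coefficients, so that one product rule covers the
  dependence on the point and on the arguments.\<close>

definition Lin :: "('n::finite \<Rightarrow> 'a \<Rightarrow> 'b::real_normed_vector) \<Rightarrow> 'a \<Rightarrow> real^'n \<Rightarrow> 'b" where
  "Lin c x u = (\<Sum>j\<in>UNIV. u $ j *\<^sub>R c j x)"

definition Tens :: "('n::finite \<Rightarrow> 'n \<Rightarrow> 'a \<Rightarrow> 'b::real_normed_vector) \<Rightarrow> 'a \<Rightarrow> real^'n \<Rightarrow> real^'n \<Rightarrow> 'b" where
  "Tens c x u v = (\<Sum>j\<in>UNIV. \<Sum>k\<in>UNIV. (u $ j * v $ k) *\<^sub>R c j k x)"

lemma bounded_linear_Lin: "bounded_linear (Lin c x)"
  unfolding Lin_def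
  by (intro bounded_linear_sum bounded_linear_compose[OF bounded_linear_scaleR_left bounded_linear_vec_nth])

lemma bilinear_Tens: "bounded_bilinear (Tens c x)"
proof (rule bilinear_conv_bounded_bilinear[THEN iffD1])
  show "bilinear (Tens c x)"
    unfolding bilinear_def Tens_def
    by (auto intro!: linearI simp: algebra_simps sum.distrib scaleR_sum_right)
qed

lemma sm_Lin:
  fixes c :: "'n::finite \<Rightarrow> 'a::real_normed_vector \<Rightarrow> 'b::real_normed_vector"
  assumes "open S" "bounded_linear L" "\<And>p. p \<in> S \<Longrightarrow> L p \<in> U" "\<And>j. sm U (c j)" "sm S u"
  shows "sm S (\<lambda>p. Lin c (L p) (u p))"
  unfolding Lin_def
  by (intro sm_sum[OF assms(1)] sm_scaleR[OF assms(1)] sm_vec_nth[OF assms(1,5)] sm_comp_linear[OF assms(1-4)])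

lemma sm_Tens:
  fixes c :: "'n::finite \<Rightarrow> 'n \<Rightarrow> 'a::real_normed_vector \<Rightarrow> 'b::real_normed_vector"
  assumes "open S" "bounded_linear L" "\<And>p. p \<in> S \<Longrightarrow> L p \<in> U" "\<And>j k. sm U (c j k)" "sm S u" "sm S v"
  shows "sm S (\<lambda>p. Tens c (L p) (u p) (v p))"
  unfolding Tens_def
  by (intro sm_sum[OF assms(1)] sm_scaleR[OF assms(1)] sm_mult[OF assms(1)] sm_vec_nth[OF assms(1)]
    assms(5,6) sm_comp_linear[OF assms(1-4)])

lemma dd_Lin:
  fixes c :: "'n::finite \<Rightarrow> 'a::real_normed_vector \<Rightarrow> 'b::real_normed_vector"
  assumes L: "bounded_linear L" and c: "\<And>j. c j differentiable (at (L p))" and u: "u differentiable (at p)"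
  shows "dd h (\<lambda>q. Lin c (L q) (u q)) p = Lin (\<lambda>j. dd (L h) (c j)) (L p) (u p) + Lin c (L p) (dd h u p)"
    and "(\<lambda>q. Lin c (L q) (u q)) differentiable (at p)"
proof -
  have dL: "L differentiable (at p)" using bounded_linear_imp_differentiable[OF L] by blast
  have cL: "(\<lambda>q. c j (L q)) differentiable (at p)" for j
    using differentiable_chain_at[OF dL c, of j] by (simp add: o_def)
  have un: "(\<lambda>q. u q $ j) differentiable (at p)" for j
    by (rule differentiable_linear_comp[OF bounded_linear_vec_nth u])
  note t = differentiable_bilinear[OF bounded_bilinear_scaleR un cL]
  show "dd h (\<lambda>q. Lin c (L q) (u q)) p = Lin (\<lambda>j. dd (L h) (c j)) (L p) (u p) + Lin c (L p) (dd h u p)"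
    unfolding Lin_def
    by (simp add: dd_sum t dd_scaleR[OF un cL] dd_comp_linear[OF L c] dd_vec_nth[OF u] sum.distrib add.commute)
  show "(\<lambda>q. Lin c (L q) (u q)) differentiable (at p)"
    unfolding Lin_def by (intro differentiable_sum) (simp_all add: t)
qed

lemma dd_Tens:
  fixes c :: "'n::finite \<Rightarrow> 'n \<Rightarrow> 'a::real_normed_vector \<Rightarrow> 'b::real_normed_vector"
  assumes L: "bounded_linear L" and c: "\<And>j k. c j k differentiable (at (L p))"
    and u: "u differentiable (at p)" and v: "v differentiable (at p)"
  shows "dd h (\<lambda>q. Tens c (L q) (u q) (v q)) p = Tens (\<lambda>j k. dd (L h) (c j k)) (L p) (u p) (v p)
      + Tens c (L p) (dd h u p) (v p) + Tens c (L p) (u p) (dd h v p)"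
    and "(\<lambda>q. Tens c (L q) (u q) (v q)) differentiable (at p)"
proof -
  have dL: "L differentiable (at p)" using bounded_linear_imp_differentiable[OF L] by blast
  have cL: "(\<lambda>q. c j k (L q)) differentiable (at p)" for j k
    using differentiable_chain_at[OF dL c, of j k] by (simp add: o_def)
  have un: "(\<lambda>q. u q $ j) differentiable (at p)" "(\<lambda>q. v q $ j) differentiable (at p)" for j
    by (rule differentiable_linear_comp[OF bounded_linear_vec_nth] u v)+
  note uv = differentiable_bilinear[OF bounded_bilinear_mult un]
  note t = differentiable_bilinear[OF bounded_bilinear_scaleR uv cL]
  have s: "(\<lambda>q. \<Sum>k\<in>UNIV. (u q $ j * v q $ k) *\<^sub>R c j k (L q)) differentiable (at p)" for j
    by (intro differentiable_sum) (simp_all add: t)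
  show "dd h (\<lambda>q. Tens c (L q) (u q) (v q)) p = Tens (\<lambda>j k. dd (L h) (c j k)) (L p) (u p) (v p)
      + Tens c (L p) (dd h u p) (v p) + Tens c (L p) (u p) (dd h v p)"
    unfolding Tens_def
    by (simp add: dd_sum s t dd_scaleR[OF uv cL] dd_mult[OF un] dd_comp_linear[OF L c] dd_vec_nth u v sum.distrib
      scaleR_add_left add_ac)
  show "(\<lambda>q. Tens c (L q) (u q) (v q)) differentiable (at p)"
    unfolding Tens_def by (intro differentiable_sum) (simp_all add: s)
qed

definition ip :: "'n::finite cmetric \<Rightarrow> real^'n \<Rightarrow> real^'n \<Rightarrow> real^'n \<Rightarrow> real" where
  "ip a = Tens (\<lambda>i j x. a x $ i $ j)"

definition Gam :: "'n::finite cmetric \<Rightarrow> real^'n \<Rightarrow> real^'n \<Rightarrow> real^'n \<Rightarrow> real^'n" where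
  "Gam a = Tens (\<lambda>j k x. \<chi> i. christoffel a x i j k)"

definition sharp :: "'n::finite cmetric \<Rightarrow> real^'n \<Rightarrow> real^'n \<Rightarrow> real^'n" where
  "sharp a = Lin (\<lambda>j x. \<chi> i. upper a x i j)"

lemma raise_eq_sharp: "raise a w x = sharp a x (w x)"
  by (simp add: raise_def sharp_def Lin_def vec_eq_iff mult.commute)

lemma alpha_eq_ip: "alpha a x y = sqrt (ip a x y y)"
  by (simp add: alpha_def ip_def Tens_def mult_ac)

interpretation ip: bounded_bilinear "ip a x" unfolding ip_def by (rule bilinear_Tens)
interpretation Gam: bounded_bilinear "Gam a x" unfolding Gam_def by (rule bilinear_Tens)

lemma bounded_linear_sharp: "bounded_linear (sharp a x)" unfolding sharp_def by (rule bounded_linear_Lin)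

lemmas ip_lin = ip.add_left ip.add_right ip.diff_left ip.diff_right ip.minus_left ip.minus_right
  ip.scaleR_left ip.scaleR_right ip.zero_left ip.zero_right
lemmas Gam_lin = Gam.add_left Gam.add_right Gam.diff_left Gam.diff_right Gam.minus_left Gam.minus_right
  Gam.scaleR_left Gam.scaleR_right Gam.zero_left Gam.zero_right

definition cov :: "'n::finite cmetric \<Rightarrow> 'n cvec \<Rightarrow> real^'n \<Rightarrow> real^'n \<Rightarrow> real^'n" where
  "cov a \<nu> x u = dd u \<nu> x + Gam a x u (\<nu> x)"

text \<open>\<open>hor a u p\<close> is the horizontal lift of \<open>u\<close> to \<open>p\<close>, and \<open>DH\<close> the induced covariant derivative of
  vectors that depend on \<open>(x, y)\<close>.\<close>

definition hor :: "'n::finite cmetric \<Rightarrow> real^'n \<Rightarrow> (real^'n) \<times> (real^'n) \<Rightarrow> (real^'n) \<times> (real^'n)" where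
  "hor a u p = (u, - Gam a (fst p) u (snd p))"

definition DH :: "'n::finite cmetric \<Rightarrow> real^'n \<Rightarrow> ((real^'n) \<times> (real^'n) \<Rightarrow> real^'n) \<Rightarrow> (real^'n) \<times> (real^'n) \<Rightarrow> real^'n" where
  "DH a u D p = dd (hor a u p) D p + Gam a (fst p) u (D p)"

text \<open>The spray coefficients of \<alpha>; that they are the ones of the definition is
  \<open>spray_alpha\<close>.\<close>

definition Gal :: "'n::finite cmetric \<Rightarrow> (real^'n) \<times> (real^'n) \<Rightarrow> real^'n" where
  "Gal a p = (1/2) *\<^sub>R Gam a (fst p) (snd p) (snd p)"

lemma Lin_axis [simp]: "Lin c x (axis j 1) = c j x"
  unfolding Lin_def by (subst sum.remove[of _ j]) (auto simp: axis_def)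

lemma Tens_axis [simp]: "Tens c x (axis i 1) (axis j 1) = c i j x"
proof -
  have "Tens c x u v = Lin (\<lambda>j x. Lin (c j) x v) x u" for u v
    by (simp add: Tens_def Lin_def scaleR_sum_right)
  then show ?thesis by simp
qed

locale chart_metric =
  fixes U :: "(real^'n::finite) set" and a :: "'n cmetric"
  assumes open_U: "open U" and sm_a: "\<And>i j. sm U (\<lambda>x. a x $ i $ j)"
    and a_sym: "\<And>x i j. x \<in> U \<Longrightarrow> a x $ i $ j = a x $ j $ i"
    and a_pos: "\<And>x y. x \<in> U \<Longrightarrow> y \<noteq> 0 \<Longrightarrow> (\<Sum>i\<in>UNIV. \<Sum>j\<in>UNIV. a x $ i $ j * y $ i * y $ j) > 0"
begin

lemma ip_sym: "x \<in> U \<Longrightarrow> ip a x u v = ip a x v u"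
  unfolding ip_def Tens_def by (subst sum.swap) (simp add: a_sym[of x] mult.commute)

lemma ip_pos: "x \<in> U \<Longrightarrow> y \<noteq> 0 \<Longrightarrow> ip a x y y > 0"
  using a_pos[of x y] by (simp add: ip_def Tens_def mult_ac)

lemma ip_nonneg: "x \<in> U \<Longrightarrow> ip a x y y \<ge> 0"
  using ip_pos[of x y] by (cases "y = 0") (auto simp: ip_lin)

lemma ip_eq_0_iff: "x \<in> U \<Longrightarrow> ip a x y y = 0 \<longleftrightarrow> y = 0"
  using ip_pos[of x y] ip.zero_left by (metis less_irrefl)

lemma ip_eqI: "x \<in> U \<Longrightarrow> (\<And>v. ip a x u v = ip a x u' v) \<Longrightarrow> u = u'"
  using ip_eq_0_iff[of x "u - u'"] by (simp add: ip_lin)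

lemma ip_matrix: "ip a x u v = u \<bullet> (a x *v v)"
  by (simp add: ip_def Tens_def inner_vec_def matrix_vector_mult_def sum_distrib_left mult_ac)

lemma invertible_a: "x \<in> U \<Longrightarrow> invertible (a x)"
proof -
  assume x: "x \<in> U"
  have "y = 0" if "a x *v y = 0" for y
    using ip_eq_0_iff[OF x, of y] that by (simp add: ip_matrix)
  then have "\<exists>B. B ** a x = mat 1"
    using matrix_left_invertible_ker[of "a x"] by blast
  then show ?thesis using invertible_left_inverse by blast
qed

lemma ip_sharp: "x \<in> U \<Longrightarrow> ip a x (sharp a x w) v = w \<bullet> v"
proof -
  assume x: "x \<in> U"
  have "sharp a x w = matrix_inv (a x) *v w"
    by (simp add: sharp_def Lin_def vec_eq_iff matrix_vector_mult_def upper_def mult.commute)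
  then have "a x *v sharp a x w = w"
    by (simp add: matrix_vector_mul_assoc matrix_inv_mult(1)[OF invertible_a[OF x]])
  then show ?thesis using ip_sym[OF x, of "sharp a x w" v] by (simp add: ip_matrix inner_commute)
qed

lemma sm_upper: "sm U (\<lambda>x. upper a x i j)"
  unfolding upper_def by (rule sm_matrix_inv[OF open_U sm_a invertible_a])

lemma sm_pd:
  assumes "sm U f" shows "sm U (pd i f)"
  by (rule sm_cong[OF open_U _ sm_dd[OF assms]]) (rule pd_eq_dd[symmetric, OF sm_diff_at[OF assms]])

lemma sm_christoffel: "sm U (\<lambda>x. christoffel a x i j k)"
  unfolding christoffel_def
  by (intro sm_mult[OF open_U] sm_sum[OF open_U] sm_diff[OF open_U] sm_add[OF open_U] sm_const sm_upper sm_pd sm_a)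

lemma sm_Gam_coeff: "sm U (\<lambda>x. \<chi> i. christoffel a x i j k)"
  by (rule sm_vec_lambda[OF open_U sm_christoffel])

lemma sm_sharp_coeff: "sm U (\<lambda>x. \<chi> i. upper a x i j)"
  by (rule sm_vec_lambda[OF open_U sm_upper])

lemma Gam_sym: "x \<in> U \<Longrightarrow> Gam a x u v = Gam a x v u"
proof -
  assume x: "x \<in> U"
  have "pd k (\<lambda>z. a z $ i $ j) x = pd k (\<lambda>z. a z $ j $ i) x" for i j k
    by (rule pd_cong[OF open_U x a_sym])
  then have "christoffel a x i j k = christoffel a x i k j" for i j k
    unfolding christoffel_def by (simp add: add.commute)
  then show ?thesis unfolding Gam_def Tens_def by (subst sum.swap) (simp add: mult.commute)
qed

lemma dd_ip_const: "x \<in> U \<Longrightarrow> dd w (\<lambda>z. ip a z u v) x = Tens (\<lambda>j k. dd w (\<lambda>x. a x $ j $ k)) x u v"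
  unfolding ip_def
  using dd_Tens(1)[of "\<lambda>z. z" "\<lambda>i j x. a x $ i $ j" x "\<lambda>z. u" "\<lambda>z. v" w] sm_diff_at[OF sm_a]
  by (simp add: dd_const bounded_linear_ident bounded_bilinear.zero_left[OF bilinear_Tens] bounded_bilinear.zero_right[OF bilinear_Tens])

lemma dd_ip_sym: "x \<in> U \<Longrightarrow> dd w (\<lambda>z. ip a z u v) x = dd w (\<lambda>z. ip a z v u) x"
  by (rule dd_cong[OF open_U]) (auto intro: ip_sym)

text \<open>The Koszul formula for constant fields, whose brackets vanish. It determines the
  connection by derivatives of the metric alone, which later gives the effect of a conformal
  change.\<close>

lemma Koszul:
  assumes x: "x \<in> U"
  shows "2 * ip a x (Gam a x u v) w =
    dd u (\<lambda>z. ip a z v w) x + dd v (\<lambda>z. ip a z u w) x - dd w (\<lambda>z. ip a z u v) x"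
proof -
  let ?d = "\<lambda>w u v. dd w (\<lambda>z. ip a z u v) x"
  have dtens: "?d w u v = (\<Sum>i\<in>UNIV. \<Sum>j\<in>UNIV. \<Sum>k\<in>UNIV. w $ i * u $ j * v $ k * pd i (\<lambda>z. a z $ j $ k) x)" for w u v
  proof -
    have "?d w u v = (\<Sum>j\<in>UNIV. \<Sum>k\<in>UNIV. u $ j * v $ k * (\<Sum>i\<in>UNIV. w $ i * pd i (\<lambda>z. a z $ j $ k) x))"
      unfolding dd_ip_const[OF x] Tens_def
      by (simp add: dd_eq_sum_axis[OF sm_diff_at[OF sm_a x], of w] pd_eq_dd[OF sm_diff_at[OF sm_a x]])
    also have "\<dots> = (\<Sum>j\<in>UNIV. \<Sum>k\<in>UNIV. \<Sum>i\<in>UNIV. w $ i * u $ j * v $ k * pd i (\<lambda>z. a z $ j $ k) x)"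
      by (simp add: sum_distrib_left mult_ac)
    also have "\<dots> = (\<Sum>j\<in>UNIV. \<Sum>i\<in>UNIV. \<Sum>k\<in>UNIV. w $ i * u $ j * v $ k * pd i (\<lambda>z. a z $ j $ k) x)"
      by (intro sum.cong refl sum.swap)
    finally show ?thesis by (subst sum.swap)
  qed
  define T where "T j k l = pd j (\<lambda>z. a z $ l $ k) x + pd k (\<lambda>z. a z $ l $ j) x - pd l (\<lambda>z. a z $ j $ k) x" for j k l
  have G: "Gam a x u v = sharp a x (\<chi> l. 1/2 * (\<Sum>j\<in>UNIV. \<Sum>k\<in>UNIV. u $ j * v $ k * T j k l))"
  proof -
    have "Gam a x u v $ i = (\<Sum>j\<in>UNIV. \<Sum>k\<in>UNIV. \<Sum>l\<in>UNIV. upper a x i l * (u $ j * v $ k * T j k l)) / 2" for i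
      unfolding Gam_def Tens_def christoffel_def T_def[symmetric]
      by (simp add: sum_distrib_left sum_divide_distrib mult_ac)
    moreover have "(\<Sum>j\<in>UNIV. \<Sum>k\<in>UNIV. \<Sum>l\<in>UNIV. upper a x i l * (u $ j * v $ k * T j k l))
      = (\<Sum>l\<in>UNIV. \<Sum>j\<in>UNIV. \<Sum>k\<in>UNIV. upper a x i l * (u $ j * v $ k * T j k l))" for i
    proof -
      have "(\<Sum>j\<in>UNIV. \<Sum>k\<in>UNIV. \<Sum>l\<in>UNIV. upper a x i l * (u $ j * v $ k * T j k l))
        = (\<Sum>j\<in>UNIV. \<Sum>l\<in>UNIV. \<Sum>k\<in>UNIV. upper a x i l * (u $ j * v $ k * T j k l))"
        by (intro sum.cong refl sum.swap)
      then show ?thesis by (subst sum.swap)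
    qed
    moreover have "sharp a x (\<chi> l. 1/2 * (\<Sum>j\<in>UNIV. \<Sum>k\<in>UNIV. u $ j * v $ k * T j k l)) $ i
      = (\<Sum>l\<in>UNIV. \<Sum>j\<in>UNIV. \<Sum>k\<in>UNIV. upper a x i l * (u $ j * v $ k * T j k l)) / 2" for i
      by (simp add: sharp_def Lin_def sum_distrib_left sum_divide_distrib mult_ac)
    ultimately show ?thesis by (simp only: vec_eq_iff) simp
  qed
  have "2 * ip a x (Gam a x u v) w = (\<Sum>l\<in>UNIV. w $ l * (\<Sum>j\<in>UNIV. \<Sum>k\<in>UNIV. u $ j * v $ k * T j k l))"
    unfolding G ip_sharp[OF x] by (simp add: inner_vec_def sum_distrib_left mult_ac)
  also have "\<dots> = (\<Sum>l\<in>UNIV. \<Sum>j\<in>UNIV. \<Sum>k\<in>UNIV. w $ l * u $ j * v $ k * pd j (\<lambda>z. a z $ l $ k) x)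
      + (\<Sum>l\<in>UNIV. \<Sum>j\<in>UNIV. \<Sum>k\<in>UNIV. w $ l * u $ j * v $ k * pd k (\<lambda>z. a z $ l $ j) x)
      - (\<Sum>l\<in>UNIV. \<Sum>j\<in>UNIV. \<Sum>k\<in>UNIV. w $ l * u $ j * v $ k * pd l (\<lambda>z. a z $ j $ k) x)"
    unfolding T_def by (simp add: sum_distrib_left algebra_simps sum.distrib sum_subtractf)
  also have "(\<Sum>l\<in>UNIV. \<Sum>j\<in>UNIV. \<Sum>k\<in>UNIV. w $ l * u $ j * v $ k * pd l (\<lambda>z. a z $ j $ k) x) = ?d w u v"
    by (simp add: dtens)
  also have "(\<Sum>l\<in>UNIV. \<Sum>j\<in>UNIV. \<Sum>k\<in>UNIV. w $ l * u $ j * v $ k * pd j (\<lambda>z. a z $ l $ k) x) = ?d u w v"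
    unfolding dtens by (subst sum.swap) (simp add: mult_ac)
  also have "(\<Sum>l\<in>UNIV. \<Sum>j\<in>UNIV. \<Sum>k\<in>UNIV. w $ l * u $ j * v $ k * pd k (\<lambda>z. a z $ l $ j) x) = ?d v w u"
  proof -
    have "(\<Sum>l\<in>UNIV. \<Sum>j\<in>UNIV. \<Sum>k\<in>UNIV. w $ l * u $ j * v $ k * pd k (\<lambda>z. a z $ l $ j) x)
      = (\<Sum>l\<in>UNIV. \<Sum>k\<in>UNIV. \<Sum>j\<in>UNIV. w $ l * u $ j * v $ k * pd k (\<lambda>z. a z $ l $ j) x)"
      by (intro sum.cong refl sum.swap)
    also have "\<dots> = ?d v w u" unfolding dtens by (subst sum.swap) (simp add: mult_ac)
    finally show ?thesis .
  qed
  also have "?d u w v = ?d u v w" by (rule dd_ip_sym[OF x])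
  also have "?d v w u = ?d v u w" by (rule dd_ip_sym[OF x])
  finally show ?thesis .
qed

text \<open>Compatibility with the metric: in the sum of the Koszul formulas for (w, u) and (w, v),
  all derivatives cancel except those along w.\<close>

lemma dd_ip_Gam:
  assumes x: "x \<in> U"
  shows "dd w (\<lambda>z. ip a z u v) x = ip a x (Gam a x w u) v + ip a x u (Gam a x w v)"
proof -
  show ?thesis
    using dd_ip_sym[OF x, of w u v] dd_ip_sym[OF x, of u v w] dd_ip_sym[OF x, of v u w] Koszul[OF x, of w u v] Koszul[OF x, of w v u] ip_sym[OF x, of u "Gam a x w v"] by linarith
qed

lemma sm_ip: 
  assumes "open S" "\<And>p. p \<in> S \<Longrightarrow> fst p \<in> U" "sm S u" "sm S v"
  shows "sm S (\<lambda>p. ip a (fst p) (u p) (v p))"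
  unfolding ip_def using sm_Tens[OF assms(1) bounded_linear_fst assms(2) sm_a assms(3,4)] by simp

lemma sm_ip_base: "sm U u \<Longrightarrow> sm U v \<Longrightarrow> sm U (\<lambda>x. ip a x (u x) (v x))"
  unfolding ip_def using sm_Tens[OF open_U bounded_linear_ident _ sm_a] by simp

lemma sm_Gam: 
  assumes "open S" "\<And>p. p \<in> S \<Longrightarrow> fst p \<in> U" "sm S u" "sm S v"
  shows "sm S (\<lambda>p. Gam a (fst p) (u p) (v p))"
  unfolding Gam_def using sm_Tens[OF assms(1) bounded_linear_fst assms(2) sm_Gam_coeff assms(3,4)] by simp

lemma sm_Gam_base: "sm U u \<Longrightarrow> sm U v \<Longrightarrow> sm U (\<lambda>x. Gam a x (u x) (v x))"
  unfolding Gam_def using sm_Tens[OF open_U bounded_linear_ident _ sm_Gam_coeff] by simp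

lemma sm_sharp_base: "sm U u \<Longrightarrow> sm U (\<lambda>x. sharp a x (u x))"
  unfolding sharp_def using sm_Lin[OF open_U bounded_linear_ident _ sm_sharp_coeff] by simp

lemma sm_cov: "sm U \<nu> \<Longrightarrow> sm U v \<Longrightarrow> sm U (\<lambda>x. cov a \<nu> x (v x))"
  unfolding cov_def by (intro sm_add[OF open_U] sm_Gam_base sm_dd_var[OF open_U])

lemma dd_ip:
  assumes p: "fst p \<in> U" and u: "u differentiable (at p)" and v: "v differentiable (at p)"
  shows "dd h (\<lambda>q. ip a (fst q) (u q) (v q)) p =
      ip a (fst p) (dd h u p + Gam a (fst p) (fst h) (u p)) (v p)
      + ip a (fst p) (u p) (dd h v p + Gam a (fst p) (fst h) (v p))"
    and differentiable_ip: "(\<lambda>q. ip a (fst q) (u q) (v q)) differentiable (at p)"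
proof -
  have c: "(\<lambda>x. a x $ i $ j) differentiable (at (fst p))" for i j by (rule sm_diff_at[OF sm_a p])
  show "dd h (\<lambda>q. ip a (fst q) (u q) (v q)) p =
      ip a (fst p) (dd h u p + Gam a (fst p) (fst h) (u p)) (v p)
      + ip a (fst p) (u p) (dd h v p + Gam a (fst p) (fst h) (v p))"
    using dd_Tens(1)[where c = "\<lambda>i j x. a x $ i $ j" and h = h, OF bounded_linear_fst c u v]
    unfolding ip_def[symmetric] dd_ip_const[OF p, symmetric] dd_ip_Gam[OF p] by (simp add: ip_lin)
  show "(\<lambda>q. ip a (fst q) (u q) (v q)) differentiable (at p)"
    using dd_Tens(2)[where c = "\<lambda>i j x. a x $ i $ j", OF bounded_linear_fst c u v] unfolding ip_def .
qed

lemma dd_ip_base: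
  assumes x: "x \<in> U" and u: "u differentiable (at x)" and v: "v differentiable (at x)"
  shows "dd h (\<lambda>z. ip a z (u z) (v z)) x = ip a x (cov a u x h) (v x) + ip a x (u x) (cov a v x h)"
proof -
  have c: "(\<lambda>x. a x $ i $ j) differentiable (at x)" for i j by (rule sm_diff_at[OF sm_a x])
  show ?thesis
    using dd_Tens(1)[where c = "\<lambda>i j x. a x $ i $ j" and h = h, OF bounded_linear_ident c u v]
    unfolding ip_def[symmetric] dd_ip_const[OF x, symmetric] dd_ip_Gam[OF x] cov_def by (simp add: ip_lin)
qed

lemma dd_Gam_vert:
  assumes p: "fst p \<in> U" and u: "u differentiable (at p)" and v: "v differentiable (at p)"
  shows "dd (0, h) (\<lambda>q. Gam a (fst q) (u q) (v q)) p =
      Gam a (fst p) (dd (0, h) u p) (v p) + Gam a (fst p) (u p) (dd (0, h) v p)"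
    and differentiable_Gam: "(\<lambda>q. Gam a (fst q) (u q) (v q)) differentiable (at p)"
proof -
  have c: "(\<lambda>x. \<chi> i. christoffel a x i j k) differentiable (at (fst p))" for j k
    by (rule sm_diff_at[OF sm_Gam_coeff p])
  have "Tens (\<lambda>j k. dd 0 (\<lambda>x. \<chi> i. christoffel a x i j k)) (fst p) (u p) (v p) = 0"
    unfolding Tens_def by (simp add: dd_dir_zero[OF c])
  then show "dd (0, h) (\<lambda>q. Gam a (fst q) (u q) (v q)) p =
      Gam a (fst p) (dd (0, h) u p) (v p) + Gam a (fst p) (u p) (dd (0, h) v p)"
    using dd_Tens(1)[OF bounded_linear_fst c u v, of "(0, h)"] unfolding Gam_def by simp
  show "(\<lambda>q. Gam a (fst q) (u q) (v q)) differentiable (at p)"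
    using dd_Tens(2)[OF bounded_linear_fst c u v] unfolding Gam_def .
qed

lemma dd_hor_ip:
  assumes "fst p \<in> U" "u differentiable (at p)" "v differentiable (at p)"
  shows "dd (hor a w p) (\<lambda>q. ip a (fst q) (u q) (v q)) p =
      ip a (fst p) (DH a w u p) (v p) + ip a (fst p) (u p) (DH a w v p)"
  unfolding dd_ip[OF assms] DH_def by (simp add: hor_def)

lemma dd_vert_ip:
  assumes "fst p \<in> U" "u differentiable (at p)" "v differentiable (at p)"
  shows "dd (0, w) (\<lambda>q. ip a (fst q) (u q) (v q)) p =
      ip a (fst p) (dd (0, w) u p) (v p) + ip a (fst p) (u p) (dd (0, w) v p)"
  unfolding dd_ip[OF assms] by (simp add: Gam_lin)

lemma differentiable_fst [simp]: "(\<lambda>q. fst q) differentiable (at p)"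
  and differentiable_snd [simp]: "(\<lambda>q. snd q) differentiable (at p)"
  by (rule differentiable_linear_comp[OF bounded_linear_fst differentiable_ident]
    differentiable_linear_comp[OF bounded_linear_snd differentiable_ident])+

lemma DH_snd: "DH a u (\<lambda>q. snd q) p = 0"
  by (simp add: DH_def dd_snd hor_def)

lemma DH_base: "\<nu> differentiable (at (fst p)) \<Longrightarrow> DH a u (\<lambda>q. \<nu> (fst q)) p = cov a \<nu> (fst p) u"
  by (simp add: DH_def dd_comp_fst hor_def cov_def)

lemma DH_scaleR:
  "f differentiable (at p) \<Longrightarrow> D differentiable (at p) \<Longrightarrow>
    DH a u (\<lambda>q. f q *\<^sub>R D q) p = dd (hor a u p) f p *\<^sub>R D p + f p *\<^sub>R DH a u D p"
  by (simp add: DH_def dd_scaleR Gam_lin algebra_simps)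

lemma DH_add:
  "D differentiable (at p) \<Longrightarrow> E differentiable (at p) \<Longrightarrow> DH a u (\<lambda>q. D q + E q) p = DH a u D p + DH a u E p"
  by (simp add: DH_def dd_add Gam_lin algebra_simps)

lemma DH_diff:
  "D differentiable (at p) \<Longrightarrow> E differentiable (at p) \<Longrightarrow> DH a u (\<lambda>q. D q - E q) p = DH a u D p - DH a u E p"
  by (simp add: DH_def dd_diff Gam_lin algebra_simps)

lemma sm_Gal: "open S \<Longrightarrow> (\<And>p. p \<in> S \<Longrightarrow> fst p \<in> U) \<Longrightarrow> sm S (Gal a)"
  unfolding Gal_def by (intro sm_scaleR sm_const sm_Gam sm_snd)

lemma dd_vert_Gal: "fst p \<in> U \<Longrightarrow> dd (0, w) (Gal a) p = Gam a (fst p) w (snd p)"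
proof -
  assume p: "fst p \<in> U"
  have "dd (0, w) (Gal a) p = (1/2) *\<^sub>R dd (0, w) (\<lambda>q. Gam a (fst q) (snd q) (snd q)) p"
    unfolding Gal_def by (rule dd_linear[OF bounded_linear_scaleR_right differentiable_Gam[OF p]]) simp_all
  also have "\<dots> = (1/2) *\<^sub>R (Gam a (fst p) w (snd p) + Gam a (fst p) w (snd p))"
    using p by (simp add: dd_Gam_vert dd_snd Gam_sym[OF p, of "snd p"])
  also have "\<dots> = Gam a (fst p) w (snd p)" by (simp flip: scaleR_2)
  finally show ?thesis .
qed

lemma open_UxV: "open (U \<times> (UNIV :: (real^'n) set))"
  by (intro open_Times open_U open_UNIV)

lemma dd_vert_vert_Gal: "fst p \<in> U \<Longrightarrow> dd (0, v) (dd (0, w) (Gal a)) p = Gam a (fst p) w v"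
proof -
  assume p: "fst p \<in> U"
  have "dd (0, v) (dd (0, w) (Gal a)) p = dd (0, v) (\<lambda>q. Gam a (fst q) w (snd q)) p"
    by (rule dd_cong[OF open_UxV]) (use p dd_vert_Gal in \<open>auto simp: mem_Times_iff\<close>)
  then show ?thesis using p by (simp add: dd_Gam_vert dd_const dd_snd Gam_lin)
qed

lemma spr_Gal: "spr (Gal a) f p = dd (hor a (snd p) p) f p"
  unfolding spr_def hor_def Gal_def by simp

text \<open>The change of curvature caused by a tensorial term D. The partial derivatives regroup
  into horizontal covariant ones, because the Christoffel terms produced by D are exactly those
  contained in \<open>DH\<close>.\<close>

lemma RR_add:
  assumes S: "open S" "p \<in> S" "\<And>q. q \<in> S \<Longrightarrow> fst q \<in> U" and D: "sm S D"
  shows "RR (\<lambda>q. Gal a q + D q) w p = RR (Gal a) w p + 3 *\<^sub>R DH a w D p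
    - dd (0, w) (\<lambda>q. DH a (snd q) D q) p + 2 *\<^sub>R dd (0, D p) (dd (0, w) D) p - dd (0, dd (0, w) D p) D p"
proof -
  note G = sm_Gal[OF S(1,3)]
  have pU: "fst p \<in> U" by (rule S(3)[OF S(2)])
  have dG: "Gal a differentiable (at q)" "dd h (Gal a) differentiable (at q)" if "q \<in> S" for h q
    using sm_diff_at[OF G that] sm_diff_at[OF sm_dd[OF G] that] by blast+
  have dD: "D differentiable (at q)" "dd h D differentiable (at q)" if "q \<in> S" for h q
    using sm_diff_at[OF D that] sm_diff_at[OF sm_dd[OF D] that] by blast+
  note dGp = dG[OF S(2)] and dDp = dD[OF S(2)]
  have vS: "sm S (\<lambda>q. (snd q, 0::real^'n))" by (intro sm_Pair S(1) sm_snd sm_const)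
  have 1: "dd h (\<lambda>q. Gal a q + D q) q = dd h (Gal a) q + dd h D q" if "q \<in> S" for h q
    by (rule dd_add[OF dG(1)[OF that] dD(1)[OF that]])
  have 2: "dd k (dd h (\<lambda>q. Gal a q + D q)) p = dd k (dd h (Gal a)) p + dd k (dd h D) p" for h k
  proof -
    have "dd k (dd h (\<lambda>q. Gal a q + D q)) p = dd k (\<lambda>q. dd h (Gal a) q + dd h D q) p"
      by (rule dd_cong[OF S(1,2) 1])
    then show ?thesis by (simp add: dd_add dGp dDp)
  qed
  have dX: "(\<lambda>q. dd (snd q, 0) (Gal a) q) differentiable (at p)" "(\<lambda>q. dd (snd q, 0) D q) differentiable (at p)"
    using sm_diff_at[OF sm_dd_var[OF S(1) vS G] S(2)] sm_diff_at[OF sm_dd_var[OF S(1) vS D] S(2)] by blast+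
  have 3: "dd h (\<lambda>q. dd (snd q, 0) (\<lambda>q. Gal a q + D q) q) p =
      dd h (\<lambda>q. dd (snd q, 0) (Gal a) q) p + dd h (\<lambda>q. dd (snd q, 0) D q) p" for h
  proof -
    have "dd h (\<lambda>q. dd (snd q, 0) (\<lambda>q. Gal a q + D q) q) p
        = dd h (\<lambda>q. dd (snd q, 0) (Gal a) q + dd (snd q, 0) D q) p"
      by (rule dd_cong[OF S(1,2) 1])
    then show ?thesis by (simp add: dd_add dX)
  qed
  let ?\<Gamma> = "Gam a (fst p)" and ?y = "snd p"
  \<comment> \<open>\<open>DH a (snd q) D q\<close> contains the spray coefficients of \<alpha>,
    which depend on the fibre variable as well; their fibre derivative accounts for the Christoffel
    terms.\<close>
  have 4: "dd (0, w) (\<lambda>q. DH a (snd q) D q) p = dd (0, w) (\<lambda>q. dd (snd q, 0) D q) p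
      - (2 *\<^sub>R dd (0, ?\<Gamma> w ?y) D p + 2 *\<^sub>R dd (0, Gal a p) (dd (0, w) D) p)
      + (?\<Gamma> w (D p) + ?\<Gamma> ?y (dd (0, w) D p))"
  proof -
    have v2: "(\<lambda>q. (0::real^'n, 2 *\<^sub>R Gal a q)) differentiable (at p)"
      by (intro differentiable_Pair differentiable_const differentiable_linear_comp[OF bounded_linear_scaleR_right] dGp)
    have s2: "sm S (\<lambda>q. (0::real^'n, 2 *\<^sub>R Gal a q))"
      by (intro sm_Pair S(1) sm_const sm_scaleR G)
    have "dd (0, w) (\<lambda>q. DH a (snd q) D q) p = dd (0, w) (\<lambda>q. dd (snd q, 0) D q - dd (0, 2 *\<^sub>R Gal a q) D q
        + Gam a (fst q) (snd q) (D q)) p"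
    proof (rule dd_cong[OF S(1,2)])
      fix q assume q: "q \<in> S"
      have "DH a (snd q) D q = dd (snd q, - 2 *\<^sub>R Gal a q) D q + Gam a (fst q) (snd q) (D q)"
        unfolding DH_def hor_def Gal_def by simp
      also have "dd (snd q, - 2 *\<^sub>R Gal a q) D q = dd (snd q, 0) D q + dd (0, - 2 *\<^sub>R Gal a q) D q"
        by (rule dd_split[OF dD(1)[OF q]])
      also have "dd (0, - 2 *\<^sub>R Gal a q) D q = - dd (0, 2 *\<^sub>R Gal a q) D q"
        by (simp add: dd_snd_minus[OF dD(1)[OF q]])
      finally show "DH a (snd q) D q = dd (snd q, 0) D q - dd (0, 2 *\<^sub>R Gal a q) D q + Gam a (fst q) (snd q) (D q)"
        by simp
    qed
    also have "\<dots> = dd (0, w) (\<lambda>q. dd (snd q, 0) D q) p - dd (0, w) (\<lambda>q. dd (0, 2 *\<^sub>R Gal a q) D q) p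
        + dd (0, w) (\<lambda>q. Gam a (fst q) (snd q) (D q)) p"
      using dX sm_diff_at[OF sm_dd_var[OF S(1) s2 D] S(2)] differentiable_Gam[OF pU differentiable_snd dDp(1)]
      by (simp add: dd_add dd_diff differentiable_diff)
    also have "dd (0, w) (\<lambda>q. Gam a (fst q) (snd q) (D q)) p = ?\<Gamma> w (D p) + ?\<Gamma> ?y (dd (0, w) D p)"
      by (simp add: dd_Gam_vert[OF pU] dDp dd_snd)
    also have "dd (0, w) (\<lambda>q. dd (0, 2 *\<^sub>R Gal a q) D q) p
        = dd (dd (0, w) (\<lambda>q. (0, 2 *\<^sub>R Gal a q)) p) D p + dd (0, w) (dd (0, 2 *\<^sub>R Gal a p) D) p"
      by (rule dd_var[OF S(1,2) D v2])
    also have "dd (0, w) (\<lambda>q. (0, 2 *\<^sub>R Gal a q)) p = (0, 2 *\<^sub>R ?\<Gamma> w ?y)"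
      by (subst dd_Pair) (auto simp: dd_const dd_linear[OF bounded_linear_scaleR_right] dGp dd_vert_Gal pU
        intro!: differentiable_linear_comp[OF bounded_linear_scaleR_right])
    also have "dd (0, w) (dd (0, 2 *\<^sub>R Gal a p) D) p = dd (0, 2 *\<^sub>R Gal a p) (dd (0, w) D) p"
      by (rule dd_symmetric[OF S(1,2) D])
    finally show ?thesis by (simp only: dd_snd_scale[OF dDp(1)] dd_snd_scale[OF dDp(2)])
  qed
  have 5: "DH a w D p = dd (w, 0) D p - dd (0, ?\<Gamma> w ?y) D p + ?\<Gamma> w (D p)"
    unfolding DH_def hor_def using dd_split[OF dDp(1), of w "- ?\<Gamma> w ?y"] by (simp add: dd_snd_minus[OF dDp(1)])
  have E: "RR (\<lambda>q. Gal a q + D q) w p = 3 *\<^sub>R dd (w, 0) (\<lambda>q. Gal a q + D q) p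
      - dd (0, w) (\<lambda>q. dd (snd q, 0) (\<lambda>q. Gal a q + D q) q) p
    + 2 *\<^sub>R dd (0, Gal a p + D p) (dd (0, w) (\<lambda>q. Gal a q + D q)) p
    - dd (0, dd (0, w) (\<lambda>q. Gal a q + D q) p) (\<lambda>q. Gal a q + D q) p"
    by (rule RR_expand[OF S(1,2) sm_add[OF S(1) G D]])
  have E': "RR (Gal a) w p = 3 *\<^sub>R dd (w, 0) (Gal a) p - dd (0, w) (\<lambda>q. dd (snd q, 0) (Gal a) q) p
    + 2 *\<^sub>R ?\<Gamma> w (Gal a p) - ?\<Gamma> (?\<Gamma> w ?y) ?y"
    using RR_expand[OF S(1,2) G, of w] by (simp add: dd_vert_Gal[OF pU] dd_vert_vert_Gal[OF pU])
  have s: "?\<Gamma> (dd (0, w) D p) ?y = ?\<Gamma> ?y (dd (0, w) D p)" by (rule Gam_sym[OF pU])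
  show ?thesis
    unfolding E E' 1[OF S(2)] 2 3 4 5 dd_snd_add[OF dGp(1)] dd_snd_add[OF dGp(2)]
      dd_snd_add[OF dDp(1)] dd_snd_add[OF dDp(2)] dd_vert_Gal[OF pU] dd_vert_vert_Gal[OF pU] Gam.add_right Gam.add_left s
    by (simp add: vec_eq_iff)
qed

end

section \<open>The Riemannian spray and its projective and conformal changes\<close>

lemma differentiable_comp_fst: "f differentiable (at (fst p)) \<Longrightarrow> (\<lambda>q. f (fst q)) differentiable (at p)"
  using differentiable_chain_at[of fst p f] bounded_linear_imp_differentiable[OF bounded_linear_fst] by (auto simp: o_def)

lemma sm_RR:
  assumes "open S" "sm S G"
  shows "sm S (RR G w)"
proof -
  have "sm S (\<lambda>p. RR G w p)"
    unfolding RR_def spr_def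
    by (intro sm_diff sm_scaleR sm_const sm_dd assms sm_dd_var sm_Pair sm_snd)
  then show ?thesis .
qed

lemma linear_RR:
  fixes G :: "('a::euclidean_space \<times> 'a) \<Rightarrow> 'a"
  assumes S: "open S" "p \<in> S" "sm S G"
  shows "linear (\<lambda>w. RR G w p)"
proof -
  have D: "G differentiable (at q)" if "q \<in> S" for q by (rule sm_diff_at[OF S(3) that])
  have D2: "dd h G differentiable (at p)" for h by (rule sm_diff_at[OF sm_dd[OF S(3)] S(2)])
  have add: "spr G (dd (0, v + w) G) p = spr G (dd (0, v) G) p + spr G (dd (0, w) G) p" for v w
  proof -
    have "spr G (dd (0, v + w) G) p = spr G (\<lambda>q. dd (0, v) G q + dd (0, w) G q) p"
      unfolding spr_def by (rule dd_cong[OF S(1,2)]) (rule dd_snd_add[OF D])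
    then show ?thesis unfolding spr_def by (simp add: dd_add[OF D2 D2])
  qed
  have sc: "spr G (dd (0, c *\<^sub>R w) G) p = c *\<^sub>R spr G (dd (0, w) G) p" for c w
  proof -
    have "spr G (dd (0, c *\<^sub>R w) G) p = spr G (\<lambda>q. c *\<^sub>R dd (0, w) G q) p"
      unfolding spr_def by (rule dd_cong[OF S(1,2)]) (rule dd_snd_scale[OF D])
    then show ?thesis unfolding spr_def by (simp add: dd_linear[OF bounded_linear_scaleR_right D2])
  qed
  have f: "dd (v + w, 0) G p = dd (v, 0) G p + dd (w, 0) G p" for v w
    using dd_dir_add[OF D[OF S(2)], of "(v, 0)" "(w, 0)"] by simp
  show ?thesis
    by (rule linearI) (simp_all add: RR_def add sc f dd_snd_add[OF D[OF S(2)]] dd_snd_scale[OF D[OF S(2)]]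
      dd_fst_scale[OF D[OF S(2)]] algebra_simps)
qed

text \<open>Under the reflection of y each fibre derivative of an even G changes sign, and so does
  the factor y. Every term of \<open>RR\<close> contains an even number of these.\<close>

lemma RR_even:
  fixes G :: "('a::euclidean_space \<times> 'a) \<Rightarrow> 'a"
  assumes S: "open S" "(x, y) \<in> S" "(x, - y) \<in> S" "sm S G" and even: "\<And>x y. G (x, - y) = G (x, y)"
  shows "RR G w (x, - y) = RR G w (x, y)"
proof -
  let ?\<sigma> = "\<lambda>q :: 'a \<times> 'a. (fst q, - snd q)"
  have L: "bounded_linear ?\<sigma>"
    by (intro bounded_linear_Pair bounded_linear_fst bounded_linear_minus bounded_linear_snd)
  define T where "T = S \<inter> ?\<sigma> -` S"
  have T: "open T" "(x, y) \<in> T" "\<And>q. q \<in> T \<Longrightarrow> q \<in> S" "\<And>q. q \<in> T \<Longrightarrow> ?\<sigma> q \<in> S"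
    using S by (auto simp: T_def intro!: open_Int open_vimage continuous_intros)
  have D: "G differentiable (at q)" "dd h G differentiable (at q)" if "q \<in> S" for h q
    using sm_diff_at[OF S(4) that] sm_diff_at[OF sm_dd[OF S(4)] that] by blast+
  have ev: "G (?\<sigma> q) = G q" for q using even[of "fst q" "snd q"] by simp
  have 1: "dd (u, v) G (?\<sigma> q) = dd (u, - v) G q" if "q \<in> T" for u v q
    using dd_comp_linear[OF L D(1)[OF T(4)[OF that]], of "(u, - v)"] by (simp add: ev)
  have d0: "dd (0, - w) G q = - dd (0, w) G q" if "q \<in> S" for w q
    by (rule dd_snd_minus[OF D(1)[OF that]])
  have "spr G (dd (0, w) G) (x, - y) = dd (- y, - 2 *\<^sub>R G (x, y)) (dd (0, w) G) (?\<sigma> (x, y))"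
    by (simp add: spr_def even)
  also have "\<dots> = dd (- y, 2 *\<^sub>R G (x, y)) (\<lambda>q. dd (0, w) G (?\<sigma> q)) (x, y)"
    using dd_comp_linear[OF L D(2), of "(x, y)" "(- y, 2 *\<^sub>R G (x, y))" "(0, w)"] S by simp
  also have "\<dots> = dd (- y, 2 *\<^sub>R G (x, y)) (\<lambda>q. - dd (0, w) G q) (x, y)"
    by (rule dd_cong[OF T(1,2)]) (simp add: 1 d0 T(3))
  also have "\<dots> = dd (- (y, - 2 *\<^sub>R G (x, y))) (\<lambda>q. - dd (0, w) G q) (x, y)" by simp
  also have "\<dots> = spr G (dd (0, w) G) (x, y)"
    unfolding spr_def by (simp only: dd_minus[OF D(2)[OF S(2)]] dd_dir_minus[OF D(2)[OF S(2)]]) simp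
  finally have 2: "spr G (dd (0, w) G) (x, - y) = spr G (dd (0, w) G) (x, y)" .
  have 3: "dd (w, 0) G (x, - y) = dd (w, 0) G (x, y)" using 1[OF T(2), of w 0] by simp
  have 4: "dd (0, w) G (x, - y) = - dd (0, w) G (x, y)" for w
    using 1[OF T(2), of 0 w] d0[OF S(2)] by simp
  show ?thesis unfolding RR_def 2 3 4 by (simp add: d0[OF S(2)] d0[OF S(3)] 4)
qed

section \<open>The spray and the curvature of \<alpha>\<close>

context chart_metric
begin

lemma Lag_alpha: "fst q \<in> U \<Longrightarrow> Lag (alpha a) q = ip a (fst q) (snd q) (snd q)"
  by (simp add: Lag_def alpha_eq_ip ip_nonneg)

lemma alpha_sq: "x \<in> U \<Longrightarrow> (alpha a x y)\<^sup>2 = ip a x y y"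
  by (simp add: alpha_eq_ip ip_nonneg)

lemma alpha_pos: "x \<in> U \<Longrightarrow> y \<noteq> 0 \<Longrightarrow> alpha a x y > 0"
  by (simp add: alpha_eq_ip ip_pos)

lemma sm_Lag_alpha: "sm (U \<times> UNIV) (Lag (alpha a))"
  by (rule sm_cong[OF open_UxV _ sm_ip[OF open_UxV]])
    (auto simp: Lag_alpha intro: sm_snd open_UxV)

lemma dd_vert_Lag_alpha: "fst p \<in> U \<Longrightarrow> dd (0, w) (Lag (alpha a)) p = 2 * ip a (fst p) w (snd p)"
proof -
  assume p: "fst p \<in> U"
  have "dd (0, w) (Lag (alpha a)) p = dd (0, w) (\<lambda>q. ip a (fst q) (snd q) (snd q)) p"
    by (rule dd_cong[OF open_UxV]) (use p in \<open>auto simp: mem_Times_iff Lag_alpha\<close>)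
  then show ?thesis using p by (simp add: dd_vert_ip dd_snd ip_sym[OF p, of "snd p"])
qed

lemma dd_hor_Lag_alpha: "fst p \<in> U \<Longrightarrow> dd (hor a w p) (Lag (alpha a)) p = 0"
proof -
  assume p: "fst p \<in> U"
  have "dd (hor a w p) (Lag (alpha a)) p = dd (hor a w p) (\<lambda>q. ip a (fst q) (snd q) (snd q)) p"
    by (rule dd_cong[OF open_UxV]) (use p in \<open>auto simp: mem_Times_iff Lag_alpha\<close>)
  then show ?thesis using p by (simp add: dd_hor_ip DH_snd ip_lin)
qed

lemma spr_Gal_Lag_alpha:
  assumes p: "fst p \<in> U"
  shows "spr (Gal a) (dd (0, u) (Lag (alpha a))) p = dd (u, 0) (Lag (alpha a)) p"
proof -
  have "spr (Gal a) (dd (0, u) (Lag (alpha a))) p = dd (hor a (snd p) p) (\<lambda>q. 2 * ip a (fst q) u (snd q)) p"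
    unfolding spr_Gal by (rule dd_cong[OF open_UxV]) (use p in \<open>auto simp: mem_Times_iff dd_vert_Lag_alpha\<close>)
  also have "\<dots> = 2 * ip a (fst p) (Gam a (fst p) u (snd p)) (snd p)"
    using p by (simp add: dd_linear[OF bounded_linear_mult_right] differentiable_ip dd_hor_ip DH_snd ip_lin Gam_sym[OF p, of u])
      (simp add: DH_def dd_const)
  also have "\<dots> = dd (hor a u p) (Lag (alpha a)) p + dd (0, Gam a (fst p) u (snd p)) (Lag (alpha a)) p"
    by (simp add: dd_hor_Lag_alpha[OF p] dd_vert_Lag_alpha[OF p])
  also have "\<dots> = dd (hor a u p + (0, Gam a (fst p) u (snd p))) (Lag (alpha a)) p"
    by (rule dd_dir_add[symmetric], rule sm_diff_at[OF sm_Lag_alpha]) (use p in \<open>simp add: mem_Times_iff\<close>)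
  also have "hor a u p + (0, Gam a (fst p) u (snd p)) = (u, 0)" by (simp add: hor_def)
  finally show ?thesis .
qed

lemma spray_alpha:
  assumes x: "x \<in> U"
  shows "spray (alpha a) x y i = Gal a (x, y) $ i"
proof (rule spray_eqI[OF open_UxV _ sm_Lag_alpha])
  show m: "(x, y) \<in> U \<times> UNIV" using x by simp
  show "dd (y, - 2 *\<^sub>R Gal a (x, y)) (dd (0, u) (Lag (alpha a))) (x, y) = dd (u, 0) (Lag (alpha a)) (x, y)" for u
    using spr_Gal_Lag_alpha[of "(x, y)" u] x by (simp add: spr_def)
  have "fund_tensor (alpha a) x y $ i $ j = a x $ i $ j" for i j
  proof -
    have "dd (0, axis j 1) (dd (0, axis i 1) (Lag (alpha a))) (x, y)
        = dd (0, axis j 1) (\<lambda>q. 2 * ip a (fst q) (axis i 1) (snd q)) (x, y)"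
      by (rule dd_cong[OF open_UxV m]) (auto simp: dd_vert_Lag_alpha)
    also have "\<dots> = 2 * ip a x (axis i 1) (axis j 1)"
      using x by (simp add: dd_linear[OF bounded_linear_mult_right] differentiable_ip dd_vert_ip dd_snd dd_const ip_lin)
    finally show ?thesis unfolding fund_tensor_eq_dd[OF open_UxV m sm_Lag_alpha] by (simp add: ip_def)
  qed
  then have "fund_tensor (alpha a) x y = a x" by (simp add: vec_eq_iff)
  then show "invertible (fund_tensor (alpha a) x y)" using invertible_a[OF x] by simp
qed

lemma sm_Gal_UxV: "sm (U \<times> UNIV) (Gal a)"
  by (rule sm_Gal[OF open_UxV]) auto

lemma riemann_alpha: "x \<in> U \<Longrightarrow> riemann (alpha a) x y i k = RR (Gal a) (axis k 1) (x, y) $ i"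
  by (rule riemann_eq_RR[OF open_UxV _ sm_Gal_UxV]) (auto simp: spray_alpha)

text \<open>The case of \<open>dd_RR_eq_0\<close> in which the Lagrangian is \<alpha>^2, with fibre
  derivative 2 <u, y>.\<close>

lemma ip_RR_Gal: "x \<in> U \<Longrightarrow> ip a x (RR (Gal a) w (x, y)) y = 0"
proof -
  assume x: "x \<in> U"
  have "dd (0, RR (Gal a) w (x, y)) (Lag (alpha a)) (x, y) = 0"
  proof (rule dd_RR_eq_0[OF open_UxV _ sm_Gal_UxV sm_Lag_alpha])
    show "spr (Gal a) (Lag (alpha a)) q = 0" if "q \<in> U \<times> UNIV" for q
      unfolding spr_Gal by (rule dd_hor_Lag_alpha) (use that in auto)
    show "spr (Gal a) (dd (0, u) (Lag (alpha a))) q = dd (u, 0) (Lag (alpha a)) q" if "q \<in> U \<times> UNIV" for q u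
      by (rule spr_Gal_Lag_alpha) (use that in auto)
  qed (use x in simp)
  then show ?thesis using dd_vert_Lag_alpha[of "(x, y)"] x by simp
qed

lemma RR_Gal_even: "x \<in> U \<Longrightarrow> RR (Gal a) w (x, - y) = RR (Gal a) w (x, y)"
  by (rule RR_even[OF open_UxV _ _ sm_Gal_UxV]) (auto simp: Gal_def Gam_lin)

lemma continuous_RR_Gal:
  assumes x: "x \<in> U"
  shows "continuous_on UNIV (\<lambda>y. RR (Gal a) w (x, y))"
proof -
  have "continuous_on (U \<times> UNIV) (RR (Gal a) w)"
    by (rule sm_continuous_on[OF sm_RR[OF open_UxV sm_Gal_UxV]])
  then show ?thesis
    by (rule continuous_on_compose2[where f = "\<lambda>y. (x, y)"]) (use x in \<open>auto intro!: continuous_intros\<close>)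
qed

abbreviation "\<alpha>\<^sub>f \<equiv> \<lambda>q. alpha a (fst q) (snd q)"

lemma differentiable_alpha:
  assumes "fst p \<in> U" "snd p \<noteq> 0"
  shows "\<alpha>\<^sub>f differentiable (at p)"
  unfolding alpha_eq_ip by (rule differentiable_sqrt[OF differentiable_ip]) (use assms ip_pos in auto)

lemma sm_alpha:
  assumes "open S" "\<And>p. p \<in> S \<Longrightarrow> fst p \<in> U" "\<And>p. p \<in> S \<Longrightarrow> snd p \<noteq> 0"
  shows "sm S \<alpha>\<^sub>f"
  unfolding alpha_eq_ip by (rule sm_sqrt[OF assms(1) sm_ip[OF assms(1,2)]]) (use assms ip_pos sm_snd in auto)

lemma dd_alpha:
  assumes p: "fst p \<in> U" "snd p \<noteq> 0"
  shows dd_hor_alpha: "dd (hor a w p) \<alpha>\<^sub>f p = 0"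
    and dd_vert_alpha: "dd (0, w) \<alpha>\<^sub>f p = ip a (fst p) w (snd p) / \<alpha>\<^sub>f p"
  unfolding alpha_eq_ip
  using p ip_pos[OF p] by (simp_all add: dd_sqrt differentiable_ip dd_hor_ip dd_vert_ip DH_snd dd_snd ip_lin ip_sym[OF p(1), of "snd p" w])

lemma differentiable_covec:
  "fst p \<in> U \<Longrightarrow> \<nu> differentiable (at (fst p)) \<Longrightarrow> (\<lambda>q. ip a (fst q) (\<nu> (fst q)) (snd q)) differentiable (at p)"
  by (rule differentiable_ip) (auto intro: differentiable_comp_fst)

lemma dd_covec:
  assumes p: "fst p \<in> U" and \<nu>: "\<nu> differentiable (at (fst p))"
  shows dd_hor_covec: "dd (hor a w p) (\<lambda>q. ip a (fst q) (\<nu> (fst q)) (snd q)) p = ip a (fst p) (cov a \<nu> (fst p) w) (snd p)"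
    and dd_vert_covec: "dd (0, w) (\<lambda>q. ip a (fst q) (\<nu> (fst q)) (snd q)) p = ip a (fst p) (\<nu> (fst p)) w"
  using p \<nu> by (simp_all add: dd_hor_ip dd_vert_ip differentiable_comp_fst DH_base DH_snd dd_comp_fst dd_dir_zero dd_snd ip_lin)

lemma cov_eq_Lin: "\<nu> differentiable (at x) \<Longrightarrow> cov a \<nu> x u = Lin (\<lambda>j x. cov a \<nu> x (axis j 1)) x u"
proof -
  assume \<nu>: "\<nu> differentiable (at x)"
  have "bounded_linear (\<lambda>u. cov a \<nu> x u)"
    unfolding cov_def by (intro bounded_linear_add bounded_linear_dd[OF \<nu>] Gam.bounded_linear_left)
  then interpret bounded_linear "\<lambda>u. cov a \<nu> x u" .
  have "cov a \<nu> x u = cov a \<nu> x (\<Sum>i\<in>UNIV. u $ i *\<^sub>R axis i 1)"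
    using basis_expansion[of u] by (simp add: scalar_mult_eq_scaleR)
  then show ?thesis by (simp add: sum scaleR Lin_def)
qed

lemma dd_vert_cov:
  assumes p: "fst p \<in> U" and \<nu>: "sm U \<nu>"
  shows "dd (0, w) (\<lambda>q. cov a \<nu> (fst q) (snd q)) p = cov a \<nu> (fst p) w"
    and "(\<lambda>q. cov a \<nu> (fst q) (snd q)) differentiable (at p)"
proof -
  let ?c = "\<lambda>j x. cov a \<nu> x (axis j 1)"
  have c: "?c j differentiable (at (fst p))" for j
    by (rule sm_diff_at[OF sm_cov[OF \<nu> sm_const] p])
  have e: "cov a \<nu> (fst q) (snd q) = Lin ?c (fst q) (snd q)" if "q \<in> U \<times> UNIV" for q
    by (rule cov_eq_Lin) (use that sm_diff_at[OF \<nu>] in auto)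
  have pU: "p \<in> U \<times> UNIV" using p by (simp add: mem_Times_iff)
  have "dd (0, w) (\<lambda>q. cov a \<nu> (fst q) (snd q)) p = dd (0, w) (\<lambda>q. Lin ?c (fst q) (snd q)) p"
    by (rule dd_cong[OF open_UxV pU e])
  also have "\<dots> = Lin ?c (fst p) w"
  proof -
    have "Lin (\<lambda>j. dd 0 (?c j)) (fst p) (snd p) = 0" by (simp add: Lin_def dd_dir_zero[OF c])
    then show ?thesis
      using dd_Lin(1)[where c = ?c and h = "(0, w)", OF bounded_linear_fst c differentiable_snd] by (simp add: dd_snd)
  qed
  also have "\<dots> = cov a \<nu> (fst p) w"
    by (rule cov_eq_Lin[symmetric, OF sm_diff_at[OF \<nu> p]])
  finally show "dd (0, w) (\<lambda>q. cov a \<nu> (fst q) (snd q)) p = cov a \<nu> (fst p) w" .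
  show "(\<lambda>q. cov a \<nu> (fst q) (snd q)) differentiable (at p)"
    by (rule differentiable_cong_open[OF open_UxV pU e[symmetric] dd_Lin(2)[OF bounded_linear_fst c differentiable_snd]])
qed

lemma dd_vert_dd:
  assumes p: "fst p \<in> U" and f: "sm U (f :: real^'n \<Rightarrow> real)"
  shows "dd (0, w) (\<lambda>q. dd (snd q) f (fst q)) p = dd w f (fst p)"
    and "(\<lambda>q. dd (snd q) f (fst q)) differentiable (at p)"
proof -
  let ?c = "\<lambda>j. dd (axis j 1) f"
  have c: "?c j differentiable (at (fst p))" for j
    by (rule sm_diff_at[OF sm_dd[OF f] p])
  have e: "dd u f x = Lin ?c x u" if "x \<in> U" for x u
    using dd_eq_sum_axis[OF sm_diff_at[OF f that], of u] by (simp add: Lin_def)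
  have pU: "p \<in> U \<times> UNIV" using p by (simp add: mem_Times_iff)
  have "dd (0, w) (\<lambda>q. dd (snd q) f (fst q)) p = dd (0, w) (\<lambda>q. Lin ?c (fst q) (snd q)) p"
    by (rule dd_cong[OF open_UxV pU]) (auto simp: e)
  also have "\<dots> = Lin ?c (fst p) w"
  proof -
    have "Lin (\<lambda>j. dd 0 (?c j)) (fst p) (snd p) = 0" by (simp add: Lin_def dd_dir_zero[OF c])
    then show ?thesis
      using dd_Lin(1)[where c = ?c and h = "(0, w)", OF bounded_linear_fst c differentiable_snd] by (simp add: dd_snd)
  qed
  finally show "dd (0, w) (\<lambda>q. dd (snd q) f (fst q)) p = dd w f (fst p)" by (simp add: e[OF p])
  show "(\<lambda>q. dd (snd q) f (fst q)) differentiable (at p)"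
    by (rule differentiable_cong_open[OF open_UxV pU _ dd_Lin(2)[OF bounded_linear_fst c differentiable_snd]])
      (auto simp: e)
qed

end

section \<open>Sprays of Weyl type\<close>

context chart_metric
begin

text \<open>The spray \<open>G + P y - \<alpha>\<^sup>2 m / 2\<close> with \<open>P = m\<^sub>0 + \<kappa> \<alpha>\<close> is a projective change by \<open>\<kappa> \<alpha>\<close> of the spray
  of the Weyl connection determined by the covector \<open>m\<close>.\<close>

definition weyl :: "'n cvec \<Rightarrow> (real^'n \<Rightarrow> real) \<Rightarrow> (real^'n) \<times> (real^'n) \<Rightarrow> real^'n" where
  "weyl m \<kappa> q = (ip a (fst q) (m (fst q)) (snd q) + \<kappa> (fst q) * \<alpha>\<^sub>f q) *\<^sub>R snd q
     - (1/2 * ip a (fst q) (snd q) (snd q)) *\<^sub>R m (fst q)"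

lemma sm_weyl:
  assumes S: "open S" "\<And>q. q \<in> S \<Longrightarrow> fst q \<in> U" "\<And>q. q \<in> S \<Longrightarrow> snd q \<noteq> 0" and m: "sm U m" and \<kappa>: "sm U \<kappa>"
  shows "sm S (weyl m \<kappa>)"
proof -
  have "sm S (\<lambda>q. weyl m \<kappa> q)"
    unfolding weyl_def
    by (intro sm_diff sm_scaleR sm_add sm_mult sm_ip sm_alpha sm_snd sm_const S sm_comp_fst[OF S(1,2) m] sm_comp_fst[OF S(1,2) \<kappa>])
  then show ?thesis .
qed

text \<open>The terms of \<open>RR_add\<close> for the spray \<open>weyl\<close>. Here A is
  \<alpha>, K is \<kappa> and yw is <w, y>; mw, mz are the values of m on w and y, cw, cz its
  covariant derivatives in these directions, kw, kz those of \<kappa>, and M is |m|^2. The result is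
  sorted by parity in A, that is, by parity in y.\<close>

lemma weyl_algebra:
  fixes y w m cw cz :: "real^'n"
  assumes "A \<noteq> 0" and P: "P = mz + K * A" and Pw: "Pw = mw + K * yw / A"
  shows "3 *\<^sub>R ((gcwy + A * kw) *\<^sub>R y - (1/2 * A\<^sup>2) *\<^sub>R cw)
    - (((gcwy + gc0w + kz * yw / A + A * kw) *\<^sub>R y + (gc0y + A * kz) *\<^sub>R w) - (yw *\<^sub>R cz + (1/2 * A\<^sup>2) *\<^sub>R cw))
    + 2 *\<^sub>R ((K * ((P * yw - 1/2 * A\<^sup>2 * mw) / A - yw * (P * A\<^sup>2 - 1/2 * A\<^sup>2 * mz) / A ^ 3)) *\<^sub>R y
       + Pw *\<^sub>R (P *\<^sub>R y - (1/2 * A\<^sup>2) *\<^sub>R m)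
       + (P * mz - 1/2 * A\<^sup>2 * M + K * (P * A\<^sup>2 - 1/2 * A\<^sup>2 * mz) / A) *\<^sub>R w - (P * yw - 1/2 * A\<^sup>2 * mw) *\<^sub>R m)
    - ((Pw * mz + P * mw - yw * M + K * (Pw * A\<^sup>2 + P * yw - yw * mz) / A) *\<^sub>R y
       + P *\<^sub>R (Pw *\<^sub>R y + P *\<^sub>R w - yw *\<^sub>R m) - (Pw * A\<^sup>2 + P * yw - yw * mz) *\<^sub>R m)
   = (2 * A * (kw - K * mw) - yw / A * (kz - K * mz)) *\<^sub>R y - (A * (kz - K * mz)) *\<^sub>R w
    + ((2 * gcwy - gc0w - mz * mw + (M - K\<^sup>2) * yw) *\<^sub>R y - (gc0y - mz\<^sup>2 + A\<^sup>2 * (M - K\<^sup>2)) *\<^sub>R w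
    - A\<^sup>2 *\<^sub>R (cw - mw *\<^sub>R m) + yw *\<^sub>R (cz - mz *\<^sub>R m))"
  unfolding P Pw vec_eq_iff using assms(1)
  by (simp add: field_simps power2_eq_square power3_eq_cube)

text \<open>The term \<kappa>\<alpha> enters the curvature linearly through d\<kappa> - \<kappa> m,
  in the odd part, and quadratically through \<kappa>^2, in the even part. The form d\<kappa> -
  \<kappa> m is natural: if \<alpha> is rescaled by a function and \<kappa>, m are adapted so that
  the spray stays the same, it is merely multiplied by a function.\<close>

lemma RR_weyl:
  assumes S: "open S" "p \<in> S" "\<And>q. q \<in> S \<Longrightarrow> fst q \<in> U" "\<And>q. q \<in> S \<Longrightarrow> snd q \<noteq> 0"
    and m: "sm U m" and \<kappa>: "sm U \<kappa>"
  defines "x \<equiv> fst p" and "y \<equiv> snd p" and "A \<equiv> alpha a (fst p) (snd p)" and "g \<equiv> ip a (fst p)"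
    and "M \<equiv> ip a (fst p) (m (fst p)) (m (fst p))"
  shows "RR (\<lambda>q. Gal a q + weyl m \<kappa> q) w p = RR (Gal a) w p
    + ((2 * A * (dd w \<kappa> x - \<kappa> x * g (m x) w) - g w y / A * (dd y \<kappa> x - \<kappa> x * g (m x) y)) *\<^sub>R y
      - (A * (dd y \<kappa> x - \<kappa> x * g (m x) y)) *\<^sub>R w
    + ((2 * g (cov a m x w) y - g (cov a m x y) w - g (m x) y * g (m x) w + (M - (\<kappa> x)\<^sup>2) * g w y) *\<^sub>R y
      - (g (cov a m x y) y - (g (m x) y)\<^sup>2 + A\<^sup>2 * (M - (\<kappa> x)\<^sup>2)) *\<^sub>R w
      - A\<^sup>2 *\<^sub>R (cov a m x w - g (m x) w *\<^sub>R m x) + g w y *\<^sub>R (cov a m x y - g (m x) y *\<^sub>R m x)))"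
proof -
  define D where "D = weyl m \<kappa>"
  \<comment> \<open>\<open>P\<close> is the factor of y in the spray, and \<open>Q v\<close> is its
    fibre derivative along v.\<close>
  define P where "P q = ip a (fst q) (m (fst q)) (snd q) + \<kappa> (fst q) * \<alpha>\<^sub>f q" for q
  define Q where "Q w q = ip a (fst q) (m (fst q)) w + \<kappa> (fst q) * (ip a (fst q) w (snd q) / \<alpha>\<^sub>f q)" for w q
  have xU: "x \<in> U" and yn: "y \<noteq> 0" using S unfolding x_def y_def by auto
  have A: "A > 0" using alpha_pos[OF xU yn] unfolding A_def x_def y_def .
  have A2: "g y y = A\<^sup>2" using alpha_sq[OF xU, of y] unfolding A_def g_def x_def y_def by simp
  have g_sym: "g u v = g v u" for u v using ip_sym xU unfolding g_def x_def by blast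
  have mD: "m differentiable (at (fst q))" and \<kappa>D: "\<kappa> differentiable (at (fst q))"
    and aD: "\<alpha>\<^sub>f differentiable (at q)" if "q \<in> S" for q
    using that S sm_diff_at[OF m] sm_diff_at[OF \<kappa>] differentiable_alpha by auto
  note mD' = differentiable_comp_fst[OF mD] and \<kappa>D' = differentiable_comp_fst[OF \<kappa>D]
  have smD: "sm S D" unfolding D_def by (rule sm_weyl[OF S(1,3,4) m \<kappa>])
  have DD: "D q = P q *\<^sub>R snd q - (1/2 * ip a (fst q) (snd q) (snd q)) *\<^sub>R m (fst q)" for q
    unfolding D_def weyl_def P_def by simp
  have PD: "P differentiable (at q)" if q: "q \<in> S" for q
    unfolding P_def using differentiable_covec[OF S(3)[OF q] mD[OF q]] \<kappa>D'[OF q] aD[OF q] by simp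
  have Pv: "dd (0, v) P q = Q v q" if q: "q \<in> S" for v q
    unfolding P_def Q_def using differentiable_covec[OF S(3)[OF q] mD[OF q]] \<kappa>D'[OF q] aD[OF q]
      dd_vert_covec[OF S(3)[OF q] mD[OF q]] dd_vert_alpha[OF S(3)[OF q] S(4)[OF q]]
    by (simp add: dd_add dd_mult dd_comp_fst \<kappa>D[OF q] dd_dir_zero[OF \<kappa>D[OF q]])
  have Ph: "dd (hor a u q) P q = ip a (fst q) (cov a m (fst q) u) (snd q) + \<alpha>\<^sub>f q * dd u \<kappa> (fst q)" if q: "q \<in> S" for u q
    unfolding P_def using differentiable_covec[OF S(3)[OF q] mD[OF q]] \<kappa>D'[OF q] aD[OF q]
      dd_hor_covec[OF S(3)[OF q] mD[OF q]] dd_hor_alpha[OF S(3)[OF q] S(4)[OF q]]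
    by (simp add: dd_add dd_mult dd_comp_fst \<kappa>D[OF q]) (simp add: hor_def)
  have yyD: "(\<lambda>q. 1/2 * ip a (fst q) (snd q) (snd q)) differentiable (at q)" if q: "q \<in> S" for q
    using differentiable_ip[OF S(3)[OF q], of snd snd] by simp
  have yyv: "dd (0, v) (\<lambda>q. 1/2 * ip a (fst q) (snd q) (snd q)) q = ip a (fst q) v (snd q)" if q: "q \<in> S" for v q
    using differentiable_ip[OF S(3)[OF q], of snd snd] S(3)[OF q]
    by (simp add: dd_linear[OF bounded_linear_mult_right] dd_vert_ip dd_snd ip_sym[OF S(3)[OF q], of "snd q" v]
      del: times_divide_eq_left)
  have yyh: "dd (hor a v q) (\<lambda>q. 1/2 * ip a (fst q) (snd q) (snd q)) q = 0" if q: "q \<in> S" for v q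
    using differentiable_ip[OF S(3)[OF q], of snd snd] S(3)[OF q]
    by (simp add: dd_linear[OF bounded_linear_mult_right] dd_hor_ip DH_snd ip_lin del: times_divide_eq_left)
  have E1: "dd (0, v) D q = Q v q *\<^sub>R snd q + P q *\<^sub>R v - ip a (fst q) v (snd q) *\<^sub>R m (fst q)" if q: "q \<in> S" for v q
    unfolding DD using PD[OF q] yyD[OF q] mD'[OF q]
    by (simp only: dd_diff dd_scaleR differentiable_scaleR differentiable_snd dd_snd yyv[OF q] Pv[OF q]
      dd_comp_fst mD[OF q]) (simp add: dd_dir_zero[OF mD[OF q]])
  have H: "DH a u D q = (ip a (fst q) (cov a m (fst q) u) (snd q) + \<alpha>\<^sub>f q * dd u \<kappa> (fst q)) *\<^sub>R snd q
      - (1/2 * ip a (fst q) (snd q) (snd q)) *\<^sub>R cov a m (fst q) u" if q: "q \<in> S" for u q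
    unfolding DD using PD[OF q] yyD[OF q] mD'[OF q]
    by (simp only: DH_diff DH_scaleR differentiable_scaleR differentiable_snd DH_snd yyh[OF q] Ph[OF q] DH_base mD[OF q]) simp
  have E3: "dd (0, w) (\<lambda>q. DH a (snd q) D q) p =
      ((g (cov a m x w) y + g (cov a m x y) w + dd y \<kappa> x * g w y / A + A * dd w \<kappa> x) *\<^sub>R y
        + (g (cov a m x y) y + A * dd y \<kappa> x) *\<^sub>R w) - (g w y *\<^sub>R cov a m x y + (1/2 * A\<^sup>2) *\<^sub>R cov a m x w)"
  proof -
    have "dd (0, w) (\<lambda>q. DH a (snd q) D q) p = dd (0, w) (\<lambda>q.
      (ip a (fst q) (cov a m (fst q) (snd q)) (snd q) + \<alpha>\<^sub>f q * dd (snd q) \<kappa> (fst q)) *\<^sub>R snd q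
      - (1/2 * ip a (fst q) (snd q) (snd q)) *\<^sub>R cov a m (fst q) (snd q)) p"
      by (rule dd_cong[OF S(1,2) H])
    also have "\<dots> = (g (cov a m x w) y + g (cov a m x y) w + (g w y / A * dd y \<kappa> x + A * dd w \<kappa> x)) *\<^sub>R y
        + (g (cov a m x y) y + A * dd y \<kappa> x) *\<^sub>R w - (g w y *\<^sub>R cov a m x y + (1/2 * g y y) *\<^sub>R cov a m x w)"
    proof -
      have pU: "fst p \<in> U" by (rule S(3)[OF S(2)])
      note c = dd_vert_cov[OF pU m] and k = dd_vert_dd[OF pU \<kappa>]
      have 1: "(\<lambda>q. ip a (fst q) (cov a m (fst q) (snd q)) (snd q)) differentiable (at p)"
        by (rule differentiable_ip[OF pU c(2) differentiable_snd])
      show ?thesis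
        using 1 c(2) k(2) aD[OF S(2)] yyD[OF S(2)] unfolding x_def y_def A_def g_def
        by (simp only: dd_diff dd_scaleR dd_add dd_mult differentiable_scaleR differentiable_snd differentiable_add
            differentiable_mult dd_snd yyv[OF S(2)] c(1) k(1) dd_vert_ip[OF pU c(2) differentiable_snd]
            dd_vert_alpha[OF S(3)[OF S(2)] S(4)[OF S(2)]]) (simp add: algebra_simps)
    qed
    finally show ?thesis unfolding A2 by (simp add: algebra_simps)
  qed
  have E2: "dd (0, v) (dd (0, w) D) p = (\<kappa> x * (g v w / A - g w y * g v y / A ^ 3)) *\<^sub>R y + Q w p *\<^sub>R v + Q v p *\<^sub>R w
      - g v w *\<^sub>R m x" for v
  proof -
    have pU: "fst p \<in> U" by (rule S(3)[OF S(2)])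
    have wy: "(\<lambda>q. ip a (fst q) w (snd q)) differentiable (at p)" by (rule differentiable_ip[OF pU]) simp_all
    have wyv: "dd (0, v) (\<lambda>q. ip a (fst q) w (snd q)) p = ip a (fst p) v w"
      using pU by (simp add: dd_vert_ip dd_const dd_snd ip_lin ip_sym[OF pU, of v])
    have mw: "(\<lambda>q. ip a (fst q) (m (fst q)) w) differentiable (at p)"
      by (rule differentiable_ip[OF pU mD'[OF S(2)]]) simp
    have mwv: "dd (0, v) (\<lambda>q. ip a (fst q) (m (fst q)) w) p = 0"
      using pU mD'[OF S(2)] mD[OF S(2)] by (simp add: dd_vert_ip dd_const dd_comp_fst dd_dir_zero ip_lin)
    have a0: "\<alpha>\<^sub>f p \<noteq> 0" using A unfolding A_def by simp
    have QD: "Q w differentiable (at p)"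
      unfolding Q_def using mw wy aD[OF S(2)] a0 \<kappa>D'[OF S(2)] by (simp add: differentiable_divide)
    have Qv: "dd (0, v) (Q w) p = \<kappa> x * (g v w / A - g w y * g v y / A ^ 3)"
      unfolding Q_def using mw wy aD[OF S(2)] a0 \<kappa>D'[OF S(2)]
      by (simp add: dd_add dd_mult dd_divide differentiable_divide mwv wyv dd_comp_fst \<kappa>D[OF S(2)] dd_dir_zero[OF \<kappa>D[OF S(2)]]
          dd_vert_alpha[OF S(3)[OF S(2)] S(4)[OF S(2)]] x_def y_def g_def A_def)
        (simp add: field_simps power2_eq_square power3_eq_cube)
    have "dd (0, v) (dd (0, w) D) p = dd (0, v) (\<lambda>q. Q w q *\<^sub>R snd q + P q *\<^sub>R w - ip a (fst q) w (snd q) *\<^sub>R m (fst q)) p"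
      by (rule dd_cong[OF S(1,2) E1])
    also have "\<dots> = dd (0, v) (Q w) p *\<^sub>R y + Q w p *\<^sub>R v + Q v p *\<^sub>R w - g v w *\<^sub>R m x"
      using QD PD[OF S(2)] wy mD'[OF S(2)]
      by (simp add: dd_diff dd_add dd_scaleR differentiable_scaleR dd_snd dd_const wyv Pv[OF S(2)] dd_comp_fst mD[OF S(2)]
          dd_dir_zero[OF mD[OF S(2)]] x_def y_def g_def)
    finally show ?thesis unfolding Qv .
  qed
  let ?P = "g (m x) y + \<kappa> x * A" and ?\<mu>w = "g (m x) w" and ?\<mu>0 = "g (m x) y" and ?yw = "g w y" and ?K = "\<kappa> x"
  let ?Pw = "?\<mu>w + ?K * ?yw / A"
  have P: "P p = ?P" unfolding P_def g_def x_def y_def A_def by simp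
  have Q: "Q v p = g (m x) v + ?K * (g v y / A)" for v unfolding Q_def g_def x_def y_def A_def by simp
  have Qw: "Q w p = ?Pw" unfolding Q by simp
  have Dp: "D p = ?P *\<^sub>R y - (1/2 * A\<^sup>2) *\<^sub>R m x" unfolding DD P A2[symmetric] g_def x_def y_def by simp
  define Z where "Z = dd (0, w) D p"
  have Z: "Z = ?Pw *\<^sub>R y + ?P *\<^sub>R w - ?yw *\<^sub>R m x"
    unfolding Z_def E1[OF S(2)] P Qw by (simp add: g_def x_def y_def)
  have gl: "g (u + v) z = g u z + g v z" "g u (v + z) = g u v + g u z" "g (u - v) z = g u z - g v z" "g u (v - z) = g u v - g u z"
    "g (c *\<^sub>R u) v = c * g u v" "g u (c *\<^sub>R v) = c * g u v" for u v z c unfolding g_def by (simp_all add: ip_lin)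
  have gD: "g (D p) w = ?P * ?yw - 1/2 * A\<^sup>2 * ?\<mu>w" "g (D p) y = ?P * A\<^sup>2 - 1/2 * A\<^sup>2 * ?\<mu>0"
    "g (m x) (D p) = ?P * ?\<mu>0 - 1/2 * A\<^sup>2 * M"
    unfolding Dp gl A2 g_sym[of y w] g_sym[of y "m x"] by (simp_all add: M_def g_def x_def y_def)
  have gZ: "g Z y = ?Pw * A\<^sup>2 + ?P * ?yw - ?yw * ?\<mu>0"  "g (m x) Z = ?Pw * ?\<mu>0 + ?P * ?\<mu>w - ?yw * M"
    unfolding Z gl A2 by (simp_all add: M_def g_def x_def y_def)
  have H1: "DH a w D p = (g (cov a m x w) y + A * dd w \<kappa> x) *\<^sub>R y - (1/2 * A\<^sup>2) *\<^sub>R cov a m x w"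
    unfolding H[OF S(2)] A2[symmetric] by (simp add: g_def x_def y_def A_def)
  have R2: "dd (0, D p) (dd (0, w) D) p = (?K * ((?P * ?yw - 1/2 * A\<^sup>2 * ?\<mu>w) / A - ?yw * (?P * A\<^sup>2 - 1/2 * A\<^sup>2 * ?\<mu>0) / A ^ 3)) *\<^sub>R y
       + ?Pw *\<^sub>R (?P *\<^sub>R y - (1/2 * A\<^sup>2) *\<^sub>R m x)
       + (?P * ?\<mu>0 - 1/2 * A\<^sup>2 * M + ?K * (?P * A\<^sup>2 - 1/2 * A\<^sup>2 * ?\<mu>0) / A) *\<^sub>R w - (?P * ?yw - 1/2 * A\<^sup>2 * ?\<mu>w) *\<^sub>R m x"
    unfolding E2 Qw Q[of "D p"] gD unfolding Dp by simp
  have R3: "dd (0, Z) D p = (?Pw * ?\<mu>0 + ?P * ?\<mu>w - ?yw * M + ?K * (?Pw * A\<^sup>2 + ?P * ?yw - ?yw * ?\<mu>0) / A) *\<^sub>R y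
       + ?P *\<^sub>R (?Pw *\<^sub>R y + ?P *\<^sub>R w - ?yw *\<^sub>R m x) - (?Pw * A\<^sup>2 + ?P * ?yw - ?yw * ?\<mu>0) *\<^sub>R m x"
  proof -
    have "dd (0, Z) D p = Q Z p *\<^sub>R y + ?P *\<^sub>R Z - g Z y *\<^sub>R m x"
      unfolding E1[OF S(2)] P by (simp add: g_def x_def y_def)
    then show ?thesis unfolding Q[of Z] gZ unfolding Z by simp
  qed
  note alg = weyl_algebra[where P = ?P and mz = ?\<mu>0 and K = ?K and A = A and Pw = ?Pw and mw = ?\<mu>w and yw = ?yw and y = y
      and w = w and m = "m x" and cw = "cov a m x w" and cz = "cov a m x y" and gcwy = "g (cov a m x w) y"
      and gc0w = "g (cov a m x y) w" and gc0y = "g (cov a m x y) y" and kw = "dd w \<kappa> x" and kz = "dd y \<kappa> x" and M = M]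
  have "RR (\<lambda>q. Gal a q + D q) w p = RR (Gal a) w p + (3 *\<^sub>R DH a w D p
    - dd (0, w) (\<lambda>q. DH a (snd q) D q) p + 2 *\<^sub>R dd (0, D p) (dd (0, w) D) p - dd (0, Z) D p)"
    using RR_add[OF S(1,2,3) smD, of w] unfolding Z_def by (simp add: algebra_simps)
  also have "3 *\<^sub>R DH a w D p - dd (0, w) (\<lambda>q. DH a (snd q) D q) p + 2 *\<^sub>R dd (0, D p) (dd (0, w) D) p - dd (0, Z) D p
    = (2 * A * (dd w \<kappa> x - \<kappa> x * g (m x) w) - g w y / A * (dd y \<kappa> x - \<kappa> x * g (m x) y)) *\<^sub>R y
      - (A * (dd y \<kappa> x - \<kappa> x * g (m x) y)) *\<^sub>R w
    + ((2 * g (cov a m x w) y - g (cov a m x y) w - g (m x) y * g (m x) w + (M - (\<kappa> x)\<^sup>2) * g w y) *\<^sub>R y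
      - (g (cov a m x y) y - (g (m x) y)\<^sup>2 + A\<^sup>2 * (M - (\<kappa> x)\<^sup>2)) *\<^sub>R w
      - A\<^sup>2 *\<^sub>R (cov a m x w - g (m x) w *\<^sub>R m x) + g w y *\<^sub>R (cov a m x y - g (m x) y *\<^sub>R m x))"
    unfolding H1 E3 R2 R3 by (rule alg) (use A in auto)
  finally show ?thesis unfolding D_def .
qed

end

section \<open>The square metric of a unit form\<close>

lemma dd_power:
  fixes f :: "_ \<Rightarrow> real"
  assumes "f differentiable (at p)"
  shows "dd h (\<lambda>q. f q ^ n) p = of_nat n * f p ^ (n - 1) * dd h f p"
  by (rule dd_eq) (rule has_derivative_eq_rhs[OF has_derivative_power[OF has_derivative_dd[OF assms]]], simp add: mult_ac)

text \<open>For L = (A + B)^4 / A^2, \<open>C1\<close> is L_A / A and \<open>C2\<close> is L_B. The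
  division by A is compensated by \<alpha> d\<alpha>(u) = <u, y>, which is free of roots.\<close>

definition C1 :: "real \<Rightarrow> real \<Rightarrow> real" where "C1 A B = 2 * (A + B) ^ 3 * (A - B) / A ^ 4"
definition C2 :: "real \<Rightarrow> real \<Rightarrow> real" where "C2 A B = 4 * (A + B) ^ 3 / A ^ 2"

lemma
  assumes f: "f differentiable (at p)" and g: "g differentiable (at p)" and 0: "f p \<noteq> 0"
  shows dd_C1: "dd k (\<lambda>q. C1 (f q) (g q)) p = 4 * (f p + g p)\<^sup>2 * (f p - 2 * g p) / f p ^ 4 * (dd k g p - g p / f p * dd k f p)"
    and dd_C2: "dd k (\<lambda>q. C2 (f q) (g q)) p
      = 4 * (f p + g p)\<^sup>2 * (f p - 2 * g p) / f p ^ 3 * dd k f p + 12 * (f p + g p)\<^sup>2 / (f p)\<^sup>2 * dd k g p"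
    and differentiable_C1: "(\<lambda>q. C1 (f q) (g q)) differentiable (at p)"
    and differentiable_C2: "(\<lambda>q. C2 (f q) (g q)) differentiable (at p)"
  unfolding C1_def C2_def
     apply (use f g 0 in \<open>simp_all add: dd_divide dd_mult dd_power dd_add dd_diff dd_const differentiable_divide differentiable_power\<close>)
   apply (simp_all add: field_simps)
   apply (simp_all add: eval_nat_numeral algebra_simps)
  done

context chart_metric
begin

lemma ip_Cauchy_Schwarz: "x \<in> U \<Longrightarrow> (ip a x u v)\<^sup>2 \<le> ip a x u u * ip a x v v"
proof -
  assume x: "x \<in> U"
  let ?z = "ip a x v v *\<^sub>R u - ip a x u v *\<^sub>R v"
  have "0 \<le> ip a x ?z ?z" by (rule ip_nonneg[OF x])
  also have "ip a x ?z ?z = ip a x v v * (ip a x u u * ip a x v v - (ip a x u v)\<^sup>2)"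
    by (simp add: ip_lin ip_sym[OF x, of v u] power2_eq_square algebra_simps)
  finally show ?thesis
    by (cases "v = 0") (auto simp: ip_lin zero_le_mult_iff ip_eq_0_iff[OF x] dest: ip_pos[OF x])
qed

end

section \<open>The fundamental tensor and the spray of F\<close>

locale unit_square = chart_metric +
  fixes bv :: "'a cvec" and F :: "'a finsler"
  assumes sm_bv: "sm U bv" and unit_bv: "\<And>x. x \<in> U \<Longrightarrow> ip a x (bv x) (bv x) = 1"
    and F_eq: "\<And>x y. x \<in> U \<Longrightarrow> F x y = (alpha a x y + ip a x (bv x) y)\<^sup>2 / alpha a x y"
begin

abbreviation "\<beta>\<^sub>f \<equiv> \<lambda>q. ip a (fst q) (bv (fst q)) (snd q)"

text \<open>As b has length one, this is the squared length of the component of y orthogonal to b;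
  it vanishes exactly on the line of b.\<close>

definition hh :: "(real^'a) \<times> (real^'a) \<Rightarrow> real" where
  "hh q = ip a (fst q) (snd q) (snd q) - (\<beta>\<^sub>f q)\<^sup>2"

text \<open>On \<open>\<Omega>0\<close> the function \<alpha>, and with it F^2, is smooth; on
  \<open>\<Omega>\<close> the metric F is moreover nondegenerate, by
  \<open>invertible_fund_tensor_iff\<close>.\<close>

definition \<Omega>0 :: "((real^'a) \<times> (real^'a)) set" where "\<Omega>0 = U \<times> (- {0})"
definition \<Omega> :: "((real^'a) \<times> (real^'a)) set" where "\<Omega> = {q \<in> U \<times> UNIV. hh q > 0}"

lemma bv_D: "x \<in> U \<Longrightarrow> bv differentiable (at x)"
  by (rule sm_diff_at[OF sm_bv])

lemma open_\<Omega>0: "open \<Omega>0"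
  unfolding \<Omega>0_def by (intro open_Times open_U) auto

lemma hh_nonneg: "fst q \<in> U \<Longrightarrow> hh q \<ge> 0"
  using ip_Cauchy_Schwarz[of "fst q" "bv (fst q)" "snd q"] unit_bv[of "fst q"] by (simp add: hh_def)

lemma sm_beta: "open S \<Longrightarrow> (\<And>q. q \<in> S \<Longrightarrow> fst q \<in> U) \<Longrightarrow> sm S \<beta>\<^sub>f"
  by (intro sm_ip sm_snd) (auto intro: sm_comp_fst[OF _ _ sm_bv])

lemma sm_hh: "open S \<Longrightarrow> (\<And>q. q \<in> S \<Longrightarrow> fst q \<in> U) \<Longrightarrow> sm S hh"
proof -
  assume S: "open S" "\<And>q. q \<in> S \<Longrightarrow> fst q \<in> U"
  have "sm S (\<lambda>q. hh q)" unfolding hh_def by (intro sm_diff sm_power sm_ip sm_beta sm_snd S)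
  then show ?thesis .
qed

lemma open_\<Omega>: "open \<Omega>"
proof -
  have "continuous_on (U \<times> UNIV) hh" by (rule sm_continuous_on[OF sm_hh[OF open_UxV]]) auto
  then have "open (U \<times> UNIV \<inter> hh -` {0<..})" by (rule continuous_open_preimage[OF _ open_UxV]) simp
  moreover have "U \<times> UNIV \<inter> hh -` {0<..} = \<Omega>" by (auto simp: \<Omega>_def)
  ultimately show ?thesis by simp
qed

lemma \<Omega>_D: assumes "q \<in> \<Omega>" shows "fst q \<in> U" "snd q \<noteq> 0" "hh q > 0"
  using assms by (auto simp: \<Omega>_def hh_def ip_lin)

lemma \<Omega>0_D: assumes "q \<in> \<Omega>0" shows "fst q \<in> U" "snd q \<noteq> 0"
  using assms by (auto simp: \<Omega>0_def)

lemma \<Omega>_subset: "\<Omega> \<subseteq> \<Omega>0"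
proof
  show "q \<in> \<Omega>0" if "q \<in> \<Omega>" for q using \<Omega>_D[OF that] by (simp add: \<Omega>0_def mem_Times_iff)
qed

lemma hh_alpha: "fst q \<in> U \<Longrightarrow> hh q = (\<alpha>\<^sub>f q)\<^sup>2 - (\<beta>\<^sub>f q)\<^sup>2"
  by (simp add: hh_def alpha_sq)

lemma \<Omega>_abs:
  assumes "q \<in> \<Omega>" shows "\<alpha>\<^sub>f q > 0" "\<alpha>\<^sub>f q - \<beta>\<^sub>f q > 0" "\<alpha>\<^sub>f q + \<beta>\<^sub>f q > 0"
proof -
  show 1: "\<alpha>\<^sub>f q > 0" using \<Omega>_D[OF assms] alpha_pos by blast
  have "\<bar>\<beta>\<^sub>f q\<bar>\<^sup>2 < (\<alpha>\<^sub>f q)\<^sup>2" using \<Omega>_D[OF assms] hh_alpha[of q] by simp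
  from power2_less_imp_less[OF this] 1 show "\<alpha>\<^sub>f q - \<beta>\<^sub>f q > 0" "\<alpha>\<^sub>f q + \<beta>\<^sub>f q > 0" by auto
qed

lemma Lag_F: "q \<in> \<Omega>0 \<Longrightarrow> Lag F q = (\<alpha>\<^sub>f q + \<beta>\<^sub>f q) ^ 4 / (\<alpha>\<^sub>f q)\<^sup>2"
  using \<Omega>0_D[of q] by (simp add: Lag_def F_eq power_divide flip: power_mult)

lemma alpha_nz: "q \<in> \<Omega>0 \<Longrightarrow> \<alpha>\<^sub>f q \<noteq> 0"
  using \<Omega>0_D[of q] alpha_pos[of "fst q" "snd q"] by simp

lemma sm_Lag_F: "sm \<Omega>0 (Lag F)"
proof (rule sm_cong[OF open_\<Omega>0 Lag_F[symmetric]])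
  show "sm \<Omega>0 (\<lambda>q. (\<alpha>\<^sub>f q + \<beta>\<^sub>f q) ^ 4 / (\<alpha>\<^sub>f q)\<^sup>2)"
    using \<Omega>0_D alpha_nz by (intro sm_divide sm_power sm_add sm_alpha sm_beta open_\<Omega>0) auto
qed

lemma differentiable_beta: "fst q \<in> U \<Longrightarrow> \<beta>\<^sub>f differentiable (at q)"
  by (rule differentiable_covec[OF _ bv_D])

lemma dd_Lag_F:
  assumes q: "q \<in> \<Omega>0"
  shows "dd k (Lag F) q = C1 (\<alpha>\<^sub>f q) (\<beta>\<^sub>f q) * \<alpha>\<^sub>f q * dd k \<alpha>\<^sub>f q + C2 (\<alpha>\<^sub>f q) (\<beta>\<^sub>f q) * dd k \<beta>\<^sub>f q"
proof -
  note qq = \<Omega>0_D[OF q]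
  have "dd k (Lag F) q = dd k (\<lambda>q. (\<alpha>\<^sub>f q + \<beta>\<^sub>f q) ^ 4 / (\<alpha>\<^sub>f q)\<^sup>2) q"
    by (rule dd_cong[OF open_\<Omega>0 q Lag_F])
  also have "\<dots> = C1 (\<alpha>\<^sub>f q) (\<beta>\<^sub>f q) * \<alpha>\<^sub>f q * dd k \<alpha>\<^sub>f q + C2 (\<alpha>\<^sub>f q) (\<beta>\<^sub>f q) * dd k \<beta>\<^sub>f q"
    using alpha_nz[OF q] differentiable_alpha[OF qq] differentiable_beta[OF qq(1)]
    apply (simp add: dd_divide dd_power dd_power2 dd_add differentiable_power C1_def C2_def)
    apply (simp add: field_simps)
    apply (simp add: eval_nat_numeral algebra_simps)
    done
  finally show ?thesis .
qed

lemma dd_vert_beta: "fst q \<in> U \<Longrightarrow> dd (0, v) \<beta>\<^sub>f q = ip a (fst q) (bv (fst q)) v"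
  by (rule dd_vert_covec[OF _ bv_D])

lemma dd_hor_beta: "fst q \<in> U \<Longrightarrow> dd (hor a v q) \<beta>\<^sub>f q = ip a (fst q) (cov a bv (fst q) v) (snd q)"
  by (rule dd_hor_covec[OF _ bv_D])

lemma dd_vert_Lag_F:
  assumes q: "q \<in> \<Omega>0"
  shows "dd (0, u) (Lag F) q = C1 (\<alpha>\<^sub>f q) (\<beta>\<^sub>f q) * ip a (fst q) u (snd q) + C2 (\<alpha>\<^sub>f q) (\<beta>\<^sub>f q) * ip a (fst q) (bv (fst q)) u"
  unfolding dd_Lag_F[OF q] using \<Omega>0_D[OF q] alpha_nz[OF q] by (simp add: dd_vert_alpha dd_vert_beta)

lemma dd_dd_Lag_F:
  assumes q: "q \<in> \<Omega>0"
  defines "x \<equiv> fst q" and "y \<equiv> snd q" and "A \<equiv> \<alpha>\<^sub>f q" and "B \<equiv> \<beta>\<^sub>f q"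
  shows "dd k (dd (0, u) (Lag F)) q =
      4 * (A + B)\<^sup>2 * (A - 2 * B) / A ^ 4 * (dd k \<beta>\<^sub>f q - B / A * dd k \<alpha>\<^sub>f q) * ip a x u y
      + C1 A B * dd k (\<lambda>q. ip a (fst q) u (snd q)) q
      + (4 * (A + B)\<^sup>2 * (A - 2 * B) / A ^ 3 * dd k \<alpha>\<^sub>f q + 12 * (A + B)\<^sup>2 / A\<^sup>2 * dd k \<beta>\<^sub>f q) * ip a x (bv x) u
      + C2 A B * dd k (\<lambda>q. ip a (fst q) (bv (fst q)) u) q"
proof -
  note qq = \<Omega>0_D[OF q]
  have d: "(\<lambda>q. ip a (fst q) u (snd q)) differentiable (at q)" "(\<lambda>q. ip a (fst q) (bv (fst q)) u) differentiable (at q)"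
    using differentiable_ip[OF qq(1) differentiable_const differentiable_snd]
      differentiable_ip[OF qq(1) differentiable_comp_fst[OF bv_D[OF qq(1)]] differentiable_const] by blast+
  note c = differentiable_C1[OF differentiable_alpha[OF qq] differentiable_beta[OF qq(1)] alpha_nz[OF q]]
    differentiable_C2[OF differentiable_alpha[OF qq] differentiable_beta[OF qq(1)] alpha_nz[OF q]]
  have "dd k (dd (0, u) (Lag F)) q = dd k (\<lambda>q. C1 (\<alpha>\<^sub>f q) (\<beta>\<^sub>f q) * ip a (fst q) u (snd q) + C2 (\<alpha>\<^sub>f q) (\<beta>\<^sub>f q) * ip a (fst q) (bv (fst q)) u) q"
    by (rule dd_cong[OF open_\<Omega>0 q dd_vert_Lag_F])
  then show ?thesis
    unfolding x_def y_def A_def B_def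
    using c d by (simp add: dd_add dd_mult differentiable_mult
        dd_C1[OF differentiable_alpha[OF qq] differentiable_beta[OF qq(1)] alpha_nz[OF q]]
        dd_C2[OF differentiable_alpha[OF qq] differentiable_beta[OF qq(1)] alpha_nz[OF q]])
qed

lemma dd_vert_dd_Lag_F:
  assumes q: "q \<in> \<Omega>0"
  defines "x \<equiv> fst q" and "y \<equiv> snd q" and "A \<equiv> \<alpha>\<^sub>f q" and "B \<equiv> \<beta>\<^sub>f q"
  shows "dd (0, v) (dd (0, u) (Lag F)) q =
      4 * (A + B)\<^sup>2 * (A - 2 * B) / A ^ 4 * (ip a x (bv x) v - B / A\<^sup>2 * ip a x v y) * ip a x u y
      + C1 A B * ip a x u v
      + (4 * (A + B)\<^sup>2 * (A - 2 * B) / A ^ 4 * ip a x v y + 12 * (A + B)\<^sup>2 / A\<^sup>2 * ip a x (bv x) v) * ip a x (bv x) u"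
proof -
  note qq = \<Omega>0_D[OF q]
  have 1: "dd (0, v) (\<lambda>q. ip a (fst q) u (snd q)) q = ip a x u v"
    "dd (0, v) (\<lambda>q. ip a (fst q) (bv (fst q)) u) q = 0"
    using qq by (simp_all add: dd_vert_ip dd_const dd_snd ip_lin differentiable_comp_fst bv_D dd_comp_fst dd_dir_zero[OF bv_D] x_def)
  show ?thesis
    unfolding dd_dd_Lag_F[OF q] 1[unfolded x_def] dd_vert_alpha[OF qq] dd_vert_beta[OF qq(1)]
    using alpha_nz[OF q] unfolding x_def y_def A_def B_def
    by (simp add: power2_eq_square eval_nat_numeral)
qed

text \<open>On the line of b the coefficient \<open>C1\<close> vanishes, and every vector orthogonal
  to b lies in the kernel. Off this line the fundamental tensor is even positive definite.\<close>

lemma invertible_fund_tensor_iff: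
  assumes x: "x \<in> U" and y: "y \<noteq> 0" and n: "CARD('a) \<ge> 2"
  shows "invertible (fund_tensor F x y) \<longleftrightarrow> hh (x, y) > 0"
proof -
  let ?M = "fund_tensor F x y" and ?g = "ip a x"
  have q: "(x, y) \<in> \<Omega>0" using x y by (simp add: \<Omega>0_def)
  define A B where "A = alpha a x y" and "B = ?g (bv x) y"
  have A: "A > 0" unfolding A_def by (rule alpha_pos[OF x y])
  have hAB: "hh (x, y) = A\<^sup>2 - B\<^sup>2" using hh_alpha[of "(x, y)"] x by (simp add: A_def B_def)
  have M: "u \<bullet> (?M *v v) = 1/2 * (4 * (A + B)\<^sup>2 * (A - 2 * B) / A ^ 4 * (?g (bv x) v - B / A\<^sup>2 * ?g v y) * ?g u y
      + C1 A B * ?g u v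
      + (4 * (A + B)\<^sup>2 * (A - 2 * B) / A ^ 4 * ?g v y + 12 * (A + B)\<^sup>2 / A\<^sup>2 * ?g (bv x) v) * ?g (bv x) u)" for u v
    unfolding fund_tensor_bilinear[OF open_\<Omega>0 q sm_Lag_F] dd_vert_dd_Lag_F[OF q] A_def B_def by simp
  show ?thesis
  proof
    assume inv: "invertible ?M"
    show "hh (x, y) > 0"
    proof (rule ccontr)
      assume "\<not> hh (x, y) > 0"
      then have h0: "A\<^sup>2 = B\<^sup>2" using hh_nonneg[of "(x, y)"] x hAB by simp
      then have "A = B \<or> A = - B" by (simp add: power2_eq_iff)
      then have C10: "C1 A B = 0" by (auto simp: C1_def)
      have "?g (y - B *\<^sub>R bv x) (y - B *\<^sub>R bv x) = A\<^sup>2 - B\<^sup>2"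
        using unit_bv[OF x] alpha_sq[OF x, of y] ip_sym[OF x, of y "bv x"]
        by (simp add: ip_lin A_def B_def power2_eq_square algebra_simps)
      then have yB: "y = B *\<^sub>R bv x" using h0 ip_eq_0_iff[OF x] by auto
      have "2 \<le> DIM(real^'a)" using n by simp
      from orthogonal_to_vector_exists[OF this] obtain v where "v \<noteq> 0" "orthogonal (a x *v bv x) v" .
      then have v: "v \<noteq> 0" "?g v (bv x) = 0" by (auto simp: orthogonal_def ip_matrix inner_commute)
      have gv: "?g (bv x) v = 0" using v ip_sym[OF x] by simp
      have "?g v y = 0" using v by (subst yB) (simp add: ip_lin)
      then have "u \<bullet> (?M *v v) = 0" for u unfolding M C10 gv by simp
      then have "?M *v v = 0" by (metis inner_eq_zero_iff)
      then have "v = 0" using matrix_inv_mult(2)[OF inv] by (metis matrix_vector_mul_assoc matrix_vector_mul_lid matrix_vector_mult_0_right)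
      then show False using v by simp
    qed
  next
    assume "hh (x, y) > 0"
    then have h: "A\<^sup>2 - B\<^sup>2 > 0" using hAB by simp
    then have AB: "A - B > 0" "A + B > 0" using A
      using \<Omega>_abs[of "(x, y)"] x hAB unfolding \<Omega>_def A_def B_def by auto
    have "v = 0" if "?M *v v = 0" for v
    proof -
      define e f V where "e = ?g v y" and "f = ?g (bv x) v" and "V = ?g v v"
      have "0 = v \<bullet> (?M *v v)" using that by simp
      also have "\<dots> = 1/2 * (4 * (A + B)\<^sup>2 * (A - 2 * B) / A ^ 4 * (f - B / A\<^sup>2 * e) * e
        + C1 A B * V + (4 * (A + B)\<^sup>2 * (A - 2 * B) / A ^ 4 * e + 12 * (A + B)\<^sup>2 / A\<^sup>2 * f) * f)"
        unfolding M e_def f_def V_def by simp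
      \<comment> \<open>The decomposition F Hess F + (dF)^2: the factor in front is F, the bracket
        is the Hessian of F on v, and the last square is dF(v)^2. By Cauchy-Schwarz all three are
        nonnegative.\<close>
      also have "\<dots> = (A + B)\<^sup>2 / A * ((A\<^sup>2 - B\<^sup>2) * (V * A\<^sup>2 - e\<^sup>2) / A ^ 5 + 2 / A * (f - B * e / A\<^sup>2)\<^sup>2)
        + ((2 * (A + B) * (e / A + f) * A - (A + B)\<^sup>2 * e / A) / A\<^sup>2)\<^sup>2"
        using A unfolding C1_def by (simp add: field_simps) (simp add: eval_nat_numeral algebra_simps)
      finally have sum0: "(A + B)\<^sup>2 / A * ((A\<^sup>2 - B\<^sup>2) * (V * A\<^sup>2 - e\<^sup>2) / A ^ 5 + 2 / A * (f - B * e / A\<^sup>2)\<^sup>2)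
        + ((2 * (A + B) * (e / A + f) * A - (A + B)\<^sup>2 * e / A) / A\<^sup>2)\<^sup>2 = 0" (is "?c * (?s + ?t) + ?u\<^sup>2 = 0") by simp
      have CS: "V * A\<^sup>2 - e\<^sup>2 \<ge> 0"
        using ip_Cauchy_Schwarz[OF x, of v y] alpha_sq[OF x, of y] by (simp add: V_def A_def e_def)
      have pos: "?c > 0" "?s \<ge> 0" "?t \<ge> 0" "?u\<^sup>2 \<ge> 0" using A AB CS h by auto
      have "?c * (?s + ?t) \<ge> 0" by (rule mult_nonneg_nonneg[OF less_imp_le[OF pos(1)] add_nonneg_nonneg[OF pos(2,3)]])
      then have "?u\<^sup>2 = 0" "?c * (?s + ?t) = 0" using sum0 pos(4) by linarith+
      then have "?s + ?t = 0" using pos(1) A AB by auto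
      then have "?s = 0" "?t = 0" using pos(2,3) by linarith+
      have f: "f = B * e / A\<^sup>2" using \<open>?t = 0\<close> A by simp
      have "V * A\<^sup>2 = e\<^sup>2" using \<open>?s = 0\<close> A h by simp
      moreover have "e = 0"
      proof -
        have "?u = (A + B)\<^sup>2 * e / A ^ 3" unfolding f using A by (simp add: field_simps) (simp add: eval_nat_numeral algebra_simps)
        then show ?thesis using \<open>?u\<^sup>2 = 0\<close> A AB by simp
      qed
      ultimately have "V = 0" using A by simp
      then show "v = 0" unfolding V_def using ip_eq_0_iff[OF x] by simp
    qed
    then have "\<exists>N. N ** ?M = mat 1" using matrix_left_invertible_ker[of ?M] by blast
    then show "invertible ?M" using invertible_left_inverse by blast
  qed
qed

text \<open>The endomorphism with components s^i_j, so that \<open>Sv x y\<close> is s^i_0; it is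
  given by its columns to make the rules for \<open>Lin\<close> applicable.\<close>

definition Sv :: "real^'a \<Rightarrow> real^'a \<Rightarrow> real^'a" where
  "Sv = Lin (\<lambda>j x. (1/2) *\<^sub>R (cov a bv x (axis j 1) - sharp a x (\<chi> i. ip a x (cov a bv x (axis i 1)) (axis j 1))))"

lemma cov_bv_lin:
  assumes "x \<in> U"
  shows "cov a bv x (u + v) = cov a bv x u + cov a bv x v" "cov a bv x (c *\<^sub>R u) = c *\<^sub>R cov a bv x u"
    "cov a bv x (u - v) = cov a bv x u - cov a bv x v" "cov a bv x (- u) = - cov a bv x u" "cov a bv x 0 = 0"
  unfolding cov_def by (simp_all add: dd_dir[OF bv_D[OF assms]] Gam_lin algebra_simps)

lemma ip_cov_bv: "x \<in> U \<Longrightarrow> ip a x (cov a bv x u) (bv x) = 0"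
proof -
  assume x: "x \<in> U"
  have "dd u (\<lambda>z. ip a z (bv z) (bv z)) x = dd u (\<lambda>z. 1) x"
    by (rule dd_cong[OF open_U x unit_bv])
  then show ?thesis using dd_ip_base[OF x bv_D[OF x] bv_D[OF x], of u] ip_sym[OF x, of "bv x"] by (simp add: dd_const)
qed

lemma ip_Sv: "x \<in> U \<Longrightarrow> ip a x (Sv x y) v = 1/2 * (ip a x (cov a bv x y) v - ip a x (cov a bv x v) y)"
proof -
  assume x: "x \<in> U"
  interpret sh: bounded_linear "sharp a x" by (rule bounded_linear_sharp)
  let ?N = "\<lambda>j. cov a bv x (axis j 1)"
  have "Sv x y = (1/2) *\<^sub>R (Lin (\<lambda>j x. cov a bv x (axis j 1)) x y - (\<Sum>j\<in>UNIV. y $ j *\<^sub>R sharp a x (\<chi> i. ip a x (?N i) (axis j 1))))"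
    unfolding Sv_def Lin_def by (simp add: scaleR_diff_right sum_subtractf scaleR_sum_right mult.commute)
  also have "(\<Sum>j\<in>UNIV. y $ j *\<^sub>R sharp a x (\<chi> i. ip a x (?N i) (axis j 1))) = sharp a x (\<chi> i. ip a x (?N i) y)"
  proof -
    have "(\<Sum>j\<in>UNIV. y $ j *\<^sub>R (\<chi> i. ip a x (?N i) (axis j 1))) = (\<chi> i. ip a x (?N i) y)"
    proof -
      have "ip a x w y = ip a x w (\<Sum>j\<in>UNIV. y $ j *\<^sub>R axis j 1)" for w
        using basis_expansion[of y] by (simp add: scalar_mult_eq_scaleR)
      then show ?thesis by (simp add: vec_eq_iff ip.sum_right ip_lin)
    qed
    then show ?thesis by (simp flip: sh.scaleR sh.sum)
  qed
  also have "Lin (\<lambda>j x. cov a bv x (axis j 1)) x y = cov a bv x y"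
    by (rule cov_eq_Lin[symmetric, OF bv_D[OF x]])
  finally have "ip a x (Sv x y) v = 1/2 * (ip a x (cov a bv x y) v - (\<chi> i. ip a x (?N i) y) \<bullet> v)"
    by (simp add: ip_lin ip_sharp[OF x])
  also have "(\<chi> i. ip a x (?N i) y) \<bullet> v = ip a x (Lin (\<lambda>j x. cov a bv x (axis j 1)) x v) y"
    by (simp add: inner_vec_def Lin_def ip.sum_left ip_lin mult.commute)
  also have "Lin (\<lambda>j x. cov a bv x (axis j 1)) x v = cov a bv x v"
    by (rule cov_eq_Lin[symmetric, OF bv_D[OF x]])
  finally show ?thesis .
qed

text \<open>\<open>rf\<close> and \<open>sf\<close> are \<open>r\<^sub>0\<^sub>0\<close> and \<open>s\<^sub>0\<close>; \<open>DF\<close> is the difference of the sprays of \<open>F\<close> and \<open>\<alpha>\<close>.\<close>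

definition rf :: "(real^'a) \<times> (real^'a) \<Rightarrow> real" where
  "rf q = ip a (fst q) (cov a bv (fst q) (snd q)) (snd q)"
definition sf :: "(real^'a) \<times> (real^'a) \<Rightarrow> real" where
  "sf q = ip a (fst q) (bv (fst q)) (Sv (fst q) (snd q))"
text \<open>Coefficients of the spray of \<alpha> \<phi>(\<beta>/\<alpha>) for \<phi>(s) = (1 + s)^2
  and b = 1: \<open>qf\<close> is \<alpha> \<phi>' / (\<phi> - s \<phi>'), and the denominator 3 hh
  of \<open>Ef\<close> comes from \<phi> - s \<phi>' + (1 - s^2) \<phi>'' = 3 (1 - s^2).\<close>

definition qf :: "(real^'a) \<times> (real^'a) \<Rightarrow> real" where
  "qf q = 2 * (\<alpha>\<^sub>f q)\<^sup>2 / (\<alpha>\<^sub>f q - \<beta>\<^sub>f q)"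
definition Ef :: "(real^'a) \<times> (real^'a) \<Rightarrow> real" where
  "Ef q = (rf q - 2 * qf q * sf q) / (3 * hh q)"
definition DF :: "(real^'a) \<times> (real^'a) \<Rightarrow> real^'a" where
  "DF q = qf q *\<^sub>R Sv (fst q) (snd q) + (Ef q * (\<alpha>\<^sub>f q - 2 * \<beta>\<^sub>f q)) *\<^sub>R snd q + (Ef q * (\<alpha>\<^sub>f q)\<^sup>2) *\<^sub>R bv (fst q)"

text \<open>The Euler-Lagrange equation for \<open>DF\<close>, compared coefficient by coefficient:
  \<open>C2 = C1 q\<close> matches the terms with s^i_0, and the two other identities are the
  coefficients of <b, u> and of <u, y>.\<close>

lemma spray_algebra:
  fixes A B :: real
  assumes "A \<noteq> 0" "A - B \<noteq> 0" "A + B \<noteq> 0"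
    and q: "q = 2 * A\<^sup>2 / (A - B)" and r: "r = 3 * (A\<^sup>2 - B\<^sup>2) * E + 2 * q * s"
  shows "4 * (A + B)\<^sup>2 * (A - 2 * B) / A ^ 4 * r * iuy + 12 * (A + B)\<^sup>2 / A\<^sup>2 * r * ibu + C2 A B * (2 * iSu)
    = 2 * (4 * (A + B)\<^sup>2 * (A - 2 * B) / A ^ 4 * ((q * s + E * (A - 2 * B) * B + E * A\<^sup>2) - B / A\<^sup>2 * (E * A\<^sup>2 * (A - B))) * iuy
      + C1 A B * (q * iSu + E * (A - 2 * B) * iuy + E * A\<^sup>2 * ibu)
      + (4 * (A + B)\<^sup>2 * (A - 2 * B) / A ^ 4 * (E * A\<^sup>2 * (A - B)) + 12 * (A + B)\<^sup>2 / A\<^sup>2 * (q * s + E * (A - 2 * B) * B + E * A\<^sup>2)) * ibu)"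
proof -
  have 1: "C2 A B = C1 A B * q" unfolding q C1_def C2_def using assms(1-3) by (simp add: field_simps)
  have 2: "12 * (A + B)\<^sup>2 / A\<^sup>2 * (3 * (A\<^sup>2 - B\<^sup>2) * E) = 2 * (C1 A B * (E * A\<^sup>2) + 4 * (A + B)\<^sup>2 * (A - 2 * B) / A ^ 4 * (E * A\<^sup>2 * (A - B))
      + 12 * (A + B)\<^sup>2 / A\<^sup>2 * (E * (A - 2 * B) * B + E * A\<^sup>2))"
    unfolding C1_def using assms(1) by (simp add: field_simps) (simp add: eval_nat_numeral algebra_simps)
  have 3: "4 * (A + B)\<^sup>2 * (A - 2 * B) / A ^ 4 * (3 * (A\<^sup>2 - B\<^sup>2) * E)
      = 2 * (4 * (A + B)\<^sup>2 * (A - 2 * B) / A ^ 4 * ((E * (A - 2 * B) * B + E * A\<^sup>2) - B / A\<^sup>2 * (E * A\<^sup>2 * (A - B))) + C1 A B * (E * (A - 2 * B)))"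
    unfolding C1_def using assms(1) by (simp add: field_simps) (simp add: eval_nat_numeral algebra_simps)
  define k where "k = 4 * (A + B)\<^sup>2 * (A - 2 * B) / A ^ 4"
  define l where "l = 12 * (A + B)\<^sup>2 / A\<^sup>2"
  have e2: "l * (3 * (A\<^sup>2 - B\<^sup>2) * E) * ibu = 2 * (C1 A B * (E * A\<^sup>2) + k * (E * A\<^sup>2 * (A - B)) + l * (E * (A - 2 * B) * B + E * A\<^sup>2)) * ibu"
    using 2 unfolding k_def l_def by simp
  have e3: "k * (3 * (A\<^sup>2 - B\<^sup>2) * E) * iuy = 2 * (k * ((E * (A - 2 * B) * B + E * A\<^sup>2) - B / A\<^sup>2 * (E * A\<^sup>2 * (A - B))) + C1 A B * (E * (A - 2 * B))) * iuy"
    using 3 unfolding k_def by simp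
  have gen: "k * (T + 2 * q * s) * iuy + l * (T + 2 * q * s) * ibu + c * q * (2 * iSu)
      = 2 * (k * ((q * s + X + Y) - b * P2) * iuy + c * (q * iSu + P3 * iuy + Y * ibu) + (k * P2 + l * (q * s + X + Y)) * ibu)"
    if "l * T * ibu = 2 * (c * Y + k * P2 + l * (X + Y)) * ibu" "k * T * iuy = 2 * (k * ((X + Y) - b * P2) + c * P3) * iuy"
    for c T X Y P2 P3 b
    using that by (simp add: algebra_simps)
  show ?thesis
    unfolding k_def[symmetric] l_def[symmetric] 1 r by (rule gen[OF e2 e3])
qed

lemma
  assumes xy: "(x, y) \<in> \<Omega>"
  shows spr_vert_Lag_F: "spr (\<lambda>q. Gal a q + DF q) (dd (0, u) (Lag F)) (x, y) = dd (u, 0) (Lag F) (x, y)"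
    and spr_Lag_F: "spr (\<lambda>q. Gal a q + DF q) (Lag F) (x, y) = 0"
proof -
  let ?q = "(x, y)" and ?L = "Lag F" and ?g = "ip a x"
  have q0: "?q \<in> \<Omega>0" using xy \<Omega>_subset by blast
  have x: "x \<in> U" and y: "y \<noteq> 0" and h: "hh ?q > 0" using \<Omega>_D[OF xy] by auto
  have x': "fst ?q \<in> U" and y': "snd ?q \<noteq> 0" using x y by auto
  define A B where "A = alpha a x y" and "B = ?g (bv x) y"
  have AB: "A > 0" "A - B > 0" "A + B > 0" using \<Omega>_abs[OF xy] unfolding A_def B_def by auto
  have hAB: "hh ?q = A\<^sup>2 - B\<^sup>2" using hh_alpha[of ?q] x by (simp add: A_def B_def)
  have A2: "?g y y = A\<^sup>2" using alpha_sq[OF x] by (simp add: A_def)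
  have Dd: "dd k ?L differentiable (at ?q)" for k by (rule sm_diff_at[OF sm_dd[OF sm_Lag_F] q0])
  have D: "?L differentiable (at ?q)" by (rule sm_diff_at[OF sm_Lag_F q0])
  let ?D = "DF ?q" and ?S = "Sv x y" and ?N = "cov a bv x" and ?G = "Gam a x"
  let ?E = "Ef ?q" and ?qq = "qf ?q" and ?s = "sf ?q" and ?r = "rf ?q"
  have r: "?r = 3 * (A\<^sup>2 - B\<^sup>2) * ?E + 2 * ?qq * ?s" using h unfolding Ef_def by (simp add: hAB[symmetric])
  have qq: "?qq = 2 * A\<^sup>2 / (A - B)" unfolding qf_def A_def B_def by simp
  have Sy: "?g ?S y = 0" using ip_Sv[OF x, of y y] by simp
  have bS: "?g (bv x) ?S = ?s" unfolding sf_def by simp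
  have DF': "?D = ?qq *\<^sub>R ?S + (?E * (A - 2 * B)) *\<^sub>R y + (?E * A\<^sup>2) *\<^sub>R bv x" unfolding DF_def A_def B_def by simp
  have gDy: "?g ?D y = ?E * A\<^sup>2 * (A - B)"
    unfolding DF' by (simp add: ip_lin Sy A2 flip: B_def) (simp add: algebra_simps)
  have gbD: "?g (bv x) ?D = ?qq * ?s + ?E * (A - 2 * B) * B + ?E * A\<^sup>2"
    unfolding DF' by (simp add: ip_lin bS unit_bv[OF x] flip: B_def)
  have guD: "?g u ?D = ?qq * ?g ?S u + ?E * (A - 2 * B) * ?g u y + ?E * A\<^sup>2 * ?g (bv x) u"
    unfolding DF' using ip_sym[OF x, of u] by (simp add: ip_lin)
  \<comment> \<open>The spray of F is the horizontal lift of y for \<alpha>, corrected by -2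
    \<open>DF\<close> along the fibre. Along the lift \<alpha> is constant, so only \<beta>
    contributes there.\<close>
  have "dd (y, - 2 *\<^sub>R (Gal a ?q + ?D)) (dd (0, u) ?L) ?q = dd (hor a y ?q + - 2 *\<^sub>R (0, ?D)) (dd (0, u) ?L) ?q"
    by (simp add: hor_def Gal_def scaleR_add_right)
  also have "\<dots> = dd (hor a y ?q) (dd (0, u) ?L) ?q - 2 * dd (0, ?D) (dd (0, u) ?L) ?q"
    by (simp only: dd_dir_add[OF Dd] dd_dir_scale[OF Dd]) simp
  also have "dd (hor a y ?q) (dd (0, u) ?L) ?q = 4 * (A + B)\<^sup>2 * (A - 2 * B) / A ^ 4 * ?r * ?g u y
      + C1 A B * ?g (?G u y) y + 12 * (A + B)\<^sup>2 / A\<^sup>2 * ?r * ?g (bv x) u + C2 A B * (?g (?N y) u + ?g (bv x) (?G u y))"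
  proof -
    have DHc: "DH a y (\<lambda>q. u) ?q = ?G u y" by (simp add: DH_def dd_const Gam_sym[OF x, of y u])
    have 1: "dd (hor a y ?q) (\<lambda>q. ip a (fst q) u (snd q)) ?q = ?g (?G u y) y"
      using dd_hor_ip[OF x' differentiable_const differentiable_snd, of y u] by (simp add: DHc DH_snd ip_lin)
    have 2: "dd (hor a y ?q) (\<lambda>q. ip a (fst q) (bv (fst q)) u) ?q = ?g (?N y) u + ?g (bv x) (?G u y)"
      using dd_hor_ip[OF x' differentiable_comp_fst[OF bv_D[OF x']] differentiable_const, of y u] DH_base[OF bv_D[OF x'], of y]
      by (simp add: DHc)
    show ?thesis
      unfolding dd_dd_Lag_F[OF q0] 1 2 dd_hor_alpha[OF x' y'] dd_hor_beta[OF x']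
      unfolding A_def[symmetric] B_def[symmetric] rf_def fst_conv snd_conv by simp
  qed
  also have "dd (0, ?D) (dd (0, u) ?L) ?q = 4 * (A + B)\<^sup>2 * (A - 2 * B) / A ^ 4 * ((?qq * ?s + ?E * (A - 2 * B) * B + ?E * A\<^sup>2) - B / A\<^sup>2 * (?E * A\<^sup>2 * (A - B))) * ?g u y
      + C1 A B * (?qq * ?g ?S u + ?E * (A - 2 * B) * ?g u y + ?E * A\<^sup>2 * ?g (bv x) u)
      + (4 * (A + B)\<^sup>2 * (A - 2 * B) / A ^ 4 * (?E * A\<^sup>2 * (A - B)) + 12 * (A + B)\<^sup>2 / A\<^sup>2 * (?qq * ?s + ?E * (A - 2 * B) * B + ?E * A\<^sup>2)) * ?g (bv x) u"
    unfolding dd_vert_dd_Lag_F[OF q0] fst_conv snd_conv A_def[symmetric] B_def[symmetric] gDy gbD guD by simp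
  finally have LHS: "dd (y, - 2 *\<^sub>R (Gal a ?q + ?D)) (dd (0, u) ?L) ?q =
      C1 A B * ?g (?G u y) y + C2 A B * (?g (?N y) u + ?g (bv x) (?G u y)) - C2 A B * (2 * ?g ?S u)"
    using spray_algebra[OF _ _ _ qq r, of "?g u y" "?g (bv x) u" "?g ?S u"] AB by linarith
  have "(u, 0) = hor a u ?q + (0, ?G u y)" by (simp add: hor_def)
  then have "dd (u, 0) ?L ?q = dd (hor a u ?q) ?L ?q + dd (0, ?G u y) ?L ?q"
    by (simp only: dd_dir_add[OF D])
  also have "\<dots> = C2 A B * ?g (?N u) y + (C1 A B * ?g (?G u y) y + C2 A B * ?g (bv x) (?G u y))"
    unfolding dd_vert_Lag_F[OF q0] unfolding dd_Lag_F[OF q0] dd_hor_alpha[OF x' y'] dd_hor_beta[OF x']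
    unfolding fst_conv snd_conv A_def[symmetric] B_def[symmetric] by simp
  finally show "spr (\<lambda>q. Gal a q + DF q) (dd (0, u) ?L) ?q = dd (u, 0) ?L ?q"
    unfolding spr_def fst_conv snd_conv LHS ip_Sv[OF x] by (simp add: algebra_simps)
  have "dd (y, - 2 *\<^sub>R (Gal a ?q + ?D)) ?L ?q = dd (hor a y ?q + - 2 *\<^sub>R (0, ?D)) ?L ?q"
    by (simp add: hor_def Gal_def scaleR_add_right)
  also have "\<dots> = dd (hor a y ?q) ?L ?q - 2 * dd (0, ?D) ?L ?q"
    by (simp only: dd_dir_add[OF D] dd_dir_scale[OF D]) simp
  also have "\<dots> = C2 A B * ?r - 2 * (C1 A B * (?E * A\<^sup>2 * (A - B)) + C2 A B * (?qq * ?s + ?E * (A - 2 * B) * B + ?E * A\<^sup>2))"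
    unfolding dd_vert_Lag_F[OF q0] unfolding dd_Lag_F[OF q0] dd_hor_alpha[OF x' y'] dd_hor_beta[OF x']
    unfolding fst_conv snd_conv A_def[symmetric] B_def[symmetric] gDy gbD rf_def by simp
  also have "\<dots> = 0"
    unfolding r C1_def C2_def using AB(1) by (simp add: field_simps) (simp add: eval_nat_numeral algebra_simps)
  finally show "spr (\<lambda>q. Gal a q + DF q) ?L ?q = 0" unfolding spr_def fst_conv snd_conv .
qed

lemma spray_F:
  assumes xy: "(x, y) \<in> \<Omega>" and n: "CARD('a) \<ge> 2"
  shows "spray F x y i = (Gal a (x, y) + DF (x, y)) $ i"
proof (rule spray_eqI[OF open_\<Omega>0 _ sm_Lag_F])
  show "(x, y) \<in> \<Omega>0" using xy \<Omega>_subset by blast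
  show "invertible (fund_tensor F x y)" using invertible_fund_tensor_iff[of x y] \<Omega>_D[OF xy] n by simp
  show "dd (y, - 2 *\<^sub>R (Gal a (x, y) + DF (x, y))) (dd (0, u) (Lag F)) (x, y) = dd (u, 0) (Lag F) (x, y)" for u
    using spr_vert_Lag_F[OF xy] by (simp add: spr_def)
qed

end

section \<open>Derivatives of the spray coefficients of F\<close>

context unit_square
begin

text \<open>The partial derivatives of 2 A^2 / (A - B) in A and in B.\<close>

definition Qa :: "real \<Rightarrow> real \<Rightarrow> real" where "Qa A B = 2 * A * (A - 2 * B) / (A - B)\<^sup>2"
definition Qb :: "real \<Rightarrow> real \<Rightarrow> real" where "Qb A B = 2 * A\<^sup>2 / (A - B)\<^sup>2"

definition Sc :: "'a \<Rightarrow> real^'a \<Rightarrow> real^'a" where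
  "Sc j x = (1/2) *\<^sub>R (cov a bv x (axis j 1) - sharp a x (\<chi> i. ip a x (cov a bv x (axis i 1)) (axis j 1)))"

lemma Sv_Lin: "Sv x y = Lin Sc x y"
  unfolding Sv_def Sc_def ..

lemma sm_Sc: "sm U (Sc j)"
proof -
  have "sm U (\<lambda>x. Sc j x)" unfolding Sc_def
    by (intro sm_scaleR sm_diff open_U sm_const sm_cov sm_bv sm_sharp_base sm_vec_lambda sm_ip_base)
  then show ?thesis .
qed

lemma Sv_lin:
  "Sv x (u + v) = Sv x u + Sv x v" "Sv x (u - v) = Sv x u - Sv x v" "Sv x (c *\<^sub>R u) = c *\<^sub>R Sv x u" "Sv x (- u) = - Sv x u" "Sv x 0 = 0"
proof -
  interpret bounded_linear "Lin Sc x" by (rule bounded_linear_Lin)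
  show "Sv x (u + v) = Sv x u + Sv x v" "Sv x (u - v) = Sv x u - Sv x v" "Sv x (c *\<^sub>R u) = c *\<^sub>R Sv x u" "Sv x (- u) = - Sv x u" "Sv x 0 = 0"
    unfolding Sv_Lin by (rule add diff scaleR neg zero)+
qed

lemma Sv_antisym: "x \<in> U \<Longrightarrow> ip a x (Sv x u) v = - ip a x u (Sv x v)"
  using ip_Sv[of x u v] ip_Sv[of x v u] ip_sym[of x u "Sv x v"] ip_sym[of x u] by simp

text \<open>The covariant derivative of the endomorphism field with columns \<open>c\<close>.\<close>

definition LD :: "('a \<Rightarrow> real^'a \<Rightarrow> real^'a) \<Rightarrow> real^'a \<Rightarrow> real^'a \<Rightarrow> real^'a \<Rightarrow> real^'a" where
  "LD c x u y = Lin (\<lambda>j. dd u (c j)) x y + Gam a x u (Lin c x y) - Lin c x (Gam a x u y)"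

lemma bilinear_LD:
  assumes x: "x \<in> U" and c: "\<And>j. sm U (c j)"
  shows "bounded_bilinear (LD c x)"
proof (rule bilinear_conv_bounded_bilinear[THEN iffD1])
  interpret L: bounded_linear "Lin c x" by (rule bounded_linear_Lin)
  have d: "Lin (\<lambda>j. dd (u + v) (c j)) x y = Lin (\<lambda>j. dd u (c j)) x y + Lin (\<lambda>j. dd v (c j)) x y"
    "Lin (\<lambda>j. dd (r *\<^sub>R u) (c j)) x y = r *\<^sub>R Lin (\<lambda>j. dd u (c j)) x y" for u v y r
    by (simp_all add: Lin_def dd_dir_add[OF sm_diff_at[OF c x]] dd_dir_scale[OF sm_diff_at[OF c x]]
      scaleR_add_right sum.distrib scaleR_sum_right mult.commute)
  have l: "Lin c' x (y + z) = Lin c' x y + Lin c' x z" "Lin c' x (r *\<^sub>R y) = r *\<^sub>R Lin c' x y" for c' :: "'a \<Rightarrow> real^'a \<Rightarrow> real^'a" and y z r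
    by (simp_all add: Lin_def scaleR_add_left sum.distrib scaleR_sum_right)
  show "bilinear (LD c x)"
    unfolding bilinear_def LD_def
    by (auto intro!: linearI simp: d l Gam_lin algebra_simps)
qed

lemma DH_Lin:
  assumes q: "fst q \<in> U" and c: "\<And>j. sm U (c j)"
  shows "DH a u (\<lambda>q. Lin c (fst q) (snd q)) q = LD c (fst q) u (snd q)"
  using dd_Lin(1)[where c = c and h = "hor a u q", OF bounded_linear_fst sm_diff_at[OF c q] differentiable_snd]
    linear_neg[OF bounded_linear.linear[OF bounded_linear_Lin[of c "fst q"]]]
  by (simp add: DH_def LD_def dd_snd) (simp add: hor_def)

definition Nc :: "'a \<Rightarrow> real^'a \<Rightarrow> real^'a" where "Nc j x = cov a bv x (axis j 1)"

lemma sm_Nc: "sm U (Nc j)"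
proof -
  have "sm U (\<lambda>x. Nc j x)" unfolding Nc_def by (intro sm_cov sm_bv sm_const)
  then show ?thesis .
qed

lemma cov_Lin: "x \<in> U \<Longrightarrow> cov a bv x u = Lin Nc x u"
  unfolding Nc_def by (rule cov_eq_Lin[OF bv_D])

text \<open>\<open>TT\<close> is the covariant derivative of s^i_j in the direction u, and
  \<open>HH\<close> the second covariant derivative of b; both are bilinear in u and y.\<close>

abbreviation "TT x u y \<equiv> LD Sc x u y"
abbreviation "HH x u y \<equiv> LD Nc x u y"

lemma differentiable_Lin_vert: "fst q \<in> U \<Longrightarrow> (\<And>j. sm U (c j)) \<Longrightarrow> (\<lambda>q. Lin c (fst q) (snd q)) differentiable (at q)"
  by (rule dd_Lin(2)[OF bounded_linear_fst sm_diff_at differentiable_snd])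

lemma dd_vert_Lin:
  fixes c :: "'a \<Rightarrow> real^'a \<Rightarrow> 'c::real_normed_vector"
  assumes "fst q \<in> U" "\<And>j. sm U (c j)"
  shows "dd (0, v) (\<lambda>q. Lin c (fst q) (snd q)) q = Lin c (fst q) v"
proof -
  have "Lin (\<lambda>j. dd 0 (c j)) (fst q) (snd q) = 0" by (simp add: Lin_def dd_dir_zero[OF sm_diff_at[OF assms(2,1)]])
  then show ?thesis
    using dd_Lin(1)[where c = c and h = "(0, v)", OF bounded_linear_fst sm_diff_at[OF assms(2,1)] differentiable_snd]
    by (simp add: dd_snd)
qed

lemma cov_diff: "q \<in> \<Omega>0 \<Longrightarrow> (\<lambda>q. cov a bv (fst q) (snd q)) differentiable (at q)"
  using dd_vert_cov(2)[OF _ sm_bv] \<Omega>0_D by blast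

lemma Sv_diff: "q \<in> \<Omega>0 \<Longrightarrow> (\<lambda>q. Sv (fst q) (snd q)) differentiable (at q)"
  unfolding Sv_Lin by (rule differentiable_Lin_vert[OF \<Omega>0_D(1) sm_Sc])

lemma DH_cov: "q \<in> \<Omega>0 \<Longrightarrow> DH a u (\<lambda>q. cov a bv (fst q) (snd q)) q = HH (fst q) u (snd q)"
proof -
  assume q: "q \<in> \<Omega>0"
  have "dd (hor a u q) (\<lambda>q. cov a bv (fst q) (snd q)) q = dd (hor a u q) (\<lambda>q. Lin Nc (fst q) (snd q)) q"
    by (rule dd_cong[OF open_\<Omega>0 q]) (use \<Omega>0_D cov_Lin in blast)
  then show ?thesis
    using DH_Lin[of q Nc u, OF \<Omega>0_D(1)[OF q] sm_Nc] cov_Lin[OF \<Omega>0_D(1)[OF q]] by (simp add: DH_def)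
qed

lemma rf_sf_diff:
  assumes q: "q \<in> \<Omega>0"
  shows "rf differentiable (at q)" "sf differentiable (at q)"
proof -
  have "(\<lambda>q. rf q) differentiable (at q)" "(\<lambda>q. sf q) differentiable (at q)"
    unfolding rf_def sf_def
    by (rule differentiable_ip[OF \<Omega>0_D(1)[OF q]] cov_diff[OF q] Sv_diff[OF q] differentiable_snd
      differentiable_comp_fst[OF bv_D[OF \<Omega>0_D(1)[OF q]]])+
  then show "rf differentiable (at q)" "sf differentiable (at q)" .
qed

lemma dd_rf_sf:
  assumes q: "q \<in> \<Omega>0"
  shows dd_vert_rf: "dd (0, v) rf q = ip a (fst q) (cov a bv (fst q) v) (snd q) + ip a (fst q) (cov a bv (fst q) (snd q)) v"
    and dd_vert_sf: "dd (0, v) sf q = ip a (fst q) (bv (fst q)) (Sv (fst q) v)"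
    and dd_hor_rf: "dd (hor a u q) rf q = ip a (fst q) (HH (fst q) u (snd q)) (snd q)"
    and dd_hor_sf: "dd (hor a u q) sf q = ip a (fst q) (cov a bv (fst q) u) (Sv (fst q) (snd q)) + ip a (fst q) (bv (fst q)) (TT (fst q) u (snd q))"
proof -
  note x = \<Omega>0_D(1)[OF q]
  note b = differentiable_comp_fst[OF bv_D[OF x]]
  have "dd (0, v) (\<lambda>q. rf q) q = ip a (fst q) (cov a bv (fst q) v) (snd q) + ip a (fst q) (cov a bv (fst q) (snd q)) v"
    unfolding rf_def dd_vert_ip[OF x cov_diff[OF q] differentiable_snd] dd_vert_cov(1)[OF x sm_bv] dd_snd by simp
  then show "dd (0, v) rf q = ip a (fst q) (cov a bv (fst q) v) (snd q) + ip a (fst q) (cov a bv (fst q) (snd q)) v" .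
  have "dd (0, v) (\<lambda>q. sf q) q = ip a (fst q) (bv (fst q)) (Sv (fst q) v)"
    unfolding sf_def dd_vert_ip[OF x b Sv_diff[OF q]] unfolding Sv_Lin dd_vert_Lin[OF x sm_Sc] dd_comp_fst[OF bv_D[OF x]]
    by (simp add: dd_dir_zero[OF bv_D[OF x]] ip_lin)
  then show "dd (0, v) sf q = ip a (fst q) (bv (fst q)) (Sv (fst q) v)" .
  have "dd (hor a u q) (\<lambda>q. rf q) q = ip a (fst q) (HH (fst q) u (snd q)) (snd q)"
    unfolding rf_def dd_hor_ip[OF x cov_diff[OF q] differentiable_snd] DH_cov[OF q] DH_snd by (simp add: ip_lin)
  then show "dd (hor a u q) rf q = ip a (fst q) (HH (fst q) u (snd q)) (snd q)" .
  have "dd (hor a u q) (\<lambda>q. sf q) q = ip a (fst q) (cov a bv (fst q) u) (Sv (fst q) (snd q)) + ip a (fst q) (bv (fst q)) (TT (fst q) u (snd q))"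
    unfolding sf_def dd_hor_ip[OF x b Sv_diff[OF q]] DH_base[OF bv_D[OF x]] unfolding Sv_Lin DH_Lin[OF x sm_Sc] ..
  then show "dd (hor a u q) sf q = ip a (fst q) (cov a bv (fst q) u) (Sv (fst q) (snd q)) + ip a (fst q) (bv (fst q)) (TT (fst q) u (snd q))" .
qed

lemma sm_rf: "sm \<Omega>0 rf"
proof -
  have "sm \<Omega>0 (\<lambda>q. ip a (fst q) (Lin Nc (fst q) (snd q)) (snd q))"
    using \<Omega>0_D by (intro sm_ip[OF open_\<Omega>0] sm_Lin[OF open_\<Omega>0 bounded_linear_fst _ sm_Nc] sm_snd[OF open_\<Omega>0])
  then show ?thesis
    by (rule sm_cong[OF open_\<Omega>0, rotated]) (simp add: rf_def cov_Lin \<Omega>0_D)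
qed

lemma sm_Sv: "sm \<Omega>0 (\<lambda>q. Sv (fst q) (snd q))"
  unfolding Sv_Lin using \<Omega>0_D by (intro sm_Lin[OF open_\<Omega>0 bounded_linear_fst _ sm_Sc] sm_snd[OF open_\<Omega>0])

lemma sm_bv_fst: "open S \<Longrightarrow> (\<And>q. q \<in> S \<Longrightarrow> fst q \<in> U) \<Longrightarrow> sm S (\<lambda>q. bv (fst q))"
  by (rule sm_comp_fst[OF _ _ sm_bv])

lemma sm_sf: "sm \<Omega>0 sf"
proof -
  have "sm \<Omega>0 (\<lambda>q. sf q)"
    unfolding sf_def using \<Omega>0_D by (intro sm_ip[OF open_\<Omega>0] sm_Sv sm_bv_fst[OF open_\<Omega>0])
  then show ?thesis .
qed

lemma \<Omega>_sm:
  shows sm_al: "sm \<Omega> \<alpha>\<^sub>f" and sm_be: "sm \<Omega> \<beta>\<^sub>f" and sm_h: "sm \<Omega> hh" and sm_q: "sm \<Omega> qf" and sm_E: "sm \<Omega> Ef" and sm_D: "sm \<Omega> DF"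
proof -
  have z: "\<alpha>\<^sub>f q - \<beta>\<^sub>f q \<noteq> 0" "3 * hh q \<noteq> 0" if "q \<in> \<Omega>" for q using \<Omega>_abs[OF that] \<Omega>_D[OF that] by auto
  show 1: "sm \<Omega> \<alpha>\<^sub>f" using \<Omega>_D by (intro sm_alpha[OF open_\<Omega>]) auto
  show 2: "sm \<Omega> \<beta>\<^sub>f" using \<Omega>_D by (intro sm_beta[OF open_\<Omega>]) auto
  show 3: "sm \<Omega> hh" using \<Omega>_D by (intro sm_hh[OF open_\<Omega>]) auto
  have 4: "sm \<Omega> (\<lambda>q. qf q)" unfolding qf_def
    using z by (intro sm_divide sm_mult sm_power sm_diff open_\<Omega> 1 2 sm_const)
  then show "sm \<Omega> qf" .
  note rs = sm_subset[OF sm_rf \<Omega>_subset] sm_subset[OF sm_sf \<Omega>_subset] sm_subset[OF sm_Sv \<Omega>_subset]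
  have 5: "sm \<Omega> (\<lambda>q. Ef q)" unfolding Ef_def
    using z(2) by (intro sm_divide sm_mult sm_diff open_\<Omega> 3 4 rs sm_const)
  then show "sm \<Omega> Ef" .
  have "sm \<Omega> (\<lambda>q. DF q)" unfolding DF_def
    using \<Omega>_D by (intro sm_add sm_scaleR sm_mult sm_diff sm_power open_\<Omega> 1 2 4 5 rs sm_const sm_snd sm_bv_fst)
  then show "sm \<Omega> DF" .
qed

lemma dd_qf:
  assumes q: "q \<in> \<Omega>"
  shows "dd k qf q = Qa (\<alpha>\<^sub>f q) (\<beta>\<^sub>f q) * dd k \<alpha>\<^sub>f q + Qb (\<alpha>\<^sub>f q) (\<beta>\<^sub>f q) * dd k \<beta>\<^sub>f q"
proof -
  note d = sm_diff_at[OF sm_al q] sm_diff_at[OF sm_be q]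
  have z: "\<alpha>\<^sub>f q - \<beta>\<^sub>f q \<noteq> 0" using \<Omega>_abs[OF q] by simp
  have "dd k (\<lambda>q. qf q) q = Qa (\<alpha>\<^sub>f q) (\<beta>\<^sub>f q) * dd k \<alpha>\<^sub>f q + Qb (\<alpha>\<^sub>f q) (\<beta>\<^sub>f q) * dd k \<beta>\<^sub>f q"
    unfolding qf_def Qa_def Qb_def
    using d z by (simp add: dd_divide dd_mult dd_power2 dd_diff dd_const flip: add_divide_distrib)
      (simp add: algebra_simps power2_eq_square)
  then show ?thesis .
qed

lemma dd_hh:
  assumes q: "q \<in> \<Omega>"
  shows dd_vert_hh: "dd (0, v) hh q = 2 * ip a (fst q) v (snd q) - 2 * \<beta>\<^sub>f q * ip a (fst q) (bv (fst q)) v"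
    and dd_hor_hh: "dd (hor a u q) hh q = - 2 * \<beta>\<^sub>f q * ip a (fst q) (cov a bv (fst q) u) (snd q)"
proof -
  note x = \<Omega>_D(1)[OF q]
  have d: "(\<lambda>q. ip a (fst q) (snd q) (snd q)) differentiable (at q)" by (rule differentiable_ip[OF x differentiable_snd differentiable_snd])
  note d' = sm_diff_at[OF sm_be q]
  have "dd k (\<lambda>q. hh q) q = dd k (\<lambda>q. ip a (fst q) (snd q) (snd q)) q - 2 * \<beta>\<^sub>f q * dd k \<beta>\<^sub>f q" for k
    unfolding hh_def using d d' by (simp add: dd_diff dd_power2)
  then have *: "dd k hh q = dd k (\<lambda>q. ip a (fst q) (snd q) (snd q)) q - 2 * \<beta>\<^sub>f q * dd k \<beta>\<^sub>f q" for k .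
  show "dd (0, v) hh q = 2 * ip a (fst q) v (snd q) - 2 * \<beta>\<^sub>f q * ip a (fst q) (bv (fst q)) v"
    unfolding * dd_vert_beta[OF x] dd_vert_ip[OF x differentiable_snd differentiable_snd] dd_snd
    using ip_sym[OF x, of v "snd q"] by simp
  show "dd (hor a u q) hh q = - 2 * \<beta>\<^sub>f q * ip a (fst q) (cov a bv (fst q) u) (snd q)"
    unfolding * dd_hor_beta[OF x] dd_hor_ip[OF x differentiable_snd differentiable_snd] DH_snd by (simp add: ip_lin)
qed

lemma dd_Ef:
  assumes q: "q \<in> \<Omega>"
  shows "dd k Ef q = (dd k rf q - 2 * dd k qf q * sf q - 2 * qf q * dd k sf q) / (3 * hh q) - Ef q * dd k hh q / hh q"
proof -
  have q0: "q \<in> \<Omega>0" using q \<Omega>_subset by blast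
  note d = rf_sf_diff[OF q0] sm_diff_at[OF sm_q q] sm_diff_at[OF sm_h q]
  have z: "3 * hh q \<noteq> 0" using \<Omega>_D[OF q] by simp
  have "dd k (\<lambda>q. Ef q) q = (dd k rf q - 2 * dd k qf q * sf q - 2 * qf q * dd k sf q) / (3 * hh q) - Ef q * dd k hh q / hh q"
    unfolding Ef_def using d z
    by (simp add: dd_divide dd_mult dd_diff dd_const) (simp add: field_simps power2_eq_square)
  then show ?thesis .
qed

definition ef :: "(real^'a) \<times> (real^'a) \<Rightarrow> real" where "ef q = Ef q * (\<alpha>\<^sub>f q - 2 * \<beta>\<^sub>f q)"
definition ff :: "(real^'a) \<times> (real^'a) \<Rightarrow> real" where "ff q = Ef q * (\<alpha>\<^sub>f q)\<^sup>2"

lemma sm_ef: "sm \<Omega> ef" and sm_ff: "sm \<Omega> ff"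
proof -
  have "sm \<Omega> (\<lambda>q. ef q)" "sm \<Omega> (\<lambda>q. ff q)"
    unfolding ef_def ff_def by (intro sm_mult sm_diff sm_power open_\<Omega> sm_E sm_al sm_be sm_const)+
  then show "sm \<Omega> ef" "sm \<Omega> ff" .
qed

lemma dd_ef: "q \<in> \<Omega> \<Longrightarrow> dd k ef q = (\<alpha>\<^sub>f q - 2 * \<beta>\<^sub>f q) * dd k Ef q + Ef q * (dd k \<alpha>\<^sub>f q - 2 * dd k \<beta>\<^sub>f q)"
  and dd_ff: "q \<in> \<Omega> \<Longrightarrow> dd k ff q = (\<alpha>\<^sub>f q)\<^sup>2 * dd k Ef q + Ef q * (2 * \<alpha>\<^sub>f q * dd k \<alpha>\<^sub>f q)"
proof -
  assume q: "q \<in> \<Omega>"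
  note d = sm_diff_at[OF sm_E q] sm_diff_at[OF sm_al q] sm_diff_at[OF sm_be q]
  have "dd k (\<lambda>q. ef q) q = (\<alpha>\<^sub>f q - 2 * \<beta>\<^sub>f q) * dd k Ef q + Ef q * (dd k \<alpha>\<^sub>f q - 2 * dd k \<beta>\<^sub>f q)"
    "dd k (\<lambda>q. ff q) q = (\<alpha>\<^sub>f q)\<^sup>2 * dd k Ef q + Ef q * (2 * \<alpha>\<^sub>f q * dd k \<alpha>\<^sub>f q)"
    unfolding ef_def ff_def using d by (simp_all add: dd_mult dd_diff dd_power2 dd_const)
  then show "dd k ef q = (\<alpha>\<^sub>f q - 2 * \<beta>\<^sub>f q) * dd k Ef q + Ef q * (dd k \<alpha>\<^sub>f q - 2 * dd k \<beta>\<^sub>f q)"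
    "dd k ff q = (\<alpha>\<^sub>f q)\<^sup>2 * dd k Ef q + Ef q * (2 * \<alpha>\<^sub>f q * dd k \<alpha>\<^sub>f q)" .
qed

lemma DF_eq: "DF q = qf q *\<^sub>R Sv (fst q) (snd q) + ef q *\<^sub>R snd q + ff q *\<^sub>R bv (fst q)"
  unfolding DF_def ef_def ff_def ..

lemma dd_vert_DF:
  assumes q: "q \<in> \<Omega>"
  shows "dd (0, v) DF q = dd (0, v) qf q *\<^sub>R Sv (fst q) (snd q) + qf q *\<^sub>R Sv (fst q) v
     + dd (0, v) ef q *\<^sub>R snd q + ef q *\<^sub>R v + dd (0, v) ff q *\<^sub>R bv (fst q)"
proof -
  have q0: "q \<in> \<Omega>0" using q \<Omega>_subset by blast
  note x = \<Omega>_D(1)[OF q]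
  note d = sm_diff_at[OF sm_q q] sm_diff_at[OF sm_ef q] sm_diff_at[OF sm_ff q] Sv_diff[OF q0] differentiable_comp_fst[OF bv_D[OF x]]
  have Sd: "dd (0, v) (\<lambda>q. Sv (fst q) (snd q)) q = Sv (fst q) v" unfolding Sv_Lin by (rule dd_vert_Lin[OF x sm_Sc])
  have "dd (0, v) (\<lambda>q. DF q) q = dd (0, v) qf q *\<^sub>R Sv (fst q) (snd q) + qf q *\<^sub>R Sv (fst q) v
     + dd (0, v) ef q *\<^sub>R snd q + ef q *\<^sub>R v + dd (0, v) ff q *\<^sub>R bv (fst q)"
    unfolding DF_eq using d by (simp only: dd_add dd_scaleR differentiable_scaleR differentiable_add differentiable_snd dd_snd Sd
      dd_comp_fst[OF bv_D[OF x]]) (simp add: dd_dir_zero[OF bv_D[OF x]])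
  then show ?thesis .
qed

lemma DH_DF:
  assumes q: "q \<in> \<Omega>"
  shows "DH a u DF q = dd (hor a u q) qf q *\<^sub>R Sv (fst q) (snd q) + qf q *\<^sub>R TT (fst q) u (snd q)
     + dd (hor a u q) ef q *\<^sub>R snd q + dd (hor a u q) ff q *\<^sub>R bv (fst q) + ff q *\<^sub>R cov a bv (fst q) u"
proof -
  have q0: "q \<in> \<Omega>0" using q \<Omega>_subset by blast
  note x = \<Omega>_D(1)[OF q]
  note d = sm_diff_at[OF sm_q q] sm_diff_at[OF sm_ef q] sm_diff_at[OF sm_ff q] Sv_diff[OF q0] differentiable_comp_fst[OF bv_D[OF x]]
  have Sd: "DH a u (\<lambda>q. Sv (fst q) (snd q)) q = TT (fst q) u (snd q)" unfolding Sv_Lin by (rule DH_Lin[OF x sm_Sc])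
  have "DH a u (\<lambda>q. DF q) q = dd (hor a u q) qf q *\<^sub>R Sv (fst q) (snd q) + qf q *\<^sub>R TT (fst q) u (snd q)
     + dd (hor a u q) ef q *\<^sub>R snd q + dd (hor a u q) ff q *\<^sub>R bv (fst q) + ff q *\<^sub>R cov a bv (fst q) u"
    unfolding DF_eq using d by (simp only: DH_add DH_scaleR differentiable_scaleR differentiable_add differentiable_snd DH_snd Sd
      DH_base[OF bv_D[OF x]]) simp
  then show ?thesis .
qed

end

lemma dd_vert_fiber:
  fixes f :: "'a::real_normed_vector \<times> 'a \<Rightarrow> 'b::real_normed_vector"
  assumes f: "f differentiable (at (x, y))" and f': "((\<lambda>v. f (x, v)) has_derivative f') (at y)"
  shows "dd (0, v) f (x, y) = f' v"
proof -
  have "((\<lambda>v. f (x, v)) has_derivative (\<lambda>h. dd (0, h) f (x, y))) (at y)"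
    using has_derivative_compose[OF has_derivative_Pair[OF has_derivative_const has_derivative_ident] has_derivative_dd[OF f]] .
  then show ?thesis using has_derivative_unique[OF f'] by metis
qed

section \<open>The curvature of F on a vector orthogonal to y and b\<close>

context unit_square
begin

text \<open>Joint differentiability in x and y is read off from the expression of \<open>TT\<close>
  by horizontal derivatives; the value of the fibre derivative then follows from bilinearity at a
  fixed x.\<close>

lemma dd_vert_TT:
  assumes q: "(x, y) \<in> \<Omega>"
  shows "dd (0, v) (\<lambda>q. TT (fst q) (snd q) (snd q)) (x, y) = TT x v y + TT x y v"
    and "(\<lambda>q. TT (fst q) (snd q) (snd q)) differentiable (at (x, y))"
proof -
  have x: "x \<in> U" using \<Omega>_D[OF q] by simp
  interpret B: bounded_bilinear "LD Sc x" by (rule bilinear_LD[OF x sm_Sc])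
  let ?f = "\<lambda>q. dd (hor a (snd q) q) (\<lambda>q. Sv (fst q) (snd q)) q + Gam a (fst q) (snd q) (Sv (fst q) (snd q))"
  have "sm \<Omega>0 ?f"
    unfolding hor_def using \<Omega>0_D
    by (intro sm_add[OF open_\<Omega>0] sm_dd_var[OF open_\<Omega>0] sm_Pair[OF open_\<Omega>0] sm_minus[OF open_\<Omega>0] sm_Gam[OF open_\<Omega>0] sm_snd[OF open_\<Omega>0] sm_Sv)
  from sm_diff_at[OF this subsetD[OF \<Omega>_subset q]] have fD: "?f differentiable (at (x, y))" .
  have eq: "?f q = TT (fst q) (snd q) (snd q)" if "q \<in> \<Omega>" for q
    using DH_Lin[of q Sc "snd q", OF \<Omega>_D(1)[OF that] sm_Sc] by (simp add: DH_def Sv_Lin)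
  show D: "(\<lambda>q. TT (fst q) (snd q) (snd q)) differentiable (at (x, y))"
    by (rule differentiable_cong_open[OF open_\<Omega> q eq fD])
  have "((\<lambda>v. TT x v v) has_derivative (\<lambda>v. TT x y v + TT x v y)) (at y)"
    by (rule B.FDERIV) (rule has_derivative_ident)+
  then show "dd (0, v) (\<lambda>q. TT (fst q) (snd q) (snd q)) (x, y) = TT x v y + TT x y v"
    using dd_vert_fiber[OF D] by (simp add: add.commute)
qed

lemma sm_spr_Gal:
  fixes f :: "(real^'a) \<times> (real^'a) \<Rightarrow> real"
  assumes "sm \<Omega> f" shows "sm \<Omega> (\<lambda>q. dd (hor a (snd q) q) f q)"
  unfolding hor_def using \<Omega>_D
  by (intro sm_dd_var[OF open_\<Omega>] sm_Pair[OF open_\<Omega>] sm_minus[OF open_\<Omega>] sm_Gam[OF open_\<Omega>] sm_snd[OF open_\<Omega>] assms)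

lemma sm_Qab: "sm \<Omega> (\<lambda>q. Qa (\<alpha>\<^sub>f q) (\<beta>\<^sub>f q))" "sm \<Omega> (\<lambda>q. Qb (\<alpha>\<^sub>f q) (\<beta>\<^sub>f q))"
proof -
  have "(\<alpha>\<^sub>f q - \<beta>\<^sub>f q)\<^sup>2 \<noteq> 0" if "q \<in> \<Omega>" for q using \<Omega>_abs[OF that] by simp
  then show "sm \<Omega> (\<lambda>q. Qa (\<alpha>\<^sub>f q) (\<beta>\<^sub>f q))" "sm \<Omega> (\<lambda>q. Qb (\<alpha>\<^sub>f q) (\<beta>\<^sub>f q))"
    unfolding Qa_def Qb_def by (intro sm_divide sm_mult sm_diff sm_power open_\<Omega> sm_al sm_be sm_const; blast)+
qed

text \<open>Pairing with w removes from \<open>RR_add\<close> everything proportional to y or b.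
  \<open>Ew\<close> is the fibre derivative of \<open>Ef\<close> along w and \<open>Z\<close> that
  of \<open>DF\<close>; derivatives of \<open>ef\<close> survive only along the spray of \<alpha>
  and along \<open>DF\<close>.\<close>

lemma RR_ww:
  assumes q: "(x, y) \<in> \<Omega>" and wy: "ip a x w y = 0" and wb: "ip a x w (bv x) = 0" and ww: "ip a x w w = 1"
  defines "g \<equiv> ip a x" and "N \<equiv> cov a bv x" and "S \<equiv> Sv x" and "A \<equiv> alpha a x y" and "B \<equiv> ip a x (bv x) y"
    and "q \<equiv> qf (x, y)" and "E \<equiv> Ef (x, y)" and "m \<equiv> alpha a x y - 2 * ip a x (bv x) y"
    and "\<sigma> \<equiv> ip a x w (Sv x y)"
    and "n1 \<equiv> ip a x (cov a bv x w) y" and "n2 \<equiv> ip a x (cov a bv x y) w"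
  defines "Ew \<equiv> (n1 + n2 - 2 * q * ip a x (bv x) (Sv x w)) / (3 * hh (x, y))"
  defines "Z \<equiv> q *\<^sub>R S w + (m * Ew) *\<^sub>R y + (E * m) *\<^sub>R w + (A\<^sup>2 * Ew) *\<^sub>R bv x"
  shows "g w (RR (\<lambda>q. Gal a q + DF q) w (x, y)) = g w (RR (Gal a) w (x, y))
    + 3 * (Qb A B * n1 * \<sigma> + q * g w (TT x w y) + E * A\<^sup>2 * g (N w) w)
    - (Qb A B * (n1 + n2) * \<sigma> + q * (g w (TT x w y) + g w (TT x y w)) + dd (hor a y (x, y)) ef (x, y)
       + A\<^sup>2 * Ew * n2 + E * A\<^sup>2 * g (N w) w)
    + 2 * (Qa A B / A * (q * \<sigma>) * \<sigma> + m * Ew * (q * \<sigma>) + dd (0, DF (x, y)) ef (x, y))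
    - ((Qa A B / A * g y Z + Qb A B * g (bv x) Z) * \<sigma> + q * g w (S Z) + (E * m)\<^sup>2)"
proof -
  let ?p = "(x, y)"
  have p0: "?p \<in> \<Omega>0" using q \<Omega>_subset by blast
  have x: "x \<in> U" and y: "y \<noteq> 0" and h: "hh ?p > 0" using \<Omega>_D[OF q] by auto
  have x': "fst ?p \<in> U" and y': "snd ?p \<noteq> 0" using x y by auto
  have A: "A > 0" "A - B > 0" using \<Omega>_abs[OF q] unfolding A_def B_def by auto
  have gs: "g u v = g v u" for u v unfolding g_def by (rule ip_sym[OF x])
  have gl: "g (u + v) z = g u z + g v z" "g u (v + z) = g u v + g u z" "g (u - v) z = g u z - g v z" "g u (v - z) = g u v - g u z"
    "g (c *\<^sub>R u) v = c * g u v" "g u (c *\<^sub>R v) = c * g u v" for u v z c unfolding g_def by (simp_all add: ip_lin)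
  have w: "g w y = 0" "g w (bv x) = 0" "g w w = 1" "g (bv x) w = 0" "g y w = 0"
    using wy wb ww gs unfolding g_def by auto
  have Sww: "g w (S w) = 0" using Sv_antisym[OF x, of w w] gs[of w "S w"] unfolding g_def S_def by simp
  \<comment> \<open>As w is orthogonal to y and b, the functions \<alpha> and \<beta>, hence also
    \<open>qf\<close> and \<open>hh\<close>, are stationary in this direction.\<close>
  have al_w: "dd (0, w) \<alpha>\<^sub>f ?p = 0" using dd_vert_alpha[OF x' y', of w] wy by simp
  have be_w: "dd (0, w) \<beta>\<^sub>f ?p = 0" using dd_vert_beta[OF x', of w] w(4) unfolding g_def by simp
  have q_w: "dd (0, w) qf ?p = 0" unfolding dd_qf[OF q] al_w be_w by simp
  have h_w: "dd (0, w) hh ?p = 0" using dd_vert_hh[OF q, of w] w(1,4) unfolding g_def by simp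
  have E_w: "dd (0, w) Ef ?p = Ew"
    unfolding dd_Ef[OF q] q_w h_w dd_vert_rf[OF p0] dd_vert_sf[OF p0] Ew_def n1_def n2_def q_def by simp
  have e_w: "dd (0, w) ef ?p = m * Ew" and f_w: "dd (0, w) ff ?p = A\<^sup>2 * Ew"
    unfolding dd_ef[OF q] dd_ff[OF q] al_w be_w E_w m_def A_def by simp_all
  note d = sm_diff_at[OF sm_al q] sm_diff_at[OF sm_be q] sm_diff_at[OF sm_q q] sm_diff_at[OF sm_ef q] sm_diff_at[OF sm_ff q]
    Sv_diff[OF p0] differentiable_comp_fst[OF bv_D[OF x']] sm_diff_at[OF sm_Qab(1) q] sm_diff_at[OF sm_Qab(2) q]
    rf_sf_diff[OF p0]
  have e: "ef ?p = E * m" and f: "ff ?p = E * A\<^sup>2" unfolding ef_def ff_def E_def m_def A_def by simp_all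
  have Sw: "dd (0, v) (\<lambda>q. Sv (fst q) (snd q)) ?p = S v" for v
    unfolding S_def Sv_Lin using dd_vert_Lin[OF x' sm_Sc, of v] by simp
  have bw: "dd (0, v) (\<lambda>q. bv (fst q)) ?p = 0" for v
    using dd_comp_fst[OF bv_D[OF x'], of "(0, v)"] dd_dir_zero[OF bv_D[OF x]] by simp
  have D: "DF ?p = q *\<^sub>R S y + (E * m) *\<^sub>R y + (E * A\<^sup>2) *\<^sub>R bv x"
    unfolding DF_eq e f q_def S_def by simp
  have wD: "g w (DF ?p) = q * \<sigma>"
    unfolding D gl w \<sigma>_def S_def by (simp add: g_def)
  have Z: "dd (0, w) DF ?p = Z"
    unfolding dd_vert_DF[OF q] q_w e_w f_w e Z_def q_def S_def by simp
  have wZ: "g w Z = E * m" unfolding Z_def gl w Sww by simp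
  have R1: "g w (DH a w DF ?p) = Qb A B * n1 * \<sigma> + q * g w (TT x w y) + E * A\<^sup>2 * g (N w) w"
  proof -
    have "dd (hor a w ?p) qf ?p = Qb A B * n1"
      unfolding dd_qf[OF q] dd_hor_alpha[OF x' y'] dd_hor_beta[OF x'] by (simp add: A_def B_def n1_def)
    then show ?thesis
      unfolding DH_DF[OF q] f using w gs[of w "N w"] by (simp add: ip_lin q_def \<sigma>_def N_def g_def)
  qed
  have R2: "g w (dd (0, w) (\<lambda>q. DH a (snd q) DF q) ?p) = Qb A B * (n1 + n2) * \<sigma> + q * (g w (TT x w y) + g w (TT x y w))
     + dd (hor a y ?p) ef ?p + A\<^sup>2 * Ew * n2 + E * A\<^sup>2 * g (N w) w"
  proof -
    have DH0: "DH a (snd q) DF q = (Qb (\<alpha>\<^sub>f q) (\<beta>\<^sub>f q) * rf q) *\<^sub>R Sv (fst q) (snd q) + qf q *\<^sub>R TT (fst q) (snd q) (snd q)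
       + dd (hor a (snd q) q) ef q *\<^sub>R snd q + dd (hor a (snd q) q) ff q *\<^sub>R bv (fst q) + ff q *\<^sub>R cov a bv (fst q) (snd q)" if "q \<in> \<Omega>" for q
    proof -
      have "dd (hor a (snd q) q) qf q = Qb (\<alpha>\<^sub>f q) (\<beta>\<^sub>f q) * rf q"
        unfolding dd_qf[OF that] dd_hor_alpha[OF \<Omega>_D(1,2)[OF that]] dd_hor_beta[OF \<Omega>_D(1)[OF that]] rf_def by simp
      then show ?thesis unfolding DH_DF[OF that] by simp
    qed
    have Qbw: "dd (0, w) (\<lambda>q. Qb (\<alpha>\<^sub>f q) (\<beta>\<^sub>f q)) ?p = 0"
      unfolding Qb_def using d(1,2) A al_w be_w
      by (simp add: dd_divide dd_mult dd_power2 dd_diff dd_const differentiable_power A_def B_def)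
    have k: "(\<lambda>q. dd (hor a (snd q) q) ef q) differentiable (at ?p)" "(\<lambda>q. dd (hor a (snd q) q) ff q) differentiable (at ?p)"
      by (rule sm_diff_at[OF sm_spr_Gal[OF sm_ef] q] sm_diff_at[OF sm_spr_Gal[OF sm_ff] q])+
    have "dd (0, w) (\<lambda>q. DH a (snd q) DF q) ?p = dd (0, w) (\<lambda>q. (Qb (\<alpha>\<^sub>f q) (\<beta>\<^sub>f q) * rf q) *\<^sub>R Sv (fst q) (snd q) + qf q *\<^sub>R TT (fst q) (snd q) (snd q)
       + dd (hor a (snd q) q) ef q *\<^sub>R snd q + dd (hor a (snd q) q) ff q *\<^sub>R bv (fst q) + ff q *\<^sub>R cov a bv (fst q) (snd q)) ?p"
      by (rule dd_cong[OF open_\<Omega> q DH0])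
    also have "\<dots> = (Qb A B * (n1 + n2)) *\<^sub>R S y + (Qb A B * rf ?p) *\<^sub>R S w + q *\<^sub>R (TT x w y + TT x y w)
      + dd (0, w) (\<lambda>q. dd (hor a (snd q) q) ef q) ?p *\<^sub>R y + dd (hor a y ?p) ef ?p *\<^sub>R w
      + dd (0, w) (\<lambda>q. dd (hor a (snd q) q) ff q) ?p *\<^sub>R bv x + (A\<^sup>2 * Ew) *\<^sub>R N y + (E * A\<^sup>2) *\<^sub>R N w"
      using d k dd_vert_TT(2)[OF q] cov_diff[OF p0]
      apply (simp only: dd_add dd_scaleR dd_mult differentiable_scaleR differentiable_add differentiable_mult differentiable_snd dd_snd
        Sw bw Qbw q_w f_w f dd_vert_TT(1)[OF q] dd_vert_rf[OF p0] dd_vert_cov(1)[OF x' sm_bv])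
      apply (simp add: A_def B_def n1_def n2_def S_def N_def q_def)
      done
    finally show ?thesis
      apply (simp only: gl w Sww)
      using gs[of w "N y"] gs[of w "N w"]
      by (simp add: \<sigma>_def n2_def S_def N_def g_def)
  qed
  have R3: "g w (dd (0, v) (dd (0, w) DF) ?p) = Qa A B / A * g w v * \<sigma> + m * Ew * g w v + dd (0, v) ef ?p" for v
  proof -
    have q_wv: "dd (0, v) (dd (0, w) qf) ?p = Qa A B * (g w v / A)"
    proof -
      have 1: "(\<lambda>q. ip a (fst q) w (snd q)) differentiable (at ?p)" by (rule differentiable_ip[OF x']) simp_all
      have 2: "(\<lambda>q. ip a (fst q) (bv (fst q)) w) differentiable (at ?p)" by (rule differentiable_ip[OF x' d(7)]) simp
      have v1: "dd (0, v) (\<lambda>q. ip a (fst q) w (snd q)) ?p = g w v"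
        using dd_vert_ip[OF x' differentiable_const differentiable_snd, of v w] by (simp add: dd_const dd_snd ip_lin g_def)
      have v2: "dd (0, v) (\<lambda>q. ip a (fst q) (bv (fst q)) w) ?p = 0"
        using dd_vert_ip[OF x' d(7) differentiable_const, of v w] by (simp add: dd_const bw ip_lin)
      have "dd (0, v) (dd (0, w) qf) ?p = dd (0, v) (\<lambda>q. Qa (\<alpha>\<^sub>f q) (\<beta>\<^sub>f q) * (ip a (fst q) w (snd q) / \<alpha>\<^sub>f q) + Qb (\<alpha>\<^sub>f q) (\<beta>\<^sub>f q) * ip a (fst q) (bv (fst q)) w) ?p"
      proof (rule dd_cong[OF open_\<Omega> q])
        show "dd (0, w) qf q = Qa (\<alpha>\<^sub>f q) (\<beta>\<^sub>f q) * (ip a (fst q) w (snd q) / \<alpha>\<^sub>f q) + Qb (\<alpha>\<^sub>f q) (\<beta>\<^sub>f q) * ip a (fst q) (bv (fst q)) w" if "q \<in> \<Omega>" for q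
          unfolding dd_qf[OF that] dd_vert_alpha[OF \<Omega>_D(1,2)[OF that]] dd_vert_beta[OF \<Omega>_D(1)[OF that]] ..
      qed
      also have "\<dots> = Qa A B * (g w v / A)"
        using d 1 2 A w(1,4) by (simp add: dd_add dd_mult dd_divide differentiable_divide v1 v2 A_def B_def g_def power2_eq_square)
      finally show ?thesis .
    qed
    have dw: "dd (0, w) qf differentiable (at ?p)" "dd (0, w) ef differentiable (at ?p)" "dd (0, w) ff differentiable (at ?p)"
      by (rule sm_diff_at[OF sm_dd[OF sm_q] q] sm_diff_at[OF sm_dd[OF sm_ef] q] sm_diff_at[OF sm_dd[OF sm_ff] q])+
    have Svw: "(\<lambda>q. Sv (fst q) w) differentiable (at ?p)" "dd (0, v) (\<lambda>q. Sv (fst q) w) ?p = 0"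
    proof -
      have c: "Sc j differentiable (at (fst ?p))" for j by (rule sm_diff_at[OF sm_Sc x'])
      show "(\<lambda>q. Sv (fst q) w) differentiable (at ?p)"
        unfolding Sv_Lin by (rule dd_Lin(2)[OF bounded_linear_fst c differentiable_const])
      have "Lin (\<lambda>j. dd 0 (Sc j)) x w = 0" using dd_dir_zero[OF sm_diff_at[OF sm_Sc x]] by (simp add: Lin_def)
      moreover have "Lin Sc x 0 = 0" by (simp add: Lin_def)
      ultimately show "dd (0, v) (\<lambda>q. Sv (fst q) w) ?p = 0"
        unfolding Sv_Lin using dd_Lin(1)[where c = Sc and h = "(0, v)", OF bounded_linear_fst c differentiable_const, of w]
        by (simp add: dd_const)
    qed
    have "dd (0, v) (dd (0, w) DF) ?p = dd (0, v) (\<lambda>q. dd (0, w) qf q *\<^sub>R Sv (fst q) (snd q) + qf q *\<^sub>R Sv (fst q) w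
       + dd (0, w) ef q *\<^sub>R snd q + ef q *\<^sub>R w + dd (0, w) ff q *\<^sub>R bv (fst q)) ?p"
      by (rule dd_cong[OF open_\<Omega> q dd_vert_DF])
    also have "\<dots> = (Qa A B * (g w v / A)) *\<^sub>R S y + dd (0, v) qf ?p *\<^sub>R S w
       + dd (0, v) (dd (0, w) ef) ?p *\<^sub>R y + (m * Ew) *\<^sub>R v + dd (0, v) ef ?p *\<^sub>R w + dd (0, v) (dd (0, w) ff) ?p *\<^sub>R bv x"
      using d dw Svw(1)
      by (simp only: dd_add dd_scaleR differentiable_scaleR differentiable_add differentiable_snd differentiable_const dd_snd
        Sw bw q_wv q_w e_w Svw(2) dd_const) (simp add: S_def)
    finally show ?thesis
      apply (simp only: gl w Sww)
      by (simp add: \<sigma>_def S_def g_def)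
  qed
  have R4: "g w (dd (0, Z) DF ?p) = (Qa A B / A * g y Z + Qb A B * g (bv x) Z) * \<sigma> + q * g w (S Z) + (E * m)\<^sup>2"
  proof -
    have "dd (0, Z) qf ?p = Qa A B / A * g y Z + Qb A B * g (bv x) Z"
      unfolding dd_qf[OF q] dd_vert_alpha[OF x' y'] dd_vert_beta[OF x'] using gs[of Z y] by (simp add: A_def B_def g_def)
    then show ?thesis
      unfolding dd_vert_DF[OF q] e gl w wZ fst_conv snd_conv w
      by (simp add: gl w wZ \<sigma>_def S_def q_def power2_eq_square) (simp add: g_def)
  qed
  have "g w (RR (\<lambda>q. Gal a q + DF q) w ?p) = g w (RR (Gal a) w ?p) + 3 * g w (DH a w DF ?p)
    - g w (dd (0, w) (\<lambda>q. DH a (snd q) DF q) ?p) + 2 * g w (dd (0, DF ?p) (dd (0, w) DF) ?p) - g w (dd (0, Z) DF ?p)"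
    using RR_add[OF open_\<Omega> q \<Omega>_D(1) sm_D, of w] unfolding Z by (simp add: gl)
  then show ?thesis unfolding R1 R2 R3 R4 wD by simp
qed

end

section \<open>Curvature near the directions where the metric degenerates\<close>

lemma tendsto_eq_rhs: "(f \<longlongrightarrow> l) F \<Longrightarrow> l = k \<Longrightarrow> (f \<longlongrightarrow> k) F"
  by simp

lemma tendsto_eq_imp:
  fixes f g :: "real \<Rightarrow> real"
  assumes "(f \<longlongrightarrow> l) (at 0)" "(g \<longlongrightarrow> k) (at 0)" "\<And>t. t \<noteq> 0 \<Longrightarrow> f t = g t"
  shows "l = k"
proof -
  have "(g \<longlongrightarrow> l) (at 0)"
    by (rule Lim_transform_eventually[OF assms(1)]) (auto simp: eventually_at_filter assms(3))
  then show ?thesis using assms(2) tendsto_unique[OF at_neq_bot] by blast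
qed

text \<open>\<open>Rexp\<close> is the value of \<open>R\<^sub>i\<^sub>k w\<^sup>i w\<^sup>k\<close> for \<open>F\<close> and \<open>w\<close> orthogonal to \<open>y\<close> and \<open>b\<close>, as a function of the
  invariants that enter. In it, \<open>eDexp\<close> and \<open>e0exp\<close> stand for the derivatives of the function \<open>ef\<close>
  in the fibre direction \<open>DF\<close> and along the spray of \<open>\<alpha>\<close>.\<close>

definition Rexp :: "real \<Rightarrow> real \<Rightarrow> real \<Rightarrow> real \<Rightarrow> real \<Rightarrow> real \<Rightarrow> real \<Rightarrow> real \<Rightarrow> real \<Rightarrow> real \<Rightarrow> real \<Rightarrow> real \<Rightarrow> real \<Rightarrow> real \<Rightarrow> real \<Rightarrow> real \<Rightarrow> real \<Rightarrow> real \<Rightarrow> real" where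
  "Rexp k0 Qa Qb q T1 T2 E A m a3 n1 n2 sy Ew e0 eD Sig B =
    k0 + 3 * (Qb * n1 * sy + q * T1 + E * A\<^sup>2 * a3)
    - (Qb * (n1 + n2) * sy + q * (T1 + T2) + e0 + A\<^sup>2 * Ew * n2 + E * A\<^sup>2 * a3)
    + 2 * (Qa / A * (q * sy) * sy + m * Ew * (q * sy) + eD)
    - ((Qa / A * (- q * sy + (m * A\<^sup>2 + A\<^sup>2 * B) * Ew) + Qb * ((m * B + A\<^sup>2) * Ew)) * sy
       + q * (- q * Sig + m * Ew * sy) + (E * m)\<^sup>2)"

definition eDexp :: "real \<Rightarrow> real \<Rightarrow> real \<Rightarrow> real \<Rightarrow> real \<Rightarrow> real \<Rightarrow> real \<Rightarrow> real \<Rightarrow> real \<Rightarrow> real \<Rightarrow> real \<Rightarrow> real \<Rightarrow> real" where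
  "eDexp A B m E q Qa Qb h sf rfD sfD bD =
    m * ((rfD - 2 * (Qa * (E * A\<^sup>2 * (A - B) / A) + Qb * bD) * sf - 2 * q * sfD) / (3 * h)
        - E * (2 * (E * A\<^sup>2 * (A - B)) - 2 * B * bD) / h)
    + E * (E * A\<^sup>2 * (A - B) / A - 2 * bD)"

definition e0exp :: "real \<Rightarrow> real \<Rightarrow> real \<Rightarrow> real \<Rightarrow> real \<Rightarrow> real \<Rightarrow> real \<Rightarrow> real \<Rightarrow> real \<Rightarrow> real \<Rightarrow> real" where
  "e0exp B m E q Qb h sf rf rf0 sf0 =
    m * ((rf0 - 2 * (Qb * rf) * sf - 2 * q * sf0) / (3 * h) - E * (- 2 * B * rf) / h) + E * (- 2 * rf)"

text \<open>On the curve used below \<alpha> - \<beta> = 2 t^2, so q, Qa and Qb have poles of order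
  2, 4 and 4 in t. The factor t^4 makes all terms without E regular; those with E are kept apart, as
  E may have a pole of its own.\<close>

lemma Rexp_scaled:
  fixes t :: real
  assumes t: "t \<noteq> 0" and A: "A \<noteq> 0"
    and q: "q = A\<^sup>2 / t\<^sup>2" and Qa: "Qa = A * m / (2 * t ^ 4)" and Qb: "Qb = A\<^sup>2 / (2 * t ^ 4)"
    and n: "n1 = 2 * t * a1" "n2 = 2 * t * a2" "sy = 2 * t * \<sigma>" and Ew: "Ew = (a1 + a2) / (6 * t)"
  shows "t ^ 4 * Rexp k0 Qa Qb q T1 T2 E A m a3 n1 n2 sy Ew e0 eD Sig B =
    t ^ 4 * (2 * eD - e0 - (E * m)\<^sup>2) + 2 * t ^ 4 * E * A\<^sup>2 * a3
    + (t ^ 4 * k0 + 6 * t\<^sup>2 * A\<^sup>2 * a1 * \<sigma> + t\<^sup>2 * A\<^sup>2 * (2 * T1 - T2) - 2 * t\<^sup>2 * A\<^sup>2 * (a1 + a2) * \<sigma>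
       - t ^ 4 * A\<^sup>2 * (a1 + a2) * a2 / 3
       + 4 * m * A\<^sup>2 * \<sigma>\<^sup>2 + 2 * t\<^sup>2 * m * A\<^sup>2 * \<sigma> * (a1 + a2) / 3
       - (m * \<sigma> * (- 2 * A\<^sup>2 * \<sigma> + (m * A\<^sup>2 + A\<^sup>2 * B) * (a1 + a2) / 6) + A\<^sup>2 * \<sigma> * ((m * B + A\<^sup>2) * (a1 + a2) / 6))
       - A\<^sup>2 * (- A\<^sup>2 * Sig + t\<^sup>2 * m * \<sigma> * (a1 + a2) / 3))"
proof -
  have pq: "t ^ 4 * (q * z) = t\<^sup>2 * A\<^sup>2 * z" and p: "t ^ 4 * (Qb * (2 * t * c) * (2 * t * \<sigma>)) = 2 * t\<^sup>2 * A\<^sup>2 * c * \<sigma>" for c z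
    unfolding q Qb using t by (simp_all add: field_simps eval_nat_numeral)
  have 1: "t ^ 4 * (A\<^sup>2 * Ew * n2) = t ^ 4 * A\<^sup>2 * (a1 + a2) * a2 / 3"
    unfolding Ew n using t by (simp add: field_simps)
  have 2: "t ^ 4 * (Qa / A * (q * sy) * sy) = 2 * m * A\<^sup>2 * \<sigma>\<^sup>2"
    unfolding Qa q n using t A by (simp add: field_simps eval_nat_numeral)
  have 3: "t ^ 4 * (m * Ew * (q * sy)) = t\<^sup>2 * m * A\<^sup>2 * \<sigma> * (a1 + a2) / 3"
    unfolding Ew q n using t by (simp add: field_simps eval_nat_numeral)
  have 4: "t ^ 4 * (Qa / A * (- q * sy + (m * A\<^sup>2 + A\<^sup>2 * B) * Ew) * sy) = m * \<sigma> * (- 2 * A\<^sup>2 * \<sigma> + (m * A\<^sup>2 + A\<^sup>2 * B) * (a1 + a2) / 6)"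
    unfolding Qa q n Ew using t A by (simp add: field_simps eval_nat_numeral)
  have 5: "t ^ 4 * (Qb * ((m * B + A\<^sup>2) * Ew) * sy) = A\<^sup>2 * \<sigma> * ((m * B + A\<^sup>2) * (a1 + a2) / 6)"
    unfolding Qb n Ew using t by (simp add: field_simps eval_nat_numeral)
  have 6: "t ^ 4 * (q * (- q * Sig + m * Ew * sy)) = A\<^sup>2 * (- A\<^sup>2 * Sig + t\<^sup>2 * m * \<sigma> * (a1 + a2) / 3)"
    unfolding q n Ew using t by (simp add: field_simps eval_nat_numeral)
  have s: "Qb * (n1 + n2) * sy = Qb * (2 * t * (a1 + a2)) * (2 * t * \<sigma>)" "Qb * n1 * sy = Qb * (2 * t * a1) * (2 * t * \<sigma>)"
    unfolding n by (simp_all add: algebra_simps)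
  have "t ^ 4 * Rexp k0 Qa Qb q T1 T2 E A m a3 n1 n2 sy Ew e0 eD Sig B =
    t ^ 4 * k0 + 3 * (t ^ 4 * (Qb * (2 * t * a1) * (2 * t * \<sigma>)) + t ^ 4 * (q * T1) + t ^ 4 * (E * A\<^sup>2 * a3))
    - (t ^ 4 * (Qb * (2 * t * (a1 + a2)) * (2 * t * \<sigma>)) + t ^ 4 * (q * (T1 + T2)) + t ^ 4 * e0 + t ^ 4 * (A\<^sup>2 * Ew * n2) + t ^ 4 * (E * A\<^sup>2 * a3))
    + 2 * (t ^ 4 * (Qa / A * (q * sy) * sy) + t ^ 4 * (m * Ew * (q * sy)) + t ^ 4 * eD)
    - (t ^ 4 * (Qa / A * (- q * sy + (m * A\<^sup>2 + A\<^sup>2 * B) * Ew) * sy) + t ^ 4 * (Qb * ((m * B + A\<^sup>2) * Ew) * sy)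
       + t ^ 4 * (q * (- q * Sig + m * Ew * sy)) + t ^ 4 * (E * m)\<^sup>2)"
    unfolding Rexp_def s by (simp add: algebra_simps)
  also have "\<dots> = t ^ 4 * (2 * eD - e0 - (E * m)\<^sup>2) + 2 * t ^ 4 * E * A\<^sup>2 * a3
    + (t ^ 4 * k0 + 6 * t\<^sup>2 * A\<^sup>2 * a1 * \<sigma> + t\<^sup>2 * A\<^sup>2 * (2 * T1 - T2) - 2 * t\<^sup>2 * A\<^sup>2 * (a1 + a2) * \<sigma>
       - t ^ 4 * A\<^sup>2 * (a1 + a2) * a2 / 3
       + 4 * m * A\<^sup>2 * \<sigma>\<^sup>2 + 2 * t\<^sup>2 * m * A\<^sup>2 * \<sigma> * (a1 + a2) / 3
       - (m * \<sigma> * (- 2 * A\<^sup>2 * \<sigma> + (m * A\<^sup>2 + A\<^sup>2 * B) * (a1 + a2) / 6) + A\<^sup>2 * \<sigma> * ((m * B + A\<^sup>2) * (a1 + a2) / 6))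
       - A\<^sup>2 * (- A\<^sup>2 * Sig + t\<^sup>2 * m * \<sigma> * (a1 + a2) / 3))"
    unfolding p pq[of T1] pq[of "T1 + T2"] 1 2 3 4 5 6 by (simp add: algebra_simps)
  finally show ?thesis .
qed

text \<open>Along the curve \<open>y = (1 - t\<^sup>2) b + 2 t v\<close>, with \<open>b\<close> and \<open>v\<close> orthonormal, \<open>\<alpha>\<close> and \<open>\<beta>\<close> are polynomials
  in \<open>t\<close> and the metric degenerates at \<open>t = 0\<close>; \<open>s\<close> is the value of \<open>s\<^sub>i\<close> on \<open>v\<close>.\<close>

lemma curve_limit_s:
  fixes s \<rho> a1 a2 a3 \<sigma> Sig K :: real and k0 T1 T2 rf0 sf0 rfD :: "real \<Rightarrow> real"
  defines "A \<equiv> \<lambda>t::real. 1 + t\<^sup>2" and "B \<equiv> \<lambda>t::real. 1 - t\<^sup>2" and "m \<equiv> \<lambda>t::real. 3 * t\<^sup>2 - 1"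
  defines "E' \<equiv> \<lambda>t. (- s * t\<^sup>2 * B t + t ^ 3 * \<rho> - s * (A t)\<^sup>2) / 3"
  defines "bD' \<equiv> \<lambda>t. 2 * s * (A t)\<^sup>2 + E' t * (6 - 2 * t\<^sup>2)"
  assumes R: "\<And>t. t \<noteq> 0 \<Longrightarrow> 16 * K / (A t)\<^sup>2 =
      Rexp (k0 t) (A t * m t / (2 * t ^ 4)) ((A t)\<^sup>2 / (2 * t ^ 4)) ((A t)\<^sup>2 / t\<^sup>2) (T1 t) (T2 t) (E' t / t ^ 3) (A t) (m t) a3
        (2 * t * a1) (2 * t * a2) (2 * t * \<sigma>) ((a1 + a2) / (6 * t))
        (e0exp (B t) (m t) (E' t / t ^ 3) ((A t)\<^sup>2 / t\<^sup>2) ((A t)\<^sup>2 / (2 * t ^ 4)) (4 * t\<^sup>2) (2 * t * s)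
           (- 4 * s * t * B t + 4 * t\<^sup>2 * \<rho>) (rf0 t) (sf0 t))
        (eDexp (A t) (B t) (m t) (E' t / t ^ 3) ((A t)\<^sup>2 / t\<^sup>2) (A t * m t / (2 * t ^ 4)) ((A t)\<^sup>2 / (2 * t ^ 4)) (4 * t\<^sup>2) (2 * t * s)
           (rfD t) (s * (- s * B t * (A t)\<^sup>2 + 2 * m t * E' t) / t\<^sup>2) (bD' t / t))
        Sig (B t)"
    and lim: "(k0 \<longlongrightarrow> k0') (at 0)" "(T1 \<longlongrightarrow> T1') (at 0)" "(T2 \<longlongrightarrow> T2') (at 0)" "(rf0 \<longlongrightarrow> rf0') (at 0)" "(sf0 \<longlongrightarrow> sf0') (at 0)"
      "((\<lambda>t. t\<^sup>2 * rfD t) \<longlongrightarrow> X') (at 0)"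
  shows "s = 0"
proof -
  define r where "r t = - 4 * s * B t + 4 * t * \<rho>" for t
  define Y where "Y t = t\<^sup>2 * rfD t" for t
  define eD' where "eD' t = m t * ((t\<^sup>2 * Y t - 4 * s * (m t * (A t)\<^sup>2 * E' t + (A t)\<^sup>2 / 2 * bD' t) - 2 * (A t)\<^sup>2 * (s * (- s * B t * (A t)\<^sup>2 + 2 * m t * E' t))) / 12
      - E' t * (4 * (A t)\<^sup>2 * E' t - 2 * B t * bD' t) / 4) + t\<^sup>2 * (E' t * (2 * A t * E' t - 2 * bD' t))" for t
  define e0' where "e0' t = m t * ((t\<^sup>2 * rf0 t - 2 * s * (A t)\<^sup>2 * r t - 2 * (A t)\<^sup>2 * sf0 t) / 12 + E' t * (2 * B t * r t) / 4) - 2 * t\<^sup>2 * (E' t * r t)" for t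
  define X where "X t = t ^ 4 * k0 t + 6 * t\<^sup>2 * (A t)\<^sup>2 * a1 * \<sigma> + t\<^sup>2 * (A t)\<^sup>2 * (2 * T1 t - T2 t) - 2 * t\<^sup>2 * (A t)\<^sup>2 * (a1 + a2) * \<sigma>
       - t ^ 4 * (A t)\<^sup>2 * (a1 + a2) * a2 / 3
       + 4 * m t * (A t)\<^sup>2 * \<sigma>\<^sup>2 + 2 * t\<^sup>2 * m t * (A t)\<^sup>2 * \<sigma> * (a1 + a2) / 3
       - (m t * \<sigma> * (- 2 * (A t)\<^sup>2 * \<sigma> + (m t * (A t)\<^sup>2 + (A t)\<^sup>2 * B t) * (a1 + a2) / 6) + (A t)\<^sup>2 * \<sigma> * ((m t * B t + (A t)\<^sup>2) * (a1 + a2) / 6))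
       - (A t)\<^sup>2 * (- (A t)\<^sup>2 * Sig + t\<^sup>2 * m t * \<sigma> * (a1 + a2) / 3)" for t
  have An: "A t \<noteq> 0" for t using add_pos_nonneg[of 1 "t\<^sup>2"] unfolding A_def by simp
  \<comment> \<open>If s is not zero, E = E'/t^3 has a pole of order three, and its square is
    responsible for the order six of the curvature.\<close>
  have eq: "t ^ 6 * (16 * K / (A t)\<^sup>2) = 2 * eD' t - t\<^sup>2 * e0' t - (E' t * m t)\<^sup>2 + 2 * t ^ 3 * E' t * (A t)\<^sup>2 * a3 + t\<^sup>2 * X t"
    if t: "t \<noteq> 0" for t
  proof -
    let ?e0 = "e0exp (B t) (m t) (E' t / t ^ 3) ((A t)\<^sup>2 / t\<^sup>2) ((A t)\<^sup>2 / (2 * t ^ 4)) (4 * t\<^sup>2) (2 * t * s)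
           (- 4 * s * t * B t + 4 * t\<^sup>2 * \<rho>) (rf0 t) (sf0 t)"
    let ?eD = "eDexp (A t) (B t) (m t) (E' t / t ^ 3) ((A t)\<^sup>2 / t\<^sup>2) (A t * m t / (2 * t ^ 4)) ((A t)\<^sup>2 / (2 * t ^ 4)) (4 * t\<^sup>2) (2 * t * s)
           (rfD t) (s * (- s * B t * (A t)\<^sup>2 + 2 * m t * E' t) / t\<^sup>2) (bD' t / t)"
    have AB: "A t - B t = 2 * t\<^sup>2" unfolding A_def B_def by simp
    have t6: "t ^ 6 * z = t\<^sup>2 * (t ^ 4 * z)" for z :: real by (simp add: eval_nat_numeral)
    have rr: "- 4 * s * t * B t + 4 * t\<^sup>2 * \<rho> = t * r t" unfolding r_def by (simp add: algebra_simps power2_eq_square)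
    have eD: "t ^ 6 * ?eD = eD' t"
      unfolding eDexp_def eD'_def Y_def AB using t An[of t] by (simp add: field_simps) (simp add: eval_nat_numeral algebra_simps)
    have e0: "t ^ 4 * ?e0 = e0' t"
      unfolding rr e0exp_def e0'_def using t by (simp add: field_simps) (simp add: eval_nat_numeral algebra_simps)
    have "t ^ 4 * (16 * K / (A t)\<^sup>2) = t ^ 4 * (2 * ?eD - ?e0 - (E' t / t ^ 3 * m t)\<^sup>2) + 2 * t ^ 4 * (E' t / t ^ 3) * (A t)\<^sup>2 * a3 + X t"
      unfolding R[OF t] X_def by (rule Rexp_scaled[OF t An]) simp_all
    then have "t ^ 6 * (16 * K / (A t)\<^sup>2) = t\<^sup>2 * (t ^ 4 * (2 * ?eD - ?e0 - (E' t / t ^ 3 * m t)\<^sup>2) + 2 * t ^ 4 * (E' t / t ^ 3) * (A t)\<^sup>2 * a3 + X t)"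
      unfolding t6 by (rule arg_cong)
    also have "\<dots> = 2 * (t ^ 6 * ?eD) - t\<^sup>2 * (t ^ 4 * ?e0) - (E' t * m t)\<^sup>2 + 2 * t ^ 3 * E' t * (A t)\<^sup>2 * a3 + t\<^sup>2 * X t"
    proof -
      have "t\<^sup>2 * (t ^ 4 * (E' t / t ^ 3 * m t)\<^sup>2) = (E' t * m t)\<^sup>2" "t\<^sup>2 * (2 * t ^ 4 * (E' t / t ^ 3) * (A t)\<^sup>2 * a3) = 2 * t ^ 3 * E' t * (A t)\<^sup>2 * a3"
        using t by (simp_all add: field_simps eval_nat_numeral)
      moreover note t6[of ?eD]
      ultimately show ?thesis by (simp add: algebra_simps)
    qed
    finally show ?thesis unfolding eD e0 .
  qed
  have poly: "(A \<longlongrightarrow> 1) (at 0)" "(B \<longlongrightarrow> 1) (at 0)" "(m \<longlongrightarrow> - 1) (at 0)"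
    unfolding A_def B_def m_def by (auto intro!: tendsto_eq_intros)
  have lE: "(E' \<longlongrightarrow> - s / 3) (at 0)" unfolding E'_def by (auto intro!: tendsto_eq_intros poly)
  have lb: "(bD' \<longlongrightarrow> 0) (at 0)" unfolding bD'_def by (rule tendsto_eq_intros poly lE refl)+ simp
  have lr: "(r \<longlongrightarrow> - 4 * s) (at 0)" unfolding r_def by (auto intro!: tendsto_eq_intros poly)
  have lY: "(Y \<longlongrightarrow> X') (at 0)" using lim(6) unfolding Y_def .
  define le where "le = (- 1) * ((0\<^sup>2 * rf0' - 2 * s * (1)\<^sup>2 * (- 4 * s) - 2 * (1)\<^sup>2 * sf0') / 12 + (- s / 3) * (2 * 1 * (- 4 * s)) / 4) - 2 * 0\<^sup>2 * ((- s / 3) * (- 4 * s))"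
  have le0: "(e0' \<longlongrightarrow> le) (at 0)"
    unfolding e0'_def le_def by (intro tendsto_intros poly lE lr lim) simp_all
  have "(eD' \<longlongrightarrow> (- 1) * ((0\<^sup>2 * X' - 4 * s * ((- 1) * (1)\<^sup>2 * (- s / 3) + (1)\<^sup>2 / 2 * 0) - 2 * (1)\<^sup>2 * (s * (- s * 1 * (1)\<^sup>2 + 2 * (- 1) * (- s / 3)))) / 12
      - (- s / 3) * (4 * (1)\<^sup>2 * (- s / 3) - 2 * 1 * 0) / 4) + 0\<^sup>2 * ((- s / 3) * (2 * 1 * (- s / 3) - 2 * 0))) (at 0)"
    unfolding eD'_def by (intro tendsto_intros poly lE lb lY) simp_all
  then have leD: "(eD' \<longlongrightarrow> s\<^sup>2 / 6) (at 0)"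
    by (rule tendsto_eq_rhs) (simp add: field_simps power2_eq_square)
  have "(X \<longlongrightarrow> 0 ^ 4 * k0' + 6 * 0\<^sup>2 * (1)\<^sup>2 * a1 * \<sigma> + 0\<^sup>2 * (1)\<^sup>2 * (2 * T1' - T2') - 2 * 0\<^sup>2 * (1)\<^sup>2 * (a1 + a2) * \<sigma>
       - 0 ^ 4 * (1)\<^sup>2 * (a1 + a2) * a2 / 3
       + 4 * (- 1) * (1)\<^sup>2 * \<sigma>\<^sup>2 + 2 * 0\<^sup>2 * (- 1) * (1)\<^sup>2 * \<sigma> * (a1 + a2) / 3
       - ((- 1) * \<sigma> * (- 2 * (1)\<^sup>2 * \<sigma> + ((- 1) * (1)\<^sup>2 + (1)\<^sup>2 * 1) * (a1 + a2) / 6) + (1)\<^sup>2 * \<sigma> * (((- 1) * 1 + (1)\<^sup>2) * (a1 + a2) / 6))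
       - (1)\<^sup>2 * (- (1)\<^sup>2 * Sig + 0\<^sup>2 * (- 1) * \<sigma> * (a1 + a2) / 3)) (at 0)"
    unfolding X_def by (intro tendsto_intros poly lim) simp_all
  then have lX: "(X \<longlongrightarrow> - 4 * \<sigma>\<^sup>2 - 2 * \<sigma>\<^sup>2 + Sig) (at 0)"
    by (rule tendsto_eq_rhs) (simp add: field_simps power2_eq_square)
  \<comment> \<open>Only \<open>2 * eD'\<close> and the square of E' survive: they contribute s^2/3
    and - s^2/9. The sum does not vanish unless s does, whereas the left side of \<open>eq\<close>
    tends to zero.\<close>
  have "((\<lambda>t. 2 * eD' t - t\<^sup>2 * e0' t - (E' t * m t)\<^sup>2 + 2 * t ^ 3 * E' t * (A t)\<^sup>2 * a3 + t\<^sup>2 * X t) \<longlongrightarrow>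
      2 * (s\<^sup>2 / 6) - 0\<^sup>2 * le - ((- s / 3) * (- 1))\<^sup>2 + 2 * 0 ^ 3 * (- s / 3) * (1)\<^sup>2 * a3 + 0\<^sup>2 * (- 4 * \<sigma>\<^sup>2 - 2 * \<sigma>\<^sup>2 + Sig)) (at 0)"
    by (intro tendsto_intros poly lE leD le0 lX)
  then have L1: "((\<lambda>t. 2 * eD' t - t\<^sup>2 * e0' t - (E' t * m t)\<^sup>2 + 2 * t ^ 3 * E' t * (A t)\<^sup>2 * a3 + t\<^sup>2 * X t) \<longlongrightarrow> 2 / 9 * s\<^sup>2) (at 0)"
    by (rule tendsto_eq_rhs) (simp add: field_simps power2_eq_square)
  have L2: "((\<lambda>t. t ^ 6 * (16 * K / (A t)\<^sup>2)) \<longlongrightarrow> 0 ^ 6 * (16 * K / 1\<^sup>2)) (at 0)"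
    by (intro tendsto_intros poly) simp
  have "0 ^ 6 * (16 * K / 1\<^sup>2) = 2 / 9 * s\<^sup>2" by (rule tendsto_eq_imp[OF L2 L1 eq])
  then show ?thesis by simp
qed

text \<open>With s_i = 0, E is the constant \<rho>/3, and the pole, now of order four, is due to q
  and its derivatives alone. Its coefficient is |S w|^2 - 6 <w, S v>^2, with \<open>Sig\<close> and
  \<sigma> standing for |S w|^2 and <w, S v>.\<close>

lemma curve_limit_S:
  fixes \<rho> a1 a2 a3 \<sigma> Sig K :: real and k0 T1 T2 rf0 rfD :: "real \<Rightarrow> real"
  defines "A \<equiv> \<lambda>t::real. 1 + t\<^sup>2" and "B \<equiv> \<lambda>t::real. 1 - t\<^sup>2" and "m \<equiv> \<lambda>t::real. 3 * t\<^sup>2 - 1"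
  assumes R: "\<And>t. t \<noteq> 0 \<Longrightarrow> 16 * K / (A t)\<^sup>2 =
      Rexp (k0 t) (A t * m t / (2 * t ^ 4)) ((A t)\<^sup>2 / (2 * t ^ 4)) ((A t)\<^sup>2 / t\<^sup>2) (T1 t) (T2 t) (\<rho> / 3) (A t) (m t) a3
        (2 * t * a1) (2 * t * a2) (2 * t * \<sigma>) ((a1 + a2) / (6 * t))
        (e0exp (B t) (m t) (\<rho> / 3) ((A t)\<^sup>2 / t\<^sup>2) ((A t)\<^sup>2 / (2 * t ^ 4)) (4 * t\<^sup>2) 0 (4 * t\<^sup>2 * \<rho>) (rf0 t) 0)
        (eDexp (A t) (B t) (m t) (\<rho> / 3) ((A t)\<^sup>2 / t\<^sup>2) (A t * m t / (2 * t ^ 4)) ((A t)\<^sup>2 / (2 * t ^ 4)) (4 * t\<^sup>2) 0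
           (rfD t) 0 (\<rho> / 3 * t\<^sup>2 * (6 - 2 * t\<^sup>2)))
        Sig (B t)"
    and lim: "(k0 \<longlongrightarrow> k0') (at 0)" "(T1 \<longlongrightarrow> T1') (at 0)" "(T2 \<longlongrightarrow> T2') (at 0)" "(rf0 \<longlongrightarrow> rf0') (at 0)"
      "((\<lambda>t. t\<^sup>2 * rfD t) \<longlongrightarrow> 0) (at 0)"
  shows "Sig = 6 * \<sigma>\<^sup>2"
proof -
  define e0' where "e0' t = m t * (t\<^sup>2 * rf0 t / 12 + t ^ 4 * (\<rho> / 3) * (2 * B t * \<rho>)) - 8 * t ^ 6 * (\<rho> / 3) * \<rho>" for t
  define Y where "Y t = t\<^sup>2 * rfD t" for t
  define eD' where "eD' t = m t * (Y t / 12 - t ^ 4 * (\<rho> / 3) * (4 * (\<rho> / 3) * (A t)\<^sup>2 - 2 * B t * (\<rho> / 3 * (6 - 2 * t\<^sup>2))) / 4)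
    + t ^ 4 * (\<rho> / 3) * (2 * (\<rho> / 3) * A t * t\<^sup>2 - 2 * (\<rho> / 3 * t\<^sup>2 * (6 - 2 * t\<^sup>2)))" for t
  define X where "X t = t ^ 4 * k0 t + 6 * t\<^sup>2 * (A t)\<^sup>2 * a1 * \<sigma> + t\<^sup>2 * (A t)\<^sup>2 * (2 * T1 t - T2 t) - 2 * t\<^sup>2 * (A t)\<^sup>2 * (a1 + a2) * \<sigma>
       - t ^ 4 * (A t)\<^sup>2 * (a1 + a2) * a2 / 3
       + 4 * m t * (A t)\<^sup>2 * \<sigma>\<^sup>2 + 2 * t\<^sup>2 * m t * (A t)\<^sup>2 * \<sigma> * (a1 + a2) / 3
       - (m t * \<sigma> * (- 2 * (A t)\<^sup>2 * \<sigma> + (m t * (A t)\<^sup>2 + (A t)\<^sup>2 * B t) * (a1 + a2) / 6) + (A t)\<^sup>2 * \<sigma> * ((m t * B t + (A t)\<^sup>2) * (a1 + a2) / 6))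
       - (A t)\<^sup>2 * (- (A t)\<^sup>2 * Sig + t\<^sup>2 * m t * \<sigma> * (a1 + a2) / 3)" for t
  have An: "A t \<noteq> 0" for t using add_pos_nonneg[of 1 "t\<^sup>2"] unfolding A_def by simp
  have eq: "t ^ 4 * (16 * K / (A t)\<^sup>2) = 2 * eD' t - e0' t - t ^ 4 * (\<rho> / 3 * m t)\<^sup>2 + 2 * t ^ 4 * (\<rho> / 3) * (A t)\<^sup>2 * a3 + X t"
    if t: "t \<noteq> 0" for t
  proof -
    let ?e0 = "e0exp (B t) (m t) (\<rho> / 3) ((A t)\<^sup>2 / t\<^sup>2) ((A t)\<^sup>2 / (2 * t ^ 4)) (4 * t\<^sup>2) 0 (4 * t\<^sup>2 * \<rho>) (rf0 t) 0"
    let ?eD = "eDexp (A t) (B t) (m t) (\<rho> / 3) ((A t)\<^sup>2 / t\<^sup>2) (A t * m t / (2 * t ^ 4)) ((A t)\<^sup>2 / (2 * t ^ 4)) (4 * t\<^sup>2) 0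
           (rfD t) 0 (\<rho> / 3 * t\<^sup>2 * (6 - 2 * t\<^sup>2))"
    have AB: "A t - B t = 2 * t\<^sup>2" unfolding A_def B_def by simp
    have eD: "t ^ 4 * ?eD = eD' t"
      unfolding eDexp_def eD'_def Y_def AB using t An[of t] by (simp add: field_simps) (simp add: eval_nat_numeral algebra_simps)
    have e0: "t ^ 4 * ?e0 = e0' t"
      unfolding e0exp_def e0'_def using t by (simp add: field_simps)
    have "t ^ 4 * (16 * K / (A t)\<^sup>2) = t ^ 4 * (2 * ?eD - ?e0 - (\<rho> / 3 * m t)\<^sup>2) + 2 * t ^ 4 * (\<rho> / 3) * (A t)\<^sup>2 * a3 + X t"
      unfolding R[OF t] X_def by (rule Rexp_scaled[OF t An]) simp_all
    also have "\<dots> = 2 * (t ^ 4 * ?eD) - t ^ 4 * ?e0 - t ^ 4 * (\<rho> / 3 * m t)\<^sup>2 + 2 * t ^ 4 * (\<rho> / 3) * (A t)\<^sup>2 * a3 + X t"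
      by (simp add: algebra_simps)
    finally show ?thesis unfolding eD e0 .
  qed
  have poly: "(A \<longlongrightarrow> 1) (at 0)" "(B \<longlongrightarrow> 1) (at 0)" "(m \<longlongrightarrow> - 1) (at 0)"
    unfolding A_def B_def m_def by (auto intro!: tendsto_eq_intros)
  have lY: "(Y \<longlongrightarrow> 0) (at 0)" using lim(5) unfolding Y_def .
  have "(e0' \<longlongrightarrow> (- 1) * (0\<^sup>2 * rf0' / 12 + 0 ^ 4 * (\<rho> / 3) * (2 * 1 * \<rho>)) - 8 * 0 ^ 6 * (\<rho> / 3) * \<rho>) (at 0)"
    unfolding e0'_def by (intro tendsto_intros poly lim) simp_all
  then have le0: "(e0' \<longlongrightarrow> 0) (at 0)" by (rule tendsto_eq_rhs) simp
  have "(eD' \<longlongrightarrow> (- 1) * (0 / 12 - 0 ^ 4 * (\<rho> / 3) * (4 * (\<rho> / 3) * (1)\<^sup>2 - 2 * 1 * (\<rho> / 3 * (6 - 2 * 0\<^sup>2))) / 4)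
    + 0 ^ 4 * (\<rho> / 3) * (2 * (\<rho> / 3) * 1 * 0\<^sup>2 - 2 * (\<rho> / 3 * 0\<^sup>2 * (6 - 2 * 0\<^sup>2)))) (at 0)"
    unfolding eD'_def by (intro tendsto_intros poly lY) simp_all
  then have leD: "(eD' \<longlongrightarrow> 0) (at 0)" by (rule tendsto_eq_rhs) simp
  have "(X \<longlongrightarrow> 0 ^ 4 * k0' + 6 * 0\<^sup>2 * (1)\<^sup>2 * a1 * \<sigma> + 0\<^sup>2 * (1)\<^sup>2 * (2 * T1' - T2') - 2 * 0\<^sup>2 * (1)\<^sup>2 * (a1 + a2) * \<sigma>
       - 0 ^ 4 * (1)\<^sup>2 * (a1 + a2) * a2 / 3
       + 4 * (- 1) * (1)\<^sup>2 * \<sigma>\<^sup>2 + 2 * 0\<^sup>2 * (- 1) * (1)\<^sup>2 * \<sigma> * (a1 + a2) / 3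
       - ((- 1) * \<sigma> * (- 2 * (1)\<^sup>2 * \<sigma> + ((- 1) * (1)\<^sup>2 + (1)\<^sup>2 * 1) * (a1 + a2) / 6) + (1)\<^sup>2 * \<sigma> * (((- 1) * 1 + (1)\<^sup>2) * (a1 + a2) / 6))
       - (1)\<^sup>2 * (- (1)\<^sup>2 * Sig + 0\<^sup>2 * (- 1) * \<sigma> * (a1 + a2) / 3)) (at 0)"
    unfolding X_def by (intro tendsto_intros poly lim) simp_all
  then have lX: "(X \<longlongrightarrow> - 4 * \<sigma>\<^sup>2 - 2 * \<sigma>\<^sup>2 + Sig) (at 0)"
    by (rule tendsto_eq_rhs) (simp add: field_simps power2_eq_square)
  have "((\<lambda>t. 2 * eD' t - e0' t - t ^ 4 * (\<rho> / 3 * m t)\<^sup>2 + 2 * t ^ 4 * (\<rho> / 3) * (A t)\<^sup>2 * a3 + X t) \<longlongrightarrow>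
      2 * 0 - 0 - 0 ^ 4 * (\<rho> / 3 * (- 1))\<^sup>2 + 2 * 0 ^ 4 * (\<rho> / 3) * (1)\<^sup>2 * a3 + (- 4 * \<sigma>\<^sup>2 - 2 * \<sigma>\<^sup>2 + Sig)) (at 0)"
    by (intro tendsto_intros poly leD le0 lX) simp_all
  then have L1: "((\<lambda>t. 2 * eD' t - e0' t - t ^ 4 * (\<rho> / 3 * m t)\<^sup>2 + 2 * t ^ 4 * (\<rho> / 3) * (A t)\<^sup>2 * a3 + X t) \<longlongrightarrow> - 4 * \<sigma>\<^sup>2 - 2 * \<sigma>\<^sup>2 + Sig) (at 0)"
    by (rule tendsto_eq_rhs) simp
  have L2: "((\<lambda>t. t ^ 4 * (16 * K / (A t)\<^sup>2)) \<longlongrightarrow> 0 ^ 4 * (16 * K / 1\<^sup>2)) (at 0)"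
    by (intro tendsto_intros poly) simp
  have "0 ^ 4 * (16 * K / 1\<^sup>2) = - 4 * \<sigma>\<^sup>2 - 2 * \<sigma>\<^sup>2 + Sig" by (rule tendsto_eq_imp[OF L2 L1 eq])
  then show ?thesis by simp
qed

context chart_metric
begin

text \<open>The Euclidean complement of the images of u and v under the matrix of the metric is
  nonzero in dimension at least three.\<close>

lemma exists_unit_orthogonal:
  assumes x: "x \<in> U" and n: "CARD('n) \<ge> 3"
  obtains w where "ip a x w w = 1" "ip a x w u = 0" "ip a x w v = 0"
proof -
  let ?S = "{a x *v u, a x *v v}"
  have "dim ?S \<le> card ?S" by (rule dim_le_card') simp
  also have "\<dots> \<le> 2" by (simp add: card_insert_if)
  finally have "dim ?S < DIM(real^'n)" using n by simp
  then obtain z where z: "z \<noteq> 0" "\<And>y. y \<in> span ?S \<Longrightarrow> orthogonal z y"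
    using orthogonal_to_subspace_exists[of ?S] by metis
  have "a x *v u \<in> span ?S" "a x *v v \<in> span ?S" by (simp_all add: span_base)
  then have o: "ip a x z u = 0" "ip a x z v = 0" using z(2) unfolding ip_matrix orthogonal_def by blast+
  define c where "c = sqrt (ip a x z z)"
  have c: "c > 0" "c * c = ip a x z z" using ip_pos[OF x z(1)] unfolding c_def by simp_all
  have "ip a x (z /\<^sub>R c) (z /\<^sub>R c) = inverse c * (inverse c * (c * c))" by (simp add: ip_lin c(2))
  then have "ip a x (z /\<^sub>R c) (z /\<^sub>R c) = 1" using c(1) by (simp add: field_simps)
  then show ?thesis using that[of "z /\<^sub>R c"] o by (simp add: ip_lin)
qed

end

section \<open>The curvature along a curve that ends at the degenerate direction\<close>

context unit_square
begin

text \<open>The flag curvature condition in one chart, contracted with w; F dF(w) is written as half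
  the fibre derivative of F^2, which is known to be smooth.\<close>

definition cfc :: "real \<Rightarrow> bool" where
  "cfc K \<longleftrightarrow> (\<forall>x y w. (x, y) \<in> \<Omega> \<longrightarrow> RR (\<lambda>q. Gal a q + DF q) w (x, y) =
     K *\<^sub>R ((F x y)\<^sup>2 *\<^sub>R w - (1/2 * dd (0, w) (Lag F) (x, y)) *\<^sub>R y))"

lemma cfc_ww:
  assumes "cfc K" and q: "(x, y) \<in> \<Omega>" and w: "ip a x w y = 0" "ip a x w (bv x) = 0" "ip a x w w = 1"
  shows "ip a x w (RR (\<lambda>q. Gal a q + DF q) w (x, y)) = K * (F x y)\<^sup>2"
proof -
  have x: "x \<in> U" using \<Omega>_D[OF q] by simp
  have "RR (\<lambda>q. Gal a q + DF q) w (x, y) = K *\<^sub>R ((F x y)\<^sup>2 *\<^sub>R w - (1/2 * dd (0, w) (Lag F) (x, y)) *\<^sub>R y)"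
    using assms(1) q unfolding cfc_def by blast
  then show ?thesis using w by (simp add: ip_lin)
qed

lemma bounded_linear_cov_bv: "x \<in> U \<Longrightarrow> bounded_linear (cov a bv x)"
proof -
  assume x: "x \<in> U"
  have "cov a bv x = Lin Nc x" by (rule ext) (rule cov_Lin[OF x])
  then show ?thesis by (simp add: bounded_linear_Lin)
qed

lemma bounded_linear_Sv: "bounded_linear (Sv x)"
  using bounded_linear_Lin[of Sc x] by (simp add: Sv_Lin[abs_def])

lemma dd_hor_ef:
  assumes q: "(x, y) \<in> \<Omega>"
  shows "dd (hor a y (x, y)) ef (x, y) = e0exp (ip a x (bv x) y) (alpha a x y - 2 * ip a x (bv x) y) (Ef (x, y)) (qf (x, y))
    (Qb (alpha a x y) (ip a x (bv x) y)) (hh (x, y)) (sf (x, y)) (rf (x, y)) (ip a x (HH x y y) y)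
    (ip a x (cov a bv x y) (Sv x y) + ip a x (bv x) (TT x y y))"
proof -
  have q0: "(x, y) \<in> \<Omega>0" using q \<Omega>_subset by blast
  have x': "fst (x, y) \<in> U" "snd (x, y) \<noteq> 0" using \<Omega>_D[OF q] by auto
  show ?thesis
    unfolding dd_ef[OF q] dd_Ef[OF q] dd_qf[OF q] dd_hor_alpha[OF x'] dd_hor_beta[OF x'(1)] dd_hor_rf[OF q0] dd_hor_sf[OF q0]
      dd_hor_hh[OF q] e0exp_def
    by (simp add: rf_def)
qed

lemma dd_vert_ef_D:
  assumes q: "(x, y) \<in> \<Omega>"
  shows "dd (0, DF (x, y)) ef (x, y) = eDexp (alpha a x y) (ip a x (bv x) y) (alpha a x y - 2 * ip a x (bv x) y) (Ef (x, y)) (qf (x, y))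
    (Qa (alpha a x y) (ip a x (bv x) y)) (Qb (alpha a x y) (ip a x (bv x) y)) (hh (x, y)) (sf (x, y))
    (ip a x (cov a bv x (DF (x, y))) y + ip a x (cov a bv x y) (DF (x, y))) (ip a x (bv x) (Sv x (DF (x, y)))) (ip a x (bv x) (DF (x, y)))"
proof -
  have q0: "(x, y) \<in> \<Omega>0" using q \<Omega>_subset by blast
  have x: "x \<in> U" and x': "fst (x, y) \<in> U" "snd (x, y) \<noteq> 0" using \<Omega>_D[OF q] by auto
  have "ip a x (Sv x y) y = 0" using ip_Sv[OF x, of y y] by simp
  then have Dy: "ip a x (DF (x, y)) y = Ef (x, y) * (alpha a x y)\<^sup>2 * (alpha a x y - ip a x (bv x) y)"
    unfolding DF_def by (simp add: ip_lin alpha_sq[OF x, symmetric]) (simp add: algebra_simps)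
  show ?thesis
    unfolding dd_ef[OF q] dd_Ef[OF q] dd_qf[OF q] dd_vert_alpha[OF x'] dd_vert_beta[OF x'(1)] dd_vert_rf[OF q0] dd_vert_sf[OF q0]
      dd_vert_hh[OF q] eDexp_def fst_conv snd_conv Dy ..
qed

text \<open>Because (1 - t^2)^2 + (2 t)^2 = (1 + t^2)^2, this is the rational parametrisation of the
  unit circle through b and v, cleared of its denominator.\<close>

definition ycurve :: "real^'a \<Rightarrow> real^'a \<Rightarrow> real \<Rightarrow> real^'a" where
  "ycurve b v t = (1 - t\<^sup>2) *\<^sub>R b + (2 * t) *\<^sub>R v"

text \<open>Specialises \<open>RR_ww\<close> to the curve. As b has constant length, its covariant
  derivative along itself is -2 s^i, so \<open>Nb\<close> says that s^i = s v. The second conclusion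
  is needed because \<open>DF\<close> itself diverges at t = 0.\<close>

lemma curve_R:
  assumes K: "cfc K" and x: "x \<in> U"
    and v: "ip a x v v = 1" "ip a x v (bv x) = 0" and w: "ip a x w w = 1" "ip a x w (bv x) = 0" "ip a x w v = 0"
    and Nb: "cov a bv x (bv x) = (- 2 * s) *\<^sub>R v" and t: "t \<noteq> 0"
  defines "g \<equiv> ip a x" and "N \<equiv> cov a bv x" and "S \<equiv> Sv x" and "y \<equiv> ycurve (bv x) v t"
    and "A \<equiv> 1 + t\<^sup>2" and "B \<equiv> 1 - t\<^sup>2" and "m \<equiv> 3 * t\<^sup>2 - 1"
  defines "\<rho> \<equiv> g (N v) v" and "\<sigma> \<equiv> g w (S v)" and "a1 \<equiv> g (N w) v" and "a2 \<equiv> g (N v) w"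
  defines "E' \<equiv> (- s * t\<^sup>2 * B + t ^ 3 * \<rho> - s * A\<^sup>2) / 3"
  shows "16 * K / A\<^sup>2 =
      Rexp (g w (RR (Gal a) w (x, y))) (A * m / (2 * t ^ 4)) (A\<^sup>2 / (2 * t ^ 4)) (A\<^sup>2 / t\<^sup>2) (g w (TT x w y)) (g w (TT x y w)) (E' / t ^ 3) A m (g (N w) w)
        (2 * t * a1) (2 * t * a2) (2 * t * \<sigma>) ((a1 + a2) / (6 * t))
        (e0exp B m (E' / t ^ 3) (A\<^sup>2 / t\<^sup>2) (A\<^sup>2 / (2 * t ^ 4)) (4 * t\<^sup>2) (2 * t * s)
           (- 4 * s * t * B + 4 * t\<^sup>2 * \<rho>) (g (HH x y y) y) (g (N y) (S y) + g (bv x) (TT x y y)))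
        (eDexp A B m (E' / t ^ 3) (A\<^sup>2 / t\<^sup>2) (A * m / (2 * t ^ 4)) (A\<^sup>2 / (2 * t ^ 4)) (4 * t\<^sup>2) (2 * t * s)
           (g (N (DF (x, y))) y + g (N y) (DF (x, y))) (s * (- s * B * A\<^sup>2 + 2 * m * E') / t\<^sup>2) ((2 * s * A\<^sup>2 + E' * (6 - 2 * t\<^sup>2)) / t))
        (g (S w) (S w)) B"
    and "t\<^sup>2 *\<^sub>R DF (x, y) = A\<^sup>2 *\<^sub>R S y + E' *\<^sub>R ((6 * t - 2 * t ^ 3) *\<^sub>R bv x + (2 * m) *\<^sub>R v)"
    and "(x, y) \<in> \<Omega>"
proof -
  let ?b = "bv x"
  have gs: "g u v = g v u" for u v unfolding g_def by (rule ip_sym[OF x])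
  have gl: "g (u + v) z = g u z + g v z" "g u (v + z) = g u v + g u z" "g (u - v) z = g u z - g v z" "g u (v - z) = g u v - g u z"
    "g (c *\<^sub>R u) v = c * g u v" "g u (c *\<^sub>R v) = c * g u v" for u v z c unfolding g_def by (simp_all add: ip_lin)
  have bb: "g ?b ?b = 1" unfolding g_def by (rule unit_bv[OF x])
  have vw: "g v v = 1" "g v ?b = 0" "g ?b v = 0" "g w w = 1" "g w ?b = 0" "g ?b w = 0" "g w v = 0" "g v w = 0"
    using v w gs unfolding g_def by auto
  have NB: "g (N u) ?b = 0" "g ?b (N u) = 0" for u using ip_cov_bv[OF x] gs unfolding N_def g_def by auto
  have Nl: "N (u + v) = N u + N v" "N (c *\<^sub>R u) = c *\<^sub>R N u" for u v c unfolding N_def by (simp_all add: cov_bv_lin[OF x])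
  have Sl: "S (u + v) = S u + S v" "S (c *\<^sub>R u) = c *\<^sub>R S u" for u v c unfolding S_def by (simp_all add: Sv_lin)
  have Nb': "N ?b = (- 2 * s) *\<^sub>R v" unfolding N_def by (rule Nb)
  have gS: "g (S u) z = 1/2 * (g (N u) z - g (N z) u)" for u z unfolding g_def S_def N_def by (rule ip_Sv[OF x])
  have gSa: "g (S u) z = - g u (S z)" for u z unfolding g_def S_def by (rule Sv_antisym[OF x])
  have y: "y = B *\<^sub>R ?b + (2 * t) *\<^sub>R v" unfolding y_def ycurve_def B_def ..
  have "g y y = B\<^sup>2 + 4 * t\<^sup>2" unfolding y gl vw bb by (simp add: power2_eq_square)
  also have "\<dots> = A\<^sup>2" unfolding A_def B_def by (simp add: power2_eq_square algebra_simps)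
  finally have yy: "g y y = A\<^sup>2" .
  have A: "A > 0" unfolding A_def by (simp add: add_pos_nonneg)
  have al: "alpha a x y = A" unfolding alpha_eq_ip g_def[symmetric] yy using A by simp
  have be: "g ?b y = B" unfolding y gl vw bb by simp
  have AB: "A - B = 2 * t\<^sup>2" "A + B = 2" "A - 2 * B = m" "m * B + A\<^sup>2 = t\<^sup>2 * (6 - 2 * t\<^sup>2)"
    unfolding A_def B_def m_def by (simp_all add: power2_eq_square algebra_simps)
  have "hh (x, y) = A\<^sup>2 - B\<^sup>2" using yy be unfolding hh_def g_def by simp
  then have h: "hh (x, y) = 4 * t\<^sup>2"
    unfolding A_def B_def by (simp add: power2_eq_square algebra_simps)
  show q: "(x, y) \<in> \<Omega>" unfolding \<Omega>_def using x t h by simp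
  have wy: "g w y = 0" unfolding y gl vw by simp
  have qf: "qf (x, y) = A\<^sup>2 / t\<^sup>2" using be unfolding qf_def g_def fst_conv snd_conv al by (simp add: AB)
  have Qa: "Qa A B = A * m / (2 * t ^ 4)" unfolding Qa_def AB by (simp add: power2_eq_square eval_nat_numeral)
  have Qb: "Qb A B = A\<^sup>2 / (2 * t ^ 4)" unfolding Qb_def AB by (simp add: power2_eq_square eval_nat_numeral)
  have sf: "sf (x, y) = 2 * t * s"
  proof -
    have "sf (x, y) = g (S y) ?b" unfolding sf_def using gs by (simp add: g_def S_def)
    also have "\<dots> = s * g v y" unfolding gS NB Nb' gl by simp
    also have "g v y = 2 * t" unfolding y gl vw by simp
    finally show ?thesis by simp
  qed
  have vy: "g v y = 2 * t" unfolding y gl vw by simp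
  have Ny: "N y = (- 2 * s * B) *\<^sub>R v + (2 * t) *\<^sub>R N v" unfolding y Nl Nb' by simp
  have rf: "rf (x, y) = - 4 * s * t * B + 4 * t\<^sup>2 * \<rho>"
  proof -
    have "rf (x, y) = g (N y) y" unfolding rf_def g_def N_def by simp
    also have "\<dots> = - 2 * s * B * g v y + 2 * t * g (N v) y" unfolding Ny gl ..
    also have "g (N v) y = 2 * t * \<rho>" unfolding y gl NB \<rho>_def by simp
    finally show ?thesis unfolding vy by (simp add: power2_eq_square)
  qed
  have E: "Ef (x, y) = E' / t ^ 3"
    unfolding Ef_def rf qf sf h E'_def using t by (simp add: field_simps eval_nat_numeral)
  have Sb: "g w (S ?b) = 0" "g v (S ?b) = - s" "g ?b (S w) = 0"
    using gS[of ?b w] gS[of ?b v] gS[of w ?b] gs[of w "S ?b"] gs[of v "S ?b"] gs[of ?b "S w"]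
    unfolding Nb' gl NB vw by simp_all
  have sy: "g w (S y) = 2 * t * \<sigma>" unfolding y Sl gl Sb \<sigma>_def by simp
  have n1: "g (N w) y = 2 * t * a1" unfolding y gl NB a1_def by simp
  have n2: "g (N y) w = 2 * t * a2" unfolding Ny gl vw a2_def by simp
  have sw: "ip a x (bv x) (Sv x w) = 0" using Sb(3) unfolding g_def S_def .
  define Ew where "Ew = (a1 + a2) / (6 * t)"
  have Ew: "(2 * t * a1 + 2 * t * a2 - 2 * (A\<^sup>2 / t\<^sup>2) * 0) / (3 * (4 * t\<^sup>2)) = Ew"
    unfolding Ew_def using t by (simp add: field_simps power2_eq_square)
  have Sww: "g w (S w) = 0" using gSa[of w w] gs[of w "S w"] by simp
  let ?q = "A\<^sup>2 / t\<^sup>2" and ?E = "E' / t ^ 3"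
  define Z where "Z = ?q *\<^sub>R S w + (m * Ew) *\<^sub>R y + (?E * m) *\<^sub>R w + (A\<^sup>2 * Ew) *\<^sub>R ?b"
  have yZ: "g y Z = - ?q * (2 * t * \<sigma>) + (m * A\<^sup>2 + A\<^sup>2 * B) * Ew"
  proof -
    have "g y (S w) = - (2 * t * \<sigma>)" using gSa[of y w] gs[of w "S y"] sy by simp
    moreover have "g y w = 0" "g y ?b = B" using wy be gs by auto
    ultimately show ?thesis unfolding Z_def gl yy by (simp add: algebra_simps)
  qed
  have bZ: "g ?b Z = (m * B + A\<^sup>2) * Ew" unfolding Z_def gl Sb vw be bb by (simp add: algebra_simps)
  have SZ: "g w (S Z) = - ?q * g (S w) (S w) + m * Ew * (2 * t * \<sigma>)"
  proof -
    have "g w (S (S w)) = - g (S w) (S w)" using gSa[of w "S w"] by simp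
    then show ?thesis unfolding Z_def Sl gl Sb Sww sy by simp
  qed
  \<comment> \<open>Along the curve \<alpha> + \<beta> = 2, hence F = 4 / \<alpha>.\<close>
  have FF: "(F x y)\<^sup>2 = 16 / A\<^sup>2"
    using be AB(2) unfolding F_eq[OF x] al g_def by (simp add: power_divide)
  let ?D = "DF (x, y)"
  have D: "?D = ?q *\<^sub>R S y + (?E * m) *\<^sub>R y + (?E * A\<^sup>2) *\<^sub>R ?b"
    using be unfolding DF_def fst_conv snd_conv al qf E g_def S_def by (simp add: AB)
  have bD: "g ?b ?D = (2 * s * A\<^sup>2 + E' * (6 - 2 * t\<^sup>2)) / t"
  proof -
    have eq: "g ?b ?D = ?q * sf (x, y) + ?E * (m * B + A\<^sup>2)"
      unfolding D gl be bb using sf_def[of "(x, y)"] by (simp add: g_def S_def algebra_simps)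
    show ?thesis unfolding eq sf AB using t by (simp add: field_simps eval_nat_numeral)
  qed
  have SD: "g ?b (S ?D) = s * (- s * B * A\<^sup>2 + 2 * m * E') / t\<^sup>2"
  proof -
    have "g ?b (S ?D) = g (S ?D) ?b" by (rule gs)
    also have "\<dots> = s * g v ?D" unfolding gS NB Nb' gl by simp
    also have "g v ?D = ?q * g v (S y) + ?E * m * (2 * t)" unfolding D gl vy vw by simp
    also have "g v (S y) = - s * B"
    proof -
      have "g v (S v) = 0" using gSa[of v v] gs[of v "S v"] by simp
      then show ?thesis unfolding y Sl gl Sb by simp
    qed
    finally show ?thesis using t by (simp add: field_simps eval_nat_numeral)
  qed
  have e0: "dd (hor a y (x, y)) ef (x, y) = e0exp B m ?E ?q (A\<^sup>2 / (2 * t ^ 4)) (4 * t\<^sup>2) (2 * t * s)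
           (- 4 * s * t * B + 4 * t\<^sup>2 * \<rho>) (g (HH x y y) y) (g (N y) (S y) + g ?b (TT x y y))"
    unfolding dd_hor_ef[OF q] al be[unfolded g_def] AB(3) E qf Qb h sf rf by (simp add: g_def N_def S_def)
  have eD: "dd (0, ?D) ef (x, y) = eDexp A B m ?E ?q (A * m / (2 * t ^ 4)) (A\<^sup>2 / (2 * t ^ 4)) (4 * t\<^sup>2) (2 * t * s)
           (g (N ?D) y + g (N y) ?D) (s * (- s * B * A\<^sup>2 + 2 * m * E') / t\<^sup>2) ((2 * s * A\<^sup>2 + E' * (6 - 2 * t\<^sup>2)) / t)"
    unfolding dd_vert_ef_D[OF q] al be[unfolded g_def] AB(3) E qf Qa Qb h sf SD[unfolded g_def S_def] bD[unfolded g_def]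
    by (simp add: g_def N_def)
  have "K * (F x y)\<^sup>2 = g w (RR (\<lambda>q. Gal a q + DF q) w (x, y))"
    using cfc_ww[OF K q] wy vw unfolding g_def by simp
  also have "\<dots> = Rexp (g w (RR (Gal a) w (x, y))) (A * m / (2 * t ^ 4)) (A\<^sup>2 / (2 * t ^ 4)) ?q (g w (TT x w y)) (g w (TT x y w)) ?E A m (g (N w) w)
        (2 * t * a1) (2 * t * a2) (2 * t * \<sigma>) Ew (dd (hor a y (x, y)) ef (x, y)) (dd (0, ?D) ef (x, y)) (g (S w) (S w)) B"
  proof -
    note R = RR_ww[OF q wy[unfolded g_def] w(2) w(1)]
    show ?thesis
      unfolding g_def R Rexp_def
      unfolding al be[unfolded g_def] AB(3) E qf Qa Qb h n1[unfolded g_def N_def] n2[unfolded g_def N_def] sy[unfolded g_def S_def] sw Ew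
        Z_def[symmetric, unfolded S_def] yZ[unfolded g_def] bZ[unfolded g_def] SZ[unfolded g_def S_def]
      unfolding S_def N_def by simp
  qed
  finally show "16 * K / A\<^sup>2 =
      Rexp (g w (RR (Gal a) w (x, y))) (A * m / (2 * t ^ 4)) (A\<^sup>2 / (2 * t ^ 4)) (A\<^sup>2 / t\<^sup>2) (g w (TT x w y)) (g w (TT x y w)) (E' / t ^ 3) A m (g (N w) w)
        (2 * t * a1) (2 * t * a2) (2 * t * \<sigma>) ((a1 + a2) / (6 * t))
        (e0exp B m (E' / t ^ 3) (A\<^sup>2 / t\<^sup>2) (A\<^sup>2 / (2 * t ^ 4)) (4 * t\<^sup>2) (2 * t * s)
           (- 4 * s * t * B + 4 * t\<^sup>2 * \<rho>) (g (HH x y y) y) (g (N y) (S y) + g (bv x) (TT x y y)))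
        (eDexp A B m (E' / t ^ 3) (A\<^sup>2 / t\<^sup>2) (A * m / (2 * t ^ 4)) (A\<^sup>2 / (2 * t ^ 4)) (4 * t\<^sup>2) (2 * t * s)
           (g (N (DF (x, y))) y + g (N y) (DF (x, y))) (s * (- s * B * A\<^sup>2 + 2 * m * E') / t\<^sup>2) ((2 * s * A\<^sup>2 + E' * (6 - 2 * t\<^sup>2)) / t))
        (g (S w) (S w)) B"
    unfolding e0 eD FF Ew_def by (simp add: mult.commute)
  have "t\<^sup>2 *\<^sub>R ?D = A\<^sup>2 *\<^sub>R S y + (E' / t) *\<^sub>R (m *\<^sub>R y + A\<^sup>2 *\<^sub>R ?b)"
    unfolding D using t by (simp add: scaleR_add_right power2_eq_square power3_eq_cube)
  also have "m *\<^sub>R y + A\<^sup>2 *\<^sub>R ?b = t *\<^sub>R ((6 * t - 2 * t ^ 3) *\<^sub>R ?b + (2 * m) *\<^sub>R v)"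
  proof -
    have "m *\<^sub>R y + A\<^sup>2 *\<^sub>R ?b = (m * B + A\<^sup>2) *\<^sub>R ?b + (m * (2 * t)) *\<^sub>R v" unfolding y by (simp add: algebra_simps)
    also have "(m * B + A\<^sup>2) *\<^sub>R ?b + (m * (2 * t)) *\<^sub>R v = t *\<^sub>R ((6 * t - 2 * t ^ 3) *\<^sub>R ?b + (2 * m) *\<^sub>R v)"
      unfolding AB by (simp add: scaleR_add_right power2_eq_square power3_eq_cube algebra_simps)
    finally show ?thesis .
  qed
  finally show "t\<^sup>2 *\<^sub>R ?D = A\<^sup>2 *\<^sub>R S y + E' *\<^sub>R ((6 * t - 2 * t ^ 3) *\<^sub>R bv x + (2 * m) *\<^sub>R v)"
    using t by simp
qed

end

section \<open>Vanishing of \<open>s_i\<close> and of \<open>s_ij\<close>\<close>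

context unit_square
begin

lemma ycurve_tendsto: "(ycurve b v \<longlongrightarrow> b) (at 0)"
proof -
  have "((\<lambda>t. (1 - t\<^sup>2) *\<^sub>R b + (2 * t) *\<^sub>R v) \<longlongrightarrow> (1 - 0\<^sup>2) *\<^sub>R b + (2 * 0) *\<^sub>R v) (at (0::real))"
    by (intro tendsto_intros)
  then show ?thesis by (simp add: ycurve_def[abs_def])
qed

text \<open>The data of \<alpha> and \<beta> are continuous in y, also at b, so the only singular
  quantities on the curve are the explicit powers of t.\<close>

lemma curve_tendsto:
  assumes x: "x \<in> U" and y: "(y \<longlongrightarrow> b) (at (0::real))"
  shows "((\<lambda>t. ip a x w (RR (Gal a) w (x, y t))) \<longlongrightarrow> ip a x w (RR (Gal a) w (x, b))) (at 0)"
    and "((\<lambda>t. ip a x w (TT x w (y t))) \<longlongrightarrow> ip a x w (TT x w b)) (at 0)"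
    and "((\<lambda>t. ip a x w (TT x (y t) w)) \<longlongrightarrow> ip a x w (TT x b w)) (at 0)"
    and "((\<lambda>t. ip a x (HH x (y t) (y t)) (y t)) \<longlongrightarrow> ip a x (HH x b b) b) (at 0)"
    and "((\<lambda>t. ip a x (cov a bv x (y t)) (Sv x (y t)) + ip a x (bv x) (TT x (y t) (y t)))
      \<longlongrightarrow> ip a x (cov a bv x b) (Sv x b) + ip a x (bv x) (TT x b b)) (at 0)"
proof -
  note T = bounded_bilinear.tendsto[OF bilinear_LD[OF x sm_Sc]] and H = bounded_bilinear.tendsto[OF bilinear_LD[OF x sm_Nc]]
  note c = tendsto_const
  have "isCont (\<lambda>y. RR (Gal a) w (x, y)) b"
    using continuous_RR_Gal[OF x, of w] by (simp add: continuous_on_eq_continuous_at)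
  from isCont_tendsto_compose[OF this y]
  show "((\<lambda>t. ip a x w (RR (Gal a) w (x, y t))) \<longlongrightarrow> ip a x w (RR (Gal a) w (x, b))) (at 0)"
    by (rule ip.tendsto[OF c])
  show "((\<lambda>t. ip a x w (TT x w (y t))) \<longlongrightarrow> ip a x w (TT x w b)) (at 0)" by (intro ip.tendsto T c y)
  show "((\<lambda>t. ip a x w (TT x (y t) w)) \<longlongrightarrow> ip a x w (TT x b w)) (at 0)" by (intro ip.tendsto T c y)
  show "((\<lambda>t. ip a x (HH x (y t) (y t)) (y t)) \<longlongrightarrow> ip a x (HH x b b) b) (at 0)" by (intro ip.tendsto H y)
  show "((\<lambda>t. ip a x (cov a bv x (y t)) (Sv x (y t)) + ip a x (bv x) (TT x (y t) (y t)))
      \<longlongrightarrow> ip a x (cov a bv x b) (Sv x b) + ip a x (bv x) (TT x b b)) (at 0)"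
    by (intro tendsto_add ip.tendsto T c y bounded_linear.tendsto[OF bounded_linear_cov_bv[OF x]]
      bounded_linear.tendsto[OF bounded_linear_Sv])
qed

text \<open>The fibre derivative of \<open>rf\<close> is linear in its direction, so the convergence
  of t^2 \<open>DF\<close> suffices.\<close>

lemma curve_rfD_tendsto:
  fixes s \<rho> :: real
  assumes x: "x \<in> U" and b: "b = bv x"
    and D: "\<And>t. t \<noteq> 0 \<Longrightarrow> t\<^sup>2 *\<^sub>R DF (x, ycurve b v t) = (1 + t\<^sup>2)\<^sup>2 *\<^sub>R Sv x (ycurve b v t)
      + ((- s * t\<^sup>2 * (1 - t\<^sup>2) + t ^ 3 * \<rho> - s * (1 + t\<^sup>2)\<^sup>2) / 3) *\<^sub>R ((6 * t - 2 * t ^ 3) *\<^sub>R b + (2 * (3 * t\<^sup>2 - 1)) *\<^sub>R v)"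
  shows "((\<lambda>t. t\<^sup>2 * (ip a x (cov a bv x (DF (x, ycurve b v t))) (ycurve b v t) + ip a x (cov a bv x (ycurve b v t)) (DF (x, ycurve b v t))))
    \<longlongrightarrow> ip a x (cov a bv x (Sv x b + (2 * s / 3) *\<^sub>R v)) b + ip a x (cov a bv x b) (Sv x b + (2 * s / 3) *\<^sub>R v)) (at 0)"
proof -
  define W where "W t = (1 + t\<^sup>2)\<^sup>2 *\<^sub>R Sv x (ycurve b v t)
      + ((- s * t\<^sup>2 * (1 - t\<^sup>2) + t ^ 3 * \<rho> - s * (1 + t\<^sup>2)\<^sup>2) / 3) *\<^sub>R ((6 * t - 2 * t ^ 3) *\<^sub>R b + (2 * (3 * t\<^sup>2 - 1)) *\<^sub>R v)" for t
  note y = ycurve_tendsto[of b v]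
  note N = bounded_linear.tendsto[OF bounded_linear_cov_bv[OF x]] and S = bounded_linear.tendsto[OF bounded_linear_Sv]
  have "(W \<longlongrightarrow> (1 + 0\<^sup>2)\<^sup>2 *\<^sub>R Sv x b
      + ((- s * 0\<^sup>2 * (1 - 0\<^sup>2) + 0 ^ 3 * \<rho> - s * (1 + 0\<^sup>2)\<^sup>2) / 3) *\<^sub>R ((6 * 0 - 2 * 0 ^ 3) *\<^sub>R b + (2 * (3 * 0\<^sup>2 - 1)) *\<^sub>R v)) (at 0)"
    unfolding W_def by (intro tendsto_intros S y) simp
  then have W: "(W \<longlongrightarrow> Sv x b + (2 * s / 3) *\<^sub>R v) (at 0)" by (rule tendsto_eq_rhs) simp
  have L: "((\<lambda>t. ip a x (cov a bv x (W t)) (ycurve b v t) + ip a x (cov a bv x (ycurve b v t)) (W t))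
    \<longlongrightarrow> ip a x (cov a bv x (Sv x b + (2 * s / 3) *\<^sub>R v)) b + ip a x (cov a bv x b) (Sv x b + (2 * s / 3) *\<^sub>R v)) (at 0)"
    by (intro tendsto_add ip.tendsto N W y)
  have eq: "ip a x (cov a bv x (W t)) (ycurve b v t) + ip a x (cov a bv x (ycurve b v t)) (W t)
    = t\<^sup>2 * (ip a x (cov a bv x (DF (x, ycurve b v t))) (ycurve b v t) + ip a x (cov a bv x (ycurve b v t)) (DF (x, ycurve b v t)))"
    if "t \<noteq> 0" for t
  proof -
    have "W t = t\<^sup>2 *\<^sub>R DF (x, ycurve b v t)" using D[OF that] unfolding W_def ..
    then show ?thesis by (simp add: cov_bv_lin[OF x] ip_lin distrib_left)
  qed
  show ?thesis
    by (rule Lim_transform_eventually[OF L]) (simp add: eventually_at_filter eq)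
qed

text \<open>If s^i were not zero, the curve could leave b in its direction, and
  \<open>curve_limit_s\<close> would exclude the resulting pole of order six.\<close>

lemma cov_bv_bv_zero:
  assumes K: "cfc K" and n: "CARD('a) \<ge> 3" and x: "x \<in> U"
  shows "cov a bv x (bv x) = 0"
proof (rule ccontr)
  let ?N = "cov a bv x" and ?b = "bv x" and ?g = "ip a x"
  assume nz: "?N ?b \<noteq> 0"
  define s where "s = sqrt (?g (?N ?b) (?N ?b)) / 2"
  have s: "s > 0" using ip_pos[OF x nz] unfolding s_def by simp
  have s2: "?g (?N ?b) (?N ?b) = (2 * s) * (2 * s)" using ip_pos[OF x nz] unfolding s_def by simp
  \<comment> \<open>The unit vector in the direction of s^i; s is the length of s^i because the
    covariant derivative of b along itself is -2 s^i.\<close>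
  define v where "v = (- 1 / (2 * s)) *\<^sub>R ?N ?b"
  have Nb: "?N ?b = (- 2 * s) *\<^sub>R v" unfolding v_def using s by simp
  have v: "?g v v = 1" "?g v ?b = 0"
    unfolding v_def using s s2 ip_cov_bv[OF x, of ?b] by (simp_all add: ip_lin)
  obtain w where w: "?g w w = 1" "?g w ?b = 0" "?g w v = 0"
    using exists_unit_orthogonal[OF x n] by blast
  let ?y = "ycurve ?b v"
  note R = curve_R[OF K x v w Nb]
  note y = ycurve_tendsto[of ?b v]
  have "s = 0"
    by (rule curve_limit_s[where ?k0.0 = "\<lambda>t. ?g w (RR (Gal a) w (x, ?y t))" and ?T1.0 = "\<lambda>t. ?g w (TT x w (?y t))"
      and ?T2.0 = "\<lambda>t. ?g w (TT x (?y t) w)" and ?rf0.0 = "\<lambda>t. ?g (HH x (?y t) (?y t)) (?y t)"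
      and ?sf0.0 = "\<lambda>t. ?g (?N (?y t)) (Sv x (?y t)) + ?g ?b (TT x (?y t) (?y t))"
      and rfD = "\<lambda>t. ?g (?N (DF (x, ?y t))) (?y t) + ?g (?N (?y t)) (DF (x, ?y t))",
      OF R(1) curve_tendsto[OF x y] curve_rfD_tendsto[OF x refl R(2)]])
  then show False using s by simp
qed

lemma sf_zero:
  assumes K: "cfc K" and n: "CARD('a) \<ge> 3" and x: "x \<in> U"
  shows "sf (x, y) = 0"
  using ip_Sv[OF x, of y "bv x"] ip_cov_bv[OF x, of y] cov_bv_bv_zero[OF K n x] ip_sym[OF x, of "bv x" "Sv x y"]
  by (simp add: sf_def ip_lin)

text \<open>For a unit vector w orthogonal to b, the curve is taken in the direction v of S w. By
  skew symmetry <w, S v>^2 = |S w|^2, and \<open>curve_limit_S\<close> becomes c^2 = 6 c^2 with c =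
  |S w|.\<close>

lemma Sv_zero:
  assumes K: "cfc K" and n: "CARD('a) \<ge> 3" and x: "x \<in> U"
  shows "Sv x u = 0"
proof -
  let ?N = "cov a bv x" and ?b = "bv x" and ?g = "ip a x" and ?S = "Sv x"
  have Nb: "?N ?b = 0" by (rule cov_bv_bv_zero[OF K n x])
  have Sb: "?S ?b = 0"
    by (rule ip_eqI[OF x]) (simp add: ip_Sv[OF x] Nb ip_cov_bv[OF x] ip_lin)
  have unit: "?S w = 0" if w: "?g w w = 1" "?g w ?b = 0" for w
  proof (rule ccontr)
    assume nz: "?S w \<noteq> 0"
    define c where "c = sqrt (?g (?S w) (?S w))"
    have c: "c > 0" "c * c = ?g (?S w) (?S w)" using ip_pos[OF x nz] unfolding c_def by simp_all
    define v where "v = (1 / c) *\<^sub>R ?S w"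
    have "?g (?S w) ?b = 0" using Sv_antisym[OF x, of w ?b] by (simp add: Sb ip_lin)
    then have v: "?g v v = 1" "?g v ?b = 0" unfolding v_def using c(1) by (simp_all add: ip_lin c(2)[symmetric])
    have "?g w (?S w) = 0" using Sv_antisym[OF x, of w w] ip_sym[OF x, of w "?S w"] by simp
    then have wv: "?g w v = 0" unfolding v_def by (simp add: ip_lin)
    let ?y = "ycurve ?b v"
    note y = ycurve_tendsto[of ?b v]
    have Nb0: "?N ?b = (- 2 * 0) *\<^sub>R v" using Nb by simp
    note R = curve_R[OF K x v w wv Nb0]
    let ?\<rho> = "?g (?N v) v" and ?\<sigma> = "?g w (?S v)"
    \<comment> \<open>This expression is the derivative of \<open>sf\<close> along the spray of
      \<alpha>, and \<open>sf\<close> vanishes identically.\<close>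
    have sf0: "?g (?N (?y t)) (?S (?y t)) + ?g ?b (TT x (?y t) (?y t)) = 0" if t: "t \<noteq> 0" for t
    proof -
      have q: "(x, ?y t) \<in> \<Omega>" by (rule R(3)[OF t])
      have "dd (hor a (?y t) (x, ?y t)) sf (x, ?y t) = dd (hor a (?y t) (x, ?y t)) (\<lambda>q. 0) (x, ?y t)"
        by (rule dd_cong[OF open_\<Omega> q]) (use \<Omega>_D sf_zero[OF K n] in \<open>metis prod.collapse\<close>)
      then show ?thesis using dd_hor_sf[OF subsetD[OF \<Omega>_subset q], of "?y t"] by (simp add: dd_const)
    qed
    have E: "(- 0 * t\<^sup>2 * (1 - t\<^sup>2) + t ^ 3 * ?\<rho> - 0 * (1 + t\<^sup>2)\<^sup>2) / 3 / t ^ 3 = ?\<rho> / 3" if "t \<noteq> 0" for t :: real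
      using that by simp
    have R': "16 * K / (1 + t\<^sup>2)\<^sup>2 =
      Rexp (?g w (RR (Gal a) w (x, ?y t))) ((1 + t\<^sup>2) * (3 * t\<^sup>2 - 1) / (2 * t ^ 4)) ((1 + t\<^sup>2)\<^sup>2 / (2 * t ^ 4)) ((1 + t\<^sup>2)\<^sup>2 / t\<^sup>2)
        (?g w (TT x w (?y t))) (?g w (TT x (?y t) w)) (?\<rho> / 3) (1 + t\<^sup>2) (3 * t\<^sup>2 - 1) (?g (?N w) w)
        (2 * t * ?g (?N w) v) (2 * t * ?g (?N v) w) (2 * t * ?\<sigma>) ((?g (?N w) v + ?g (?N v) w) / (6 * t))
        (e0exp (1 - t\<^sup>2) (3 * t\<^sup>2 - 1) (?\<rho> / 3) ((1 + t\<^sup>2)\<^sup>2 / t\<^sup>2) ((1 + t\<^sup>2)\<^sup>2 / (2 * t ^ 4)) (4 * t\<^sup>2) 0 (4 * t\<^sup>2 * ?\<rho>)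
          (?g (HH x (?y t) (?y t)) (?y t)) 0)
        (eDexp (1 + t\<^sup>2) (1 - t\<^sup>2) (3 * t\<^sup>2 - 1) (?\<rho> / 3) ((1 + t\<^sup>2)\<^sup>2 / t\<^sup>2) ((1 + t\<^sup>2) * (3 * t\<^sup>2 - 1) / (2 * t ^ 4)) ((1 + t\<^sup>2)\<^sup>2 / (2 * t ^ 4)) (4 * t\<^sup>2) 0
           (?g (?N (DF (x, ?y t))) (?y t) + ?g (?N (?y t)) (DF (x, ?y t))) 0 (?\<rho> / 3 * t\<^sup>2 * (6 - 2 * t\<^sup>2)))
        (?g (?S w) (?S w)) (1 - t\<^sup>2)" if t: "t \<noteq> 0" for t
    proof -
      have z: "(2 * 0 * (1 + t\<^sup>2)\<^sup>2 + (- 0 * t\<^sup>2 * (1 - t\<^sup>2) + t ^ 3 * ?\<rho> - 0 * (1 + t\<^sup>2)\<^sup>2) / 3 * (6 - 2 * t\<^sup>2)) / t = ?\<rho> / 3 * t\<^sup>2 * (6 - 2 * t\<^sup>2)"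
        "2 * t * (0::real) = 0" "- 4 * 0 * t * (1 - t\<^sup>2) + 4 * t\<^sup>2 * ?\<rho> = 4 * t\<^sup>2 * ?\<rho>" "0 * z / t\<^sup>2 = 0" for z
        using t by (simp_all add: field_simps eval_nat_numeral)
      show ?thesis using R(1)[OF t] unfolding sf0[OF t] E[OF t] z .
    qed
    have lim: "((\<lambda>t. t\<^sup>2 * (?g (?N (DF (x, ?y t))) (?y t) + ?g (?N (?y t)) (DF (x, ?y t)))) \<longlongrightarrow> 0) (at 0)"
      by (rule tendsto_eq_rhs[OF curve_rfD_tendsto[OF x refl R(2)]]) (simp_all add: Sb Nb cov_bv_lin[OF x] ip_lin)
    have "?g (?S w) (?S w) = 6 * ?\<sigma>\<^sup>2"
      by (rule curve_limit_S[OF R' curve_tendsto(1-4)[OF x y] lim])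
    moreover have "?\<sigma> = - c"
    proof -
      have "?\<sigma> = - ?g (?S w) v" using Sv_antisym[OF x, of w v] by simp
      also have "?g (?S w) v = (1 / c) * (c * c)" unfolding v_def c(2) by (simp add: ip_lin)
      finally show ?thesis using c(1) by simp
    qed
    ultimately show False using c by (simp add: power2_eq_square)
  qed
  \<comment> \<open>A general vector is split along b, where S vanishes, and its orthogonal
    complement.\<close>
  let ?u = "u - ?g ?b u *\<^sub>R ?b"
  have ub: "?g ?u ?b = 0" using unit_bv[OF x] ip_sym[OF x, of u ?b] by (simp add: ip_lin)
  have "?S ?u = 0"
  proof (cases "?u = 0")
    case False
    define c where "c = sqrt (?g ?u ?u)"
    have c: "c > 0" "c * c = ?g ?u ?u" using ip_pos[OF x False] unfolding c_def by simp_all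
    have "?S ((1 / c) *\<^sub>R ?u) = 0"
      by (rule unit) (use c ub in \<open>simp_all add: ip.scaleR_left ip.scaleR_right c(2)[symmetric]\<close>)
    then show ?thesis using c(1) unfolding Sv_lin(3) by simp
  qed (simp add: Sv_lin)
  then show ?thesis by (simp add: Sv_lin Sb)
qed

end

section \<open>Comparison of opposite directions\<close>

text \<open>A real binary quadratic form whose square is divisible by p^2 + q^2 is itself a multiple
  of p^2 + q^2. Five points (p, q) suffice to see it.\<close>

lemma quartic_divisible:
  fixes a b c \<alpha> \<beta> \<gamma> :: real
  assumes "\<And>p q. (a * p\<^sup>2 + 2 * b * p * q + c * q\<^sup>2)\<^sup>2 = (p\<^sup>2 + q\<^sup>2) * (\<alpha> * p\<^sup>2 + \<beta> * p * q + \<gamma> * q\<^sup>2)"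
  shows "b = 0" "a = c"
proof -
  have 1: "a\<^sup>2 = \<alpha>" using assms[of 1 0] by simp
  have 2: "c\<^sup>2 = \<gamma>" using assms[of 0 1] by simp
  have 3: "(a + 2 * b + c)\<^sup>2 = 2 * (\<alpha> + \<beta> + \<gamma>)" using assms[of 1 1] by simp
  have 4: "(a - 2 * b + c)\<^sup>2 = 2 * (\<alpha> - \<beta> + \<gamma>)" using assms[of 1 "- 1"] by simp
  have 5: "(4 * a + 4 * b + c)\<^sup>2 = 5 * (4 * \<alpha> + 2 * \<beta> + \<gamma>)" using assms[of 2 1] by (simp add: algebra_simps)
  have 6: "4 * b\<^sup>2 = (a - c)\<^sup>2" using 3 4 unfolding 1[symmetric] 2[symmetric] by (simp add: power2_eq_square algebra_simps)
  have 7: "\<beta> = 2 * b * (a + c)" using 3 4 unfolding 1[symmetric] 2[symmetric] by (simp add: power2_eq_square algebra_simps)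
  have "12 * (b * (a - c)) = 4 * (a - c)\<^sup>2 - 16 * b\<^sup>2"
    using 5 unfolding 1[symmetric] 2[symmetric] 7 by (simp add: power2_eq_square algebra_simps)
  then have "12 * (b * (a - c)) = 0" using 6 by linarith
  then have "b * (a - c) = 0" by simp
  then show "b = 0" using 6 by auto
  then show "a = c" using 6 by auto
qed

text \<open>In the difference of the equations at y and - y, the curvature k of \<alpha> and all
  other even terms cancel. The coefficients q, Qa, Qb differ at the two points but are multiplied by
  terms of S, which are zero here.\<close>

lemma parity_algebra:
  fixes A B h E k a3 Ew n K rf rf0 :: real
  assumes A: "A > 0" and h: "h = A\<^sup>2 - B\<^sup>2" "h \<noteq> 0" and E: "E = rf / (3 * h)"
    and p: "K * ((A + B)\<^sup>2 / A)\<^sup>2 = Rexp k Qa1 Qb1 q1 0 0 E A (A - 2 * B) a3 n n 0 Ew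
        (e0exp B (A - 2 * B) E q1 Qb1 h 0 rf rf0 0)
        (eDexp A B (A - 2 * B) E q1 Qa1 Qb1 h 0 (2 * (E * (A - 2 * B) * rf)) 0 (E * ((A - 2 * B) * B + A\<^sup>2))) 0 B"
    and m: "K * ((A - B)\<^sup>2 / A)\<^sup>2 = Rexp k Qa2 Qb2 q2 0 0 E A (A + 2 * B) a3 (- n) (- n) 0 (- Ew)
        (e0exp (- B) (A + 2 * B) E q2 Qb2 h 0 rf (- rf0) 0)
        (eDexp A (- B) (A + 2 * B) E q2 Qa2 Qb2 h 0 (2 * (E * (A + 2 * B) * rf)) 0 (E * ((A + 2 * B) * (- B) + A\<^sup>2))) 0 (- B)"
  shows "A\<^sup>2 * (3 * h * rf0 + 8 * B * rf\<^sup>2) = - 36 * K * B * (A\<^sup>2 + B\<^sup>2) * h\<^sup>2"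
proof -
  have rf: "rf = 3 * h * E" unfolding E using h by simp
  have eD: "eDexp A B (A - 2 * B) E q Qa Qb h 0 (2 * (E * (A - 2 * B) * rf)) 0 (E * ((A - 2 * B) * B + A\<^sup>2)) = E\<^sup>2 * (4 * B\<^sup>2 - 3 * A * B - A\<^sup>2)"
    if h: "h = A\<^sup>2 - B\<^sup>2" "h \<noteq> 0" and rf: "rf = 3 * h * E" and A: "A > 0" for A B E q Qa Qb h rf :: real
  proof -
    have 1: "2 * (E * A\<^sup>2 * (A - B)) - 2 * B * (E * ((A - 2 * B) * B + A\<^sup>2)) = 2 * E * (A - 2 * B) * h"
      unfolding h(1) by (simp add: power2_eq_square algebra_simps)
    have 2: "E * A\<^sup>2 * (A - B) / A = E * A * (A - B)" using A by (simp add: power2_eq_square)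
    show ?thesis unfolding eDexp_def 1 2 rf using h(2) by (simp add: field_simps) (simp add: power2_eq_square algebra_simps)
  qed
  have eD1: "eDexp A B (A - 2 * B) E q1 Qa1 Qb1 h 0 (2 * (E * (A - 2 * B) * rf)) 0 (E * ((A - 2 * B) * B + A\<^sup>2)) = E\<^sup>2 * (4 * B\<^sup>2 - 3 * A * B - A\<^sup>2)"
    by (rule eD[OF h rf A])
  have eD2: "eDexp A (- B) (A + 2 * B) E q2 Qa2 Qb2 h 0 (2 * (E * (A + 2 * B) * rf)) 0 (E * ((A + 2 * B) * (- B) + A\<^sup>2)) = E\<^sup>2 * (4 * B\<^sup>2 + 3 * A * B - A\<^sup>2)"
    using eD[of h A "- B" rf E q2 Qa2 Qb2] h rf A by simp
  have e1: "e0exp B (A - 2 * B) E q1 Qb1 h 0 rf rf0 0 = (A - 2 * B) * (rf0 / (3 * h) + 6 * E\<^sup>2 * B) - 6 * h * E\<^sup>2"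
    unfolding e0exp_def rf using h(2) by (simp add: power2_eq_square)
  have e2: "e0exp (- B) (A + 2 * B) E q2 Qb2 h 0 rf (- rf0) 0 = - (A + 2 * B) * (rf0 / (3 * h) + 6 * E\<^sup>2 * B) - 6 * h * E\<^sup>2"
    unfolding e0exp_def rf using h(2) by (simp add: power2_eq_square algebra_simps add_divide_distrib)
  define W where "W = rf0 / (3 * h)"
  have "K * ((A + B)\<^sup>2 / A)\<^sup>2 - K * ((A - B)\<^sup>2 / A)\<^sup>2 = - 2 * A * W - 16 * A * B * E\<^sup>2"
    unfolding p m eD1 eD2 e1 e2 W_def[symmetric] Rexp_def by (simp add: power2_eq_square algebra_simps)
  moreover have "K * ((A + B)\<^sup>2 / A)\<^sup>2 - K * ((A - B)\<^sup>2 / A)\<^sup>2 = 8 * K * B * (A\<^sup>2 + B\<^sup>2) / A"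
    using A by (simp add: field_simps) (simp add: eval_nat_numeral algebra_simps)
  ultimately have "8 * K * B * (A\<^sup>2 + B\<^sup>2) / A = - 2 * A * W - 16 * A * B * E\<^sup>2" by simp
  then have *: "8 * K * B * (A\<^sup>2 + B\<^sup>2) = - 2 * A\<^sup>2 * W - 16 * A\<^sup>2 * B * E\<^sup>2"
    using A by (simp add: field_simps power2_eq_square)
  have "rf0 = 3 * h * W" unfolding W_def using h by simp
  then have "A\<^sup>2 * (3 * h * rf0 + 8 * B * rf\<^sup>2) = (9 * h\<^sup>2 / 2) * (2 * A\<^sup>2 * W + 16 * A\<^sup>2 * B * E\<^sup>2)"
    unfolding rf by (simp add: power2_eq_square algebra_simps)
  also have "\<dots> = (9 * h\<^sup>2 / 2) * (- (8 * K * B * (A\<^sup>2 + B\<^sup>2)))" unfolding * by simp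
  finally show ?thesis by simp
qed

section \<open>Umbilicity of the unit form and vanishing of K\<close>

context unit_square
begin

context
  fixes K :: real
  assumes K: "cfc K" and n: "CARD('a) \<ge> 3"
begin

lemma cov_bv_sym: "x \<in> U \<Longrightarrow> ip a x (cov a bv x u) v = ip a x (cov a bv x v) u"
  using ip_Sv[of x u v] Sv_zero[OF K n, of x u] by (simp add: ip_lin)

lemma TT_zero:
  assumes x: "x \<in> U"
  shows "TT x u y = 0"
proof -
  have "TT x u y = DH a u (\<lambda>q. Sv (fst q) (snd q)) (x, y)"
    using DH_Lin[of "(x, y)" Sc u, OF _ sm_Sc] x by (simp add: Sv_Lin)
  moreover have "dd (hor a u (x, y)) (\<lambda>q. Sv (fst q) (snd q)) (x, y) = dd (hor a u (x, y)) (\<lambda>q. 0) (x, y)"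
    by (rule dd_cong[OF open_UxV]) (use x Sv_zero[OF K n] in auto)
  ultimately show ?thesis using Sv_zero[OF K n x] by (simp add: DH_def dd_const Gam_lin)
qed

text \<open>One vector w orthogonal to b and y serves for y and for - y, so the two values of the
  curvature of \<alpha> on w coincide and can be eliminated.\<close>

lemma parity_identity:
  assumes q: "(x, y) \<in> \<Omega>"
  shows "ip a x y y * (3 * hh (x, y) * ip a x (HH x y y) y + 8 * ip a x (bv x) y * (rf (x, y))\<^sup>2)
    = - 36 * K * ip a x (bv x) y * (ip a x y y + (ip a x (bv x) y)\<^sup>2) * (hh (x, y))\<^sup>2"
proof -
  have x: "x \<in> U" and h: "hh (x, y) > 0" using \<Omega>_D[OF q] by auto
  have q': "(x, - y) \<in> \<Omega>" using x h by (simp add: \<Omega>_def hh_def ip_lin)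
  obtain w where w: "ip a x w w = 1" "ip a x w (bv x) = 0" "ip a x w y = 0"
    using exists_unit_orthogonal[OF x n] by blast
  have main: "K * ((alpha a x y + ip a x (bv x) y)\<^sup>2 / alpha a x y)\<^sup>2 =
      Rexp (ip a x w (RR (Gal a) w (x, y))) (Qa (alpha a x y) (ip a x (bv x) y)) (Qb (alpha a x y) (ip a x (bv x) y)) (qf (x, y)) 0 0
        (Ef (x, y)) (alpha a x y) (alpha a x y - 2 * ip a x (bv x) y) (ip a x (cov a bv x w) w) (ip a x (cov a bv x w) y) (ip a x (cov a bv x w) y) 0
        (2 * ip a x (cov a bv x w) y / (3 * hh (x, y)))
        (e0exp (ip a x (bv x) y) (alpha a x y - 2 * ip a x (bv x) y) (Ef (x, y)) (qf (x, y)) (Qb (alpha a x y) (ip a x (bv x) y)) (hh (x, y)) 0 (rf (x, y)) (ip a x (HH x y y) y) 0)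
        (eDexp (alpha a x y) (ip a x (bv x) y) (alpha a x y - 2 * ip a x (bv x) y) (Ef (x, y)) (qf (x, y)) (Qa (alpha a x y) (ip a x (bv x) y)) (Qb (alpha a x y) (ip a x (bv x) y)) (hh (x, y)) 0
           (2 * (Ef (x, y) * (alpha a x y - 2 * ip a x (bv x) y) * rf (x, y))) 0
           (Ef (x, y) * ((alpha a x y - 2 * ip a x (bv x) y) * ip a x (bv x) y + (alpha a x y)\<^sup>2))) 0 (ip a x (bv x) y)"
    if q: "(x, y) \<in> \<Omega>" and wy: "ip a x w y = 0" for y
  proof -
    let ?A = "alpha a x y" and ?B = "ip a x (bv x) y"
    have S0: "Sv x u = 0" for u by (rule Sv_zero[OF K n x])
    have sf: "sf (x, y) = 0" by (rule sf_zero[OF K n x])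
    have D: "DF (x, y) = (Ef (x, y) * (?A - 2 * ?B)) *\<^sub>R y + (Ef (x, y) * ?A\<^sup>2) *\<^sub>R bv x"
      unfolding DF_def by (simp add: S0)
    have yb: "ip a x (cov a bv x y) (bv x) = 0" by (rule ip_cov_bv[OF x])
    have rfD: "ip a x (cov a bv x (DF (x, y))) y + ip a x (cov a bv x y) (DF (x, y)) = 2 * (Ef (x, y) * (?A - 2 * ?B) * rf (x, y))"
      unfolding cov_bv_sym[OF x, of "DF (x, y)" y] unfolding D by (simp add: ip_lin yb rf_def)
    have bD: "ip a x (bv x) (DF (x, y)) = Ef (x, y) * ((?A - 2 * ?B) * ?B + ?A\<^sup>2)"
      unfolding D by (simp add: ip_lin unit_bv[OF x] algebra_simps)
    have e0: "dd (hor a y (x, y)) ef (x, y) = e0exp ?B (?A - 2 * ?B) (Ef (x, y)) (qf (x, y)) (Qb ?A ?B) (hh (x, y)) 0 (rf (x, y)) (ip a x (HH x y y) y) 0"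
      unfolding dd_hor_ef[OF q] sf S0 TT_zero[OF x] by (simp add: ip_lin)
    have eD: "dd (0, DF (x, y)) ef (x, y) = eDexp ?A ?B (?A - 2 * ?B) (Ef (x, y)) (qf (x, y)) (Qa ?A ?B) (Qb ?A ?B) (hh (x, y)) 0
        (2 * (Ef (x, y) * (?A - 2 * ?B) * rf (x, y))) 0 (Ef (x, y) * ((?A - 2 * ?B) * ?B + ?A\<^sup>2))"
      unfolding dd_vert_ef_D[OF q] sf S0 rfD bD by (simp add: ip_lin)
    have "K * ((?A + ?B)\<^sup>2 / ?A)\<^sup>2 = ip a x w (RR (\<lambda>q. Gal a q + DF q) w (x, y))"
      using cfc_ww[OF K q wy w(2,1)] F_eq[OF x] by simp
    also have "\<dots> = Rexp (ip a x w (RR (Gal a) w (x, y))) (Qa ?A ?B) (Qb ?A ?B) (qf (x, y)) 0 0 (Ef (x, y)) ?A (?A - 2 * ?B)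
       (ip a x (cov a bv x w) w) (ip a x (cov a bv x w) y) (ip a x (cov a bv x w) y) 0 (2 * ip a x (cov a bv x w) y / (3 * hh (x, y)))
       (dd (hor a y (x, y)) ef (x, y)) (dd (0, DF (x, y)) ef (x, y)) 0 ?B"
      unfolding RR_ww[OF q wy w(2,1)] Rexp_def S0 TT_zero[OF x] cov_bv_sym[OF x, of y w]
      by (simp add: ip_lin)
    finally show ?thesis unfolding e0 eD .
  qed
  have al: "alpha a x (- y) = alpha a x y" by (simp add: alpha_eq_ip ip_lin)
  have hm: "hh (x, - y) = hh (x, y)" by (simp add: hh_def ip_lin)
  have rm: "rf (x, - y) = rf (x, y)" by (simp add: rf_def ip_lin cov_bv_lin[OF x])
  have Em: "Ef (x, - y) = Ef (x, y)" unfolding Ef_def hm rm by (simp add: sf_zero[OF K n x])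
  interpret H: bounded_bilinear "LD Nc x" by (rule bilinear_LD[OF x sm_Nc])
  have Hm: "HH x (- y) (- y) = HH x y y" by (simp add: H.minus_left H.minus_right)
  have bm: "ip a x u (- y) = - ip a x u y" for u by (simp add: ip_lin)
  have "(alpha a x y)\<^sup>2 * (3 * hh (x, y) * ip a x (HH x y y) y + 8 * ip a x (bv x) y * (rf (x, y))\<^sup>2)
    = - 36 * K * ip a x (bv x) y * ((alpha a x y)\<^sup>2 + (ip a x (bv x) y)\<^sup>2) * (hh (x, y))\<^sup>2"
  proof (rule parity_algebra[OF \<Omega>_abs(1)[OF q, simplified] _ _ _ main[OF q w(3)]])
    show "hh (x, y) = (alpha a x y)\<^sup>2 - (ip a x (bv x) y)\<^sup>2" using hh_alpha[of "(x, y)"] x by simp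
    show "hh (x, y) \<noteq> 0" using h by simp
    show "Ef (x, y) = rf (x, y) / (3 * hh (x, y))" unfolding Ef_def by (simp add: sf_zero[OF K n x])
    show "K * ((alpha a x y - ip a x (bv x) y)\<^sup>2 / alpha a x y)\<^sup>2 =
      Rexp (ip a x w (RR (Gal a) w (x, y))) (Qa (alpha a x y) (- ip a x (bv x) y)) (Qb (alpha a x y) (- ip a x (bv x) y)) (qf (x, - y)) 0 0
        (Ef (x, y)) (alpha a x y) (alpha a x y + 2 * ip a x (bv x) y) (ip a x (cov a bv x w) w) (- ip a x (cov a bv x w) y) (- ip a x (cov a bv x w) y) 0
        (- (2 * ip a x (cov a bv x w) y / (3 * hh (x, y))))
        (e0exp (- ip a x (bv x) y) (alpha a x y + 2 * ip a x (bv x) y) (Ef (x, y)) (qf (x, - y)) (Qb (alpha a x y) (- ip a x (bv x) y)) (hh (x, y)) 0 (rf (x, y)) (- ip a x (HH x y y) y) 0)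
        (eDexp (alpha a x y) (- ip a x (bv x) y) (alpha a x y + 2 * ip a x (bv x) y) (Ef (x, y)) (qf (x, - y)) (Qa (alpha a x y) (- ip a x (bv x) y)) (Qb (alpha a x y) (- ip a x (bv x) y)) (hh (x, y)) 0
           (2 * (Ef (x, y) * (alpha a x y + 2 * ip a x (bv x) y) * rf (x, y))) 0
           (Ef (x, y) * ((alpha a x y + 2 * ip a x (bv x) y) * (- ip a x (bv x) y) + (alpha a x y)\<^sup>2))) 0 (- ip a x (bv x) y)"
      using main[OF q'] w(3) unfolding al hm rm Em Hm bm RR_Gal_even[OF x] by simp
  qed
  then show ?thesis unfolding alpha_sq[OF x] .
qed

text \<open>On the line y = \<eta> + z b neither \<open>hh\<close> nor \<open>rf\<close> depends on
  z, so the parity identity is polynomial in z. In its odd part K enters the coefficients of z and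
  z^3 as 36 K P^3 and 72 K P^2, while the other terms of these coefficients agree up to a factor P
  once the z^5 term has forced c3 = 0.\<close>

lemma curvature_zero_and_square:
  assumes x: "x \<in> U" and \<eta>: "\<eta> \<noteq> 0" "ip a x \<eta> (bv x) = 0"
  shows "K = 0" and "8 * (ip a x (cov a bv x \<eta>) \<eta>)\<^sup>2 = - 3 * ip a x \<eta> \<eta> *
    (ip a x (HH x \<eta> \<eta>) (bv x) + ip a x (HH x \<eta> (bv x)) \<eta> + ip a x (HH x (bv x) \<eta>) \<eta>)"
proof -
  let ?g = "ip a x" and ?b = "bv x" and ?H = "HH x"
  interpret H: bounded_bilinear "LD Nc x" by (rule bilinear_LD[OF x sm_Nc])
  define P where "P = ?g \<eta> \<eta>"
  have P: "P > 0" unfolding P_def by (rule ip_pos[OF x \<eta>(1)])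
  define \<rho> where "\<rho> = ?g (cov a bv x \<eta>) \<eta>"
  define c0 c1 c2 c3 where "c0 = ?g (?H \<eta> \<eta>) \<eta>" and "c1 = ?g (?H \<eta> \<eta>) ?b + ?g (?H \<eta> ?b) \<eta> + ?g (?H ?b \<eta>) \<eta>"
    and "c2 = ?g (?H ?b ?b) \<eta> + ?g (?H \<eta> ?b) ?b + ?g (?H ?b \<eta>) ?b" and "c3 = ?g (?H ?b ?b) ?b"
  have b\<eta>: "?g ?b \<eta> = 0" using \<eta>(2) ip_sym[OF x] by simp
  have id: "(P + z\<^sup>2) * (3 * P * (c0 + c1 * z + c2 * z\<^sup>2 + c3 * z ^ 3) + 8 * z * \<rho>\<^sup>2) = - 36 * K * z * (P + 2 * z\<^sup>2) * P\<^sup>2" for z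
  proof -
    let ?y = "\<eta> + z *\<^sub>R ?b"
    have yy: "?g ?y ?y = P + z\<^sup>2" using \<eta>(2) b\<eta> unit_bv[OF x] by (simp add: ip_lin P_def power2_eq_square)
    have yb: "?g ?b ?y = z" using b\<eta> unit_bv[OF x] by (simp add: ip_lin)
    have h: "hh (x, ?y) = P" using yy yb unfolding hh_def by simp
    have q: "(x, ?y) \<in> \<Omega>" using x h P by (simp add: \<Omega>_def)
    have rf: "rf (x, ?y) = \<rho>"
      using cov_bv_bv_zero[OF K n x] ip_cov_bv[OF x, of \<eta>] by (simp add: rf_def cov_bv_lin[OF x] ip_lin \<rho>_def)
    have H: "?g (?H ?y ?y) ?y = c0 + c1 * z + c2 * z\<^sup>2 + c3 * z ^ 3"
      unfolding c0_def c1_def c2_def c3_def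
      by (simp add: H.add_left H.add_right H.scaleR_left H.scaleR_right ip_lin power2_eq_square power3_eq_cube algebra_simps)
    show ?thesis using parity_identity[OF q] unfolding yy yb h rf H by (simp add: algebra_simps)
  qed
  \<comment> \<open>Subtracting the identities at z and - z leaves the odd powers; division by z
    leaves a quadratic polynomial in z^2.\<close>
  have u: "\<alpha>0 + \<alpha>1 * z\<^sup>2 + \<alpha>2 * z ^ 4 = 0" if "z \<noteq> 0" "\<alpha>0 = P * (3 * P * c1 + 8 * \<rho>\<^sup>2) + 36 * K * P ^ 3"
    "\<alpha>1 = 3 * P * c1 + 8 * \<rho>\<^sup>2 + 3 * P\<^sup>2 * c3 + 72 * K * P\<^sup>2" "\<alpha>2 = 3 * P * c3" for z \<alpha>0 \<alpha>1 \<alpha>2 :: real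
  proof -
    have "z * (\<alpha>0 + \<alpha>1 * z\<^sup>2 + \<alpha>2 * z ^ 4) = 0"
      using id[of z] id[of "- z"] unfolding that(2-4) by (simp add: eval_nat_numeral algebra_simps)
    then show ?thesis using that(1) by simp
  qed
  \<comment> \<open>The three values z = 1, 2, 3 give three distinct z^2, enough for a quadratic
    polynomial in z^2.\<close>
  define \<alpha>0 \<alpha>1 \<alpha>2 where "\<alpha>0 = P * (3 * P * c1 + 8 * \<rho>\<^sup>2) + 36 * K * P ^ 3"
    and "\<alpha>1 = 3 * P * c1 + 8 * \<rho>\<^sup>2 + 3 * P\<^sup>2 * c3 + 72 * K * P\<^sup>2" and "\<alpha>2 = 3 * P * c3"
  have "\<alpha>0 + \<alpha>1 + \<alpha>2 = 0" "\<alpha>0 + 4 * \<alpha>1 + 16 * \<alpha>2 = 0" "\<alpha>0 + 9 * \<alpha>1 + 81 * \<alpha>2 = 0"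
    using u[OF _ \<alpha>0_def \<alpha>1_def \<alpha>2_def, of 1] u[OF _ \<alpha>0_def \<alpha>1_def \<alpha>2_def, of 2] u[OF _ \<alpha>0_def \<alpha>1_def \<alpha>2_def, of 3] by simp_all
  then have z: "\<alpha>0 = 0" "\<alpha>1 = 0" "\<alpha>2 = 0" by linarith+
  have c3: "c3 = 0" using z(3) P unfolding \<alpha>2_def by simp
  have "P * (3 * P * c1 + 8 * \<rho>\<^sup>2 + 36 * K * P\<^sup>2) = 0" using z(1) unfolding \<alpha>0_def by (simp add: eval_nat_numeral algebra_simps)
  then have 1: "3 * P * c1 + 8 * \<rho>\<^sup>2 + 36 * K * P\<^sup>2 = 0" using P by simp
  have 2: "3 * P * c1 + 8 * \<rho>\<^sup>2 + 72 * K * P\<^sup>2 = 0" using z(2) unfolding \<alpha>1_def c3 by simp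
  have "K * P\<^sup>2 = 0" using 1 2 by linarith
  then show K0: "K = 0" using P by simp
  have "8 * \<rho>\<^sup>2 = - 3 * P * c1" using 1 unfolding K0 by simp
  then show "8 * (ip a x (cov a bv x \<eta>) \<eta>)\<^sup>2 = - 3 * ip a x \<eta> \<eta> *
    (ip a x (HH x \<eta> \<eta>) (bv x) + ip a x (HH x \<eta> (bv x)) \<eta> + ip a x (HH x (bv x) \<eta>) \<eta>)"
    unfolding \<rho>_def P_def c1_def .
qed

text \<open>On the plane of u and v, \<open>curvature_zero_and_square\<close> makes the square of
  the quadratic form of r divisible by |\<eta>|^2, so \<open>quartic_divisible\<close>
  applies.\<close>

lemma cov_bv_orthonormal:
  assumes x: "x \<in> U" and u: "ip a x u u = 1" "ip a x u (bv x) = 0" and v: "ip a x v v = 1" "ip a x v (bv x) = 0" and uv: "ip a x u v = 0"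
  shows "ip a x (cov a bv x u) v = 0" "ip a x (cov a bv x u) u = ip a x (cov a bv x v) v"
proof -
  let ?g = "ip a x" and ?b = "bv x" and ?H = "HH x" and ?N = "cov a bv x"
  interpret H: bounded_bilinear "LD Nc x" by (rule bilinear_LD[OF x sm_Nc])
  define c where "c \<eta> \<zeta> = ?g (?H \<eta> \<zeta>) (bv x) + ?g (?H \<eta> (bv x)) \<zeta> + ?g (?H (bv x) \<eta>) \<zeta>" for \<eta> \<zeta>
  have vu: "?g v u = 0" using uv ip_sym[OF x] by simp
  have c: "c (p *\<^sub>R u + q *\<^sub>R v) (p *\<^sub>R u + q *\<^sub>R v) = p\<^sup>2 * c u u + p * q * (c u v + c v u) + q\<^sup>2 * c v v" for p q
    unfolding c_def by (simp add: H.add_left H.add_right H.scaleR_left H.scaleR_right ip_lin power2_eq_square algebra_simps)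
  have "(?g (?N u) u * p\<^sup>2 + 2 * ?g (?N u) v * p * q + ?g (?N v) v * q\<^sup>2)\<^sup>2
    = (p\<^sup>2 + q\<^sup>2) * ((- 3 / 8 * c u u) * p\<^sup>2 + (- 3 / 8 * (c u v + c v u)) * p * q + (- 3 / 8 * c v v) * q\<^sup>2)" for p q
  proof -
    let ?\<eta> = "p *\<^sub>R u + q *\<^sub>R v"
    have N: "?g (?N ?\<eta>) ?\<eta> = ?g (?N u) u * p\<^sup>2 + 2 * ?g (?N u) v * p * q + ?g (?N v) v * q\<^sup>2"
      using cov_bv_sym[OF x, of v u] by (simp add: cov_bv_lin[OF x] ip_lin power2_eq_square algebra_simps)
    have gg: "?g ?\<eta> ?\<eta> = p\<^sup>2 + q\<^sup>2" by (simp add: ip_lin u v uv vu power2_eq_square)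
    have "8 * (?g (?N ?\<eta>) ?\<eta>)\<^sup>2 = - 3 * ?g ?\<eta> ?\<eta> * c ?\<eta> ?\<eta>"
    proof (cases "?\<eta> = 0")
      case False
      have "?g ?\<eta> ?b = 0" by (simp add: ip_lin u v)
      then show ?thesis unfolding c_def by (rule curvature_zero_and_square(2)[OF x False])
    qed (simp add: ip_lin)
    then have "(?g (?N ?\<eta>) ?\<eta>)\<^sup>2 = ?g ?\<eta> ?\<eta> * (- 3 / 8 * c ?\<eta> ?\<eta>)" by simp
    then show ?thesis unfolding N gg c by (simp add: algebra_simps add_divide_distrib)
  qed
  from quartic_divisible[OF this] show "?g (?N u) v = 0" "?g (?N u) u = ?g (?N v) v" by auto
qed

text \<open>One unit vector u0 fixes the value \<tau>; each direction orthogonal to u0 and b has the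
  same value and no mixed term with u0. Polarisation and the splitting along b then give the whole
  endomorphism.\<close>

lemma cov_bv_umbilic:
  assumes x: "x \<in> U"
  obtains \<tau> where "\<And>u. cov a bv x u = \<tau> *\<^sub>R (u - ip a x (bv x) u *\<^sub>R bv x)"
proof -
  let ?g = "ip a x" and ?b = "bv x" and ?N = "cov a bv x"
  have gs: "?g u v = ?g v u" for u v by (rule ip_sym[OF x])
  obtain u0 where u0: "?g u0 u0 = 1" "?g u0 ?b = 0" using exists_unit_orthogonal[OF x n] by metis
  define \<tau> where "\<tau> = ?g (?N u0) u0"
  have orth: "?g (?N u0) \<eta> = 0 \<and> ?g (?N \<eta>) \<eta> = \<tau> * ?g \<eta> \<eta>" if \<eta>: "?g \<eta> ?b = 0" "?g u0 \<eta> = 0" for \<eta>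
  proof (cases "\<eta> = 0")
    case False
    define c where "c = sqrt (?g \<eta> \<eta>)"
    have c: "c > 0" "c * c = ?g \<eta> \<eta>" using ip_pos[OF x False] unfolding c_def by simp_all
    let ?v = "(1 / c) *\<^sub>R \<eta>"
    have v: "?g ?v ?v = 1" "?g ?v ?b = 0" "?g u0 ?v = 0"
      using c \<eta> by (simp_all add: ip.scaleR_left ip.scaleR_right flip: c(2))
    note o = cov_bv_orthonormal[OF x u0 v]
    have "?g (?N u0) \<eta> = 0" using o(1) c(1) by (simp add: ip_lin)
    moreover have "?g (?N \<eta>) \<eta> = \<tau> * (c * c)"
      using o(2) c(1) unfolding \<tau>_def by (simp add: ip_lin cov_bv_lin[OF x] field_simps)
    ultimately show ?thesis unfolding c(2) by simp
  qed (simp add: ip_lin)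
  have quad: "?g (?N \<xi>) \<xi> = \<tau> * ?g \<xi> \<xi>" if \<xi>: "?g \<xi> ?b = 0" for \<xi>
  proof -
    define p where "p = ?g u0 \<xi>"
    define \<eta> where "\<eta> = \<xi> - p *\<^sub>R u0"
    have e: "\<xi> = p *\<^sub>R u0 + \<eta>" unfolding \<eta>_def by simp
    have \<eta>: "?g \<eta> ?b = 0" "?g u0 \<eta> = 0" unfolding \<eta>_def p_def using \<xi> u0 by (simp_all add: ip_lin)
    have \<eta>': "?g \<eta> u0 = 0" "?g (?N \<eta>) u0 = 0" using \<eta> gs orth[OF \<eta>] cov_bv_sym[OF x, of \<eta> u0] by auto
    show ?thesis unfolding e using orth[OF \<eta>] \<eta> \<eta>' u0 \<tau>_def
      by (simp add: cov_bv_lin[OF x] ip_lin algebra_simps)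
  qed
  have pol: "?g (?N u) v = \<tau> * ?g u v" if "?g u ?b = 0" "?g v ?b = 0" for u v
  proof -
    have "?g (u + v) ?b = 0" "?g (u - v) ?b = 0" using that by (simp_all add: ip_lin)
    from quad[OF this(1)] quad[OF this(2)] show ?thesis
      using cov_bv_sym[OF x, of v u] gs[of v u] by (simp add: cov_bv_lin[OF x] ip_lin algebra_simps)
  qed
  have "?N u = \<tau> *\<^sub>R (u - ?g ?b u *\<^sub>R ?b)" for u
  proof (rule ip_eqI[OF x])
    fix v
    let ?p = "\<lambda>u. u - ?g ?b u *\<^sub>R ?b"
    have pb: "?g (?p u) ?b = 0" for u using unit_bv[OF x] gs[of u ?b] by (simp add: ip_lin)
    have Np: "?N (?p u) = ?N u" for u using cov_bv_bv_zero[OF K n x] by (simp add: cov_bv_lin[OF x])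
    have gp: "?g (?N u) (?p v) = ?g (?N u) v" for u v using ip_cov_bv[OF x] by (simp add: ip_lin)
    have "?g (?N u) v = \<tau> * ?g (?p u) (?p v)" using pol[OF pb pb, of u v] unfolding Np gp .
    also have "?g (?p u) (?p v) = ?g (?p u) v" using pb[of u] by (simp only: ip.diff_right ip.scaleR_right) simp
    finally show "?g (?N u) v = ?g (\<tau> *\<^sub>R ?p u) v" by (simp only: ip.scaleR_left) simp
  qed
  then show ?thesis using that by blast
qed

definition \<tau>\<^sub>f :: "real^'a \<Rightarrow> real" where
  "\<tau>\<^sub>f x = (\<Sum>i\<in>UNIV. cov a bv x (axis i 1) $ i) / (real CARD('a) - 1)"

text \<open>The projection off b has trace n - 1. Unlike the pointwise choice in
  \<open>cov_bv_umbilic\<close>, the trace depends smoothly on x.\<close>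

lemma cov_bv_\<tau>:
  assumes x: "x \<in> U"
  shows "cov a bv x u = \<tau>\<^sub>f x *\<^sub>R (u - ip a x (bv x) u *\<^sub>R bv x)"
proof -
  obtain \<tau> where \<tau>: "\<And>u. cov a bv x u = \<tau> *\<^sub>R (u - ip a x (bv x) u *\<^sub>R bv x)" by (rule cov_bv_umbilic[OF x]) blast
  have "(\<Sum>i\<in>UNIV. ip a x (bv x) (axis i 1) * bv x $ i) = ip a x (bv x) (\<Sum>i\<in>UNIV. bv x $ i *\<^sub>R axis i 1)"
    by (simp add: ip.sum_right ip_lin mult.commute)
  also have "(\<Sum>i\<in>UNIV. bv x $ i *\<^sub>R axis i 1) = bv x"
    using basis_expansion[of "bv x"] by (simp add: scalar_mult_eq_scaleR)
  finally have s: "(\<Sum>i\<in>UNIV. ip a x (bv x) (axis i 1) * bv x $ i) = 1" using unit_bv[OF x] by simp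
  have "(\<Sum>i\<in>UNIV. cov a bv x (axis i 1) $ i) = \<tau> * (real CARD('a) - 1)"
    unfolding \<tau> using s by (simp add: sum_subtractf algebra_simps sum_distrib_left[symmetric])
  then have "\<tau>\<^sub>f x = \<tau>" unfolding \<tau>\<^sub>f_def using n by simp
  then show ?thesis unfolding \<tau> by simp
qed

lemma sm_\<tau>: "sm U \<tau>\<^sub>f"
proof -
  have "sm U (\<lambda>x. \<tau>\<^sub>f x)" unfolding \<tau>\<^sub>f_def
    using n by (intro sm_divide sm_sum sm_vec_nth sm_cov sm_bv sm_const open_U) auto
  then show ?thesis .
qed

end

end

section \<open>The square metric of a form of variable length\<close>

context chart_metric
begin

lemma ip_raise: "x \<in> U \<Longrightarrow> ip a x (raise a \<omega> x) v = \<omega> x \<bullet> v"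
  unfolding raise_eq_sharp by (rule ip_sharp)

lemma raise_ip: "x \<in> U \<Longrightarrow> ip a x (raise a \<omega> x) (axis i 1) = \<omega> x $ i"
  by (simp add: ip_raise inner_axis)

lemma sm_cvec:
  fixes \<omega> :: "'n cvec"
  shows "(\<And>i. sm U (\<lambda>x. \<omega> x $ i)) \<Longrightarrow> sm U \<omega>"
proof -
  assume "\<And>i. sm U (\<lambda>x. \<omega> x $ i)"
  from sm_vec_lambda[OF open_U, of "\<lambda>i x. \<omega> x $ i", OF this] show ?thesis by simp
qed

lemma sm_raise: "sm U \<omega> \<Longrightarrow> sm U (raise a \<omega>)"
proof -
  assume "sm U \<omega>"
  then have "sm U (\<lambda>x. raise a \<omega> x)" unfolding raise_eq_sharp by (rule sm_sharp_base)
  then show ?thesis .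
qed

lemma cov_lower_eq:
  assumes x: "x \<in> U" and \<omega>: "sm U \<omega>"
  shows "cov_lower a \<omega> x i j = ip a x (cov a (raise a \<omega>) x (axis j 1)) (axis i 1)"
proof -
  have W: "raise a \<omega> differentiable (at x)" by (rule sm_diff_at[OF sm_raise[OF \<omega>] x])
  have "pd j (\<lambda>z. \<omega> z $ i) x = dd (axis j 1) (\<lambda>z. \<omega> z $ i) x"
    by (rule pd_eq_dd) (rule sm_diff_at[OF sm_vec_nth[OF open_U \<omega>] x])
  also have "\<dots> = dd (axis j 1) (\<lambda>z. ip a z (raise a \<omega> z) (axis i 1)) x"
    by (rule dd_cong[OF open_U x]) (simp add: raise_ip)
  also have "\<dots> = ip a x (cov a (raise a \<omega>) x (axis j 1)) (axis i 1) + ip a x (raise a \<omega> x) (Gam a x (axis j 1) (axis i 1))"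
    using dd_ip_base[OF x W differentiable_const, of "axis j 1" "axis i 1"] by (simp add: cov_def dd_const)
  also have "ip a x (raise a \<omega> x) (Gam a x (axis j 1) (axis i 1)) = (\<Sum>k\<in>UNIV. christoffel a x k i j * \<omega> x $ k)"
    unfolding ip_raise[OF x] Gam_sym[OF x, of "axis j 1"] by (simp add: Gam_def inner_vec_def mult.commute)
  finally show ?thesis unfolding cov_lower_def by simp
qed

lemma cov_upper_eq:
  assumes x: "x \<in> U" and W: "sm U W"
  shows "cov_upper a W x i j = cov a W x (axis j 1) $ i"
proof -
  have "pd j (\<lambda>z. W z $ i) x = dd (axis j 1) W x $ i"
    using pd_eq_dd[OF sm_diff_at[OF sm_vec_nth[OF open_U W] x]] dd_vec_nth[OF sm_diff_at[OF W x]] by simp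
  moreover have "Gam a x (axis j 1) (W x) $ i = (\<Sum>k\<in>UNIV. christoffel a x i k j * W x $ k)"
  proof -
    have e: "W x = (\<Sum>k\<in>UNIV. W x $ k *\<^sub>R axis k 1)"
      using basis_expansion[of "W x"] by (simp add: scalar_mult_eq_scaleR)
    have "Gam a x (axis j 1) (W x) = (\<Sum>k\<in>UNIV. W x $ k *\<^sub>R Gam a x (axis k 1) (axis j 1))"
      by (subst e) (simp add: Gam.sum_right Gam_lin Gam_sym[OF x, of "axis j 1"])
    then show ?thesis by (simp add: Gam_def mult.commute)
  qed
  ultimately show ?thesis unfolding cov_upper_def cov_def by simp
qed

end

section \<open>Normalisation to unit length and the structure equation\<close>

locale sq_chart = chart_metric U a for U :: "(real^'n::finite) set" and a +
  fixes b :: "'n cvec"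
  assumes sm_b: "sm U b" and b_nz: "\<And>x. x \<in> U \<Longrightarrow> b x \<noteq> 0"
begin

abbreviation "BB \<equiv> blength a b"
abbreviation "bs \<equiv> raise a b"

lemma ip_bs: "x \<in> U \<Longrightarrow> ip a x (bs x) v = b x \<bullet> v"
  by (rule ip_raise)

lemma bs_nz: "x \<in> U \<Longrightarrow> bs x \<noteq> 0"
  using ip_bs[of x "b x"] b_nz[of x] by (auto simp: ip_lin)

lemma BB_eq: "x \<in> U \<Longrightarrow> BB x = sqrt (ip a x (bs x) (bs x))"
proof -
  assume x: "x \<in> U"
  have "b x \<bullet> bs x = (\<Sum>i\<in>UNIV. \<Sum>j\<in>UNIV. upper a x i j * b x $ i * b x $ j)"
    by (simp add: inner_vec_def raise_def sum_distrib_left mult_ac)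
  then show ?thesis unfolding ip_bs[OF x] blength_def by simp
qed

lemma BB_pos: "x \<in> U \<Longrightarrow> BB x > 0"
  using ip_pos[OF _ bs_nz] by (simp add: BB_eq)

lemma BB_sq: "x \<in> U \<Longrightarrow> ip a x (bs x) (bs x) = (BB x)\<^sup>2"
  using ip_pos[OF _ bs_nz, of x x] by (simp add: BB_eq)

lemma sm_bs: "sm U bs"
  by (rule sm_raise[OF sm_b])

lemma sm_BB: "sm U BB"
  by (rule sm_cong[OF open_U BB_eq[symmetric]])
    (auto intro!: sm_sqrt sm_ip_base sm_bs open_U ip_pos bs_nz)

lemma beta_eq: "x \<in> U \<Longrightarrow> beta b x y = ip a x (bs x) y"
  by (simp add: ip_bs beta_def inner_vec_def)

text \<open>After the conformal change \<open>a \<mapsto> B\<^sup>4 a\<close> the form \<open>B \<beta>\<close> has unit length, and the square metric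
  of the new pair is again \<open>F\<close>.\<close>

definition abar :: "'n cmetric" where "abar x = (\<chi> i j. (BB x) ^ 4 * a x $ i $ j)"
definition bbar :: "'n cvec" where "bbar x = (1 / (BB x) ^ 3) *\<^sub>R bs x"

lemma ip_abar: "ip abar x u v = (BB x) ^ 4 * ip a x u v"
  by (simp add: ip_def Tens_def abar_def sum_distrib_left mult_ac)

lemma alpha_abar: "x \<in> U \<Longrightarrow> alpha abar x y = (BB x)\<^sup>2 * alpha a x y"
proof -
  assume x: "x \<in> U"
  have "sqrt ((BB x) ^ 4) = (BB x)\<^sup>2" using real_sqrt_power[of "BB x ^ 2" 2] by (simp flip: power_mult)
  then show ?thesis by (simp add: alpha_eq_ip ip_abar real_sqrt_mult)
qed

lemma chart_metric_abar: "chart_metric U abar"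
proof
  show "open U" by (rule open_U)
  show "sm U (\<lambda>x. abar x $ i $ j)" for i j
    unfolding abar_def by (simp add: sm_mult[OF open_U sm_power[OF open_U sm_BB] sm_a])
  show "abar x $ i $ j = abar x $ j $ i" if "x \<in> U" for x i j
    unfolding abar_def using a_sym[OF that] by simp
  show "(\<Sum>i\<in>UNIV. \<Sum>j\<in>UNIV. abar x $ i $ j * y $ i * y $ j) > 0" if "x \<in> U" "y \<noteq> 0" for x y
  proof -
    have "(\<Sum>i\<in>UNIV. \<Sum>j\<in>UNIV. abar x $ i $ j * y $ i * y $ j) = (BB x) ^ 4 * ip a x y y"
      unfolding ip_abar[symmetric] by (simp add: ip_def Tens_def mult_ac)
    then show ?thesis using BB_pos[OF that(1)] ip_pos[OF that] by simp
  qed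
qed

sublocale N: unit_square U abar bbar "singular_square a b"
proof -
  interpret A: chart_metric U abar by (rule chart_metric_abar)
  show "unit_square U abar bbar (singular_square a b)"
  proof
    show "sm U bbar"
    proof -
      have "sm U (\<lambda>x. (1 / (BB x) ^ 3) *\<^sub>R bs x)"
        by (intro sm_scaleR sm_divide sm_power sm_const sm_BB sm_bs open_U) (use BB_pos in force)
      then show ?thesis unfolding bbar_def[abs_def] .
    qed
    show "ip abar x (bbar x) (bbar x) = 1" if "x \<in> U" for x
      using BB_pos[OF that] BB_sq[OF that] unfolding ip_abar bbar_def
      by (simp add: ip_lin power2_eq_square eval_nat_numeral)
    show "singular_square a b x y = (alpha abar x y + ip abar x (bbar x) y)\<^sup>2 / alpha abar x y" if x: "x \<in> U" for x y
    proof -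
      have "ip abar x (bbar x) y = BB x * beta b x y"
        using BB_pos[OF x] unfolding ip_abar bbar_def beta_eq[OF x] by (simp add: ip_lin eval_nat_numeral)
      then have "(alpha abar x y + ip abar x (bbar x) y)\<^sup>2 / alpha abar x y
        = (BB x)\<^sup>2 * (BB x * alpha a x y + beta b x y)\<^sup>2 / ((BB x)\<^sup>2 * alpha a x y)"
        unfolding alpha_abar[OF x] by (simp add: power2_eq_square algebra_simps)
      then show ?thesis using BB_pos[OF x] by (simp add: singular_square_def)
    qed
  qed
qed

definition gB :: "'n cvec" where "gB x = sharp a x (\<chi> i. dd (axis i 1) BB x)"

lemma ip_gB: "x \<in> U \<Longrightarrow> ip a x (gB x) u = dd u BB x"
  unfolding gB_def by (simp add: ip_sharp dd_eq_sum_axis[OF sm_diff_at[OF sm_BB], of x u] inner_vec_def mult.commute)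

lemma dd_BB: "x \<in> U \<Longrightarrow> dd u BB x = ip a x (cov a bs x u) (bs x) / BB x"
proof -
  assume x: "x \<in> U"
  have "dd u (\<lambda>z. (BB z)\<^sup>2) x = dd u (\<lambda>z. ip a z (bs z) (bs z)) x"
    by (rule dd_cong[OF open_U x]) (simp add: BB_sq)
  then have "2 * BB x * dd u BB x = 2 * ip a x (cov a bs x u) (bs x)"
    using dd_ip_base[OF x sm_diff_at[OF sm_bs x] sm_diff_at[OF sm_bs x], of u] ip_sym[OF x, of "bs x"]
    by (simp add: dd_power2[OF sm_diff_at[OF sm_BB x]])
  then show ?thesis using BB_pos[OF x] by (simp add: field_simps)
qed

text \<open>The conformal change of the Levi-Civita connection for the factor e^(2f) with f = 2 ln
  B, whence the coefficient df = 2 dB / B.\<close>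

lemma Gam_abar:
  assumes x: "x \<in> U"
  shows "Gam abar x u v = Gam a x u v + (2 / BB x) *\<^sub>R (dd u BB x *\<^sub>R v + dd v BB x *\<^sub>R u - ip a x u v *\<^sub>R gB x)"
proof (rule N.ip_eqI[OF x])
  fix w
  let ?g = "ip a x" and ?B = "BB x"
  have d: "dd u (\<lambda>z. ip abar z v w) x = 4 * ?B ^ 3 * dd u BB x * ?g v w + ?B ^ 4 * dd u (\<lambda>z. ip a z v w) x" for u v w
  proof -
    have "(\<lambda>z. ip a z v w) differentiable (at x)" by (rule sm_diff_at[OF sm_ip_base[OF sm_const sm_const] x])
    then show ?thesis unfolding ip_abar using sm_diff_at[OF sm_BB x] by (simp add: dd_mult dd_power)
  qed
  have "2 * ip abar x (Gam abar x u v) w = 4 * ?B ^ 3 * (dd u BB x * ?g v w + dd v BB x * ?g u w - dd w BB x * ?g u v) + ?B ^ 4 * (2 * ?g (Gam a x u v) w)"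
    unfolding N.Koszul[OF x] Koszul[OF x] d by (simp add: algebra_simps)
  also have "\<dots> = 2 * ip abar x (Gam a x u v + (2 / ?B) *\<^sub>R (dd u BB x *\<^sub>R v + dd v BB x *\<^sub>R u - ?g u v *\<^sub>R gB x)) w"
    using BB_pos[OF x] unfolding ip_abar by (simp add: ip_lin ip_gB[OF x]) (simp add: field_simps eval_nat_numeral)
  finally show "ip abar x (Gam abar x u v) w = ip abar x (Gam a x u v + (2 / ?B) *\<^sub>R (dd u BB x *\<^sub>R v + dd v BB x *\<^sub>R u - ?g u v *\<^sub>R gB x)) w"
    by simp
qed

lemma cov_abar_bbar:
  assumes x: "x \<in> U"
  shows "cov abar bbar x u = (1 / (BB x) ^ 3) *\<^sub>R (cov a bs x u - (dd u BB x / BB x) *\<^sub>R bs x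
    + (2 / BB x) *\<^sub>R (dd (bs x) BB x *\<^sub>R u - ip a x u (bs x) *\<^sub>R gB x))"
proof -
  have B: "BB x \<noteq> 0" using BB_pos[OF x] by simp
  note d = sm_diff_at[OF sm_BB x] sm_diff_at[OF sm_bs x]
  have "dd u bbar x = dd u (\<lambda>x. (1 / (BB x) ^ 3) *\<^sub>R bs x) x" unfolding bbar_def[abs_def] ..
  also have "\<dots> = (- 3 * dd u BB x / (BB x) ^ 4) *\<^sub>R bs x + (1 / (BB x) ^ 3) *\<^sub>R dd u bs x"
    using d B by (simp add: dd_scaleR dd_divide dd_power dd_const differentiable_divide) (simp add: field_simps eval_nat_numeral)
  finally have 1: "dd u bbar x = (- 3 * dd u BB x / (BB x) ^ 4) *\<^sub>R bs x + (1 / (BB x) ^ 3) *\<^sub>R dd u bs x" .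
  have c: "(- 3 * e / B ^ 4) *\<^sub>R z + (1 / B ^ 3) *\<^sub>R w + ((1 / B ^ 3) *\<^sub>R G + (2 / B) *\<^sub>R (e *\<^sub>R ((1 / B ^ 3) *\<^sub>R z) + (f / B ^ 3) *\<^sub>R u - (h / B ^ 3) *\<^sub>R k))
    = (1 / B ^ 3) *\<^sub>R (w + G - (e / B) *\<^sub>R z + (2 / B) *\<^sub>R (f *\<^sub>R u - h *\<^sub>R k))"
    if "B \<noteq> 0" for B e f h :: real and z w G u k :: "real^'n"
    using that by (simp add: vec_eq_iff field_simps eval_nat_numeral)
  have "dd (bbar x) BB x = dd (bs x) BB x / BB x ^ 3" unfolding bbar_def dd_dir_scale[OF d(1)] by simp
  then show ?thesis unfolding cov_def 1 Gam_abar[OF x] using c[OF B]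
    by (simp add: bbar_def Gam_lin ip_lin)
qed

text \<open>Found by matching coefficients in the spray of F: the term \<alpha> y determines
  \<kappa>, and the term \<alpha>^2 times a vector field determines m.\<close>

definition wform :: "(real^'n \<Rightarrow> real) \<Rightarrow> 'n cvec \<Rightarrow> 'n cvec" where
  "wform d sv x = (2/3 * d x) *\<^sub>R bs x - (4 / (BB x)\<^sup>2) *\<^sub>R sv x"
definition wkap :: "(real^'n \<Rightarrow> real) \<Rightarrow> (real^'n \<Rightarrow> real) \<Rightarrow> real^'n \<Rightarrow> real" where
  "wkap c d x = (c x + 2/3 * d x * (BB x)\<^sup>2) / BB x"

text \<open>The sum of the prescribed \<open>r_ij\<close> and \<open>s_ij\<close>, as one equation
  for the covariant derivative of b; the coefficients -3 + 1 and -3 - 1 of the two mixed terms give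
  2 and 4.\<close>

definition struct :: "real \<Rightarrow> real \<Rightarrow> real^'n \<Rightarrow> real^'n \<Rightarrow> bool" where
  "struct c d s x \<longleftrightarrow> ip a x s (bs x) = 0 \<and>
    (\<forall>u. cov a bs x u = c *\<^sub>R u + (d * ip a x (bs x) u) *\<^sub>R bs x - (2 / (BB x)\<^sup>2 * ip a x s u) *\<^sub>R bs x
      - (4 / (BB x)\<^sup>2 * ip a x (bs x) u) *\<^sub>R s)"

lemma struct_gB:
  assumes x: "x \<in> U" and st: "struct c d s x"
  shows "dd u BB x = (c + d * (BB x)\<^sup>2) / BB x * ip a x (bs x) u - 2 / BB x * ip a x s u"
    and "gB x = ((c + d * (BB x)\<^sup>2) / BB x) *\<^sub>R bs x - (2 / BB x) *\<^sub>R s"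
proof -
  have B: "BB x > 0" by (rule BB_pos[OF x])
  have 0: "ip a x s (bs x) = 0" and N: "cov a bs x u = c *\<^sub>R u + (d * ip a x (bs x) u) *\<^sub>R bs x - (2 / (BB x)\<^sup>2 * ip a x s u) *\<^sub>R bs x
      - (4 / (BB x)\<^sup>2 * ip a x (bs x) u) *\<^sub>R s" for u using st unfolding struct_def by auto
  show *: "dd u BB x = (c + d * (BB x)\<^sup>2) / BB x * ip a x (bs x) u - 2 / BB x * ip a x s u" for u
    unfolding dd_BB[OF x] N using B ip_sym[OF x, of u "bs x"]
    by (simp add: ip_lin 0 BB_sq[OF x]) (simp add: field_simps power2_eq_square)
  show "gB x = ((c + d * (BB x)\<^sup>2) / BB x) *\<^sub>R bs x - (2 / BB x) *\<^sub>R s"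
    by (rule ip_eqI[OF x]) (simp add: ip_gB[OF x] * ip_lin)
qed

text \<open>In the normalised metric the structure equation is umbilicity of the unit form: the
  conformal factor absorbs the terms with s_i.\<close>

lemma struct_cov_abar:
  assumes x: "x \<in> U" and st: "struct c d s x"
  shows "cov abar bbar x u = ((3 * c + 2 * d * (BB x)\<^sup>2) / (BB x) ^ 3) *\<^sub>R (u - ip abar x (bbar x) u *\<^sub>R bbar x)"
proof -
  have B: "BB x > 0" by (rule BB_pos[OF x])
  have 0: "ip a x s (bs x) = 0" and N: "cov a bs x u = c *\<^sub>R u + (d * ip a x (bs x) u) *\<^sub>R bs x - (2 / (BB x)\<^sup>2 * ip a x s u) *\<^sub>R bs x
      - (4 / (BB x)\<^sup>2 * ip a x (bs x) u) *\<^sub>R s" using st unfolding struct_def by auto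
  have alg: "(1 / B ^ 3) *\<^sub>R (c *\<^sub>R u + (d * bu) *\<^sub>R z - (2 / B\<^sup>2 * su) *\<^sub>R z - (4 / B\<^sup>2 * bu) *\<^sub>R s
      - (((c + d * B\<^sup>2) / B * bu - 2 / B * su) / B) *\<^sub>R z
      + (2 / B) *\<^sub>R (((c + d * B\<^sup>2) / B * B\<^sup>2 - 2 / B * 0) *\<^sub>R u - bu *\<^sub>R (((c + d * B\<^sup>2) / B) *\<^sub>R z - (2 / B) *\<^sub>R s)))
    = ((3 * c + 2 * d * B\<^sup>2) / B ^ 3) *\<^sub>R (u - (B ^ 4 * (1 / B ^ 3 * bu)) *\<^sub>R ((1 / B ^ 3) *\<^sub>R z))"
    if "B > 0" for B bu su :: real and u z s :: "real^'n"
    using that by (simp add: vec_eq_iff field_simps) (simp add: eval_nat_numeral algebra_simps)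
  show ?thesis
    unfolding cov_abar_bbar[OF x] struct_gB[OF x st] N BB_sq[OF x] 0 ip_sym[OF x, of u "bs x"] alg[OF B]
    by (simp add: ip_abar bbar_def ip_lin)
qed

text \<open>By umbilicity \<open>rf\<close> is \<tau> \<open>hh\<close> and the s-terms vanish, so
  \<open>Ef\<close> is \<tau>/3 and \<open>DF\<close> loses its denominator. The remaining vectors b
  and the gradient of B combine to m.\<close>

lemma weyl_spray:
  assumes q: "(x, y) \<in> N.\<Omega>" and st: "struct (c x) (d x) (sv x) x"
  shows "Gal abar (x, y) + N.DF (x, y) = Gal a (x, y) + weyl (wform d sv) (wkap c d) (x, y)"
proof -
  have x: "x \<in> U" using N.\<Omega>_D[OF q] by simp
  have B: "BB x > 0" by (rule BB_pos[OF x])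
  define \<tau> where "\<tau> = (3 * c x + 2 * d x * (BB x)\<^sup>2) / (BB x) ^ 3"
  have N: "cov abar bbar x u = \<tau> *\<^sub>R (u - ip abar x (bbar x) u *\<^sub>R bbar x)" for u
    unfolding \<tau>_def by (rule struct_cov_abar[OF x st])
  have S: "N.Sv x u = 0" for u
    by (rule N.ip_eqI[OF x]) (simp add: N.ip_Sv[OF x] N ip_lin N.ip_sym[OF x, of _ u] algebra_simps)
  have sf: "N.sf (x, y) = 0" by (simp add: N.sf_def S ip_lin)
  have "N.rf (x, y) = \<tau> * N.hh (x, y)"
    by (simp add: N.rf_def N N.hh_def ip_lin power2_eq_square algebra_simps)
  then have E: "N.Ef (x, y) = \<tau> / 3" unfolding N.Ef_def sf using N.\<Omega>_D(3)[OF q] by simp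
  have bb: "ip abar x (bbar x) y = BB x * ip a x (bs x) y"
    using B by (simp add: ip_abar bbar_def ip_lin eval_nat_numeral)
  have D: "N.DF (x, y) = (\<tau> / 3 * ((BB x)\<^sup>2 * alpha a x y - 2 * BB x * ip a x (bs x) y)) *\<^sub>R y + (\<tau> / 3 * BB x * ip a x y y) *\<^sub>R bs x"
    using B unfolding N.DF_def fst_conv snd_conv S E bb alpha_abar[OF x]
    unfolding bbar_def
    by (simp add: alpha_sq[OF x, symmetric] power_mult_distrib) (simp add: eval_nat_numeral mult_ac)
  have G: "Gal abar (x, y) = Gal a (x, y) + (2 / BB x * dd y BB x) *\<^sub>R y - (1 / BB x * ip a x y y) *\<^sub>R gB x"
    unfolding Gal_def fst_conv snd_conv Gam_abar[OF x] by (simp add: vec_eq_iff field_simps)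
  have alg: "G + (2 / B * ((c + d * B\<^sup>2) / B * bu - 2 / B * su)) *\<^sub>R y - (1 / B * yy) *\<^sub>R (((c + d * B\<^sup>2) / B) *\<^sub>R z - (2 / B) *\<^sub>R s)
     + (((3 * c + 2 * d * B\<^sup>2) / B ^ 3 / 3 * (B\<^sup>2 * A - 2 * B * bu)) *\<^sub>R y + ((3 * c + 2 * d * B\<^sup>2) / B ^ 3 / 3 * B * yy) *\<^sub>R z)
   = G + ((((2/3 * d) * bu - (4 / B\<^sup>2) * su) + (c + 2/3 * d * B\<^sup>2) / B * A) *\<^sub>R y - (1/2 * yy) *\<^sub>R ((2/3 * d) *\<^sub>R z - (4 / B\<^sup>2) *\<^sub>R s))"
    if "B > 0" for B c d A bu su yy :: real and G y z s :: "real^'n"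
    using that by (simp add: vec_eq_iff field_simps) (simp add: eval_nat_numeral algebra_simps)
  show ?thesis
    unfolding G D struct_gB[OF x st] \<tau>_def alg[OF B] weyl_def fst_conv snd_conv wform_def wkap_def
    by (simp add: ip_lin)
qed

end

lemma axis_expansion: "(u :: real^'n::finite) = (\<Sum>i\<in>UNIV. u $ i *\<^sub>R axis i 1)"
  using basis_expansion[of u] by (simp add: scalar_mult_eq_scaleR)

lemma linear_axis_eqI:
  fixes f g :: "real^'n::finite \<Rightarrow> 'b::real_vector"
  assumes "linear f" "linear g" "\<And>i. f (axis i 1) = g (axis i 1)"
  shows "f u = g u"
  by (subst (1 2) axis_expansion[of u]) (simp add: linear_sum[OF assms(1)] linear_sum[OF assms(2)] linear_scale[OF assms(1)] linear_scale[OF assms(2)] assms(3))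

context chart_metric
begin

lemma bounded_linear_cov: "\<nu> differentiable (at x) \<Longrightarrow> bounded_linear (cov a \<nu> x)"
  unfolding cov_def by (intro bounded_linear_add bounded_linear_dd Gam.bounded_linear_left)

lemma cov_scaleR:
  "f differentiable (at x) \<Longrightarrow> \<nu> differentiable (at x) \<Longrightarrow>
    cov a (\<lambda>x. f x *\<^sub>R \<nu> x) x u = dd u f x *\<^sub>R \<nu> x + f x *\<^sub>R cov a \<nu> x u"
  unfolding cov_def by (simp add: dd_scaleR Gam_lin algebra_simps)

lemma cov_subtract:
  "\<mu> differentiable (at x) \<Longrightarrow> \<nu> differentiable (at x) \<Longrightarrow>
    cov a (\<lambda>x. \<mu> x - \<nu> x) x u = cov a \<mu> x u - cov a \<nu> x u"
  unfolding cov_def by (simp add: dd_diff Gam_lin algebra_simps)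

end

section \<open>From constant flag curvature to the structure equation\<close>

context sq_chart
begin

abbreviation "FF \<equiv> singular_square a b"
abbreviation "GF \<equiv> \<lambda>q. Gal abar q + N.DF q"
abbreviation "ss \<equiv> raise a (s_form a b)"

lemma sm_GF: "sm N.\<Omega> GF"
  by (intro sm_add N.open_\<Omega> N.sm_D N.sm_Gal) (auto dest: N.\<Omega>_D)

lemma FF_pd:
  assumes q: "(x, y) \<in> N.\<Omega>0"
  shows "FF x y * pd k (FF x) y = 1/2 * dd (0, axis k 1) (Lag FF) (x, y)"
proof -
  have "sm N.\<Omega>0 (\<lambda>q. (N.\<alpha>\<^sub>f q + N.\<beta>\<^sub>f q)\<^sup>2 / N.\<alpha>\<^sub>f q)"
    using N.\<Omega>0_D N.alpha_nz by (intro sm_divide sm_power sm_add N.sm_alpha N.sm_beta N.open_\<Omega>0) auto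
  then have "sm N.\<Omega>0 (\<lambda>q. FF (fst q) (snd q))"
    by (rule sm_cong[OF N.open_\<Omega>0, rotated]) (use N.F_eq N.\<Omega>0_D in auto)
  from sm_diff_at[OF this q] have D: "(\<lambda>q. FF (fst q) (snd q)) differentiable (at (x, y))" .
  have "pd k (FF x) y = dd (0, axis k 1) (\<lambda>q. FF (fst q) (snd q)) (x, y)"
    by (rule pd_slice_snd[OF N.open_\<Omega>0 q _ D, of FF]) simp
  then show ?thesis unfolding Lag_def[abs_def] by (simp add: dd_power2[OF D])
qed

text \<open>Both sides are linear in the lower index, so coordinate vectors decide, and the
  nondegenerate directions are exactly those of \<open>N.\<Omega>\<close>.\<close>

lemma constant_flag_curvature_iff_cfc:
  assumes n: "CARD('n) \<ge> 3"
  shows "(\<forall>x\<in>U. \<forall>y. y \<noteq> 0 \<longrightarrow> invertible (fund_tensor FF x y) \<longrightarrow>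
      (\<forall>i k. riemann FF x y i k = K * ((FF x y)\<^sup>2 * kdelta i k - FF x y * y $ i * pd k (\<lambda>w. FF x w) y)))
    \<longleftrightarrow> N.cfc K"
proof -
  have \<Omega>: "(x, y) \<in> N.\<Omega> \<longleftrightarrow> x \<in> U \<and> y \<noteq> 0 \<and> invertible (fund_tensor FF x y)" for x y
    using N.invertible_fund_tensor_iff[of x y] N.\<Omega>_D[of "(x, y)"] n by (auto simp: N.\<Omega>_def)
  have "(\<forall>i k. riemann FF x y i k = K * ((FF x y)\<^sup>2 * kdelta i k - FF x y * y $ i * pd k (\<lambda>w. FF x w) y))
    \<longleftrightarrow> (\<forall>w. RR GF w (x, y) = K *\<^sub>R ((FF x y)\<^sup>2 *\<^sub>R w - (1/2 * dd (0, w) (Lag FF) (x, y)) *\<^sub>R y))"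
    (is "?l \<longleftrightarrow> (\<forall>w. _ = ?r w)") if q: "(x, y) \<in> N.\<Omega>" for x y
  proof -
    have q0: "(x, y) \<in> N.\<Omega>0" using q N.\<Omega>_subset by blast
    have R: "riemann FF x y i k = RR GF (axis k 1) (x, y) $ i" for i k
      by (rule riemann_eq_RR[OF N.open_\<Omega> q sm_GF]) (use N.spray_F n in auto)
    have r: "K * ((FF x y)\<^sup>2 * kdelta i k - FF x y * y $ i * pd k (\<lambda>w. FF x w) y) = ?r (axis k 1) $ i" for i k
      using FF_pd[OF q0, of k] by (simp add: kdelta_def axis_def algebra_simps)
    have LD: "Lag FF differentiable (at (x, y))" by (rule sm_diff_at[OF N.sm_Lag_F q0])
    have lr: "linear ?r"
      by (rule linearI) (simp_all add: dd_snd_add[OF LD] dd_snd_scale[OF LD] algebra_simps)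
    have "?l \<longleftrightarrow> (\<forall>k. RR GF (axis k 1) (x, y) = ?r (axis k 1))" unfolding R r vec_eq_iff by blast
    also have "\<dots> \<longleftrightarrow> (\<forall>w. RR GF w (x, y) = ?r w)"
      using linear_axis_eqI[OF linear_RR[OF N.open_\<Omega> q sm_GF] lr] by blast
    finally show ?thesis .
  qed
  then show ?thesis unfolding N.cfc_def using \<Omega> by blast
qed

lemma bounded_linear_cov_bs: "x \<in> U \<Longrightarrow> bounded_linear (cov a bs x)"
  by (rule bounded_linear_cov[OF sm_diff_at[OF sm_bs]])

lemma s_form_nth:
  assumes x: "x \<in> U"
  shows "s_form a b x $ i = 1/2 * (ip a x (cov a bs x (axis i 1)) (bs x) - ip a x (cov a bs x (bs x)) (axis i 1))"
proof -
  interpret c: bounded_linear "cov a bs x" by (rule bounded_linear_cov_bs[OF x])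
  have "s_form a b x $ i = 1/2 * ((\<Sum>m\<in>UNIV. bs x $ m * ip a x (cov a bs x (axis i 1)) (axis m 1))
      - (\<Sum>m\<in>UNIV. bs x $ m * ip a x (cov a bs x (axis m 1)) (axis i 1)))"
    unfolding s_form_def s_tensor_def cov_lower_eq[OF x sm_b]
    by (simp add: sum_distrib_left right_diff_distrib sum_subtractf mult_ac)
  also have "(\<Sum>m\<in>UNIV. bs x $ m * ip a x (cov a bs x (axis i 1)) (axis m 1)) = ip a x (cov a bs x (axis i 1)) (bs x)"
    by (subst (3) axis_expansion) (simp add: ip.sum_right ip_lin)
  also have "(\<Sum>m\<in>UNIV. bs x $ m * ip a x (cov a bs x (axis m 1)) (axis i 1)) = ip a x (cov a bs x (bs x)) (axis i 1)"
    by (subst (4) axis_expansion) (simp add: c.sum c.scaleR ip.sum_left ip_lin)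
  finally show ?thesis .
qed

lemma ip_ss:
  assumes x: "x \<in> U"
  shows "ip a x (ss x) u = 1/2 * (ip a x (cov a bs x u) (bs x) - ip a x (cov a bs x (bs x)) u)"
proof (rule linear_axis_eqI[of "ip a x (ss x)"])
  interpret c: bounded_linear "cov a bs x" by (rule bounded_linear_cov_bs[OF x])
  show "linear (\<lambda>u. 1/2 * (ip a x (cov a bs x u) (bs x) - ip a x (cov a bs x (bs x)) u))"
    by (rule linearI) (simp_all add: c.add c.scaleR ip_lin algebra_simps)
  show "linear (ip a x (ss x))" by (simp add: bounded_linear.linear ip.bounded_linear_right)
qed (simp add: raise_ip[OF x] s_form_nth[OF x])

lemma ip_ss_bs: "x \<in> U \<Longrightarrow> ip a x (ss x) (bs x) = 0"
  by (simp add: ip_ss)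

lemma sm_s_form: "sm U (s_form a b)"
proof (rule sm_cvec)
  show "sm U (\<lambda>x. s_form a b x $ i)" for i
    by (rule sm_cong[OF open_U s_form_nth[symmetric]])
      (assumption | intro sm_mult sm_diff sm_const sm_ip_base sm_cov sm_bs open_U)+
qed

lemma sm_ss: "sm U ss"
  by (rule sm_raise[OF sm_s_form])

text \<open>Undoes the conformal change in the umbilicity equation of the unit form. The gradient of
  B, which then appears, is expressed by b and s_i.\<close>

lemma struct_exists:
  assumes K: "N.cfc K" and n: "CARD('n) \<ge> 3"
  obtains c d where "sm U c" "sm U d" "\<And>x. x \<in> U \<Longrightarrow> struct (c x) (d x) (ss x) x"
proof -
  let ?\<epsilon> = "\<lambda>x. dd (bs x) BB x / (BB x)\<^sup>2" and ?\<tau> = "N.\<tau>\<^sub>f"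
  \<comment> \<open>The solutions of \<tau> B^3 = 3 c + 2 d B^2 and \<epsilon> B = c + d B^2. The
    first equation is dictated by \<open>struct_cov_abar\<close>, the second by the derivative of B
    along b in \<open>struct_gB\<close>.\<close>
  let ?c = "\<lambda>x. (?\<tau> x * (BB x) ^ 4 - 2 * ?\<epsilon> x * (BB x)\<^sup>2) / BB x"
  let ?d = "\<lambda>x. (3 * ?\<epsilon> x - ?\<tau> x * (BB x)\<^sup>2) / BB x"
  have nz: "BB x \<noteq> 0" if "x \<in> U" for x using BB_pos[OF that] by simp
  have \<epsilon>: "sm U ?\<epsilon>"
    by (intro sm_divide sm_dd_var sm_BB sm_bs sm_power open_U) (use nz in auto)
  have "struct (?c x) (?d x) (ss x) x" if x: "x \<in> U" for x
  proof -
    let ?g = "ip a x" and ?B = "BB x"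
    define e where "e = dd (bs x) BB x / ?B\<^sup>2"
    define t where "t = ?\<tau> x"
    have B: "?B > 0" by (rule BB_pos[OF x])
    have e: "dd (bs x) BB x = e * ?B\<^sup>2" unfolding e_def using B by simp
    have alg: "C = (t * B ^ 3) *\<^sub>R u - (t * B * bu) *\<^sub>R z + (du / B) *\<^sub>R z - (2 * e * B) *\<^sub>R u + (2 / B * bu) *\<^sub>R k"
      if "(1 / B ^ 3) *\<^sub>R (C - (du / B) *\<^sub>R z + (2 / B) *\<^sub>R ((e * B\<^sup>2) *\<^sub>R u - bu *\<^sub>R k)) = t *\<^sub>R (u - (B ^ 4 * (1 / B ^ 3 * bu)) *\<^sub>R ((1 / B ^ 3) *\<^sub>R z))" "B > 0"
      for B bu du t e :: real and C u z k :: "real^'n"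
    proof -
      have "C - (du / B) *\<^sub>R z + (2 / B) *\<^sub>R ((e * B\<^sup>2) *\<^sub>R u - bu *\<^sub>R k) = B ^ 3 *\<^sub>R (t *\<^sub>R (u - (B ^ 4 * (1 / B ^ 3 * bu)) *\<^sub>R ((1 / B ^ 3) *\<^sub>R z)))"
        unfolding that(1)[symmetric] using that(2) by simp
      then show ?thesis using that(2) by (simp add: vec_eq_iff field_simps eval_nat_numeral)
    qed
    have cov: "cov a bs x u = (t * ?B ^ 3) *\<^sub>R u - (t * ?B * ?g (bs x) u) *\<^sub>R bs x + (dd u BB x / ?B) *\<^sub>R bs x
        - (2 * e * ?B) *\<^sub>R u + (2 / ?B * ?g (bs x) u) *\<^sub>R gB x" for u
      by (rule alg[OF _ B])
        (use cov_abar_bbar[OF x, of u] N.cov_bv_\<tau>[OF K n x, of u] e ip_sym[OF x, of u "bs x"] in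
          \<open>simp add: t_def ip_abar bbar_def ip_lin\<close>)
    have s: "?g (ss x) u = 1/2 * (e * ?B * ?g (bs x) u - ?B * dd u BB x)" for u
    proof -
      have 1: "?g (cov a bs x u) (bs x) = ?B * dd u BB x" using dd_BB[OF x, of u] B by simp
      have 2: "cov a bs x (bs x) = - (e * ?B) *\<^sub>R bs x + (2 * ?B) *\<^sub>R gB x"
        unfolding cov BB_sq[OF x] e using B by (simp add: vec_eq_iff field_simps eval_nat_numeral)
      show ?thesis unfolding ip_ss[OF x] 1 2 by (simp add: ip_lin ip_gB[OF x] algebra_simps)
    qed
    \<comment> \<open>The formula for s_i, solved for the gradient of B.\<close>
    have gB: "gB x = e *\<^sub>R bs x - (2 / ?B) *\<^sub>R ss x"
      by (rule ip_eqI[OF x]) (use B in \<open>simp add: ip_gB[OF x] ip_lin s field_simps\<close>)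
    have du: "dd u BB x = e * ?g (bs x) u - 2 / ?B * ?g (ss x) u" for u
      unfolding ip_gB[OF x, symmetric] gB by (simp add: ip_lin)
    show ?thesis
      unfolding struct_def t_def[symmetric] e_def[symmetric] unfolding cov gB du using B
      by (simp add: ip_ss_bs[OF x] vec_eq_iff field_simps) (simp add: eval_nat_numeral algebra_simps)
  qed
  moreover have "sm U ?c" "sm U ?d"
    by (intro sm_divide sm_diff sm_mult sm_const sm_power sm_BB \<epsilon> N.sm_\<tau>[OF K n] open_U nz; assumption)+
  ultimately show ?thesis using that by blast
qed

text \<open>The two families of equations are the symmetric and the skew part of a single one for
  the covariant derivative of b.\<close>

lemma struct_iff:
  assumes x: "x \<in> U"
  shows "struct c d (ss x) x \<longleftrightarrow>
    (\<forall>i j. r_tensor a b x i j = c * a x $ i $ j + d * b x $ i * b x $ j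
       - 3 / (BB x)\<^sup>2 * (b x $ i * s_form a b x $ j + b x $ j * s_form a b x $ i)) \<and>
    (\<forall>i j. s_tensor a b x i j = 1 / (BB x)\<^sup>2 * (b x $ i * s_form a b x $ j - b x $ j * s_form a b x $ i))"
    (is "?l \<longleftrightarrow> (\<forall>i j. _ = ?r i j) \<and> (\<forall>i j. _ = ?s i j)")
proof -
  let ?C = "\<lambda>u. c *\<^sub>R u + (d * ip a x (bs x) u) *\<^sub>R bs x - (2 / (BB x)\<^sup>2 * ip a x (ss x) u) *\<^sub>R bs x
      - (4 / (BB x)\<^sup>2 * ip a x (bs x) u) *\<^sub>R ss x"
  have lC: "linear ?C" by (rule linearI) (simp_all add: ip_lin algebra_simps)
  have lc: "linear (cov a bs x)" by (rule bounded_linear.linear[OF bounded_linear_cov_bs[OF x]])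
  have ax: "ip a x (axis i 1) (axis j 1) = a x $ i $ j" for i j by (simp add: ip_def)
  have C: "ip a x (?C (axis j 1)) (axis i 1) = ?r i j + ?s i j" for i j
    by (simp add: ip_lin raise_ip[OF x] ax a_sym[OF x, of j i] add_divide_distrib algebra_simps)
  have rs: "?r i j = ?r j i" "?s i j = - ?s j i" for i j
    using a_sym[OF x, of i j] by (simp_all add: algebra_simps)
  have "?l \<longleftrightarrow> (\<forall>u. cov a bs x u = ?C u)" unfolding struct_def by (simp add: ip_ss_bs[OF x])
  also have "\<dots> \<longleftrightarrow> (\<forall>j. cov a bs x (axis j 1) = ?C (axis j 1))"
    using linear_axis_eqI[OF lc lC] by blast
  also have "\<dots> \<longleftrightarrow> (\<forall>i j. ip a x (cov a bs x (axis j 1)) (axis i 1) = ip a x (?C (axis j 1)) (axis i 1))"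
  proof -
    have "u = v \<longleftrightarrow> (\<forall>i. ip a x u (axis i 1) = ip a x v (axis i 1))" for u v
      using ip_eqI[OF x, of u v] linear_axis_eqI[of "ip a x u" "ip a x v"]
      by (auto simp: bounded_linear.linear ip.bounded_linear_right)
    then show ?thesis by blast
  qed
  also have "\<dots> \<longleftrightarrow> (\<forall>i j. cov_lower a b x i j = ?r i j + ?s i j)"
    unfolding C cov_lower_eq[OF x sm_b] ..
  also have "\<dots> \<longleftrightarrow> (\<forall>i j. r_tensor a b x i j = ?r i j) \<and> (\<forall>i j. s_tensor a b x i j = ?s i j)"
  proof (intro iffI conjI allI)
    fix i j assume h: "\<forall>i j. cov_lower a b x i j = ?r i j + ?s i j"
    have 1: "cov_lower a b x i j = ?r i j + ?s i j" using h by blast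
    have 2: "cov_lower a b x j i = ?r i j + - ?s i j" unfolding rs(1)[of i j] rs(2)[of i j] minus_minus using h by blast
    have alg: "1/2 * ((R + S) + (R + - S)) = R" "1/2 * ((R + S) - (R + - S)) = S" for R S :: real by simp_all
    show "r_tensor a b x i j = ?r i j" "s_tensor a b x i j = ?s i j"
      unfolding r_tensor_def s_tensor_def 1 2 by (rule alg)+
  next
    fix i j assume h: "(\<forall>i j. r_tensor a b x i j = ?r i j) \<and> (\<forall>i j. s_tensor a b x i j = ?s i j)"
    have "cov_lower a b x i j = r_tensor a b x i j + s_tensor a b x i j" unfolding r_tensor_def s_tensor_def by (simp add: field_simps)
    then show "cov_lower a b x i j = ?r i j + ?s i j" using h by presburger
  qed
  finally show ?thesis .
qed

end

section \<open>The curvature equation\<close>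

context chart_metric
begin

text \<open>The lowered Riemann tensor that makes the spray of \<open>weyl m \<kappa>\<close> flat when \<open>m\<close> is closed,
  written so that it is symmetric in \<open>w\<close> and \<open>z\<close>.\<close>

definition symform :: "'n cvec \<Rightarrow> (real^'n \<Rightarrow> real) \<Rightarrow> real^'n \<Rightarrow> real^'n \<Rightarrow> real^'n \<Rightarrow> real^'n \<Rightarrow> real" where
  "symform m \<kappa> x y w z = (let g = ip a x; \<mu> = g (m x); C = cov a m x; L = g (m x) (m x) - (\<kappa> x)\<^sup>2 in
     (g (C y) y - (\<mu> y)\<^sup>2 + g y y * L) * g w z - (g (C y) w - \<mu> y * \<mu> w + L * g w y) * g y z
     + g y y * (1/2 * (g (C w) z + g (C z) w) - \<mu> w * \<mu> z) - g w y * (g (C y) z - \<mu> y * \<mu> z))"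

text \<open>Only the skew part of the covariant derivative of m is left for z = y. As the Riemann
  tensor of \<alpha> is orthogonal to y, the curvature equation forces m to be closed.\<close>

lemma symform_transvection:
  assumes x: "x \<in> U"
  shows "symform m \<kappa> x y w y = 1/2 * ip a x y y * (ip a x (cov a m x w) y - ip a x (cov a m x y) w)"
  using ip_sym[OF x, of w y] by (simp add: symform_def Let_def field_simps power2_eq_square)

end

text \<open>Matches the prescribed tensor with \<open>symform\<close>, given the structure equation
  N and the derivative dB. The letters C and S stand for the covariant derivatives of m and of s^i.
  In terms of r = 1/B^2 both sides become polynomials.\<close>

lemma curvature_algebra:
  fixes B :: real
  assumes B: "B > 0" and r: "r = 1 / B\<^sup>2" and t: "t = - ss"
    and C: "\<And>u v. C u v = 2/3 * (du u * b v) + 2/3 * (d * N u v) + 8 / B ^ 3 * dB u * s v - 4 / B\<^sup>2 * S u v"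
    and N: "\<And>u v. N u v = c * g u v + d * b u * b v - 2 / B\<^sup>2 * s u * b v - 4 / B\<^sup>2 * b u * s v"
    and dB: "\<And>u. dB u = (c + d * B\<^sup>2) / B * b u - 2 / B * s u"
    and \<mu>: "\<And>u. \<mu> u = 2/3 * d * b u - 4 / B\<^sup>2 * s u"
    and L: "L = 4/9 * d\<^sup>2 * B\<^sup>2 + 16 / B ^ 4 * ss - ((c + 2/3 * d * B\<^sup>2) / B)\<^sup>2"
    and g: "g w y = g y w" "g z w = g w z" "g z y = g y z"
  shows "- (1 / (9 * B ^ 4)) *
     (((9 * B\<^sup>2 * c\<^sup>2 + 144 * t) * g y y - 2 * B ^ 4 * d\<^sup>2 * (b y)\<^sup>2
         - 6 * (B ^ 4 * du y + 12 * c * s y + 14 * B\<^sup>2 * d * s y) * b y + 288 * (s y)\<^sup>2 + 36 * B\<^sup>2 * S y y) * g w z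
       - (9 * B\<^sup>2 * c\<^sup>2 + 144 * t) * (g y w * g y z)
       + 2 * B\<^sup>2 * (B\<^sup>2 * d\<^sup>2 * b y + 3 * B\<^sup>2 * du y + 6 * d * s y) * (b w * g y z + g y w * b z)
       - 2 * B ^ 4 * d\<^sup>2 * g y y * (b w * b z)
       - 3 * B ^ 4 * g y y * (du w * b z + b w * du z)
       - 6 * g y y * (6 * c + 7 * B\<^sup>2 * d) * (s w * b z + b w * s z)
       + 72 * ((c + B\<^sup>2 * d) * b y - 4 * s y) * (s w * g y z + g y w * s z)
       + 288 * g y y * (s w * s z)
       - 36 * B\<^sup>2 * (S y w * g y z + g y w * S y z)
       + 18 * B\<^sup>2 * g y y * (S w z + S z w))
   = (C y y - (\<mu> y)\<^sup>2 + g y y * L) * g w z - (C y w - \<mu> y * \<mu> w + L * g w y) * g y z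
     + g y y * (1/2 * (C w z + C z w) - \<mu> w * \<mu> z) - g w y * (C y z - \<mu> y * \<mu> z)" (is "?l = ?r")
proof -
  have C': "C u v = 2/3 * du u * b v + 2/3 * c * d * g u v + 2/3 * d\<^sup>2 * b u * b v - 4/3 * d * r * s u * b v
      + (16/3 * d * r + 8 * c * r\<^sup>2) * b u * s v - 16 * r\<^sup>2 * s u * s v - 4 * r * S u v" for u v
    unfolding C N dB r using B by (simp add: field_simps) (simp add: eval_nat_numeral algebra_simps)
  have L': "L = 16 * r\<^sup>2 * ss - c\<^sup>2 * r - 4/3 * c * d"
    unfolding L r using B by (simp add: field_simps) (simp add: eval_nat_numeral algebra_simps)
  have \<mu>': "\<mu> u = 2/3 * d * b u - 4 * r * s u" for u unfolding \<mu> r by simp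
  have "?l = - ((c\<^sup>2 * r - 16 * r\<^sup>2 * ss) * g y y - 2/9 * d\<^sup>2 * (b y)\<^sup>2
         - 2/3 * (du y + 12 * c * r\<^sup>2 * s y + 14 * d * r * s y) * b y + 32 * r\<^sup>2 * (s y)\<^sup>2 + 4 * r * S y y) * g w z
       + (c\<^sup>2 * r - 16 * r\<^sup>2 * ss) * (g y w * g y z)
       - 2/9 * (d\<^sup>2 * b y + 3 * du y + 6 * d * r * s y) * (b w * g y z + g y w * b z)
       + 2/9 * d\<^sup>2 * g y y * (b w * b z)
       + 1/3 * g y y * (du w * b z + b w * du z)
       + 2/3 * g y y * (6 * c * r\<^sup>2 + 7 * d * r) * (s w * b z + b w * s z)
       - 8 * ((c * r\<^sup>2 + d * r) * b y - 4 * r\<^sup>2 * s y) * (s w * g y z + g y w * s z)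
       - 32 * r\<^sup>2 * g y y * (s w * s z)
       + 4 * r * (S y w * g y z + g y w * S y z)
       - 2 * r * g y y * (S w z + S z w)"
    unfolding r t using B by (simp add: field_simps) (simp add: eval_nat_numeral algebra_simps)
  also have "\<dots> = ?r"
    unfolding C' L' \<mu>' g by (simp add: field_simps power2_eq_square)
  finally show ?thesis .
qed

section \<open>The prescribed curvature without indices\<close>

context sq_chart
begin

text \<open>The adjoint of the covariant derivative of s^i; it represents s_k with its raised
  derivative index, contracted with w.\<close>

definition \<sigma>T :: "real^'n \<Rightarrow> real^'n \<Rightarrow> real^'n" where
  "\<sigma>T x w = sharp a x (\<chi> j. ip a x (cov a ss x (axis j 1)) w)"

definition grad :: "(real^'n \<Rightarrow> real) \<Rightarrow> real^'n \<Rightarrow> real^'n" where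
  "grad f x = raise a (gradient_form f) x"

definition presc_vec :: "real \<Rightarrow> (real^'n \<Rightarrow> real) \<Rightarrow> real^'n \<Rightarrow> real^'n \<Rightarrow> real^'n \<Rightarrow> real^'n" where
  "presc_vec c df x y w = (let g = ip a x; B = BB x; d = df x; \<beta> = g (bs x); s = g (ss x); t = - g (ss x) (ss x);
      du = (\<lambda>u. dd u df x); S = cov a ss x in
   (- (1 / (9 * B ^ 4))) *\<^sub>R
     (((9 * B\<^sup>2 * c\<^sup>2 + 144 * t) * g y y - 2 * B ^ 4 * d\<^sup>2 * (\<beta> y)\<^sup>2
         - 6 * (B ^ 4 * du y + 12 * c * s y + 14 * B\<^sup>2 * d * s y) * \<beta> y + 288 * (s y)\<^sup>2 + 36 * B\<^sup>2 * g (S y) y) *\<^sub>R w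
       - (9 * B\<^sup>2 * c\<^sup>2 + 144 * t) *\<^sub>R (g y w *\<^sub>R y)
       + (2 * B\<^sup>2 * (B\<^sup>2 * d\<^sup>2 * \<beta> y + 3 * B\<^sup>2 * du y + 6 * d * s y)) *\<^sub>R (\<beta> w *\<^sub>R y + g y w *\<^sub>R bs x)
       - (2 * B ^ 4 * d\<^sup>2 * g y y) *\<^sub>R (\<beta> w *\<^sub>R bs x)
       - (3 * B ^ 4 * g y y) *\<^sub>R (du w *\<^sub>R bs x + \<beta> w *\<^sub>R grad df x)
       - (6 * g y y * (6 * c + 7 * B\<^sup>2 * d)) *\<^sub>R (s w *\<^sub>R bs x + \<beta> w *\<^sub>R ss x)
       + (72 * ((c + B\<^sup>2 * d) * \<beta> y - 4 * s y)) *\<^sub>R (s w *\<^sub>R y + g y w *\<^sub>R ss x)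
       + (288 * g y y) *\<^sub>R (s w *\<^sub>R ss x)
       - (36 * B\<^sup>2) *\<^sub>R (g (S y) w *\<^sub>R y + g y w *\<^sub>R S y)
       + (18 * B\<^sup>2 * g y y) *\<^sub>R (S w + \<sigma>T x w)))"

lemma ip_\<sigma>T: "x \<in> U \<Longrightarrow> ip a x (\<sigma>T x w) z = ip a x (cov a ss x z) w"
proof -
  assume x: "x \<in> U"
  interpret c: bounded_linear "cov a ss x" by (rule bounded_linear_cov[OF sm_diff_at[OF sm_ss x]])
  have l: "linear (\<lambda>z. ip a x (cov a ss x z) w)" by (rule linearI) (simp_all add: c.add c.scaleR ip_lin)
  show ?thesis
    by (rule linear_axis_eqI[OF bounded_linear.linear[OF ip.bounded_linear_right] l])
      (simp add: \<sigma>T_def ip_sharp[OF x] inner_axis)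
qed

lemma gradient_form_inner:
  "f differentiable (at x) \<Longrightarrow> gradient_form f x \<bullet> u = dd u f x"
  by (simp add: gradient_form_def dd_eq_sum_axis[of f x u] pd_eq_dd inner_vec_def mult.commute)

lemma ip_grad: "x \<in> U \<Longrightarrow> f differentiable (at x) \<Longrightarrow> ip a x (grad f x) u = dd u f x"
  by (simp add: grad_def ip_raise gradient_form_inner)

text \<open>Contracting the first factor of t_ij with b gives s_m, and by skew symmetry contracting
  the second one gives - s^m.\<close>

lemma t_scalar_eq: "x \<in> U \<Longrightarrow> t_scalar a b x = - ip a x (ss x) (ss x)"
proof -
  assume x: "x \<in> U"
  let ?s = "s_tensor a b x" and ?f = "s_form a b x"
  have anti: "?s i j = - ?s j i" for i j by (simp add: s_tensor_def field_simps)
  have 1: "(\<Sum>i\<in>UNIV. bs x $ i * ?s i m) = ?f $ m" for m by (simp add: s_form_def)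
  have 2: "(\<Sum>j\<in>UNIV. ?s l j * bs x $ j) = - ?f $ l" for l
    unfolding 1[symmetric] sum_negf[symmetric] by (rule sum.cong) (auto simp: anti[of l])
  have "t_scalar a b x = (\<Sum>i\<in>UNIV. \<Sum>j\<in>UNIV. \<Sum>m\<in>UNIV. \<Sum>l\<in>UNIV. (bs x $ i * ?s i m) * (upper a x m l * (?s l j * bs x $ j)))"
    unfolding t_scalar_def t_tensor_def by (simp add: sum_distrib_left sum_distrib_right mult_ac)
  also have "\<dots> = (\<Sum>m\<in>UNIV. \<Sum>i\<in>UNIV. \<Sum>l\<in>UNIV. \<Sum>j\<in>UNIV. (bs x $ i * ?s i m) * (upper a x m l * (?s l j * bs x $ j)))"
  proof -
    have "(\<Sum>j\<in>UNIV. \<Sum>m\<in>UNIV. \<Sum>l\<in>UNIV. h j m l) = (\<Sum>m\<in>UNIV. \<Sum>l\<in>UNIV. \<Sum>j\<in>UNIV. h j m l)" for h :: "'n \<Rightarrow> 'n \<Rightarrow> 'n \<Rightarrow> real"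
    proof -
      have "(\<Sum>j\<in>UNIV. \<Sum>m\<in>UNIV. \<Sum>l\<in>UNIV. h j m l) = (\<Sum>m\<in>UNIV. \<Sum>j\<in>UNIV. \<Sum>l\<in>UNIV. h j m l)" by (rule sum.swap)
      also have "\<dots> = (\<Sum>m\<in>UNIV. \<Sum>l\<in>UNIV. \<Sum>j\<in>UNIV. h j m l)" by (rule sum.cong[OF refl]) (rule sum.swap)
      finally show ?thesis .
    qed
    note swap = this
    show ?thesis by (rule trans[OF sum.cong[OF refl swap] sum.swap])
  qed
  also have "\<dots> = (\<Sum>m\<in>UNIV. ?f $ m * (\<Sum>l\<in>UNIV. upper a x m l * - ?f $ l))"
    by (simp only: sum_distrib_left[symmetric] sum_distrib_right[symmetric] 1 2)
  also have "\<dots> = - (?f \<bullet> ss x)"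
    by (simp add: inner_vec_def raise_def sum_negf)
  finally show ?thesis by (simp add: ip_raise[OF x])
qed

lemma prescribed_eq:
  assumes x: "x \<in> U" and d: "sm U d"
  shows "prescribed_curvature a b c d x y i k = presc_vec (c x) d x y (axis k 1) $ i"
proof -
  let ?g = "ip a x"
  interpret S: bounded_linear "cov a ss x" by (rule bounded_linear_cov[OF sm_diff_at[OF sm_ss x]])
  have D: "d differentiable (at x)" by (rule sm_diff_at[OF d x])
  have Sll: "cov_lower a (s_form a b) x i j = ?g (cov a ss x (axis j 1)) (axis i 1)" for i j
    by (rule cov_lower_eq[OF x sm_s_form])
  have Sul: "cov_upper a ss x i j = cov a ss x (axis j 1) $ i" for i j
    by (rule cov_upper_eq[OF x sm_ss])
  have yl: "(\<Sum>j\<in>UNIV. a x $ k $ j * y $ j) = ?g y (axis k 1)" for k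
  proof -
    have "?g (axis k 1) y = ?g (axis k 1) (\<Sum>j\<in>UNIV. y $ j *\<^sub>R axis j 1)" using axis_expansion[of y] by simp
    also have "\<dots> = (\<Sum>j\<in>UNIV. a x $ k $ j * y $ j)"
      by (simp add: ip.sum_right ip_lin) (simp add: ip_def mult.commute)
    finally show ?thesis by (simp add: ip_sym[OF x, of y])
  qed
  have d0: "(\<Sum>j\<in>UNIV. gradient_form d x $ j * y $ j) = dd y d x"
    using gradient_form_inner[OF D, of y] by (simp add: inner_vec_def)
  have s0: "(\<Sum>j\<in>UNIV. s_form a b x $ j * y $ j) = ?g (ss x) y"
    by (simp add: ip_raise[OF x] inner_vec_def)
  have Cy: "cov a ss x y = (\<Sum>j\<in>UNIV. y $ j *\<^sub>R cov a ss x (axis j 1))"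
    by (subst axis_expansion) (simp add: S.sum S.scaleR)
  have Sl0: "(\<Sum>j\<in>UNIV. cov_lower a (s_form a b) x k j * y $ j) = ?g (cov a ss x y) (axis k 1)" for k
    unfolding Sll Cy by (simp add: ip.sum_left ip_lin mult.commute)
  have S00: "(\<Sum>i\<in>UNIV. \<Sum>j\<in>UNIV. cov_lower a (s_form a b) x i j * y $ i * y $ j) = ?g (cov a ss x y) y"
  proof -
    have "(\<Sum>i\<in>UNIV. \<Sum>j\<in>UNIV. cov_lower a (s_form a b) x i j * y $ i * y $ j)
        = (\<Sum>i\<in>UNIV. y $ i * (\<Sum>j\<in>UNIV. cov_lower a (s_form a b) x i j * y $ j))"
      by (simp add: sum_distrib_left mult_ac)
    also have "\<dots> = ?g (cov a ss x y) y"
      unfolding Sl0 by (subst (4) axis_expansion) (simp add: ip.sum_right ip_lin)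
    finally show ?thesis .
  qed
  have Su0: "(\<Sum>j\<in>UNIV. cov_upper a ss x i j * y $ j) = cov a ss x y $ i" for i
    unfolding Sul Cy by (simp add: mult.commute)
  have Slu: "(\<Sum>j\<in>UNIV. upper a x i j * cov_lower a (s_form a b) x k j) = \<sigma>T x (axis k 1) $ i" for i k
    unfolding Sll \<sigma>T_def sharp_def by (simp add: Lin_def mult.commute)
  have du: "gradient_form d x $ k = dd (axis k 1) d x" for k
    using gradient_form_inner[OF D, of "axis k 1"] by (simp add: inner_axis)
  have k: "kdelta i k = axis k 1 $ i" by (simp add: kdelta_def axis_def)
  have by': "beta b x y = ?g (bs x) y" by (rule beta_eq[OF x])
  have bk: "b x $ k = ?g (bs x) (axis k 1)" and sk: "s_form a b x $ k = ?g (ss x) (axis k 1)" for k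
    by (simp_all add: raise_ip[OF x])
  show ?thesis
    unfolding prescribed_curvature_def Let_def Sl0 S00 Su0 Slu yl d0 s0 t_scalar_eq[OF x] by' alpha_sq[OF x] k
    unfolding Sul du bk sk presc_vec_def Let_def grad_def
    by (simp add: mult.commute)
qed

end

section \<open>Equivalence of flatness and prescribed curvature\<close>

context sq_chart
begin

lemma hh_eq: "x \<in> U \<Longrightarrow> N.hh (x, y) = (BB x) ^ 4 * ip a x y y - (BB x)\<^sup>2 * (ip a x (bs x) y)\<^sup>2"
  using BB_pos[of x] by (simp add: N.hh_def ip_abar bbar_def ip_lin field_simps eval_nat_numeral)

text \<open>Moving along a unit vector orthogonal to b, with its sign chosen so that <\<eta>, y> is
  nonnegative, increases \<open>hh\<close>. Hence every y, even on the line of b or zero, is a limit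
  of nondegenerate directions.\<close>

lemma obtain_direction:
  assumes x: "x \<in> U" and n: "CARD('n) \<ge> 3"
  obtains \<eta> where "\<And>t. t > 0 \<Longrightarrow> (x, y + t *\<^sub>R \<eta>) \<in> N.\<Omega>" "(x, \<eta>) \<in> N.\<Omega>"
proof -
  obtain w where w: "ip a x w w = 1" "ip a x w (bs x) = 0" by (rule exists_unit_orthogonal[OF x n]) blast
  define \<eta> where "\<eta> = (if ip a x y w \<ge> 0 then w else - w)"
  have \<eta>: "ip a x \<eta> \<eta> = 1" "ip a x (bs x) \<eta> = 0" "ip a x \<eta> y \<ge> 0"
    using w ip_sym[OF x, of "bs x" w] ip_sym[OF x, of y w] by (auto simp: \<eta>_def ip_lin)
  have B: "BB x > 0" by (rule BB_pos[OF x])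
  have "N.hh (x, y + t *\<^sub>R \<eta>) = N.hh (x, y) + (BB x) ^ 4 * (2 * t * ip a x \<eta> y + t\<^sup>2)" for t
    unfolding hh_eq[OF x] using ip_sym[OF x, of y \<eta>] by (simp add: ip_lin \<eta> power2_eq_square algebra_simps)
  moreover have "(BB x) ^ 4 * (2 * t * ip a x \<eta> y + t\<^sup>2) > 0" if "t > 0" for t
    using B \<eta>(3) that by (intro mult_pos_pos add_nonneg_pos) auto
  ultimately have "(x, y + t *\<^sub>R \<eta>) \<in> N.\<Omega>" if "t > 0" for t
    using x that N.hh_nonneg[of "(x, y)"] by (auto simp: N.\<Omega>_def intro: add_nonneg_pos)
  moreover have "(x, \<eta>) \<in> N.\<Omega>" using x B by (simp add: N.\<Omega>_def hh_eq \<eta>)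
  ultimately show ?thesis by (rule that)
qed

context
  fixes c d :: "real^'n \<Rightarrow> real"
  assumes sm_c: "sm U c" and sm_d: "sm U d" and st: "\<And>x. x \<in> U \<Longrightarrow> struct (c x) (d x) (ss x) x"
begin

abbreviation "mm \<equiv> wform d ss"
abbreviation "kk \<equiv> wkap c d"

lemma sm_mm: "sm U mm"
proof -
  have "sm U (\<lambda>x. mm x)" unfolding wform_def
    by (intro sm_diff sm_scaleR sm_mult sm_divide sm_power sm_const sm_BB sm_bs sm_ss sm_d open_U) (use BB_pos in force)
  then show ?thesis .
qed

lemma sm_kk: "sm U kk"
proof -
  have "sm U (\<lambda>x. kk x)" unfolding wkap_def
    by (intro sm_divide sm_add sm_mult sm_power sm_const sm_BB sm_c sm_d open_U) (use BB_pos in force)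
  then show ?thesis .
qed

lemma linear_cov_mm: "x \<in> U \<Longrightarrow> linear (cov a mm x)"
  by (rule bounded_linear.linear[OF bounded_linear_cov[OF sm_diff_at[OF sm_mm]]])

lemma ip_cov_mm:
  assumes x: "x \<in> U"
  shows "ip a x (cov a mm x u) v = 2/3 * (dd u d x * ip a x (bs x) v) + 2/3 * (d x * ip a x (cov a bs x u) v)
     + 8 / (BB x) ^ 3 * dd u BB x * ip a x (ss x) v - 4 / (BB x)\<^sup>2 * ip a x (cov a ss x u) v"
proof -
  have B: "BB x \<noteq> 0" using BB_pos[OF x] by simp
  note D = sm_diff_at[OF sm_d x] sm_diff_at[OF sm_BB x] sm_diff_at[OF sm_bs x] sm_diff_at[OF sm_ss x]
  have e: "(\<lambda>x. 4 / (BB x)\<^sup>2) differentiable (at x)"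
    using D B by (intro differentiable_divide differentiable_power differentiable_const) auto
  have e': "dd u (\<lambda>x. 4 / (BB x)\<^sup>2) x = - 8 / (BB x) ^ 3 * dd u BB x"
    using D B by (simp add: dd_divide dd_power2 dd_const differentiable_power) (simp add: eval_nat_numeral)
  have f: "(\<lambda>x. 2/3 * d x) differentiable (at x)" using D by (intro differentiable_mult differentiable_const) auto
  have f': "dd u (\<lambda>x. 2/3 * d x) x = 2/3 * dd u d x" by (rule dd_linear[OF bounded_linear_mult_right D(1)])
  have "cov a mm x u = cov a (\<lambda>x. (2/3 * d x) *\<^sub>R bs x - (4 / (BB x)\<^sup>2) *\<^sub>R ss x) x u"
    unfolding wform_def[abs_def] ..
  also have "\<dots> = (2/3 * dd u d x) *\<^sub>R bs x + (2/3 * d x) *\<^sub>R cov a bs x u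
      - ((- 8 / (BB x) ^ 3 * dd u BB x) *\<^sub>R ss x + (4 / (BB x)\<^sup>2) *\<^sub>R cov a ss x u)"
    by (simp only: cov_subtract[OF differentiable_scaleR[OF f D(3)] differentiable_scaleR[OF e D(4)]]
      cov_scaleR[OF f D(3)] cov_scaleR[OF e D(4)] e' f')
  finally show ?thesis by (simp add: ip_lin)
qed

lemma ip_presc_vec:
  assumes x: "x \<in> U"
  shows "ip a x (presc_vec (c x) d x y w) z = symform mm kk x y w z"
proof -
  let ?g = "ip a x"
  have N: "?g (cov a bs x u) v = c x * ?g u v + d x * ?g (bs x) u * ?g (bs x) v
      - 2 / (BB x)\<^sup>2 * ?g (ss x) u * ?g (bs x) v - 4 / (BB x)\<^sup>2 * ?g (bs x) u * ?g (ss x) v" for u v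
    using st[OF x] by (simp add: struct_def ip_lin)
  have \<mu>: "?g (mm x) u = 2/3 * d x * ?g (bs x) u - 4 / (BB x)\<^sup>2 * ?g (ss x) u" for u
    by (simp add: wform_def ip_lin)
  have L: "?g (mm x) (mm x) - (kk x)\<^sup>2 = 4/9 * (d x)\<^sup>2 * (BB x)\<^sup>2 + 16 / (BB x) ^ 4 * ?g (ss x) (ss x)
      - ((c x + 2/3 * d x * (BB x)\<^sup>2) / BB x)\<^sup>2"
    using BB_pos[OF x] ip_ss_bs[OF x] ip_sym[OF x, of "bs x" "ss x"]
    by (simp add: wform_def wkap_def ip_lin BB_sq[OF x]) (simp add: power2_eq_square eval_nat_numeral)
  show ?thesis
    using curvature_algebra[OF BB_pos[OF x] refl refl ip_cov_mm[OF x] N struct_gB(1)[OF x st[OF x]] \<mu> L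
        ip_sym[OF x, of w y] ip_sym[OF x, of z w] ip_sym[OF x, of z y]]
    unfolding presc_vec_def symform_def Let_def
    by (simp only: real_scaleR_def ip_lin ip_\<sigma>T[OF x] ip_grad[OF x sm_diff_at[OF sm_d x]])
qed

lemma riemann_prescribed_iff:
  assumes x: "x \<in> U"
  shows "(\<forall>y i k. riemann (alpha a) x y i k = prescribed_curvature a b c d x y i k)
    \<longleftrightarrow> (\<forall>y w z. ip a x (RR (Gal a) w (x, y)) z = symform mm kk x y w z)"
proof -
  interpret C: linear "cov a mm x" by (rule linear_cov_mm[OF x])
  have lr: "linear (\<lambda>w. ip a x (RR (Gal a) w (x, y)) z)" for y z
    by (rule linear_compose[OF linear_RR[OF open_UxV _ sm_Gal_UxV], unfolded o_def])
      (use x in \<open>auto simp: bounded_linear.linear ip.bounded_linear_left\<close>)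
  have ls: "linear (\<lambda>w. symform mm kk x y w z)" for y z
    by (rule linearI) (simp_all add: symform_def Let_def C.add C.scale ip_lin algebra_simps add_divide_distrib)
  have "(\<forall>y i k. riemann (alpha a) x y i k = prescribed_curvature a b c d x y i k)
      \<longleftrightarrow> (\<forall>y k. RR (Gal a) (axis k 1) (x, y) = presc_vec (c x) d x y (axis k 1))"
    unfolding riemann_alpha[OF x] prescribed_eq[OF x sm_d] vec_eq_iff by blast
  also have "\<dots> \<longleftrightarrow> (\<forall>y k z. ip a x (RR (Gal a) (axis k 1) (x, y)) z = symform mm kk x y (axis k 1) z)"
    unfolding ip_presc_vec[OF x, symmetric] using ip_eqI[OF x] by metis
  also have "\<dots> \<longleftrightarrow> (\<forall>y w z. ip a x (RR (Gal a) w (x, y)) z = symform mm kk x y w z)"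
    using linear_axis_eqI[OF lr ls] by blast
  finally show ?thesis .
qed

text \<open>The form d\<kappa> - \<kappa> m, on which the odd part of the curvature of F depends
  linearly.\<close>

definition \<nu> :: "real^'n \<Rightarrow> real^'n \<Rightarrow> real" where
  "\<nu> x u = dd u kk x - kk x * ip a x (mm x) u"

definition oddpart :: "real^'n \<Rightarrow> real^'n \<Rightarrow> real^'n \<Rightarrow> real^'n" where
  "oddpart x y w = (2 * alpha a x y * \<nu> x w - ip a x w y / alpha a x y * \<nu> x y) *\<^sub>R y - (alpha a x y * \<nu> x y) *\<^sub>R w"

definition evenpart :: "real^'n \<Rightarrow> real^'n \<Rightarrow> real^'n \<Rightarrow> real^'n" where
  "evenpart x y w = (let g = ip a x; m = mm x; C = cov a mm x; M = g m m in
     (2 * g (C w) y - g (C y) w - g m y * g m w + (M - (kk x)\<^sup>2) * g w y) *\<^sub>R y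
      - (g (C y) y - (g m y)\<^sup>2 + g y y * (M - (kk x)\<^sup>2)) *\<^sub>R w
      - g y y *\<^sub>R (C w - g m w *\<^sub>R m) + g w y *\<^sub>R (C y - g m y *\<^sub>R m))"

lemma RR_GF:
  assumes q: "(x, y) \<in> N.\<Omega>"
  shows "RR GF w (x, y) = RR (Gal a) w (x, y) + (oddpart x y w + evenpart x y w)"
proof -
  have x: "x \<in> U" using N.\<Omega>_D[OF q] by simp
  have "RR GF w (x, y) = RR (\<lambda>q. Gal a q + weyl mm kk q) w (x, y)"
    by (rule RR_cong[OF N.open_\<Omega> q]) (use N.\<Omega>_D st in \<open>auto intro!: weyl_spray\<close>)
  also have "\<dots> = RR (Gal a) w (x, y) + (oddpart x y w + evenpart x y w)"
    using RR_weyl[OF N.open_\<Omega> q N.\<Omega>_D(1,2) sm_mm sm_kk, of w]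
    by (simp add: oddpart_def evenpart_def Let_def \<nu>_def alpha_sq[OF x])
  finally show ?thesis .
qed

lemma \<nu>_lin: "x \<in> U \<Longrightarrow> linear (\<nu> x)"
  using dd_dir[OF sm_diff_at[OF sm_kk]] by (intro linearI) (simp_all add: \<nu>_def ip_lin algebra_simps)

lemma oddpart_minus: "x \<in> U \<Longrightarrow> oddpart x (- y) w = - oddpart x y w"
  by (simp add: oddpart_def alpha_eq_ip ip_lin linear_neg[OF \<nu>_lin])

lemma evenpart_minus: "x \<in> U \<Longrightarrow> evenpart x (- y) w = evenpart x y w"
  by (simp add: evenpart_def Let_def ip_lin linear_neg[OF linear_cov_mm] algebra_simps)

lemma \<Omega>_uminus: "(x, y) \<in> N.\<Omega> \<Longrightarrow> (x, - y) \<in> N.\<Omega>"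
  by (simp add: N.\<Omega>_def N.hh_def ip_lin)

lemma ip_evenpart_transvection:
  "x \<in> U \<Longrightarrow> ip a x (evenpart x y w) y = ip a x y y * (ip a x (cov a mm x w) y - ip a x (cov a mm x y) w)"
  using ip_sym[of x w y] by (simp add: evenpart_def Let_def ip_lin algebra_simps power2_eq_square)

lemma ip_evenpart:
  assumes "x \<in> U" and "\<And>u v. ip a x (cov a mm x u) v = ip a x (cov a mm x v) u"
  shows "ip a x (evenpart x y w) z = - symform mm kk x y w z"
  using assms(2)[of w y] assms(2)[of z w] by (simp add: evenpart_def symform_def Let_def ip_lin algebra_simps)

text \<open>The flatness equations at y and - y together remove the odd part and leave the curvature
  of \<alpha> equal to minus \<open>evenpart\<close>. Orthogonality to y then makes m closed, and
  for closed m the even part is - \<open>symform\<close>.\<close>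

lemma flat_imp_curvature:
  assumes flat: "N.cfc 0" and x: "x \<in> U" and n: "CARD('n) \<ge> 3"
  shows "ip a x (RR (Gal a) w (x, y)) z = symform mm kk x y w z"
proof -
  interpret C: linear "cov a mm x" by (rule linear_cov_mm[OF x])
  have R: "RR (Gal a) w (x, y) = - evenpart x y w" if q: "(x, y) \<in> N.\<Omega>" for y w
  proof -
    have 0: "RR GF w (x, y) = 0" if "(x, y) \<in> N.\<Omega>" for y using flat that unfolding N.cfc_def by auto
    have alg: "r = - e" if "r + (p + e) = 0" "r + (- p + e) = 0" for r p e :: "real^'n"
      using arg_cong2[OF that, of "(+)"] by (simp add: vec_eq_iff) (smt (verit))
    show ?thesis
      by (rule alg[of _ "oddpart x y w"])
        (use 0[OF q] 0[OF \<Omega>_uminus[OF q]] RR_GF[OF q, of w] RR_GF[OF \<Omega>_uminus[OF q], of w] in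
          \<open>simp_all add: RR_Gal_even[OF x] oddpart_minus[OF x] evenpart_minus[OF x]\<close>)
  qed
  have cl: "ip a x (cov a mm x w) y = ip a x (cov a mm x y) w" if q: "(x, y) \<in> N.\<Omega>" for y w
  proof -
    have "ip a x y y * (ip a x (cov a mm x w) y - ip a x (cov a mm x y) w) = 0"
      using ip_RR_Gal[OF x, of w y] unfolding R[OF q] by (simp add: ip_lin ip_evenpart_transvection[OF x])
    then show ?thesis using ip_pos[OF x, of y] N.\<Omega>_D(2)[OF q] by simp
  qed
  \<comment> \<open>The condition is linear in y, so subtracting its instances at y + \<eta> and at
    \<eta> reaches every y.\<close>
  have closed: "ip a x (cov a mm x w) y = ip a x (cov a mm x y) w" for w y
  proof -
    obtain \<eta> where \<eta>: "\<And>t. t > 0 \<Longrightarrow> (x, y + t *\<^sub>R \<eta>) \<in> N.\<Omega>" "(x, \<eta>) \<in> N.\<Omega>"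
      by (rule obtain_direction[OF x n]) blast
    show ?thesis using cl[OF \<eta>(1)[of 1], of w] cl[OF \<eta>(2), of w] by (simp add: C.add ip_lin)
  qed
  obtain \<eta> where \<eta>: "\<And>t. t > 0 \<Longrightarrow> (x, y + t *\<^sub>R \<eta>) \<in> N.\<Omega>"
    by (rule obtain_direction[OF x n]) blast
  \<comment> \<open>The identity is known at y + t \<eta> for t > 0; continuity of f in y carries it
    to the degenerate directions and to y = 0.\<close>
  define f where "f y = ip a x (RR (Gal a) w (x, y)) z - symform mm kk x y w z" for y
  have "continuous_on UNIV f"
    unfolding f_def symform_def Let_def
    by (intro continuous_intros ip.continuous_on continuous_RR_Gal[OF x]
      linear_continuous_on[OF linear_linear[THEN iffD2, OF linear_cov_mm[OF x]]])
  then have "continuous_on UNIV (\<lambda>t. f (y + t *\<^sub>R \<eta>))"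
    by (rule continuous_on_compose2) (auto intro!: continuous_intros)
  then have "isCont (\<lambda>t. f (y + t *\<^sub>R \<eta>)) 0" by (simp add: continuous_on_eq_continuous_at)
  then have "((\<lambda>t. f (y + t *\<^sub>R \<eta>)) \<longlongrightarrow> f (y + 0 *\<^sub>R \<eta>)) (at_right 0)"
    unfolding isCont_def filterlim_at_split by blast
  moreover have "f (y + t *\<^sub>R \<eta>) = 0" if "t > 0" for t
    unfolding f_def R[OF \<eta>[OF that]] by (simp add: ip_lin ip_evenpart[OF x closed])
  then have "((\<lambda>t. f (y + t *\<^sub>R \<eta>)) \<longlongrightarrow> 0) (at_right 0)"
    by (intro tendsto_eventually) (auto simp: eventually_at_right_field intro: exI[of _ 1])
  ultimately have "f (y + 0 *\<^sub>R \<eta>) = 0" by (rule tendsto_unique[OF trivial_limit_at_right_real])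
  then show ?thesis by (simp add: f_def)
qed

text \<open>The fibre derivative of \<open>F\<^sup>2\<close> annihilates the image of the Riemann tensor of \<open>F\<close>; for \<open>y\<close>
  orthogonal to \<open>b\<close> this forces the odd part of the latter to vanish.\<close>

lemma curvature_imp_flat:
  assumes R: "\<And>x y w z. x \<in> U \<Longrightarrow> ip a x (RR (Gal a) w (x, y)) z = symform mm kk x y w z" and n: "CARD('n) \<ge> 3"
  shows "N.cfc 0"
proof -
  have odd: "RR GF w (x, y) = oddpart x y w" if q: "(x, y) \<in> N.\<Omega>" for x y w
  proof -
    have x: "x \<in> U" using N.\<Omega>_D[OF q] by simp
    interpret C: linear "cov a mm x" by (rule linear_cov_mm[OF x])
    have closed: "ip a x (cov a mm x w) y = ip a x (cov a mm x y) w" for w y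
    proof (cases "y = 0")
      case True
      then show ?thesis by (simp add: C.zero ip_lin)
    next
      case False
      then show ?thesis
        using ip_RR_Gal[OF x, of w y] ip_pos[OF x, of y] unfolding R[OF x] symform_transvection[OF x] by simp
    qed
    have "RR (Gal a) w (x, y) = - evenpart x y w"
      by (rule ip_eqI[OF x]) (simp add: ip_lin R[OF x] ip_evenpart[OF x closed])
    then show ?thesis unfolding RR_GF[OF q] by simp
  qed
  have \<nu>: "\<nu> x u = 0" if x: "x \<in> U" for x u
  proof -
    interpret \<nu>: linear "\<nu> x" by (rule \<nu>_lin[OF x])
    let ?g = "ip a x" and ?B = "BB x"
    have B: "?B > 0" by (rule BB_pos[OF x])
    \<comment> \<open>\<open>dd_RR_eq_0\<close> for F^2, with the curvature applied to b. Where
      \<beta> = 0 the coefficients simplify to C1 = 2 and C2 = 4 times the rescaled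
      \<alpha>.\<close>
    have key: "alpha a x y * \<nu> x (bs x) = ?B * \<nu> x y" if y: "y \<noteq> 0" "?g (bs x) y = 0" for y
    proof -
      have A: "alpha a x y > 0" by (rule alpha_pos[OF x y(1)])
      have q: "(x, y) \<in> N.\<Omega>" using x B ip_pos[OF x y(1)] by (simp add: N.\<Omega>_def hh_eq y)
      then have q0: "(x, y) \<in> N.\<Omega>0" using N.\<Omega>_subset by blast
      have "dd (0, RR GF (bs x) (x, y)) (Lag FF) (x, y) = 0"
        by (rule dd_RR_eq_0[OF N.open_\<Omega> q sm_GF sm_subset[OF N.sm_Lag_F N.\<Omega>_subset]])
          (auto intro: N.spr_Lag_F N.spr_vert_Lag_F)
      then have "2 * ip abar x (oddpart x y (bs x)) y + 4 * (?B\<^sup>2 * alpha a x y) * ip abar x (bbar x) (oddpart x y (bs x)) = 0"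
        unfolding odd[OF q] N.dd_vert_Lag_F[OF q0] using A B y
        by (simp add: alpha_abar[OF x] C1_def C2_def ip_abar bbar_def ip_lin) (simp add: field_simps eval_nat_numeral)
      then have "?B ^ 4 * alpha a x y * (alpha a x y) * (alpha a x y * \<nu> x (bs x) - ?B * \<nu> x y) = 0"
        using A B unfolding oddpart_def ip_abar bbar_def
        by (simp add: ip_lin y ip_sym[OF x, of "bs x" y] BB_sq[OF x] alpha_sq[OF x, of y, symmetric])
          (simp add: eval_nat_numeral algebra_simps)
      then show ?thesis using A B by simp
    qed
    \<comment> \<open>The left side of \<open>key\<close> is even in y and the right side is odd, so
      both vanish.\<close>
    have perp: "\<nu> x y = 0 \<and> \<nu> x (bs x) = 0" if y: "y \<noteq> 0" "?g (bs x) y = 0" for y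
      using key[OF y] key[of "- y"] y B alpha_pos[OF x y(1)] by (simp add: ip_lin \<nu>.neg alpha_eq_ip)
    obtain \<eta> where "?g \<eta> \<eta> = 1" "?g \<eta> (bs x) = 0" by (rule exists_unit_orthogonal[OF x n]) blast
    then have b: "\<nu> x (bs x) = 0" using perp[of \<eta>] ip_sym[OF x, of "bs x" \<eta>] by (cases "\<eta> = 0") (auto simp: ip_lin)
    define v where "v = u - (?g (bs x) u / ?B\<^sup>2) *\<^sub>R bs x"
    have "?g (bs x) v = 0" using B by (simp add: v_def ip_lin BB_sq[OF x])
    then have "\<nu> x v = 0" using perp[of v] by (cases "v = 0") (auto simp: \<nu>.zero)
    then show ?thesis by (simp add: v_def \<nu>.diff \<nu>.scale b)
  qed
  show ?thesis unfolding N.cfc_def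
  proof (intro allI impI)
    fix x y w assume q: "(x, y) \<in> N.\<Omega>"
    then have "x \<in> U" using N.\<Omega>_D by fastforce
    then show "RR GF w (x, y) = 0 *\<^sub>R ((FF x y)\<^sup>2 *\<^sub>R w - (1/2 * dd (0, w) (Lag FF) (x, y)) *\<^sub>R y)"
      by (simp add: odd[OF q] oddpart_def \<nu>)
  qed
qed

lemma flat_iff_prescribed:
  assumes n: "CARD('n) \<ge> 3"
  shows "N.cfc 0 \<longleftrightarrow> (\<forall>x\<in>U. \<forall>y i k. riemann (alpha a) x y i k = prescribed_curvature a b c d x y i k)"
  using riemann_prescribed_iff flat_imp_curvature[OF _ _ n] curvature_imp_flat[OF _ n] by blast

end

lemma curvature_zero:
  assumes K: "N.cfc K" and n: "CARD('n) \<ge> 3" and x: "x \<in> U"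
  shows "K = 0"
proof -
  obtain \<eta> where "ip abar x \<eta> \<eta> = 1" "ip abar x \<eta> (bbar x) = 0" by (rule N.exists_unit_orthogonal[OF x n]) blast
  then show ?thesis using N.curvature_zero_and_square(1)[OF K n x, of \<eta>] by (cases "\<eta> = 0") (auto simp: ip_lin)
qed

end

section \<open>Independence of the chart\<close>

locale coordinate_change = X: sq_chart U a b + Y: sq_chart U' a' b'
  for U :: "(real^'n::finite) set" and a b and U' :: "(real^'n) set" and a' b' +
  fixes W :: "(real^'n) set" and \<phi> :: "real^'n \<Rightarrow> real^'n"
  assumes open_W: "open W" and W_U: "W \<subseteq> U" and \<phi>_U': "\<And>x. x \<in> W \<Longrightarrow> \<phi> x \<in> U'" and sm_\<phi>: "sm W \<phi>"
    and ip_\<phi>: "\<And>x u v. x \<in> W \<Longrightarrow> ip a x u v = ip a' (\<phi> x) (dd u \<phi> x) (dd v \<phi> x)"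
    and form_\<phi>: "\<And>x u. x \<in> W \<Longrightarrow> b x \<bullet> u = b' (\<phi> x) \<bullet> dd u \<phi> x"
begin

lemma \<phi>_D: "x \<in> W \<Longrightarrow> \<phi> differentiable (at x)"
  by (rule sm_diff_at[OF sm_\<phi>])

text \<open>The metrics being positive definite, \<open>ip_\<phi>\<close> makes the derivative
  injective, and the dimensions agree.\<close>

lemma surj_dd_\<phi>:
  assumes x: "x \<in> W"
  shows "\<exists>u. v = dd u \<phi> x"
proof -
  interpret P: bounded_linear "\<lambda>u. dd u \<phi> x" by (rule bounded_linear_dd[OF \<phi>_D[OF x]])
  have "u = 0" if "dd u \<phi> x = 0" for u
    using ip_\<phi>[OF x, of u u] X.ip_eq_0_iff[of x u] x W_U that by (auto simp: ip_lin)
  then have "inj (\<lambda>u. dd u \<phi> x)" using linear_injective_0[OF P.linear] by blast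
  from linear_injective_imp_surjective[OF P.linear this] show ?thesis by (auto simp: surj_def)
qed

lemma bs_\<phi>: "x \<in> W \<Longrightarrow> Y.bs (\<phi> x) = dd (X.bs x) \<phi> x"
proof (rule Y.ip_eqI)
  assume x: "x \<in> W"
  show "\<phi> x \<in> U'" by (rule \<phi>_U'[OF x])
  fix v
  obtain u where u: "v = dd u \<phi> x" using surj_dd_\<phi>[OF x] by blast
  show "ip a' (\<phi> x) (Y.bs (\<phi> x)) v = ip a' (\<phi> x) (dd (X.bs x) \<phi> x) v"
    unfolding u Y.ip_bs[OF \<phi>_U'[OF x]] ip_\<phi>[OF x, symmetric] form_\<phi>[OF x, symmetric]
    using X.ip_bs[of x u] x W_U by auto
qed

text \<open>The quadratic form of \<open>r\<^sub>i\<^sub>j\<close> is a tensor. The second derivatives of \<open>\<phi>\<close> that enter through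
  \<open>b\<^sup>i\<close> and through the metric cancel.\<close>

lemma ip_cov_bs_\<phi>:
  assumes x: "x \<in> W"
  shows "ip a x (cov a X.bs x u) u = ip a' (\<phi> x) (cov a' Y.bs (\<phi> x) (dd u \<phi> x)) (dd u \<phi> x)"
proof -
  have xU: "x \<in> U" using x W_U by blast
  note yU = \<phi>_U'[OF x]
  let ?P = "\<lambda>u. dd u \<phi> x" and ?g' = "ip a' (\<phi> x)"
  have "dd u (\<lambda>z. Y.bs (\<phi> z)) x = dd (?P u) Y.bs (\<phi> x)"
    by (rule dd_chain[OF \<phi>_D[OF x] sm_diff_at[OF Y.sm_bs yU]])
  moreover have "dd u (\<lambda>z. Y.bs (\<phi> z)) x = dd u (\<lambda>z. dd (X.bs z) \<phi> z) x"
    by (rule dd_cong[OF open_W x bs_\<phi>])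
  moreover have "dd u (\<lambda>z. dd (X.bs z) \<phi> z) x = ?P (dd u X.bs x) + dd u (dd (X.bs x) \<phi>) x"
    by (rule dd_var[OF open_W x sm_\<phi> sm_diff_at[OF X.sm_bs xU]])
  moreover have "dd u (dd (X.bs x) \<phi>) x = dd (X.bs x) (dd u \<phi>) x"
    by (rule dd_symmetric[OF open_W x sm_\<phi>])
  ultimately have 1: "?P (dd u X.bs x) = dd (?P u) Y.bs (\<phi> x) - dd (X.bs x) (dd u \<phi>) x"
    by (simp add: algebra_simps)
  have 2: "2 * ip a x (Gam a x (X.bs x) u) u = 2 * ?g' (dd (X.bs x) (dd u \<phi>) x + Gam a' (\<phi> x) (Y.bs (\<phi> x)) (?P u)) (?P u)"
  proof -
    let ?p = "\<lambda>z. (\<phi> z, dd u \<phi> z)"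
    have D: "dd u \<phi> differentiable (at x)" by (rule sm_diff_at[OF sm_dd[OF sm_\<phi>] x])
    have "2 * ip a x (Gam a x (X.bs x) u) u = dd (X.bs x) (\<lambda>z. ip a z u u) x"
      unfolding X.dd_ip_Gam[OF xU] using X.ip_sym[OF xU, of u "Gam a x (X.bs x) u"] by simp
    also have "\<dots> = dd (X.bs x) (\<lambda>z. ip a' (fst (?p z)) (snd (?p z)) (snd (?p z))) x"
      by (rule dd_cong[OF open_W x]) (simp add: ip_\<phi>)
    also have "\<dots> = dd (dd (X.bs x) ?p x) (\<lambda>q. ip a' (fst q) (snd q) (snd q)) (?p x)"
      by (rule dd_chain) (auto intro!: differentiable_Pair \<phi>_D x D Y.differentiable_ip yU)
    also have "dd (X.bs x) ?p x = (Y.bs (\<phi> x), dd (X.bs x) (dd u \<phi>) x)"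
      by (simp add: dd_Pair \<phi>_D x D bs_\<phi>)
    finally show ?thesis
      using yU Y.ip_sym[OF yU, of "?P u"] by (simp add: Y.dd_ip dd_snd)
  qed
  have "ip a x (cov a X.bs x u) u = ip a x (dd u X.bs x) u + ip a x (Gam a x (X.bs x) u) u"
    by (simp add: cov_def ip_lin X.Gam_sym[OF xU, of u "X.bs x"])
  also have "ip a x (dd u X.bs x) u = ?g' (dd (?P u) Y.bs (\<phi> x)) (?P u) - ?g' (dd (X.bs x) (dd u \<phi>) x) (?P u)"
    unfolding ip_\<phi>[OF x] 1 by (simp add: ip_lin)
  finally show ?thesis
    using 2 by (simp add: cov_def ip_lin Y.Gam_sym[OF yU, of "?P u" "Y.bs (\<phi> x)"])
qed

text \<open>\<open>c\<close> is the value of the form \<open>r\<^sub>i\<^sub>j\<close> on the unit vectors orthogonal to \<open>b\<close>, and \<open>d\<close> is then read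
  off from its value on \<open>b\<close>.\<close>

lemma struct_\<phi>:
  assumes x: "x \<in> W" and n: "CARD('n) \<ge> 3" and st: "X.struct c d s x" and st': "Y.struct c' d' s' (\<phi> x)"
  shows "c = c' \<and> d = d'"
proof -
  have xU: "x \<in> U" using x W_U by blast
  let ?B = "X.BB x"
  have B: "?B > 0" by (rule X.BB_pos[OF xU])
  have X: "ip a x (cov a X.bs x u) u = c * ip a x u u + d * (ip a x (X.bs x) u)\<^sup>2 - 6 / ?B\<^sup>2 * ip a x s u * ip a x (X.bs x) u"
    and Xs: "ip a x s (X.bs x) = 0" for u
    using st by (auto simp: X.struct_def ip_lin power2_eq_square)
  have Y: "ip a' (\<phi> x) (cov a' Y.bs (\<phi> x) u) u = c' * ip a' (\<phi> x) u u + d' * (ip a' (\<phi> x) (Y.bs (\<phi> x)) u)\<^sup>2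
      - 6 / (Y.BB (\<phi> x))\<^sup>2 * ip a' (\<phi> x) s' u * ip a' (\<phi> x) (Y.bs (\<phi> x)) u"
    and Ys: "ip a' (\<phi> x) s' (Y.bs (\<phi> x)) = 0" for u
    using st' by (auto simp: Y.struct_def ip_lin power2_eq_square)
  obtain w where w: "ip a x w w = 1" "ip a x w (X.bs x) = 0" by (rule X.exists_unit_orthogonal[OF xU n]) blast
  then have w': "ip a x (X.bs x) w = 0" using X.ip_sym[OF xU] by simp
  have c: "c = c'"
    using ip_cov_bs_\<phi>[OF x, of w] w w' unfolding X Y bs_\<phi>[OF x] ip_\<phi>[OF x, symmetric] by simp
  have "ip a' (\<phi> x) s' (dd (X.bs x) \<phi> x) = 0" using Ys unfolding bs_\<phi>[OF x] .
  then have "d * (?B\<^sup>2)\<^sup>2 = d' * (?B\<^sup>2)\<^sup>2"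
    using ip_cov_bs_\<phi>[OF x, of "X.bs x"] c Xs
    unfolding X Y bs_\<phi>[OF x] ip_\<phi>[OF x, symmetric] X.BB_sq[OF xU] by simp
  then show ?thesis using c B by simp
qed

end

section \<open>From charts to the manifold\<close>

lemma open_overlap:
  assumes "smooth_atlas A" "C \<in> A" "C' \<in> A"
  shows "open (overlap C C')"
proof -
  have C: "open (fst C)" "open (fst C')" "open (cimage C)" "homeomorphism (fst C) (cimage C) (snd C) (cinv C)"
    using assms unfolding smooth_atlas_def by auto
  have "openin (top_of_set (fst C)) (fst C \<inter> fst C')" using C by (simp add: openin_open_Int)
  from homeomorphism_imp_open_map[OF C(4) this] show ?thesis
    unfolding overlap_def using C(3) openin_open_eq by blast
qed

lemma sq_chart_atlas:
  assumes "smooth_atlas A" "riemannian_metric A a" "one_form A b" "nowhere_vanishing A b" "C \<in> A"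
  shows "sq_chart (cimage C) (a C) (b C)"
proof -
  have o: "open (cimage C)" using assms unfolding smooth_atlas_def by auto
  interpret chart_metric "cimage C" "a C"
    by standard (use assms o in \<open>auto simp: riemannian_metric_def smooth_on_iff_sm[OF o, symmetric]\<close>)
  show ?thesis
    by standard (use assms o in \<open>auto simp: one_form_def nowhere_vanishing_def smooth_on_iff_sm[OF o, symmetric] intro!: sm_cvec\<close>)
qed

lemma coordinate_change_atlas:
  assumes A: "smooth_atlas A" "riemannian_metric A a" "one_form A b" "nowhere_vanishing A b"
    and C: "C \<in> A" "C' \<in> A"
  shows "coordinate_change (cimage C) (a C) (b C) (cimage C') (a C') (b C') (overlap C C') (transition C C')"
proof -
  let ?W = "overlap C C'" and ?\<phi> = "transition C C'"
  interpret X: sq_chart "cimage C" "a C" "b C" by (rule sq_chart_atlas[OF A C(1)])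
  interpret Y: sq_chart "cimage C'" "a C'" "b C'" by (rule sq_chart_atlas[OF A C(2)])
  have W: "open ?W" by (rule open_overlap[OF A(1) C])
  have h: "homeomorphism (fst C) (cimage C) (snd C) (cinv C)" using A(1) C unfolding smooth_atlas_def by auto
  have sm: "sm ?W ?\<phi>"
  proof -
    have "sm ?W (\<lambda>x. \<chi> i. ?\<phi> x $ i)"
      using A(1) C by (intro sm_vec_lambda[OF W]) (auto simp: smooth_atlas_def smooth_on_iff_sm[OF W, symmetric])
    then show ?thesis by simp
  qed
  have pd: "pd i (\<lambda>z. ?\<phi> z $ k) x = dd (axis i 1) ?\<phi> x $ k" if x: "x \<in> ?W" for i k x
    using pd_eq_dd[OF sm_diff_at[OF sm_vec_nth[OF W sm] x]] dd_vec_nth[OF sm_diff_at[OF sm x]] by simp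
  have lin: "linear (\<lambda>u. dd u ?\<phi> x)" if "x \<in> ?W" for x
    by (rule bounded_linear.linear[OF bounded_linear_dd[OF sm_diff_at[OF sm that]]])
  show ?thesis
  proof
    show "open ?W" "sm ?W ?\<phi>" by fact+
    show "?W \<subseteq> cimage C" by (auto simp: overlap_def cimage_def)
    fix x assume x: "x \<in> ?W"
    then obtain p where p: "p \<in> fst C" "p \<in> fst C'" "x = snd C p" by (auto simp: overlap_def)
    then show "?\<phi> x \<in> cimage C'"
      using homeomorphism_apply1[OF h] by (simp add: transition_def cimage_def)
    fix u v
    show "b C x \<bullet> u = b C' (?\<phi> x) \<bullet> dd u ?\<phi> x"
    proof (rule linear_axis_eqI[of "\<lambda>u. b C x \<bullet> u" "\<lambda>u. b C' (?\<phi> x) \<bullet> dd u ?\<phi> x"])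
      show "linear (\<lambda>u. b C' (?\<phi> x) \<bullet> dd u ?\<phi> x)"
        by (rule linear_compose[OF lin[OF x] bounded_linear.linear[OF bounded_linear_inner_right], unfolded o_def])
      show "b C x \<bullet> axis i 1 = b C' (?\<phi> x) \<bullet> dd (axis i 1) ?\<phi> x" for i
        using A(3) C x unfolding one_form_def by (simp add: inner_axis) (simp add: inner_vec_def pd[OF x] mult.commute)
    qed (simp add: bounded_linear.linear bounded_linear_inner_right)
    have axis: "ip (a C) x (axis i 1) (axis j 1) = ip (a C') (?\<phi> x) (dd (axis i 1) ?\<phi> x) (dd (axis j 1) ?\<phi> x)" for i j
      using A(2) C x unfolding riemannian_metric_def by (simp add: ip_def Tens_axis) (simp add: Tens_def pd[OF x] mult.assoc)
    have l: "linear (\<lambda>u. ip (a C') (?\<phi> x) (dd u ?\<phi> x) w)" "linear (\<lambda>u. ip (a C') (?\<phi> x) w (dd u ?\<phi> x))" for w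
      by (rule linear_compose[OF lin[OF x] bounded_linear.linear[OF ip.bounded_linear_left], unfolded o_def],
        rule linear_compose[OF lin[OF x] bounded_linear.linear[OF ip.bounded_linear_right], unfolded o_def])
    have axis': "ip (a C) x (axis i 1) v = ip (a C') (?\<phi> x) (dd (axis i 1) ?\<phi> x) (dd v ?\<phi> x)" for i
      by (rule linear_axis_eqI[OF _ l(2) axis]) (simp add: bounded_linear.linear ip.bounded_linear_right)
    show "ip (a C) x u v = ip (a C') (?\<phi> x) (dd u ?\<phi> x) (dd v ?\<phi> x)"
      by (rule linear_axis_eqI[OF _ l(1) axis']) (simp add: bounded_linear.linear ip.bounded_linear_left)
  qed
qed

theorem theorem1p2:
  fixes A :: "('m::{t2_space, second_countable_topology}, 'n::finite) chart set"
    and a :: "('m, 'n) chart \<Rightarrow> real^'n \<Rightarrow> real^'n^'n"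
    and b :: "('m, 'n) chart \<Rightarrow> real^'n \<Rightarrow> real^'n"
    and K :: real
  assumes "CARD('n) \<ge> 3"
    and "smooth_atlas A"
    and "riemannian_metric A a"
    and "one_form A b"
    and "nowhere_vanishing A b"
  shows "constant_flag_curvature A (\<lambda>C. singular_square (a C) (b C)) K \<longleftrightarrow>
    K = 0 \<and>
    (\<exists>c d. scalar_field A c \<and> scalar_field A d \<and>
      (\<forall>C\<in>A. \<forall>x\<in>cimage C.
        (\<forall>y i k. riemann (alpha (a C)) x y i k =
           prescribed_curvature (a C) (b C) (c \<circ> cinv C) (d \<circ> cinv C) x y i k) \<and>
        (\<forall>i j. r_tensor (a C) (b C) x i j =
           c (cinv C x) * a C x $ i $ j + d (cinv C x) * b C x $ i * b C x $ j
           - 3 / (blength (a C) (b C) x)\<^sup>2 *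
             (b C x $ i * s_form (a C) (b C) x $ j + b C x $ j * s_form (a C) (b C) x $ i)) \<and>
        (\<forall>i j. s_tensor (a C) (b C) x i j =
           1 / (blength (a C) (b C) x)\<^sup>2 *
             (b C x $ i * s_form (a C) (b C) x $ j - b C x $ j * s_form (a C) (b C) x $ i))))"
proof -
  note n = assms(1) and A = assms(2-5)
  define ss where "ss C = raise (a C) (s_form (a C) (b C))" for C
  define st where "st C c d x = sq_chart.struct (a C) (b C) (c x) (d x) (ss C x) x" for C and c d :: "real^'n \<Rightarrow> real" and x
  define cfc where "cfc C K = unit_square.cfc (cimage C) (sq_chart.abar (a C) (b C)) (sq_chart.bbar (a C) (b C)) (singular_square (a C) (b C)) K"
    for C K
  have homeo: "homeomorphism (fst C) (cimage C) (snd C) (cinv C)" and op: "open (cimage C)" if "C \<in> A" for C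
    using A(1) that unfolding smooth_atlas_def by auto
  have cfc: "constant_flag_curvature A (\<lambda>C. singular_square (a C) (b C)) K \<longleftrightarrow> (\<forall>C\<in>A. cfc C K)"
    unfolding constant_flag_curvature_def cfc_def
    using sq_chart.constant_flag_curvature_iff_cfc[OF sq_chart_atlas[OF A] n] by blast
  have st_iff: "st C (c \<circ> cinv C) (d \<circ> cinv C) x \<longleftrightarrow>
      (\<forall>i j. r_tensor (a C) (b C) x i j =
           c (cinv C x) * a C x $ i $ j + d (cinv C x) * b C x $ i * b C x $ j
           - 3 / (blength (a C) (b C) x)\<^sup>2 *
             (b C x $ i * s_form (a C) (b C) x $ j + b C x $ j * s_form (a C) (b C) x $ i)) \<and>
        (\<forall>i j. s_tensor (a C) (b C) x i j =
           1 / (blength (a C) (b C) x)\<^sup>2 *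
             (b C x $ i * s_form (a C) (b C) x $ j - b C x $ j * s_form (a C) (b C) x $ i))"
    if "C \<in> A" "x \<in> cimage C" for C c d x
    unfolding st_def ss_def o_def by (rule sq_chart.struct_iff[OF sq_chart_atlas[OF A that(1)] that(2)])
  have flat: "cfc C 0 \<longleftrightarrow> (\<forall>x\<in>cimage C. \<forall>y i k. riemann (alpha (a C)) x y i k = prescribed_curvature (a C) (b C) c d x y i k)"
    if "C \<in> A" "sm (cimage C) c" "sm (cimage C) d" "\<And>x. x \<in> cimage C \<Longrightarrow> st C c d x" for C c d
    unfolding cfc_def using that(4) unfolding st_def ss_def
    by (intro sq_chart.flat_iff_prescribed[OF sq_chart_atlas[OF A that(1)] that(2,3) _ n])
  have scalar: "scalar_field A f \<longleftrightarrow> (\<forall>C\<in>A. sm (cimage C) (f \<circ> cinv C))" for f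
    unfolding scalar_field_def using smooth_on_iff_sm[OF op] by blast
  have "(\<forall>C\<in>A. cfc C K) \<longleftrightarrow> K = 0 \<and> (\<exists>c d. scalar_field A c \<and> scalar_field A d \<and> (\<forall>C\<in>A. \<forall>x\<in>cimage C.
      (\<forall>y i k. riemann (alpha (a C)) x y i k = prescribed_curvature (a C) (b C) (c \<circ> cinv C) (d \<circ> cinv C) x y i k) \<and>
      st C (c \<circ> cinv C) (d \<circ> cinv C) x))" (is "?l \<longleftrightarrow> _ \<and> ?r")
  proof
    assume l: ?l
    have ex: "\<exists>C. C \<in> A \<and> p \<in> fst C" for p using A(1) unfolding smooth_atlas_def by blast
    \<comment> \<open>The functions c and d are obtained chart by chart; a chosen chart around each
      point turns them into functions on the manifold.\<close>
    define ch where "ch p = (SOME C. C \<in> A \<and> p \<in> fst C)" for p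
    have ch: "ch p \<in> A" "p \<in> fst (ch p)" for p using someI_ex[OF ex[of p]] unfolding ch_def by auto
    \<comment> \<open>Types are inhabited, so \<open>undefined\<close> is a point of the manifold,
      and its chart is a place where \<open>curvature_zero\<close> applies.\<close>
    have K: "K = 0"
      using l ch[of undefined] sq_chart.curvature_zero[OF sq_chart_atlas[OF A ch(1)] _ n, of undefined K]
      unfolding cfc_def by (auto simp: cimage_def)
    have "\<forall>C\<in>A. \<exists>c d. sm (cimage C) c \<and> sm (cimage C) d \<and> (\<forall>x\<in>cimage C. st C c d x)"
      unfolding st_def ss_def using l sq_chart.struct_exists[OF sq_chart_atlas[OF A] _ n] unfolding cfc_def by metis
    then obtain c d where cd: "\<And>C. C \<in> A \<Longrightarrow> sm (cimage C) (c C)" "\<And>C. C \<in> A \<Longrightarrow> sm (cimage C) (d C)"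
      "\<And>C x. C \<in> A \<Longrightarrow> x \<in> cimage C \<Longrightarrow> st C (c C) (d C) x" by metis
    define gc where "gc p = c (ch p) (snd (ch p) p)" for p
    define gd where "gd p = d (ch p) (snd (ch p) p)" for p
    \<comment> \<open>On the overlap of C with the chosen chart, \<open>struct_\<phi>\<close>
      identifies the two pairs of values. The smoothness of the glued functions in C thus follows
      from that of the functions obtained in C itself.\<close>
    have eq: "gc (cinv C x) = c C x \<and> gd (cinv C x) = d C x" if C: "C \<in> A" and x: "x \<in> cimage C" for C x
    proof -
      define p where "p = cinv C x"
      have p: "p \<in> fst C" "snd C p = x"
        using homeomorphism_image2[OF homeo[OF C]] homeomorphism_apply2[OF homeo[OF C] x] x unfolding p_def by auto
      interpret coordinate_change "cimage C" "a C" "b C" "cimage (ch p)" "a (ch p)" "b (ch p)" "overlap C (ch p)" "transition C (ch p)"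
        by (rule coordinate_change_atlas[OF A C ch(1)])
      have W: "x \<in> overlap C (ch p)" using p ch(2) unfolding overlap_def by blast
      have "transition C (ch p) x = snd (ch p) p" by (simp add: transition_def p_def)
      then show ?thesis
        using struct_\<phi>[OF W n cd(3)[OF C x, unfolded st_def] cd(3)[OF ch(1) \<phi>_U'[OF W], unfolded st_def]]
        unfolding gc_def gd_def p_def[symmetric] by simp
    qed
    have sf: "sm (cimage C) (gc \<circ> cinv C)" "sm (cimage C) (gd \<circ> cinv C)" if "C \<in> A" for C
      using sm_cong[OF op[OF that] _ cd(1)[OF that]] sm_cong[OF op[OF that] _ cd(2)[OF that]] eq[OF that] by auto
    have gst: "st C (gc \<circ> cinv C) (gd \<circ> cinv C) x" if "C \<in> A" "x \<in> cimage C" for C x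
      using cd(3)[OF that] eq[OF that] unfolding st_def by simp
    have "riemann (alpha (a C)) x y i k = prescribed_curvature (a C) (b C) (gc \<circ> cinv C) (gd \<circ> cinv C) x y i k"
      if "C \<in> A" "x \<in> cimage C" for C x y i k
      using flat[OF that(1) sf[OF that(1)] gst[OF that(1)]] l K that by blast
    then have ?r unfolding scalar using sf gst by blast
    with K show "K = 0 \<and> ?r" ..
  next
    assume r: "K = 0 \<and> ?r"
    then obtain c d where cd: "scalar_field A c" "scalar_field A d" and
      R: "\<And>C x y i k. C \<in> A \<Longrightarrow> x \<in> cimage C \<Longrightarrow> riemann (alpha (a C)) x y i k = prescribed_curvature (a C) (b C) (c \<circ> cinv C) (d \<circ> cinv C) x y i k"
      and s: "\<And>C x. C \<in> A \<Longrightarrow> x \<in> cimage C \<Longrightarrow> st C (c \<circ> cinv C) (d \<circ> cinv C) x" by blast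
    have "cfc C K" if "C \<in> A" for C
      using flat[of C "c \<circ> cinv C" "d \<circ> cinv C"] cd R s that r unfolding scalar by blast
    then show ?l by blast
  qed
  then show ?thesis unfolding cfc by (simp only: st_iff cong: ball_cong)
qed

end
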